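(* Let $f\in C_b(X)$, $\lambda>0$ and $s\in(0,1)\setminus\{1/2\}$, and let $-(-L)^s$ be the fractional power of the Gross Laplacian described in the context. Then the equation $$\lambda u+(-L)^su=f$$ has a unique solution $u\in C^{2s}_H(X)$, and there is $C>0$, independent of $f$, such that $\|u\|_{C^{2s}_H(X)}\le C\|f\|_\infty$. If $s=1/2$, the equation $\lambda u+(-L)^su=f$ has a unique solution in $Z^1_H(X)$, and there is $C>0$, independent of $f$, such that $\|u\|_{Z^1_H(X)}\le C\|f\|_\infty$. If in addition $f\in C^\alpha_H(X)$ with $\alpha\in(0,1)$ and $\alpha+2s\notin\{1,2\}$, then $u\in C^{\alpha+2s}_H(X)$, and there is $C>0$, independent of $f$, such that $\|u\|_{C^{\alpha+2s}_H(X)}\le C\|f\|_{C^\alpha_H(X)}$. If (with $f\in C^\alpha_H(X)$, $\alpha\in(0,1)$) $\alpha+2s=k\in\{1,2\}$, then $u\in Z^k_H(X)$, and there is $C>0$, independent of $f$, such that $\|u\|_{Z^k_H(X)}\le C\|f\|_{C^\alpha_H(X)}$.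
   Context: The operator. $X$ is a real separable Hilbert space and $Q\in\mathcal{L}(X)$ (bounded linear operators on $X$) is a self-adjoint positive operator with finite trace. $H=Q^{1/2}(X)$ with norm $\|h\|_H=\|Q^{-1/2}h\|$ ($Q^{-1/2}$ the pseudo-inverse of $Q^{1/2}$), the Cameron–Martin space of the centered Gaussian measure $\mathcal{N}(0,Q)$ with covariance $Q$. $P_tf(x)=\int_Xf(x+y)\,\mathcal{N}(0,tQ)(dy)$, $t>0$, $f\in C_b(X)$; its generator $L$ (a realization of the Gross Laplacian $\frac12\mathrm{Tr}(QD^2u)$) is the closed operator in $C_b(X)$ with resolvent $R(\lambda,L)f(x)=\int_0^\infty e^{-\lambda t}P_tf(x)\,dt$, $\lambda>0$. For $s\in(0,1)$, $t>0$, let $\eta^{(s)}_t:(0,\infty)\to\mathbb{R}$ be the inverse Laplace transform of $\lambda\mapsto e^{-t\lambda^s}$, i.e. $\int_0^\infty e^{-\lambda\sigma}\eta^{(s)}_t(\sigma)\,d\sigma=e^{-t\lambda^s}$, and $S_tf(x)=\int_0^\infty P_\sigma f(x)\,\eta^{(s)}_t(\sigma)\,d\sigma$, $S_0=I$. By definition $-(-L)^s$ is the generator of $S_t$, i.e. the closed operator in $C_b(X)$ whose resolvent at $\lambda>0$ is $f\mapsto\int_0^\infty e^{-\lambda t}S_tf(\cdot)\,dt$. The solution of $\lambda u+(-L)^su=f$ is $u(x)=\int_0^\infty e^{-\lambda t}S_tf(x)\,dt$ (unique in the domain of $(-L)^s$). Function spaces. For a Banach space $Y$, $C_b(X;Y)$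 is the space of bounded functions $X\to Y$ that are continuous with respect to the norm of $Y$, with sup norm $\|\cdot\|_\infty$; $C_b(X)=C_b(X;\mathbb{R})$. $F:X\to Y$ is $H$-Gateaux differentiable at $x$ if $\partial F/\partial h(x)=\lim_{t\to0}(F(x+th)-F(x))/t$ exists for all $h\in H$ and $D_HF(x):h\mapsto\partial F/\partial h(x)$ belongs to the space $\mathcal{L}(H,Y)$ of bounded linear operators. $\mathcal{L}^n(H)$: continuous $n$-linear maps $H^n\to\mathbb{R}$ with norm $\|T\|_{\mathcal{L}^n(H)}=\sup\{|T(h_1,\dots,h_n)|/(\|h_1\|_H\cdots\|h_n\|_H):h_i\in H\setminus\{0\}\}$, identified with $\mathcal{L}(H,\mathcal{L}^{n-1}(H))$; $D^n_Hf(x)$ is the $H$-Gateaux derivative at $x$ of $D^{n-1}_Hf:X\to\mathcal{L}^{n-1}(H)$. $C^n_H(X)$ ($n\in\mathbb{N}=\{1,2,\dots\}$): $f\in C_b(X)$ having $H$-Gateaux derivatives up to order $n$ at every point with $x\mapsto D^k_Hf(x)(h_1,\dots,h_k)$ continuous and bounded for all $k\le n$, $h_i\in H$; norm $\|f\|_\infty+\sum_{k=1}^n\sup_x\|D^k_Hf(x)\|_{\mathcal{L}^k(H)}$. For $\sigma\in(0,1)$, $C^\sigma_H(X,Y)=\{F\in C_b(X;Y):[F]_{C^\sigma_H(X,Y)}:=\sup_{x\in X,h\in H\setminus\{0\}}\|F(x+h)-F(x)\|_Y/\|h\|_H^\sigma<\infty\}$ with norm $\|F\|_\infty+[F]_{C^\sigma_H(X,Y)}$;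 $C^\sigma_H(X)=C^\sigma_H(X,\mathbb{R})$; $C^{\sigma+n}_H(X)=\{f\in C^n_H(X):D^n_Hf\in C^\sigma_H(X,\mathcal{L}^n(H))\}$ with norm $\|f\|_{C^n_H(X)}+[D^n_Hf]_{C^\sigma_H(X,\mathcal{L}^n(H))}$. $Z^1_H(X,Y)=\{F\in C_b(X;Y):[F]_{Z^1_H(X,Y)}:=\sup_{x\in X,h\in H\setminus\{0\}}\|F(x+2h)-2F(x+h)+F(x)\|_Y/\|h\|_H<\infty\}$ with norm $\|F\|_\infty+[F]_{Z^1_H(X,Y)}$; $Z^1_H(X)=Z^1_H(X,\mathbb{R})$; $Z^2_H(X)=\{f\in C^1_H(X):D_Hf\in Z^1_H(X,\mathcal{L}^1(H))\}$ with norm $\|f\|_{C^1_H(X)}+[D_Hf]_{Z^1_H(X,\mathcal{L}^1(H))}$. *)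

theory Defs
  imports "HOL-Probability.Probability"
begin

section \<open>Self-adjoint, positive and trace class operators\<close>

definition self_adjoint :: "('a::real_inner \<Rightarrow>\<^sub>L 'a) \<Rightarrow> bool" where
  "self_adjoint Q \<longleftrightarrow> (\<forall>x y. blinfun_apply Q x \<bullet> y = x \<bullet> blinfun_apply Q y)"

definition positive_op :: "('a::real_inner \<Rightarrow>\<^sub>L 'a) \<Rightarrow> bool" where
  "positive_op Q \<longleftrightarrow> (\<forall>x. 0 \<le> blinfun_apply Q x \<bullet> x)"

definition orthonormal_basis :: "'a::real_inner set \<Rightarrow> bool" where
  "orthonormal_basis E \<longleftrightarrow>
     pairwise orthogonal E \<and> (\<forall>e\<in>E. norm e = 1) \<and> closure (span E) = UNIV"

text \<open>For positive operators finiteness of the trace does not depend on the basis.\<close>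

definition finite_trace :: "('a::real_inner \<Rightarrow>\<^sub>L 'a) \<Rightarrow> bool" where
  "finite_trace Q \<longleftrightarrow>
     (\<exists>E. orthonormal_basis E \<and> (\<lambda>e. blinfun_apply Q e \<bullet> e) summable_on E)"

definition sqrt_op :: "('a::real_inner \<Rightarrow>\<^sub>L 'a) \<Rightarrow> ('a \<Rightarrow>\<^sub>L 'a)" where
  "sqrt_op Q = (THE R. self_adjoint R \<and> positive_op R \<and> R o\<^sub>L R = Q)"

text \<open>The pseudo-inverse picks the preimage orthogonal to the kernel.\<close>

definition pseudo_inverse :: "('a::real_inner \<Rightarrow>\<^sub>L 'a) \<Rightarrow> 'a \<Rightarrow> 'a" where
  "pseudo_inverse R h =
     (THE x. blinfun_apply R x = h \<and> (\<forall>y. blinfun_apply R y = 0 \<longrightarrow> x \<bullet> y = 0))"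

definition CM_space :: "('a::real_inner \<Rightarrow>\<^sub>L 'a) \<Rightarrow> 'a set" where
  "CM_space Q = range (blinfun_apply (sqrt_op Q))"

definition CM_norm :: "('a::real_inner \<Rightarrow>\<^sub>L 'a) \<Rightarrow> 'a \<Rightarrow> real" where
  "CM_norm Q h = norm (pseudo_inverse (sqrt_op Q) h)"


section \<open>Gaussian measures and the operator\<close>

definition is_centered_gaussian :: "('a::real_inner \<Rightarrow>\<^sub>L 'a) \<Rightarrow> 'a measure \<Rightarrow> bool" where
  "is_centered_gaussian Q \<mu> \<longleftrightarrow>
     prob_space \<mu> \<and> sets \<mu> = sets borel \<and>
     (\<forall>h. (LINT x|\<mu>. cis (h \<bullet> x)) = complex_of_real (exp (- (blinfun_apply Q h \<bullet> h) / 2)))"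

definition gaussian :: "('a::real_inner \<Rightarrow>\<^sub>L 'a) \<Rightarrow> 'a measure" where
  "gaussian Q = (THE \<mu>. is_centered_gaussian Q \<mu>)"

definition P_sg :: "('a::real_inner \<Rightarrow>\<^sub>L 'a) \<Rightarrow> real \<Rightarrow> ('a \<Rightarrow> real) \<Rightarrow> 'a \<Rightarrow> real" where
  "P_sg Q t f x = (LINT y|gaussian (t *\<^sub>R Q). f (x + y))"

text \<open>\<open>\<eta> t\<close> is an inverse Laplace transform of \<open>l \<mapsto> exp (- t l\<^sup>s)\<close>. This determines
  \<open>\<eta> t\<close> on the positive half-line up to a null set, so that the integrals
  \<open>S_sg Q \<eta> t f x\<close> do not depend on the version.\<close>

definition is_stable_density :: "real \<Rightarrow> (real \<Rightarrow> real \<Rightarrow> real) \<Rightarrow> bool" where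
  "is_stable_density s \<eta> \<longleftrightarrow>
     (\<forall>t>0. \<forall>l>0. set_integrable lborel {0<..} (\<lambda>\<sigma>. exp (- l * \<sigma>) * \<eta> t \<sigma>) \<and>
        (LBINT \<sigma>:{0<..}. exp (- l * \<sigma>) * \<eta> t \<sigma>) = exp (- t * l powr s))"

definition S_sg ::
  "('a::real_inner \<Rightarrow>\<^sub>L 'a) \<Rightarrow> (real \<Rightarrow> real \<Rightarrow> real) \<Rightarrow> real \<Rightarrow> ('a \<Rightarrow> real) \<Rightarrow> 'a \<Rightarrow> real" where
  "S_sg Q \<eta> t f x =
     (if t = 0 then f x else (LBINT \<sigma>:{0<..}. P_sg Q \<sigma> f x * \<eta> t \<sigma>))"

definition S_resolvent ::
  "('a::real_inner \<Rightarrow>\<^sub>L 'a) \<Rightarrow> (real \<Rightarrow> real \<Rightarrow> real) \<Rightarrow> real \<Rightarrow> ('a \<Rightarrow>\<^sub>C real) \<Rightarrow> ('a \<Rightarrow>\<^sub>C real)" where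
  "S_resolvent Q \<eta> l f =
     Bcontfun (\<lambda>x. LBINT t:{0<..}. exp (- l * t) * S_sg Q \<eta> t (apply_bcontfun f) x)"

text \<open>Unbounded operators are represented by their graphs. The last condition says that, for
  every \<open>l > 0\<close>, the operator \<open>l - A\<close> maps the domain of \<open>A\<close> bijectively onto the whole space,
  with inverse \<open>R l\<close>.\<close>

definition closed_op_with_resolvent ::
  "('b::real_normed_vector \<times> 'b) set \<Rightarrow> (real \<Rightarrow> 'b \<Rightarrow> 'b) \<Rightarrow> bool" where
  "closed_op_with_resolvent A R \<longleftrightarrow>
     subspace A \<and> single_valued A \<and> closed A \<and>
     (\<forall>l>0. \<forall>f u. (u, l *\<^sub>R u - f) \<in> A \<longleftrightarrow> u = R l f)"

text \<open>The graph of \<open>-(-L)\<^sup>s\<close>, where \<open>\<eta>\<close> is the density with exponent \<open>s\<close>.\<close>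

definition neg_frac_power ::
  "('a::real_inner \<Rightarrow>\<^sub>L 'a) \<Rightarrow> (real \<Rightarrow> real \<Rightarrow> real) \<Rightarrow> (('a \<Rightarrow>\<^sub>C real) \<times> ('a \<Rightarrow>\<^sub>C real)) set" where
  "neg_frac_power Q \<eta> = (THE A. closed_op_with_resolvent A (S_resolvent Q \<eta>))"

text \<open>\<open>u\<close> lies in the domain and \<open>l u + (-L)\<^sup>s u = f\<close>; here \<open>v = -(-L)\<^sup>s u\<close>.\<close>

definition solves ::
  "('a::real_inner \<Rightarrow>\<^sub>L 'a) \<Rightarrow> (real \<Rightarrow> real \<Rightarrow> real) \<Rightarrow> real \<Rightarrow> ('a \<Rightarrow>\<^sub>C real) \<Rightarrow> ('a \<Rightarrow>\<^sub>C real) \<Rightarrow> bool" where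
  "solves Q \<eta> l f u \<longleftrightarrow> (\<exists>v. (u, v) \<in> neg_frac_power Q \<eta> \<and> l *\<^sub>R u - v = f)"


section \<open>Multilinear forms on \<open>H\<close> and \<open>H\<close>-derivatives\<close>

text \<open>An \<open>n\<close>-linear form on \<open>H\<close> is a function on lists of length \<open>n\<close> over \<open>H\<close>, extended by \<open>0\<close>
  to all other lists so that equality of forms is equality of functions. A form of degree \<open>0\<close>
  is a real number, the value at the empty list. All norms and seminorms take values in
  \<open>ennreal\<close>, so that suprema over empty sets (if \<open>H\<close> is trivial) are \<open>0\<close>.\<close>

definition H_args :: "('a::real_inner \<Rightarrow>\<^sub>L 'a) \<Rightarrow> nat \<Rightarrow> 'a list set" where
  "H_args Q n = {hs. length hs = n \<and> set hs \<subseteq> CM_space Q}"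

definition form_norm :: "('a::real_inner \<Rightarrow>\<^sub>L 'a) \<Rightarrow> nat \<Rightarrow> ('a list \<Rightarrow> real) \<Rightarrow> ennreal" where
  "form_norm Q n T =
     (SUP hs \<in> {hs \<in> H_args Q n. 0 \<notin> set hs}. ennreal (\<bar>T hs\<bar> / prod_list (map (CM_norm Q) hs)))"

definition forms :: "('a::real_inner \<Rightarrow>\<^sub>L 'a) \<Rightarrow> nat \<Rightarrow> ('a list \<Rightarrow> real) set" where
  "forms Q n = {T.
     (\<forall>hs. hs \<notin> H_args Q n \<longrightarrow> T hs = 0) \<and>
     (\<forall>hs\<in>H_args Q n. \<forall>i<n. \<forall>a\<in>CM_space Q. \<forall>b\<in>CM_space Q. \<forall>c.
        T (hs[i := a + b]) = T (hs[i := a]) + T (hs[i := b]) \<and>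
        T (hs[i := c *\<^sub>R a]) = c * T (hs[i := a])) \<and>
     form_norm Q n T < \<infinity>}"

text \<open>\<open>G\<close> is the \<open>H\<close>-Gateaux derivative at \<open>x\<close> of \<open>F\<close>, which takes values in the forms of
  degree \<open>n\<close>; limits are taken in the norm of forms. The bounded linear operator
  \<open>h \<mapsto> (hs \<mapsto> G (h # hs))\<close> from \<open>H\<close> to forms of degree \<open>n\<close> is identified with the form \<open>G\<close> of
  degree \<open>n + 1\<close>.\<close>

definition has_H_derivative ::
  "('a::real_inner \<Rightarrow>\<^sub>L 'a) \<Rightarrow> nat \<Rightarrow> ('a \<Rightarrow> 'a list \<Rightarrow> real) \<Rightarrow> ('a list \<Rightarrow> real) \<Rightarrow> 'a \<Rightarrow> bool" where
  "has_H_derivative Q n F G x \<longleftrightarrow>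
     G \<in> forms Q (Suc n) \<and>
     (\<forall>h\<in>CM_space Q.
        ((\<lambda>t. form_norm Q n (\<lambda>hs. (F (x + t *\<^sub>R h) hs - F x hs) / t - G (h # hs))) \<longlongrightarrow> 0) (at 0))"

primrec H_deriv ::
  "('a::real_inner \<Rightarrow>\<^sub>L 'a) \<Rightarrow> nat \<Rightarrow> ('a \<Rightarrow> real) \<Rightarrow> 'a \<Rightarrow> 'a list \<Rightarrow> real" where
  "H_deriv Q 0 f = (\<lambda>x hs. if hs = [] then f x else 0)"
| "H_deriv Q (Suc n) f = (\<lambda>x. THE G. has_H_derivative Q n (H_deriv Q n f) G x)"


section \<open>Function spaces\<close>

definition CnH :: "('a::real_inner \<Rightarrow>\<^sub>L 'a) \<Rightarrow> nat \<Rightarrow> ('a \<Rightarrow>\<^sub>C real) set" where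
  "CnH Q n = {f.
     (\<forall>k<n. \<forall>x. \<exists>G. has_H_derivative Q k (H_deriv Q k (apply_bcontfun f)) G x) \<and>
     (\<forall>k\<in>{1..n}. \<forall>hs\<in>H_args Q k. (\<lambda>x. H_deriv Q k (apply_bcontfun f) x hs) \<in> bcontfun)}"

definition CnH_norm :: "('a::real_inner \<Rightarrow>\<^sub>L 'a) \<Rightarrow> nat \<Rightarrow> ('a \<Rightarrow>\<^sub>C real) \<Rightarrow> ennreal" where
  "CnH_norm Q n f =
     ennreal (norm f) + (\<Sum>k=1..n. SUP x. form_norm Q k (H_deriv Q k (apply_bcontfun f) x))"

definition Cb_forms :: "('a::real_inner \<Rightarrow>\<^sub>L 'a) \<Rightarrow> nat \<Rightarrow> ('a \<Rightarrow> 'a list \<Rightarrow> real) set" where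
  "Cb_forms Q n = {F.
     (\<forall>x. F x \<in> forms Q n) \<and>
     (SUP x. form_norm Q n (F x)) < \<infinity> \<and>
     (\<forall>x. ((\<lambda>y. form_norm Q n (\<lambda>hs. F y hs - F x hs)) \<longlongrightarrow> 0) (at x))}"

definition holder_seminorm ::
  "('a::real_inner \<Rightarrow>\<^sub>L 'a) \<Rightarrow> nat \<Rightarrow> real \<Rightarrow> ('a \<Rightarrow> 'a list \<Rightarrow> real) \<Rightarrow> ennreal" where
  "holder_seminorm Q n \<sigma> F =
     (SUP x. SUP h \<in> CM_space Q - {0}.
        form_norm Q n (\<lambda>hs. F (x + h) hs - F x hs) / ennreal (CM_norm Q h powr \<sigma>))"

definition zygmund_seminorm ::
  "('a::real_inner \<Rightarrow>\<^sub>L 'a) \<Rightarrow> nat \<Rightarrow> ('a \<Rightarrow> 'a list \<Rightarrow> real) \<Rightarrow> ennreal" where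
  "zygmund_seminorm Q n F =
     (SUP x. SUP h \<in> CM_space Q - {0}.
        form_norm Q n (\<lambda>hs. F (x + 2 *\<^sub>R h) hs - 2 * F (x + h) hs + F x hs) / ennreal (CM_norm Q h))"

text \<open>The space with exponent \<open>r = n + \<sigma>\<close>, where \<open>r > 0\<close> is not an integer, \<open>n = \<lfloor>r\<rfloor>\<close> and
  \<open>\<sigma> = frac r\<close>. For \<open>n = 0\<close> this is the plain Hoelder space, because \<open>H_deriv Q 0 f\<close> is \<open>f\<close>
  regarded as a map into the forms of degree \<open>0\<close>.\<close>

definition CH :: "('a::real_inner \<Rightarrow>\<^sub>L 'a) \<Rightarrow> real \<Rightarrow> ('a \<Rightarrow>\<^sub>C real) set" where
  "CH Q r = (let n = nat \<lfloor>r\<rfloor> in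
     {f \<in> CnH Q n. H_deriv Q n (apply_bcontfun f) \<in> Cb_forms Q n \<and>
        holder_seminorm Q n (frac r) (H_deriv Q n (apply_bcontfun f)) < \<infinity>})"

definition CH_norm :: "('a::real_inner \<Rightarrow>\<^sub>L 'a) \<Rightarrow> real \<Rightarrow> ('a \<Rightarrow>\<^sub>C real) \<Rightarrow> ennreal" where
  "CH_norm Q r f = (let n = nat \<lfloor>r\<rfloor> in
     CnH_norm Q n f + holder_seminorm Q n (frac r) (H_deriv Q n (apply_bcontfun f)))"

text \<open>For \<open>k = n + 1 \<ge> 1\<close> the Zygmund condition is imposed on the derivative of order \<open>n\<close>.\<close>

definition ZH :: "('a::real_inner \<Rightarrow>\<^sub>L 'a) \<Rightarrow> nat \<Rightarrow> ('a \<Rightarrow>\<^sub>C real) set" where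
  "ZH Q k = (let n = k - 1 in
     {f \<in> CnH Q n. H_deriv Q n (apply_bcontfun f) \<in> Cb_forms Q n \<and>
        zygmund_seminorm Q n (H_deriv Q n (apply_bcontfun f)) < \<infinity>})"

definition ZH_norm :: "('a::real_inner \<Rightarrow>\<^sub>L 'a) \<Rightarrow> nat \<Rightarrow> ('a \<Rightarrow>\<^sub>C real) \<Rightarrow> ennreal" where
  "ZH_norm Q k f = (let n = k - 1 in
     CnH_norm Q n f + zygmund_seminorm Q n (H_deriv Q n (apply_bcontfun f)))"

end

theory Submission
  imports Defs
begin

text \<open>The function \<open>\<lambda> \<mapsto> exp (- \<lambda>\<^sup>s)\<close> is completely monotone, so the stable density is nonnegative
  and the resolvent is \<open>u = (1 / l) \<integral> P\<^sub>\<sigma> f d\<kappa>(\<sigma>)\<close>, where the probability \<open>\<kappa>\<close> is the law of the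
  subordinator at an independent exponential time. Its Laplace transform is \<open>l / (l + \<lambda>\<^sup>s)\<close>, whence
  \<open>\<kappa> [0, v] \<le> C v\<^sup>s\<close>. On the other hand, the centered Gaussian measure with covariance \<open>Q\<close> is the
  image of \<open>N(0, 1) \<times> \<gamma>'\<close> under \<open>(\<xi>, y) \<mapsto> \<xi> h + y\<close> for every \<open>h\<close> in the unit ball of \<open>H\<close>, with
  another Gaussian measure \<open>\<gamma>'\<close>; so the heat semigroup is smoothing along \<open>H\<close> exactly as in dimension
  one, and each derivative costs a factor \<open>\<sigma>\<close> to the power \<open>- 1 / 2\<close>. Differences of the derivatives of
  \<open>P\<^sub>\<sigma> f\<close> are thus at most a constant times \<open>\<sigma>\<close> to the power \<open>- q\<close> times the minimum of \<open>1\<close> and a power of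
  \<open>\<parallel>h\<parallel>\<^sup>2 / \<sigma>\<close>, and integrating this against \<open>\<kappa>\<close> gives the Hoelder and Zygmund bounds.\<close>

section \<open>Completely monotone functions\<close>

text \<open>Two obstacles shape the argument. The hypothesis gives \<open>\<eta> t\<close> for each
  \<open>t\<close> separately, with no sign and no joint measurability in \<open>t\<close>. The sign
  comes from the Laplace transform at the integers, which is a moment sequence on the unit interval
  in the variable \<open>exp (- x)\<close>. The time leaves the measure through self-similarity:
  \<open>N t\<close> is replaced by \<open>N 1\<close> and a factor \<open>t powr (1 / s)\<close>,
  after which averaging over \<open>t\<close> is harmless. The second obstacle is that
  \<open>f\<close> is continuous but in general not uniformly so: its translates need not converge
  in the sup norm, while the derivatives of the solution have to be continuous in the norm of forms.
  This is why derivatives are also bounded by the square root of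
  \<open>P t (\<lambda>x. (f x)\<^sup>2) x\<close>, which is small for
  \<open>f (y + z) - f y\<close> in place of \<open>f y\<close>, with a factor that treats all
  directions alike. Square roots, Gaussian measures, derivatives and the operator itself are
  definite descriptions, so each is first shown to exist uniquely. A single exponent
  \<open>\<theta>\<close> covers bounded data (\<open>\<theta> = 0\<close>) and Hoelder data
  (\<open>\<theta> = \<alpha>\<close>).\<close>

primrec fdiff :: "nat \<Rightarrow> (real \<Rightarrow> real) \<Rightarrow> real \<Rightarrow> real" where
  "fdiff 0 f x = f x"
| "fdiff (Suc m) f x = fdiff m (\<lambda>y. f y - f (y + 1)) x"

lemma fdiff_add: "fdiff m (\<lambda>y. f y + g y) x = fdiff m f x + fdiff m g x"
proof (induction m arbitrary: f g)
  case (Suc m)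
  have "(\<lambda>y. f y + g y - (f (y + 1) + g (y + 1))) = (\<lambda>y. (f y - f (y + 1)) + (g y - g (y + 1)))"
    by auto
  then show ?case using Suc by simp
qed simp

lemma fdiff_cmult: "fdiff m (\<lambda>y. c * f y) x = c * fdiff m f x"
proof (induction m arbitrary: f)
  case (Suc m)
  show ?case using Suc[of "\<lambda>y. f y - f (y + 1)"] by (simp add: right_diff_distrib)
qed simp

lemma fdiff_shift: "fdiff m (\<lambda>y. f (y + 1)) x = fdiff m f (x + 1)"
proof (induction m arbitrary: f)
  case (Suc m)
  show ?case using Suc[of "\<lambda>y. f y - f (y + 1)"] by simp
qed simp

text \<open>The recursion takes a difference of the function; this form takes a difference of the
  values, which is what the moment computation on the unit interval produces.\<close>

lemma fdiff_Suc: "fdiff (Suc m) f x = fdiff m f x - fdiff m f (x + 1)"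
  using fdiff_add[of m f "\<lambda>y. -1 * f (y + 1)" x] fdiff_cmult[of m "-1" "\<lambda>y. f (y + 1)" x] fdiff_shift[of m f x]
  by simp

lemma fdiff_const: "fdiff (Suc m) (\<lambda>_. c) x = 0"
proof -
  have "fdiff m (\<lambda>_. 0) x = 0" by (induction m) simp_all
  then show ?thesis by simp
qed

lemma fdiff_tendsto:
  assumes "\<And>y. (\<lambda>n. f n y) \<longlonglongrightarrow> g y"
  shows "(\<lambda>n. fdiff m (f n) x) \<longlonglongrightarrow> fdiff m g x"
  using assms
proof (induction m arbitrary: f g)
  case (Suc m)
  show ?case by (simp, intro Suc.IH tendsto_intros Suc.prems)
qed simp

lemma fdiff_deriv:
  assumes "\<And>y. y > 0 \<Longrightarrow> (f has_real_derivative f' y) (at y)" "x > 0"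
  shows "(fdiff m f has_real_derivative fdiff m f' x) (at x)"
  using assms
proof (induction m arbitrary: f f')
  case (Suc m)
  have "((\<lambda>y. f y - f (y + 1)) has_real_derivative (f' y - f' (y + 1))) (at y)" if "y > 0" for y
  proof -
    have "((\<lambda>y. f (y + 1)) has_real_derivative f' (y + 1)) (at y)"
      using Suc.prems(1)[of "y + 1"] that DERIV_shift[of f "f' (y + 1)" y 1] by simp
    then show ?thesis using Suc.prems(1)[OF that] by (intro DERIV_diff)
  qed
  from Suc.IH[OF this Suc.prems(2)] show ?case by (simp add: ext[where f = "fdiff (Suc m) f"])
qed (simp add: ext[where f = "fdiff 0 f" for f])

text \<open>Differences commute with differentiation, so the mean value theorem trades the outermost
  difference for a derivative at a later point, with a minus sign from the order of subtraction.
  Signs of derivatives thereby become signs of differences.\<close>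

lemma fdiff_Suc_mvt:
  assumes "\<And>y. y > 0 \<Longrightarrow> (f has_real_derivative f' y) (at y)" "x > 0"
  shows "\<exists>z > x. fdiff (Suc m) f x = - fdiff m f' z"
proof -
  have "\<exists>z. x < z \<and> z < x + 1 \<and> fdiff m f (x + 1) - fdiff m f x = (x + 1 - x) * fdiff m f' z"
    using assms by (intro MVT2 fdiff_deriv) auto
  then show ?thesis unfolding fdiff_Suc by auto
qed

text \<open>Induction lowers the exponent: the derivative brings the factor
  \<open>a \<le> 0\<close>, which cancels the minus sign of the mean value step.\<close>

lemma fdiff_powr_nonneg: "a \<le> 0 \<Longrightarrow> x > 0 \<Longrightarrow> 0 \<le> fdiff m (\<lambda>y. y powr a) x"
proof (induction m arbitrary: a x)
  case (Suc m)
  obtain z where z: "z > x" "fdiff (Suc m) (\<lambda>y. y powr a) x = - fdiff m (\<lambda>y. a * y powr (a - 1)) z"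
    using fdiff_Suc_mvt[OF has_real_derivative_powr Suc.prems(2)] by blast
  have "a * fdiff m (\<lambda>y. y powr (a - 1)) z \<le> 0"
    using Suc.IH[of "a - 1" z] Suc.prems z(1) by (intro mult_nonpos_nonneg) auto
  then show ?case unfolding z(2) fdiff_cmult by simp
qed simp

text \<open>The derivative \<open>s * y powr (s - 1)\<close> has nonnegative differences of every
  order, so those of \<open>y powr s\<close> are nonpositive from order one on: it is a Bernstein
  function.\<close>

lemma fdiff_powr_nonpos:
  assumes "0 < s" "s < 1" "x > 0"
  shows "fdiff (Suc m) (\<lambda>y. y powr s) x \<le> 0"
proof -
  obtain z where z: "z > x" "fdiff (Suc m) (\<lambda>y. y powr s) x = - fdiff m (\<lambda>y. s * y powr (s - 1)) z"
    using fdiff_Suc_mvt[OF has_real_derivative_powr assms(3)] by blast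
  show ?thesis unfolding z(2) fdiff_cmult
    using fdiff_powr_nonneg[of "s - 1" z m] assms z(1) by simp
qed

text \<open>The bound \<open>b\<close> is needed because \<open>1 - t y\<^sup>s / n\<close> is nonnegative only on bounded sets.\<close>

lemma fdiff_mult_nonneg:
  assumes "\<And>j x. j \<le> m \<Longrightarrow> 0 < x \<Longrightarrow> x + real j \<le> b \<Longrightarrow> 0 \<le> fdiff j f x"
    and "\<And>j x. j \<le> m \<Longrightarrow> 0 < x \<Longrightarrow> x + real j \<le> b \<Longrightarrow> 0 \<le> fdiff j g x"
    and "0 < x" "x + real m \<le> b"
  shows "0 \<le> fdiff m (\<lambda>y. f y * g y) x"
  using assms
proof (induction m arbitrary: f g b)
  case 0
  then show ?case using "0.prems"(1)[of 0 x] "0.prems"(2)[of 0 x] by simp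
next
  case (Suc m)
  \<comment> \<open>Discrete product rule. The factor shifted by one reaches one unit further to the
    right, so the window shrinks to \<open>b - 1\<close> in the induction.\<close>
  have e: "(\<lambda>y. f y * g y - f (y + 1) * g (y + 1)) =
      (\<lambda>y. (f y - f (y + 1)) * g y + f (y + 1) * (g y - g (y + 1)))"
    by (auto simp: algebra_simps)
  have "0 \<le> fdiff m (\<lambda>y. (f y - f (y + 1)) * g y) x"
  proof (rule Suc.IH[of "b - 1"])
    fix j z assume j: "j \<le> m" "0 < z" "z + real j \<le> b - 1"
    show "0 \<le> fdiff j (\<lambda>y. f y - f (y + 1)) z" using Suc.prems(1)[of "Suc j" z] j by simp
    show "0 \<le> fdiff j g z" using Suc.prems(2)[of j z] j by simp
  qed (use Suc.prems in auto)
  moreover have "0 \<le> fdiff m (\<lambda>y. f (y + 1) * (g y - g (y + 1))) x"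
  proof (rule Suc.IH[of "b - 1"])
    fix j z assume j: "j \<le> m" "0 < z" "z + real j \<le> b - 1"
    show "0 \<le> fdiff j (\<lambda>y. f (y + 1)) z" using Suc.prems(1)[of j "z + 1"] j by (simp add: fdiff_shift)
    show "0 \<le> fdiff j (\<lambda>y. g y - g (y + 1)) z" using Suc.prems(2)[of "Suc j" z] j by simp
  qed (use Suc.prems in auto)
  ultimately show ?case by (simp add: e fdiff_add)
qed

lemma fdiff_power_nonneg:
  assumes "\<And>j x. 0 < x \<Longrightarrow> x + real j \<le> b \<Longrightarrow> 0 \<le> fdiff j f x"
  shows "0 < x \<Longrightarrow> x + real m \<le> b \<Longrightarrow> 0 \<le> fdiff m (\<lambda>y. f y ^ n) x"
proof (induction n arbitrary: m x)
  case 0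
  then show ?case by (cases m) (simp_all del: fdiff.simps(2) add: fdiff_const)
next
  case (Suc n)
  show ?case using fdiff_mult_nonneg[of m b f "\<lambda>y. f y ^ n" x] assms Suc by simp
qed

text \<open>The exponential is the limit of the powers \<open>?F n\<close>. Their base has
  nonnegative differences: in order zero because \<open>n\<close> is large, in higher orders because
  those of \<open>y powr s\<close> are nonpositive. Products and limits preserve this.\<close>

lemma fdiff_exp_powr_nonneg:
  assumes "0 < s" "s < 1" "0 < t" "0 < x"
  shows "0 \<le> fdiff m (\<lambda>y. exp (- t * y powr s)) x"
proof (rule LIMSEQ_le_const)
  let ?F = "\<lambda>n y. (1 + (- t * y powr s) / real n) ^ n"
  show "(\<lambda>n. fdiff m (?F n) x) \<longlonglongrightarrow> fdiff m (\<lambda>y. exp (- t * y powr s)) x"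
    by (intro fdiff_tendsto tendsto_exp_limit_sequentially)
  \<comment> \<open>A difference of order \<open>m\<close> at \<open>x\<close> samples no point
    beyond \<open>x + m\<close>, so the base has to be nonnegative only up to there, which holds
    once \<open>n\<close> exceeds \<open>t * b powr s\<close>.\<close>
  define b where "b = x + real m"
  obtain N where N: "real N > t * b powr s" "N > 0"
    using reals_Archimedean2[of "max 1 (t * b powr s)"] by (metis max_less_iff_conj of_nat_0_less_iff zero_less_one order_less_trans)
  show "\<exists>N. \<forall>n\<ge>N. 0 \<le> fdiff m (?F n) x"
  proof (intro exI[of _ N] allI impI)
    fix n assume n: "n \<ge> N"
    have n0: "real n > 0" using N n by simp
    show "0 \<le> fdiff m (?F n) x"
    proof (rule fdiff_power_nonneg[of b])
      fix j z assume z: "0 < z" "z + real j \<le> b"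
      show "0 \<le> fdiff j (\<lambda>y. 1 + (- t * y powr s) / real n) z"
      proof (cases j)
        case 0
        have "z powr s \<le> b powr s" using z 0 assms by (intro powr_mono2) auto
        then have "t * z powr s \<le> t * b powr s" using assms by simp
        also have "\<dots> \<le> real n" using N(1) n by simp
        finally show ?thesis using n0 0 by (simp add: field_simps)
      next
        case (Suc k)
        have "(\<lambda>y. 1 + (- t * y powr s) / real n) = (\<lambda>y. 1 + (- t / real n) * y powr s)" by auto
        then have "fdiff j (\<lambda>y. 1 + (- t * y powr s) / real n) z = (- t / real n) * fdiff (Suc k) (\<lambda>y. y powr s) z"
          using fdiff_add[of j "\<lambda>_. 1" "\<lambda>y. (- t / real n) * y powr s" z] fdiff_const[of k 1 z]
            fdiff_cmult[of j "- t / real n" "\<lambda>y. y powr s" z] unfolding Suc by simp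
        also have "\<dots> \<ge> 0"
          using fdiff_powr_nonpos[OF assms(1,2) z(1), of k] assms n0 by (intro mult_nonpos_nonpos) auto
        finally show ?thesis .
      qed
    qed (use assms b_def in auto)
  qed
qed

lemma fdiff_cong: "(\<And>y. x \<le> y \<Longrightarrow> f y = g y) \<Longrightarrow> fdiff m f x = fdiff m g x"
proof (induction m arbitrary: f g)
  case 0
  show ?case using 0[OF order_refl] by (simp only: fdiff.simps)
next
  case (Suc m)
  show ?case unfolding fdiff.simps
    by (rule Suc.IH, intro arg_cong2[of _ _ _ _ "(-)"] Suc.prems) auto
qed

section \<open>Laplace transforms of measures on the half-line\<close>

text \<open>Hausdorff's moment argument. The value of \<open>\<Lambda>\<close> at
  \<open>x ^ k * (1 - x) ^ m\<close> is a difference of order \<open>m\<close> of the moments, so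
  \<open>\<Lambda>\<close> is nonnegative on Bernstein polynomials of nonnegative functions, and
  these approximate uniformly. The moments are indexed from \<open>1\<close> because the Laplace
  transform of the density is given at positive arguments.\<close>

lemma moment_functional_nonneg:
  fixes \<Lambda> :: "(real \<Rightarrow> real) \<Rightarrow> real"
  assumes lin: "\<And>f g a. continuous_on {0..1} f \<Longrightarrow> continuous_on {0..1} g \<Longrightarrow> \<Lambda> (\<lambda>x. a * f x + g x) = a * \<Lambda> f + \<Lambda> g"
    and bound: "\<And>f e. continuous_on {0..1} f \<Longrightarrow> (\<And>x. x \<in> {0..1} \<Longrightarrow> \<bar>f x\<bar> \<le> e) \<Longrightarrow> \<bar>\<Lambda> f\<bar> \<le> C * e"
    and mom: "\<And>k. \<Lambda> (\<lambda>x. x ^ k) = F (real k + 1)"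
    and F: "\<And>m k. 0 \<le> fdiff m F (real k + 1)"
    and \<phi>: "continuous_on {0..1} \<phi>" "\<And>x. x \<in> {0..1} \<Longrightarrow> 0 \<le> \<phi> x"
  shows "0 \<le> \<Lambda> \<phi>"
proof -
  have mom': "\<Lambda> (\<lambda>x. x ^ k * (1 - x) ^ m) = fdiff m F (real k + 1)" for k m
  proof (induction m arbitrary: k)
    case 0
    then show ?case by (simp add: mom)
  next
    case (Suc m)
    have "(\<lambda>x::real. x ^ k * (1 - x) ^ Suc m) = (\<lambda>x. (-1) * (x ^ Suc k * (1 - x) ^ m) + x ^ k * (1 - x) ^ m)"
      by (auto simp: algebra_simps)
    then have "\<Lambda> (\<lambda>x. x ^ k * (1 - x) ^ Suc m) = (-1) * \<Lambda> (\<lambda>x. x ^ Suc k * (1 - x) ^ m) + \<Lambda> (\<lambda>x. x ^ k * (1 - x) ^ m)"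
      by (simp only:) (intro lin continuous_intros)
    then show ?case unfolding Suc fdiff_Suc by (simp add: add.commute)
  qed
  have sum: "\<Lambda> (\<lambda>x. \<Sum>k\<le>n. c k * f k x) = (\<Sum>k\<le>n. c k * \<Lambda> (f k))"
    if "\<And>k. continuous_on {0..1} (f k)" for c :: "nat \<Rightarrow> real" and f :: "nat \<Rightarrow> real \<Rightarrow> real" and n :: nat
  proof (induction n)
    case 0
    have z: "\<Lambda> (\<lambda>x. 0) = 0" using bound[of "\<lambda>x. 0" 0] by simp
    show ?case using lin[of "f 0" "\<lambda>x. 0" "c 0"] that z by simp
  next
    case (Suc n)
    have "\<Lambda> (\<lambda>x. c (Suc n) * f (Suc n) x + (\<Sum>k\<le>n. c k * f k x)) = c (Suc n) * \<Lambda> (f (Suc n)) + \<Lambda> (\<lambda>x. \<Sum>k\<le>n. c k * f k x)"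
      by (intro lin continuous_intros that)
    then show ?case using Suc by (simp add: add.commute)
  qed
  have lower: "- (\<bar>C\<bar> * e) \<le> \<Lambda> \<phi>" if e: "e > 0" for e
  proof -
    obtain n where n: "\<And>x. x \<in> {0..1} \<Longrightarrow> \<bar>\<phi> x - (\<Sum>k\<le>n. \<phi> (real k / real n) * Bernstein n k x)\<bar> < e"
      using Bernstein_Weierstrass[OF \<phi>(1) e] by blast
    let ?B = "\<lambda>x. \<Sum>k\<le>n. (\<phi> (real k / real n) * real (n choose k)) * (x ^ k * (1 - x) ^ (n - k))"
    have B: "(\<Sum>k\<le>n. \<phi> (real k / real n) * Bernstein n k x) = ?B x" for x
      by (intro sum.cong) (auto simp: Bernstein_def)
    have cB: "continuous_on {0..1} ?B" by (intro continuous_intros)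
    have "0 \<le> (\<Sum>k\<le>n. (\<phi> (real k / real n) * real (n choose k)) * fdiff (n - k) F (real k + 1))"
      by (intro sum_nonneg mult_nonneg_nonneg F \<phi>) (auto simp: divide_le_eq_1)
    also have "\<dots> = \<Lambda> ?B"
      unfolding mom'[symmetric] by (rule sum[symmetric]) (intro continuous_intros)
    finally have 1: "0 \<le> \<Lambda> ?B" .
    have "\<Lambda> (\<lambda>x. (-1) * ?B x + \<phi> x) = (-1) * \<Lambda> ?B + \<Lambda> \<phi>" by (rule lin[OF cB \<phi>(1)])
    moreover have "\<bar>\<Lambda> (\<lambda>x. (-1) * ?B x + \<phi> x)\<bar> \<le> C * e"
    proof (rule bound)
      show "continuous_on {0..1} (\<lambda>x. (-1) * ?B x + \<phi> x)" by (intro continuous_intros \<phi>)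
      show "\<And>x. x \<in> {0..1} \<Longrightarrow> \<bar>(-1) * ?B x + \<phi> x\<bar> \<le> e" using n unfolding B by fastforce
    qed
    moreover have "C * e \<le> \<bar>C\<bar> * e" using e by simp
    ultimately show ?thesis using 1 by linarith
  qed
  show ?thesis
  proof (rule ccontr)
    assume "\<not> 0 \<le> \<Lambda> \<phi>"
    then have e: "- \<Lambda> \<phi> / (\<bar>C\<bar> + 1) > 0" by (intro divide_pos_pos) auto
    have "\<bar>C\<bar> * (- \<Lambda> \<phi> / (\<bar>C\<bar> + 1)) < (\<bar>C\<bar> + 1) * (- \<Lambda> \<phi> / (\<bar>C\<bar> + 1))"
      by (rule mult_strict_right_mono[OF _ e]) simp
    also have "\<dots> = - \<Lambda> \<phi>" by (simp add: field_simps add_pos_nonneg)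
    finally show False using lower[OF e] by linarith
  qed
qed

text \<open>Indicators of open sets are limits of the functions
  \<open>min 1 (n * infdist x (- U))\<close>; outer regularity passes from open sets to Borel
  sets.\<close>

lemma measure_le_if_integral_le:
  fixes M N :: "real measure"
  assumes fM: "finite_measure M" and fN: "finite_measure N"
    and sM: "sets M = sets borel" and sN: "sets N = sets borel"
    and le: "\<And>\<phi> :: real \<Rightarrow> real. continuous_on UNIV \<phi> \<Longrightarrow> (\<And>x. 0 \<le> \<phi> x \<and> \<phi> x \<le> 1) \<Longrightarrow> (\<integral>x. \<phi> x \<partial>M) \<le> (\<integral>x. \<phi> x \<partial>N)"
    and A: "A \<in> sets borel"
  shows "emeasure M A \<le> emeasure N A"
proof -
  interpret M: finite_measure M by (rule fM)
  interpret N: finite_measure N by (rule fN)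
  have spaces: "space M = UNIV" "space N = UNIV"
    using sets_eq_imp_space_eq[OF sM] sets_eq_imp_space_eq[OF sN] by simp_all
  have open_le: "emeasure M U \<le> emeasure N U" if U: "open U" for U
  proof -
    have bU: "U \<in> sets borel" using U by simp
    \<comment> \<open>\<open>infdist\<close> to the empty set is \<open>0\<close>, which would give
      the zero function; hence the separate value for the whole line.\<close>
    define \<phi> where "\<phi> n x = (if U = UNIV then 1 else min 1 (real n * infdist x (- U)))" for n x
    have c: "continuous_on UNIV (\<phi> n)" for n
      unfolding \<phi>_def by (cases "U = UNIV") (auto intro!: continuous_intros)
    have b: "0 \<le> \<phi> n x \<and> \<phi> n x \<le> 1" for n x by (auto simp: \<phi>_def infdist_nonneg)
    have lim: "(\<lambda>n. \<phi> n x) \<longlonglongrightarrow> indicator U x" for x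
    proof (cases "U = UNIV")
      case False
      show ?thesis
      proof (cases "x \<in> U")
        case True
        have "closed (- U)" "- U \<noteq> {}" using U False by auto
        then have d: "infdist x (- U) > 0"
          using True infdist_pos_not_in_closed[of "- U" x] by simp
        obtain n0 where n0: "real n0 * infdist x (- U) > 1" using ex_less_of_nat_mult[OF d] by blast
        have "\<phi> n x = 1" if "n \<ge> n0" for n
        proof -
          have "real n0 * infdist x (- U) \<le> real n * infdist x (- U)"
            using that d by (intro mult_right_mono) auto
          then show ?thesis using n0 False by (simp add: \<phi>_def)
        qed
        then have "\<forall>\<^sub>F n in sequentially. \<phi> n x = 1" by (auto simp: eventually_sequentially)
        then show ?thesis using True by (simp add: tendsto_eventually)
      qed (use False in \<open>simp add: \<phi>_def\<close>)
    qed (simp add: \<phi>_def)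
    have meas: "\<phi> n \<in> borel_measurable borel" for n using c by (rule borel_measurable_continuous_onI)
    have "(\<lambda>n. \<integral>x. \<phi> n x \<partial>M) \<longlonglongrightarrow> (\<integral>x. indicator U x \<partial>M)"
      by (rule integral_dominated_convergence[where w = "\<lambda>_. 1"])
        (use lim meas b bU sM in \<open>auto simp: measurable_cong_sets[OF sM refl]\<close>)
    moreover have "(\<lambda>n. \<integral>x. \<phi> n x \<partial>N) \<longlonglongrightarrow> (\<integral>x. indicator U x \<partial>N)"
      by (rule integral_dominated_convergence[where w = "\<lambda>_. 1"])
        (use lim meas b bU sN in \<open>auto simp: measurable_cong_sets[OF sN refl]\<close>)
    ultimately have "(\<integral>x. indicator U x \<partial>M) \<le> (\<integral>x. (indicator U x :: real) \<partial>N)"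
      by (rule LIMSEQ_le) (use le[OF c] b in blast)
    then have "measure M U \<le> measure N U" using bU sM sN spaces by simp
    then show ?thesis by (simp add: M.emeasure_eq_measure N.emeasure_eq_measure)
  qed
  have "emeasure M A \<le> emeasure N U" if "A \<subseteq> U" "open U" for U
    using emeasure_mono[OF that(1), of M] open_le[OF that(2)] that(2) sM by (auto intro: order_trans)
  then have "emeasure M A \<le> (INF U \<in> {U. A \<subseteq> U \<and> open U}. emeasure N U)" by (intro INF_greatest) auto
  also have "\<dots> = emeasure N A" by (rule outer_regular[symmetric]) (use sN A in auto)
  finally show ?thesis .
qed

lemma continuous_clamp_exp:
  assumes "continuous_on {0..1} \<phi>"
  shows "continuous_on UNIV (\<lambda>x::real. \<phi> (min 1 (exp (- x))) :: real)"
  by (rule continuous_on_compose2[OF assms]) (auto intro!: continuous_intros)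

lemma borel_clamp_exp:
  assumes "continuous_on {0..1} \<phi>"
  shows "(\<lambda>x::real. \<phi> (min 1 (exp (- x))) :: real) \<in> borel_measurable borel"
  by (rule borel_measurable_continuous_onI[OF continuous_clamp_exp[OF assms]])

lemma continuous_on_01_bounded:
  fixes f :: "real \<Rightarrow> real"
  assumes "continuous_on {0..1} f"
  obtains B where "\<And>x. x \<in> {0..1} \<Longrightarrow> \<bar>f x\<bar> \<le> B"
proof -
  have "bounded (f ` {0..1})" by (intro compact_imp_bounded compact_continuous_image assms) auto
  then obtain B where "\<forall>y\<in>f ` {0..1}. norm y \<le> B" by (auto simp: bounded_iff)
  then show thesis by (intro that[of B]) auto
qed

text \<open>The substitution \<open>exp (- x)\<close> turns the Laplace transform at
  \<open>1, 2, ...\<close> into the moments of the signed measure with density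
  \<open>exp (- x) * g x\<close>, carried to the unit interval. Its functional is nonnegative, so
  the image of the negative part is dominated by that of the positive part, and the latter has no
  mass where \<open>g\<close> is negative.\<close>

lemma density_nonneg_if_cm:
  fixes g :: "real \<Rightarrow> real"
  assumes meas[measurable]: "g \<in> borel_measurable borel" and supp: "\<And>x. x \<le> 0 \<Longrightarrow> g x = 0"
    and int: "integrable lborel (\<lambda>x. exp (- x) * g x)"
    and F: "\<And>m k. 0 \<le> fdiff m (\<lambda>l. \<integral>x. exp (- l * x) * g x \<partial>lborel) (real k + 1)"
  shows "AE x in lborel. 0 \<le> g x"
proof -
  \<comment> \<open>The minimum keeps the argument in the unit interval for \<open>x \<le> 0\<close>
    too, where \<open>g\<close> vanishes.\<close>
  let ?c = "\<lambda>x::real. min 1 (exp (- x))" and ?w = "\<lambda>x. exp (- x) * g x"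
  define \<Lambda> where "\<Lambda> \<phi> = (\<integral>x. \<phi> (?c x) * ?w x \<partial>lborel)" for \<phi>
  have integ: "integrable lborel (\<lambda>x. \<phi> (?c x) * ?w x)" if c: "continuous_on {0..1} \<phi>" for \<phi>
  proof -
    obtain B where B: "\<And>x. x \<in> {0..1} \<Longrightarrow> \<bar>\<phi> x\<bar> \<le> B" using continuous_on_01_bounded[OF c] by blast
    show ?thesis
      by (rule Bochner_Integration.integrable_bound[OF integrable_mult_right[OF integrable_abs[OF int], of B]])
        (use borel_clamp_exp[OF c] order_trans[OF B abs_ge_self] in \<open>auto simp: abs_mult intro!: mult_right_mono\<close>)
  qed
  have pos: "0 \<le> \<Lambda> \<phi>" if "continuous_on {0..1} \<phi>" "\<And>x. x \<in> {0..1} \<Longrightarrow> 0 \<le> \<phi> x" for \<phi>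
  proof (rule moment_functional_nonneg[where \<phi> = \<phi> and F = "\<lambda>l. \<integral>x. exp (- l * x) * g x \<partial>lborel"
        and C = "\<integral>x. \<bar>?w x\<bar> \<partial>lborel"])
    fix f h :: "real \<Rightarrow> real" and a assume fh: "continuous_on {0..1} f" "continuous_on {0..1} h"
    show "\<Lambda> (\<lambda>x. a * f x + h x) = a * \<Lambda> f + \<Lambda> h"
      using integ[OF fh(1)] integ[OF fh(2)] unfolding \<Lambda>_def
      by (simp add: distrib_right mult.assoc)
  next
    fix f :: "real \<Rightarrow> real" and e assume f: "continuous_on {0..1} f" "\<And>x. x \<in> {0..1} \<Longrightarrow> \<bar>f x\<bar> \<le> e"
    have "\<bar>\<Lambda> f\<bar> \<le> (\<integral>x. \<bar>f (?c x) * ?w x\<bar> \<partial>lborel)" unfolding \<Lambda>_def by (rule integral_abs_bound)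
    also have "\<dots> \<le> (\<integral>x. e * \<bar>?w x\<bar> \<partial>lborel)"
    proof (rule integral_mono)
      show "\<And>x. \<bar>f (?c x) * ?w x\<bar> \<le> e * \<bar>?w x\<bar>"
        unfolding abs_mult by (intro mult_right_mono f) auto
    qed (use integ[OF f(1)] int in auto)
    finally show "\<bar>\<Lambda> f\<bar> \<le> (\<integral>x. \<bar>?w x\<bar> \<partial>lborel) * e" by (simp add: mult.commute)
  next
    fix k
    have "?c x ^ k * ?w x = exp (- (real k + 1) * x) * g x" for x
    proof (cases "x \<le> 0")
      case False
      then have "?c x ^ k = exp (- (real k * x))" by (simp add: exp_of_nat_mult[symmetric])
      moreover have "exp (- (real k + 1) * x) = exp (- (real k * x)) * exp (- x)"
        by (simp add: exp_add[symmetric] algebra_simps)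
      ultimately show ?thesis by simp
    qed (simp add: supp)
    then show "\<Lambda> (\<lambda>x. x ^ k) = (\<integral>x. exp (- (real k + 1) * x) * g x \<partial>lborel)" by (simp only: \<Lambda>_def)
  qed (use that F in auto)
  define p where "p x = exp (- x) * max 0 (g x)" for x
  define n where "n x = exp (- x) * max 0 (- g x)" for x
  have pn[measurable]: "p \<in> borel_measurable borel" "n \<in> borel_measurable borel"
    unfolding p_def n_def by measurable
  have pn0: "0 \<le> p x" "0 \<le> n x" for x by (auto simp: p_def n_def)
  have pn_int: "integrable lborel p" "integrable lborel n"
    by (rule Bochner_Integration.integrable_bound[OF int]; auto simp: p_def n_def abs_mult)+
  have wpn: "?w x = p x - n x" for x by (auto simp: p_def n_def max_def)
  define D where "D q = distr (density lborel (\<lambda>x. ennreal (q x))) borel ?c" for q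
  have sD: "sets (D q) = sets borel" for q by (simp add: D_def)
  have Dfin: "finite_measure (D q)" if "integrable lborel q" "\<And>x. 0 \<le> q x" for q
  proof -
    have [measurable]: "q \<in> borel_measurable borel" using borel_measurable_integrable[OF that(1)] by simp
    have "emeasure (density lborel (\<lambda>x. ennreal (q x))) UNIV = ennreal (\<integral>x. q x \<partial>lborel)"
      using that by (simp add: emeasure_density nn_integral_eq_integral)
    then have "finite_measure (density lborel (\<lambda>x. ennreal (q x)))" by (intro finite_measureI) simp
    then show ?thesis unfolding D_def by (rule finite_measure.finite_measure_distr) simp
  qed
  have Dint: "(\<integral>x. \<phi> x \<partial>D q) = (\<integral>x. q x * \<phi> (?c x) \<partial>lborel)"
    if "continuous_on UNIV \<phi>" "integrable lborel q" "\<And>x. 0 \<le> q x" for \<phi> :: "real \<Rightarrow> real" and q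
  proof -
    have [measurable]: "q \<in> borel_measurable borel" "\<phi> \<in> borel_measurable borel"
      using borel_measurable_integrable[OF that(2)] borel_measurable_continuous_onI[OF that(1)] by auto
    show ?thesis unfolding D_def using that by (simp add: integral_distr integral_density)
  qed
  have main: "emeasure (D n) A \<le> emeasure (D p) A" if A: "A \<in> sets borel" for A
  proof (rule measure_le_if_integral_le[OF Dfin Dfin sD sD _ A])
    fix \<phi> :: "real \<Rightarrow> real" assume \<phi>: "continuous_on UNIV \<phi>" "\<And>x. 0 \<le> \<phi> x \<and> \<phi> x \<le> 1"
    have c: "continuous_on {0..1} \<phi>" using \<phi>(1) continuous_on_subset by blast
    have i: "integrable lborel (\<lambda>x. q x * \<phi> (?c x))" if "integrable lborel q" for q
      by (rule Bochner_Integration.integrable_bound[OF that])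
        (use borel_clamp_exp[OF c] borel_measurable_integrable[OF that] \<phi>(2) in \<open>auto simp: abs_mult intro!: mult_left_le\<close>)
    have "0 \<le> \<Lambda> \<phi>" using \<phi>(2) by (intro pos c) auto
    also have "\<Lambda> \<phi> = (\<integral>x. p x * \<phi> (?c x) - n x * \<phi> (?c x) \<partial>lborel)"
      unfolding \<Lambda>_def wpn by (simp add: algebra_simps)
    also have "\<dots> = (\<integral>x. \<phi> x \<partial>D p) - (\<integral>x. \<phi> x \<partial>D n)"
      using i pn_int pn0 Dint[OF \<phi>(1)] by simp
    finally show "(\<integral>x. \<phi> x \<partial>D n) \<le> (\<integral>x. \<phi> x \<partial>D p)" by simp
  qed (use pn_int pn0 in auto)
  \<comment> \<open>The image of \<open>{x. g x < 0}\<close> under \<open>exp (- x)\<close>, written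
    with the inverse map \<open>- ln x\<close>.\<close>
  define A where "A = {x. 0 < x \<and> x < 1 \<and> g (- ln x) < 0}"
  have A[measurable]: "A \<in> sets borel" unfolding A_def by measurable
  have mem: "?c x \<in> A \<longleftrightarrow> g x < 0" for x
  proof (cases "x \<le> 0")
    case True
    then have "?c x = 1" by simp
    then show ?thesis using supp[OF True] by (simp add: A_def)
  qed (simp add: A_def min_def)
  have eD: "emeasure (D q) A = (\<integral>\<^sup>+x. ennreal (q x) * indicator {x. g x < 0} x \<partial>lborel)"
    if "integrable lborel q" for q
  proof -
    have [measurable]: "q \<in> borel_measurable borel" using borel_measurable_integrable[OF that] by simp
    have "?c -` A = {x. g x < 0}" using mem by auto
    then show ?thesis unfolding D_def by (simp add: emeasure_distr emeasure_density)
  qed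
  have "emeasure (D p) A = 0"
    unfolding eD[OF pn_int(1)] by (subst nn_integral_0_iff_AE) (auto simp: p_def split: split_indicator)
  with main[OF A] have "emeasure (D n) A = 0" by simp
  then have "AE x in lborel. ennreal (n x) * indicator {x. g x < 0} x = 0"
    unfolding eD[OF pn_int(2)] by (subst (asm) nn_integral_0_iff_AE) auto
  then show ?thesis
    by eventually_elim (auto simp: n_def max_def mult_le_0_iff split: split_indicator_asm if_splits)
qed

text \<open>All moments of the combined image on the unit interval vanish, so the moment argument
  with \<open>F = 0\<close> applies to the functional and to its negative. A finite family with
  signed coefficients is allowed because the lemma serves both to compare two laws and to prove a
  linear relation among three.\<close>

lemma laplace_unique:
  fixes M :: "'i \<Rightarrow> real measure" and c :: "'i \<Rightarrow> real" and g :: "real \<Rightarrow> real"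
  assumes I: "finite I" and fin: "\<And>i. i \<in> I \<Longrightarrow> finite_measure (M i)"
    and sM: "\<And>i. i \<in> I \<Longrightarrow> sets (M i) = sets borel"
    and pos: "\<And>i. i \<in> I \<Longrightarrow> AE x in M i. 0 < x"
    and mom: "\<And>k::nat. (\<Sum>i\<in>I. c i * (\<integral>x. exp (- (real k * x)) \<partial>M i)) = 0"
    and g: "continuous_on UNIV g" "\<And>x. \<bar>g x\<bar> \<le> B"
  shows "(\<Sum>i\<in>I. c i * (\<integral>x. g x \<partial>M i)) = 0"
proof -
  let ?c = "\<lambda>x::real. min 1 (exp (- x))"
  define \<Lambda> where "\<Lambda> \<phi> = (\<Sum>i\<in>I. c i * (\<integral>x. \<phi> (?c x) \<partial>M i))" for \<phi> :: "real \<Rightarrow> real"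
  have integ: "integrable (M i) (\<lambda>x. \<phi> (?c x))" if c: "continuous_on {0..1} \<phi>" and i: "i \<in> I" for \<phi> :: "real \<Rightarrow> real" and i
  proof -
    obtain B where "\<And>x. x \<in> {0..1} \<Longrightarrow> \<bar>\<phi> x\<bar> \<le> B" using continuous_on_01_bounded[OF c] by blast
    then show ?thesis
      using borel_clamp_exp[OF c] by (intro finite_measure.integrable_const_bound[OF fin[OF i], of _ B])
        (auto simp: measurable_cong_sets[OF sM[OF i] refl])
  qed
  have lin: "\<Lambda> (\<lambda>x. a * f x + h x) = a * \<Lambda> f + \<Lambda> h"
    if fh: "continuous_on {0..1} f" "continuous_on {0..1} h" for f h a
    unfolding \<Lambda>_def sum_distrib_left sum.distrib[symmetric]
    by (intro sum.cong refl) (simp add: integ[OF fh(1)] integ[OF fh(2)] algebra_simps)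
  define K where "K = (\<Sum>i\<in>I. \<bar>c i\<bar> * measure (M i) (space (M i)))"
  have bound: "\<bar>\<Lambda> f\<bar> \<le> K * e" if f: "continuous_on {0..1} f" "\<And>x. x \<in> {0..1} \<Longrightarrow> \<bar>f x\<bar> \<le> e" for f e
  proof -
    have "\<bar>\<Lambda> f\<bar> \<le> (\<Sum>i\<in>I. \<bar>c i * (\<integral>x. f (?c x) \<partial>M i)\<bar>)" unfolding \<Lambda>_def by (rule sum_abs)
    also have "\<dots> \<le> (\<Sum>i\<in>I. \<bar>c i\<bar> * (measure (M i) (space (M i)) * e))"
    proof (rule sum_mono)
      fix i assume i: "i \<in> I"
      have "\<bar>\<integral>x. f (?c x) \<partial>M i\<bar> \<le> (\<integral>x. \<bar>f (?c x)\<bar> \<partial>M i)" by (rule integral_abs_bound)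
      also have "\<dots> \<le> (\<integral>x. e \<partial>M i)"
        by (rule integral_mono) (use integ[OF f(1) i] f(2) finite_measure.integrable_const[OF fin[OF i]] in auto)
      finally show "\<bar>c i * (\<integral>x. f (?c x) \<partial>M i)\<bar> \<le> \<bar>c i\<bar> * (measure (M i) (space (M i)) * e)"
        by (simp add: abs_mult mult_left_mono)
    qed
    finally show ?thesis by (simp add: K_def sum_distrib_right mult.assoc)
  qed
  have mom0: "\<Lambda> (\<lambda>x. x ^ k) = 0" for k
  proof -
    have "(\<integral>x. ?c x ^ k \<partial>M i) = (\<integral>x. exp (- (real k * x)) \<partial>M i)" if i: "i \<in> I" for i
    proof (rule integral_cong_AE)
      show "AE x in M i. ?c x ^ k = exp (- (real k * x))"
        using pos[OF i] by eventually_elim (simp add: exp_of_nat_mult[symmetric])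
    qed (auto simp: measurable_cong_sets[OF sM[OF i] refl])
    then show ?thesis using mom[of k] by (simp add: \<Lambda>_def cong: sum.cong)
  qed
  have z: "fdiff m (\<lambda>_. 0) x = 0" for m x by (induction m) auto
  have bound': "\<bar>- \<Lambda> f\<bar> \<le> K * e" if f: "continuous_on {0..1} f" "\<And>x. x \<in> {0..1} \<Longrightarrow> \<bar>f x\<bar> \<le> e" for f e
    using bound[of f e] f by simp
  have "\<Lambda> \<phi> = 0" if "continuous_on {0..1} \<phi>" "\<And>x. x \<in> {0..1} \<Longrightarrow> 0 \<le> \<phi> x" for \<phi>
  proof -
    have "0 \<le> \<Lambda> \<phi>"
      by (rule moment_functional_nonneg[of \<Lambda> K "\<lambda>_. 0" \<phi>])
        (fact lin, fact bound, simp only: mom0, simp only: z order_refl, fact that(1), fact that(2))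
    moreover have "0 \<le> - \<Lambda> \<phi>"
      by (rule moment_functional_nonneg[of "\<lambda>f. - \<Lambda> f" K "\<lambda>_. 0" \<phi>])
        (simp only: lin mult_minus_right minus_add_distrib, fact bound', simp only: mom0 minus_zero,
          simp only: z order_refl, fact that(1), fact that(2))
    ultimately show ?thesis by simp
  qed note zero = this
  have zero: "\<Lambda> \<phi> = 0" if c: "continuous_on {0..1} \<phi>" for \<phi>
  proof -
    obtain b where b: "\<And>x. x \<in> {0..1} \<Longrightarrow> \<bar>\<phi> x\<bar> \<le> b" using continuous_on_01_bounded[OF c] by blast
    have "\<Lambda> (\<lambda>x. 1 * \<phi> x + \<bar>b\<bar>) = 1 * \<Lambda> \<phi> + \<Lambda> (\<lambda>_. \<bar>b\<bar>)" by (intro lin c continuous_intros)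
    moreover have "\<Lambda> (\<lambda>x. 1 * \<phi> x + \<bar>b\<bar>) = 0"
      by (rule zero, intro continuous_intros c) (use b in fastforce)
    moreover have "\<Lambda> (\<lambda>_. \<bar>b\<bar>) = 0" by (rule zero) auto
    ultimately show ?thesis by simp
  qed
  \<comment> \<open>In the variable \<open>exp (- x)\<close> the function \<open>g\<close> need not
    extend continuously to \<open>0\<close>. The truncation at \<open>1 / (j + 1)\<close> is
    continuous and exact at each given point for large \<open>j\<close>.\<close>
  define \<phi> where "\<phi> j x = g (- ln (max x (1 / real (Suc j))))" for j x
  have c\<phi>: "continuous_on {0..1} (\<phi> j)" for j
  proof -
    have "continuous_on {0..1} (\<lambda>x. - ln (max x (1 / real (Suc j))))"
      by (intro continuous_intros) (auto simp: max_def)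
    then show ?thesis unfolding \<phi>_def by (rule continuous_on_compose2[OF g(1)]) auto
  qed
  have "(\<lambda>j. \<Sum>i\<in>I. c i * (\<integral>x. \<phi> j (?c x) \<partial>M i)) \<longlonglongrightarrow> (\<Sum>i\<in>I. c i * (\<integral>x. g x \<partial>M i))"
  proof (intro tendsto_sum tendsto_mult_left)
    fix i assume i: "i \<in> I"
    note [simp] = measurable_cong_sets[OF sM[OF i] refl]
    show "(\<lambda>j. \<integral>x. \<phi> j (?c x) \<partial>M i) \<longlonglongrightarrow> (\<integral>x. g x \<partial>M i)"
    proof (rule integral_dominated_convergence[where w = "\<lambda>_. B"])
      show "AE x in M i. (\<lambda>j. \<phi> j (?c x)) \<longlonglongrightarrow> g x"
        using pos[OF i]
      proof eventually_elim
        case (elim x)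
        obtain n0 where n0: "inverse (real (Suc n0)) < exp (- x)" using reals_Archimedean[of "exp (- x)"] by auto
        have "\<phi> j (?c x) = g x" if "j \<ge> n0" for j
        proof -
          have "1 / real (Suc j) \<le> 1 / real (Suc n0)" using that by (simp add: frac_le)
          also have "\<dots> < exp (- x)" using n0 by (simp add: inverse_eq_divide)
          finally have "max (?c x) (1 / real (Suc j)) = exp (- x)" using elim by (simp add: max_def)
          then show ?thesis unfolding \<phi>_def by (metis ln_exp minus_minus)
        qed
        then have "\<forall>\<^sub>F j in sequentially. \<phi> j (?c x) = g x" by (auto simp: eventually_sequentially)
        then show ?case by (rule tendsto_eventually)
      qed
      show "integrable (M i) (\<lambda>_. B)" by (rule finite_measure.integrable_const[OF fin[OF i]])
    qed (use g borel_clamp_exp[OF c\<phi>] in \<open>auto simp: \<phi>_def intro!: borel_measurable_continuous_onI\<close>)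
  qed
  moreover have "(\<Sum>i\<in>I. c i * (\<integral>x. \<phi> j (?c x) \<partial>M i)) = 0" for j
    using zero[OF c\<phi>] by (simp add: \<Lambda>_def)
  ultimately show ?thesis by (simp add: LIMSEQ_const_iff)
qed

section \<open>The stable subordinator at an exponential time\<close>

locale stable_density =
  fixes s :: real and \<eta> :: "real \<Rightarrow> real \<Rightarrow> real"
  assumes s: "0 < s" "s < 1" and \<eta>: "is_stable_density s \<eta>"
begin

text \<open>The hypothesis speaks about \<open>\<eta> t\<close> on the positive half-line; cutting
  off there gives a function on the whole line with the same transform.\<close>

definition dens :: "real \<Rightarrow> real \<Rightarrow> real" where
  "dens t x = indicator {0<..} x * \<eta> t x"

lemma dens_laplace:
  assumes "0 < t" "0 < l"
  shows "integrable lborel (\<lambda>x. exp (- l * x) * dens t x)"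
    and "(\<integral>x. exp (- l * x) * dens t x \<partial>lborel) = exp (- t * l powr s)"
proof -
  have e: "(\<lambda>x. indicator {0<..} x *\<^sub>R (exp (- l * x) * \<eta> t x)) = (\<lambda>x. exp (- l * x) * dens t x)"
    by (auto simp: dens_def split: split_indicator)
  have "set_integrable lborel {0<..} (\<lambda>x. exp (- l * x) * \<eta> t x)"
    and "(LBINT x:{0<..}. exp (- l * x) * \<eta> t x) = exp (- t * l powr s)"
    using \<eta> assms by (simp_all add: is_stable_density_def)
  then show "integrable lborel (\<lambda>x. exp (- l * x) * dens t x)"
    and "(\<integral>x. exp (- l * x) * dens t x \<partial>lborel) = exp (- t * l powr s)"
    unfolding set_integrable_def set_lebesgue_integral_def e by simp_all
qed

text \<open>Measurability is extracted from the integrability of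
  \<open>exp (- x) * dens t x\<close>, which the hypothesis contains.\<close>

lemma dens_measurable:
  assumes "0 < t"
  shows "dens t \<in> borel_measurable borel"
proof -
  have [measurable]: "(\<lambda>x. exp (- 1 * x) * dens t x) \<in> borel_measurable borel"
    using borel_measurable_integrable[OF dens_laplace(1)[OF assms, of 1]] by simp
  have "(\<lambda>x. exp x * (exp (- 1 * x) * dens t x)) \<in> borel_measurable borel" by measurable
  moreover have "(\<lambda>x. exp x * (exp (- 1 * x) * dens t x)) = dens t"
    by (auto simp: exp_minus field_simps)
  ultimately show ?thesis by (simp only:)
qed

lemma dens_nonneg:
  assumes t: "0 < t"
  shows "AE x in lborel. 0 \<le> dens t x"
proof (rule density_nonneg_if_cm)
  show "dens t \<in> borel_measurable borel" by (rule dens_measurable[OF t])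
  show "\<And>x. x \<le> 0 \<Longrightarrow> dens t x = 0" by (simp add: dens_def)
  show "integrable lborel (\<lambda>x. exp (- x) * dens t x)" using dens_laplace(1)[OF t, of 1] by simp
  fix m k
  have "fdiff m (\<lambda>l. \<integral>x. exp (- l * x) * dens t x \<partial>lborel) (real k + 1) =
      fdiff m (\<lambda>l. exp (- t * l powr s)) (real k + 1)"
    by (rule fdiff_cong, rule dens_laplace[OF t]) auto
  then show "0 \<le> fdiff m (\<lambda>l. \<integral>x. exp (- l * x) * dens t x \<partial>lborel) (real k + 1)"
    using fdiff_exp_powr_nonneg[OF s t, of "real k + 1" m] by simp
qed

text \<open>The law at time \<open>t\<close> of the \<open>s\<close>-stable subordinator.\<close>

definition N :: "real \<Rightarrow> real measure" where
  "N t = density lborel (\<lambda>x. ennreal (dens t x))"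

lemma sets_N [simp, measurable_cong]: "sets (N t) = sets borel" by (simp add: N_def)

text \<open>Monotone convergence along the arguments \<open>1 / (n + 1)\<close>, legitimate because
  the density is nonnegative, gives the mass as the limit of \<open>exp (- t * l powr s)\<close> for
  \<open>l\<close> tending to \<open>0\<close>.\<close>

lemma dens_mass:
  assumes t: "0 < t"
  shows "integrable lborel (dens t)" "(\<integral>x. dens t x \<partial>lborel) = 1"
proof -
  let ?f = "\<lambda>n x. exp (- (1 / real (Suc n)) * x) * dens t x"
  have lim0: "(\<lambda>n. 1 / real (Suc n)) \<longlonglongrightarrow> 0" by (rule LIMSEQ_Suc[OF lim_1_over_n])
  have a: "AE x in lborel. mono (\<lambda>n. ?f n x)" using dens_nonneg[OF t]
  proof eventually_elim
    case (elim x)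
    show ?case
    proof (cases "x > 0")
      case True
      show ?thesis
      proof (rule monoI)
        fix m n :: nat assume "m \<le> n"
        then have "1 / real (Suc n) \<le> 1 / real (Suc m)" by (simp add: frac_le)
        then have "(1 / real (Suc n)) * x \<le> (1 / real (Suc m)) * x" using True by (intro mult_right_mono) auto
        then show "?f m x \<le> ?f n x" using elim by (intro mult_right_mono) auto
      qed
    qed (simp add: dens_def mono_def)
  qed
  have b: "AE x in lborel. (\<lambda>n. ?f n x) \<longlonglongrightarrow> dens t x"
  proof (intro AE_I2)
    fix x
    have "(\<lambda>n. ?f n x) \<longlonglongrightarrow> exp (- 0 * x) * dens t x" by (intro tendsto_intros lim0)
    then show "(\<lambda>n. ?f n x) \<longlonglongrightarrow> dens t x" by simp
  qed
  have "(\<lambda>n. (1 / real (Suc n)) powr s) \<longlonglongrightarrow> 0 powr s"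
    using s by (intro tendsto_powr' lim0 tendsto_const) auto
  then have "(\<lambda>n. exp (- t * (1 / real (Suc n)) powr s)) \<longlonglongrightarrow> exp (- t * 0 powr s)"
    by (rule tendsto_exp[OF tendsto_mult[OF tendsto_const]])
  then have c: "(\<lambda>n. \<integral>x. ?f n x \<partial>lborel) \<longlonglongrightarrow> 1"
    by (subst dens_laplace(2)[OF t]) auto
  have f: "integrable lborel (?f n)" for n by (rule dens_laplace(1)[OF t]) simp
  have m: "dens t \<in> borel_measurable lborel" using dens_measurable[OF t] by simp
  show "integrable lborel (dens t)" by (rule integrable_monotone_convergence[where f = ?f, OF f a b c m])
  show "(\<integral>x. dens t x \<partial>lborel) = 1" by (rule integral_monotone_convergence[where f = ?f, OF f a b c m])
qed

lemma prob_N: "0 < t \<Longrightarrow> prob_space (N t)"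
proof (rule prob_spaceI)
  assume t: "0 < t"
  have [measurable]: "dens t \<in> borel_measurable borel" by (rule dens_measurable[OF t])
  have "emeasure (N t) (space (N t)) = (\<integral>\<^sup>+x. ennreal (dens t x) \<partial>lborel)"
    by (simp add: N_def emeasure_density)
  also have "\<dots> = ennreal 1"
    using nn_integral_eq_integral[OF dens_mass(1)[OF t] dens_nonneg[OF t]] dens_mass(2)[OF t] by simp
  finally show "emeasure (N t) (space (N t)) = 1" by simp
qed

lemma integral_N:
  fixes f :: "real \<Rightarrow> real"
  assumes t: "0 < t" and f: "f \<in> borel_measurable borel"
  shows "(\<integral>x. f x \<partial>N t) = (\<integral>x. dens t x * f x \<partial>lborel)"
  unfolding N_def using integral_density[of f lborel "dens t"] f dens_measurable[OF t] dens_nonneg[OF t] by simp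

lemma N_pos:
  assumes t: "0 < t"
  shows "AE x in N t. 0 < x"
proof -
  have [measurable]: "dens t \<in> borel_measurable borel" by (rule dens_measurable[OF t])
  have "AE x in lborel. 0 < ennreal (dens t x) \<longrightarrow> 0 < x" by (auto simp: dens_def split: split_indicator_asm)
  then show ?thesis unfolding N_def by (subst AE_density) auto
qed

lemma N_laplace:
  assumes t: "0 < t" and a: "0 \<le> a"
  shows "(\<integral>x. exp (- (a * x)) \<partial>N t) = exp (- (t * a powr s))"
proof (cases "a = 0")
  case True
  then show ?thesis using prob_space.prob_space[OF prob_N[OF t]] by simp
next
  case False
  have "(\<integral>x. exp (- (a * x)) \<partial>N t) = (\<integral>x. exp (- a * x) * dens t x \<partial>lborel)"
    by (subst integral_N[OF t]) (auto simp: mult.commute)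
  then show ?thesis using dens_laplace(2)[OF t, of a] False a by simp
qed

text \<open>Self-similarity: both measures have the Laplace transform
  \<open>exp (- (t * a powr s))\<close>. The time moves from the measure into the integrand, where
  it enters continuously.\<close>

lemma N_scaling:
  assumes t: "0 < t" and g: "continuous_on UNIV g" "\<And>x. \<bar>g x\<bar> \<le> (B::real)"
  shows "(\<integral>x. g x \<partial>N t) = (\<integral>x. g (t powr (1 / s) * x) \<partial>N 1)"
proof -
  let ?r = "t powr (1 / s)"
  define M where "M i = (if i then N t else distr (N 1) borel (\<lambda>x. ?r * x))" for i
  define c :: "bool \<Rightarrow> real" where "c i = (if i then 1 else - 1)" for i
  have r: "?r > 0" using t by simp
  have [measurable]: "g \<in> borel_measurable borel" using g(1) by (rule borel_measurable_continuous_onI)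
  have "(\<Sum>i\<in>UNIV. c i * (\<integral>x. g x \<partial>M i)) = 0"
  proof (rule laplace_unique[where B = B])
    fix i :: bool
    show "finite_measure (M i)"
      using prob_space.finite_measure[OF prob_N[OF t]]
        prob_space.finite_measure[OF prob_space.prob_space_distr[OF prob_N[of 1], of "\<lambda>x. ?r * x" borel]]
      by (simp add: M_def)
    show "sets (M i) = sets borel" by (simp add: M_def)
    have "AE x in distr (N 1) borel (\<lambda>x. ?r * x). 0 < x"
      using N_pos[of 1] r by (subst AE_distr_iff) (auto simp: zero_less_mult_iff)
    moreover have "M i = N t \<or> M i = distr (N 1) borel (\<lambda>x. ?r * x)" by (simp add: M_def)
    ultimately show "AE x in M i. 0 < x" using N_pos[OF t] by metis
  next
    fix k :: nat
    have "(\<integral>x. exp (- (real k * x)) \<partial>distr (N 1) borel (\<lambda>x. ?r * x)) = (\<integral>x. exp (- ((real k * ?r) * x)) \<partial>N 1)"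
      by (subst integral_distr) (auto simp: mult.assoc)
    also have "\<dots> = exp (- (t * real k powr s))"
      using s t by (subst N_laplace) (auto simp: powr_mult powr_powr)
    finally show "(\<Sum>i\<in>UNIV. c i * (\<integral>x. exp (- (real k * x)) \<partial>M i)) = 0"
      using N_laplace[OF t, of "real k"] by (simp add: UNIV_bool c_def M_def)
  qed (use g in auto)
  then have "(\<integral>x. g x \<partial>N t) = (\<integral>x. g x \<partial>distr (N 1) borel (\<lambda>x. ?r * x))"
    by (simp add: UNIV_bool c_def M_def)
  then show ?thesis by (subst (asm) integral_distr) auto
qed

lemma stable_integral:
  assumes t: "0 < t" and g: "continuous_on UNIV g" "\<And>x. \<bar>g x\<bar> \<le> (B::real)"
  shows "(LBINT x:{0<..}. g x * \<eta> t x) = (\<integral>x. g (t powr (1 / s) * x) \<partial>N 1)"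
proof -
  have "(LBINT x:{0<..}. g x * \<eta> t x) = (\<integral>x. dens t x * g x \<partial>lborel)"
    unfolding set_lebesgue_integral_def by (intro Bochner_Integration.integral_cong) (auto simp: dens_def split: split_indicator)
  also have "\<dots> = (\<integral>x. g x \<partial>N t)"
    using g(1) by (subst integral_N[OF t]) (auto intro: borel_measurable_continuous_onI)
  finally show ?thesis using N_scaling[OF t g] by simp
qed

section \<open>The subordinator at an independent exponential time\<close>

definition E :: "real \<Rightarrow> real measure" where
  "E l = density lborel (\<lambda>x. ennreal (exponential_density l x))"

lemma sets_E [simp, measurable_cong]: "sets (E l) = sets borel" by (simp add: E_def)

lemma prob_E: "0 < l \<Longrightarrow> prob_space (E l)"
  unfolding E_def by (rule prob_space_exponential_density)

lemma integral_E:
  fixes f :: "real \<Rightarrow> real"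
  assumes l: "0 < l" and f: "f \<in> borel_measurable borel"
  shows "(\<integral>x. f x \<partial>E l) = (\<integral>x. exponential_density l x * f x \<partial>lborel)"
  unfolding E_def using integral_density[of f lborel "exponential_density l"] f exponential_density_nonneg[OF l] by simp

lemma E_pos:
  assumes l: "0 < l"
  shows "AE x in E l. 0 < x"
proof -
  have "AE x in lborel. x \<noteq> (0::real)" by (rule AE_lborel_singleton)
  then have "AE x in lborel. 0 < ennreal (exponential_density l x) \<longrightarrow> 0 < x"
    by eventually_elim (auto simp: exponential_density_def split: if_splits)
  then show ?thesis unfolding E_def by (subst AE_density) auto
qed

text \<open>\<open>K l\<close> is the law of the subordinator at an independent exponential time, so that
  the resolvent at \<open>l\<close> is \<open>1 / l\<close> times the average of the heat semigroup over \<open>K l\<close>.\<close>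

definition K :: "real \<Rightarrow> real measure" where
  "K l = distr (E l \<Otimes>\<^sub>M N 1) borel (\<lambda>(t, x). t powr (1 / s) * x)"

lemma sets_K [simp, measurable_cong]: "sets (K l) = sets borel" by (simp add: K_def)

lemma pair_EN: "0 < l \<Longrightarrow> pair_prob_space (E l) (N 1)"
  using prob_E prob_N[of 1] by (simp add: pair_prob_space_def pair_sigma_finite_def prob_space_imp_sigma_finite)

lemma prob_K: "0 < l \<Longrightarrow> prob_space (K l)"
proof -
  assume "0 < l"
  then interpret pair_prob_space "E l" "N 1" by (rule pair_EN)
  show ?thesis unfolding K_def by (rule prob_space_distr) simp
qed

lemma integral_K:
  fixes f :: "real \<Rightarrow> real"
  assumes l: "0 < l" and f[measurable]: "f \<in> borel_measurable borel" and B: "\<And>x. \<bar>f x\<bar> \<le> B"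
  shows "(\<integral>x. f x \<partial>K l) = (\<integral>t. (\<integral>x. f (t powr (1 / s) * x) \<partial>N 1) \<partial>E l)"
proof -
  interpret pair_prob_space "E l" "N 1" by (rule pair_EN[OF l])
  have i: "integrable (E l \<Otimes>\<^sub>M N 1) (\<lambda>(t, x). f (t powr (1 / s) * x))"
    by (rule P.integrable_const_bound[of _ B]) (use B in auto)
  have "(\<integral>x. f x \<partial>K l) = (\<integral>p. f ((\<lambda>(t, x). t powr (1 / s) * x) p) \<partial>(E l \<Otimes>\<^sub>M N 1))"
    unfolding K_def by (rule integral_distr) auto
  also have "\<dots> = (\<integral>p. (\<lambda>(t, x). f (t powr (1 / s) * x)) p \<partial>(E l \<Otimes>\<^sub>M N 1))"
    by (intro Bochner_Integration.integral_cong) auto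
  also have "\<dots> = (\<integral>t. (\<integral>x. f (t powr (1 / s) * x) \<partial>N 1) \<partial>E l)"
    using integral_fst[OF i] by simp
  finally show ?thesis .
qed

lemma K_pos:
  assumes l: "0 < l"
  shows "AE x in K l. 0 < x"
proof -
  interpret pair_prob_space "E l" "N 1" by (rule pair_EN[OF l])
  have "AE p in E l \<Otimes>\<^sub>M N 1. 0 < fst p powr (1 / s) * snd p"
  proof (rule AE_pair_measure)
    show "AE x in E l. AE y in N 1. 0 < fst (x, y) powr (1 / s) * snd (x, y)"
      using E_pos[OF l]
    proof eventually_elim
      case (elim x)
      have "AE y in N 1. 0 < y" by (rule N_pos) simp
      then show ?case by eventually_elim (use elim in simp)
    qed
  qed measurable
  then show ?thesis unfolding K_def by (subst AE_distr_iff) (auto simp: case_prod_beta)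
qed

lemma K_laplace:
  assumes l: "0 < l" and a: "0 \<le> a"
  shows "(\<integral>x. exp (- (a * x)) \<partial>K l) = l / (l + a powr s)"
proof -
  let ?b = "a powr s"
  have lb: "0 < l + ?b" using l by (simp add: add_pos_nonneg)
  \<comment> \<open>\<open>integral_K\<close> asks for a function bounded on the whole line; the
    exponential is bounded on the positive half-line, which carries the measure.\<close>
  have "(\<integral>x. exp (- (a * x)) \<partial>K l) = (\<integral>x. exp (- (a * max 0 x)) \<partial>K l)"
  proof (rule integral_cong_AE)
    show "AE x in K l. exp (- (a * x)) = exp (- (a * max 0 x))"
      using K_pos[OF l] by eventually_elim simp
  qed auto
  also have "\<dots> = (\<integral>t. (\<integral>x. exp (- (a * max 0 (t powr (1 / s) * x))) \<partial>N 1) \<partial>E l)"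
    using a by (intro integral_K[OF l, of _ 1]) auto
  also have "\<dots> = (\<integral>t. exp (- (t * ?b)) \<partial>E l)"
  proof (rule integral_cong_AE)
    show "AE t in E l. (\<integral>x. exp (- (a * max 0 (t powr (1 / s) * x))) \<partial>N 1) = exp (- (t * ?b))"
      using E_pos[OF l]
    proof eventually_elim
      case (elim t)
      have "(\<integral>x. exp (- (a * max 0 (t powr (1 / s) * x))) \<partial>N 1) = (\<integral>x. exp (- ((a * t powr (1 / s)) * x)) \<partial>N 1)"
      proof (rule integral_cong_AE)
        show "AE x in N 1. exp (- (a * max 0 (t powr (1 / s) * x))) = exp (- ((a * t powr (1 / s)) * x))"
          using N_pos[OF zero_less_one] by eventually_elim (simp add: mult.assoc)
      qed auto
      also have "\<dots> = exp (- (t * ?b))"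
        using elim a s by (subst N_laplace) (auto simp: powr_mult powr_powr mult.commute)
      finally show ?case .
    qed
    interpret sigma_finite_measure "N 1" using prob_N[of 1] by (simp add: prob_space_imp_sigma_finite)
    show "(\<lambda>t. \<integral>x. exp (- (a * max 0 (t powr (1 / s) * x))) \<partial>N 1) \<in> borel_measurable (E l)"
      by measurable
  qed auto
  also have "\<dots> = (\<integral>t. (l / (l + ?b)) * exponential_density (l + ?b) t \<partial>lborel)"
    unfolding integral_E[OF l, of "\<lambda>t. exp (- (t * ?b))", simplified]
  proof (intro Bochner_Integration.integral_cong refl)
    fix t
    have "l / (l + ?b) * ((l + ?b) * X) = l * X" for X using lb by simp
    moreover have "exp (- t * l) * exp (- (t * ?b)) = exp (- t * (l + ?b))"
      by (simp add: exp_add[symmetric] algebra_simps)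
    ultimately show "exponential_density l t * exp (- (t * ?b)) = l / (l + ?b) * exponential_density (l + ?b) t"
      by (cases "t < 0") (simp add: exponential_density_def, metis exponential_density_def mult.assoc)
  qed
  also have "\<dots> = l / (l + ?b)"
  proof -
    have "(\<integral>t. exponential_density (l + ?b) t * 1 \<partial>lborel) = (\<integral>t. 1 \<partial>E (l + ?b))"
      by (rule integral_E[OF lb, symmetric]) simp
    also have "\<dots> = 1" using prob_space.prob_space[OF prob_E[OF lb]] by simp
    finally show ?thesis by simp
  qed
  finally show ?thesis .
qed

lemma K_resolvent:
  assumes l: "0 < l" and g: "continuous_on UNIV g" "\<And>x. \<bar>g x\<bar> \<le> (B::real)"
  shows "(LBINT t:{0<..}. exp (- l * t) * (\<integral>x. g (t powr (1 / s) * x) \<partial>N 1)) = (1 / l) * (\<integral>x. g x \<partial>K l)"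
proof -
  interpret sigma_finite_measure "N 1" using prob_N[of 1] by (simp add: prob_space_imp_sigma_finite)
  have [measurable]: "g \<in> borel_measurable borel" using g(1) by (rule borel_measurable_continuous_onI)
  let ?h = "\<lambda>t. \<integral>x. g (t powr (1 / s) * x) \<partial>N 1"
  have h[measurable]: "?h \<in> borel_measurable borel" by measurable
  have "(\<integral>x. g x \<partial>K l) = (\<integral>t. exponential_density l t * ?h t \<partial>lborel)"
    unfolding integral_K[OF l \<open>g \<in> _\<close> g(2)] by (rule integral_E[OF l h])
  also have "\<dots> = (\<integral>t. l * (indicator {0<..} t *\<^sub>R (exp (- l * t) * ?h t)) \<partial>lborel)"
  proof (rule integral_cong_AE)
    have "AE x in lborel. x \<noteq> (0::real)" by (rule AE_lborel_singleton)
    then show "AE t in lborel. exponential_density l t * ?h t = l * (indicator {0<..} t *\<^sub>R (exp (- l * t) * ?h t))"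
      by eventually_elim (auto simp: exponential_density_def mult_ac split: split_indicator)
  qed auto
  finally show ?thesis using l by (simp add: set_lebesgue_integral_def)
qed

text \<open>Markov's inequality for \<open>exp (- (x / v))\<close>, which is at least
  \<open>exp (- 1)\<close> on \<open>{..v}\<close>, with the Laplace transform at
  \<open>1 / v\<close>. The regularity estimates draw their information on \<open>K l\<close> near
  zero from this bound.\<close>

lemma K_tail:
  assumes l: "0 < l" and v: "0 < v"
  shows "emeasure (K l) {..v} \<le> ennreal (exp 1 * l * v powr s)"
proof -
  interpret prob_space "K l" by (rule prob_K[OF l])
  have sp: "space (K l) = UNIV" by (simp add: K_def)
  have "measure (K l) {..v} = (\<integral>x. indicator {..v} x \<partial>K l)" by (simp add: sp)
  also have "\<dots> \<le> (\<integral>x. exp 1 * exp (- ((1 / v) * x)) \<partial>K l)"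
  proof (rule integral_mono_AE)
    show "integrable (K l) (\<lambda>x. exp 1 * exp (- ((1 / v) * x)))"
    proof (rule integrable_const_bound[of _ "exp 1"])
      show "AE x in K l. norm (exp 1 * exp (- ((1 / v) * x))) \<le> exp 1"
        using K_pos[OF l] by eventually_elim (use v in auto)
    qed auto
    show "AE x in K l. indicator {..v} x \<le> exp 1 * exp (- ((1 / v) * x))"
      using v by (auto simp: exp_add[symmetric] field_simps split: split_indicator)
  qed (auto intro!: integrable_const_bound[of _ 1] split: split_indicator)
  also have "\<dots> = exp 1 * (l / (l + (1 / v) powr s))"
    using K_laplace[OF l, of "1 / v"] v by simp
  also have "\<dots> \<le> exp 1 * (l * v powr s)"
  proof -
    have vs: "(1 / v) powr s = 1 / v powr s" using v by (simp add: powr_divide)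
    have p: "v powr s > 0" using v by simp
    have "l / (l + 1 / v powr s) \<le> l / (1 / v powr s)"
      by (intro divide_left_mono mult_pos_pos add_pos_pos) (use l p in auto)
    also have "l / (1 / v powr s) = l * v powr s" by simp
    finally show ?thesis unfolding vs by (rule mult_left_mono) simp
  qed
  finally show ?thesis by (simp add: emeasure_eq_measure ennreal_leI mult.assoc)
qed

text \<open>If \<open>g\<close> changes by at most a constant factor between \<open>x\<close> and
  \<open>2 * x\<close>, then \<open>g x\<close> is at most \<open>2 * D\<close> times the integral
  of \<open>g v / v\<close> over that interval. After Fubini the measure enters through its
  distribution function, and the tail bound contributes the weight
  \<open>v powr s / v\<close>.\<close>

lemma K_nn_bound:
  assumes l: "0 < l" and g[measurable]: "g \<in> borel_measurable borel" and g0: "\<And>x. 0 \<le> g x"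
    and D: "0 \<le> D" "\<And>x v. 0 < x \<Longrightarrow> x \<le> v \<Longrightarrow> v \<le> 2 * x \<Longrightarrow> g x \<le> D * g v"
  shows "(\<integral>\<^sup>+x. ennreal (g x) \<partial>K l) \<le>
    ennreal (2 * D * exp 1 * l) * (\<integral>\<^sup>+v. ennreal (indicator {0<..} v * (v powr (s - 1) * g v)) \<partial>lborel)"
proof -
  interpret prob_space "K l" by (rule prob_K[OF l])
  interpret pair_sigma_finite lborel "K l"
    by (simp add: pair_sigma_finite_def lborel.sigma_finite_measure_axioms sigma_finite_measure_axioms)
  define f :: "real \<Rightarrow> real \<Rightarrow> ennreal" where
    "f v x = (if 0 < v \<and> x \<le> v \<and> v \<le> 2 * x then ennreal (D * g v / v) else 0)" for v x
  have f[measurable]: "(\<lambda>(v, x). f v x) \<in> borel_measurable (lborel \<Otimes>\<^sub>M K l)"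
    unfolding f_def by measurable
  have pt: "ennreal (g x) \<le> 2 * (\<integral>\<^sup>+v. f v x \<partial>lborel)" if x: "0 < x" for x
  proof -
    have "ennreal (g x / (2 * x)) * emeasure lborel {x..2 * x} = (\<integral>\<^sup>+v. ennreal (g x / (2 * x)) * indicator {x..2 * x} v \<partial>lborel)"
      by (rule nn_integral_cmult_indicator[symmetric]) simp
    also have "\<dots> \<le> (\<integral>\<^sup>+v. f v x \<partial>lborel)"
    proof (rule nn_integral_mono)
      fix v
      show "ennreal (g x / (2 * x)) * indicator {x..2 * x} v \<le> f v x"
      proof (cases "v \<in> {x..2 * x}")
        case True
        then have v: "v > 0" "x \<le> v" "v \<le> 2 * x" using x by auto
        have "g x / (2 * x) \<le> (D * g v) / v"
          using D(2)[OF x v(2,3)] v x g0[of x] by (intro frac_le) auto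
        then show ?thesis using v by (simp add: f_def ennreal_leI)
      qed simp
    qed
    finally have "ennreal (g x / (2 * x)) * ennreal x \<le> (\<integral>\<^sup>+v. f v x \<partial>lborel)" using x by simp
    then have "ennreal (g x / 2) \<le> (\<integral>\<^sup>+v. f v x \<partial>lborel)" using x g0[of x] by (simp add: ennreal_mult[symmetric])
    then have "2 * ennreal (g x / 2) \<le> 2 * (\<integral>\<^sup>+v. f v x \<partial>lborel)" by (intro mult_left_mono) auto
    also have "2 * ennreal (g x / 2) = ennreal (g x)"
      using ennreal_mult[of 2 "g x / 2"] g0[of x] by simp
    finally show ?thesis .
  qed
  have "(\<integral>\<^sup>+x. ennreal (g x) \<partial>K l) \<le> (\<integral>\<^sup>+x. 2 * (\<integral>\<^sup>+v. f v x \<partial>lborel) \<partial>K l)"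
    using K_pos[OF l] by (intro nn_integral_mono_AE) (auto elim!: eventually_mono intro: pt)
  also have "\<dots> = 2 * (\<integral>\<^sup>+x. (\<integral>\<^sup>+v. f v x \<partial>lborel) \<partial>K l)"
    by (rule nn_integral_cmult) measurable
  also have "(\<integral>\<^sup>+x. (\<integral>\<^sup>+v. f v x \<partial>lborel) \<partial>K l) = (\<integral>\<^sup>+v. (\<integral>\<^sup>+x. f v x \<partial>K l) \<partial>lborel)"
    by (rule Fubini'[OF f])
  also have "\<dots> \<le> (\<integral>\<^sup>+v. ennreal (D * exp 1 * l) * ennreal (indicator {0<..} v * (v powr (s - 1) * g v)) \<partial>lborel)"
  proof (rule nn_integral_mono)
    fix v
    show "(\<integral>\<^sup>+x. f v x \<partial>K l) \<le> ennreal (D * exp 1 * l) * ennreal (indicator {0<..} v * (v powr (s - 1) * g v))"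
    proof (cases "v > 0")
      case True
      have "(\<integral>\<^sup>+x. f v x \<partial>K l) \<le> (\<integral>\<^sup>+x. ennreal (D * g v / v) * indicator {..v} x \<partial>K l)"
        by (intro nn_integral_mono) (auto simp: f_def split: split_indicator)
      also have "\<dots> = ennreal (D * g v / v) * emeasure (K l) {..v}" by (rule nn_integral_cmult_indicator) simp
      also have "\<dots> \<le> ennreal (D * g v / v) * ennreal (exp 1 * l * v powr s)"
        by (intro mult_left_mono K_tail l True) auto
      also have "\<dots> = ennreal ((D * g v / v) * (exp 1 * l * v powr s))"
        using True D l g0[of v] by (intro ennreal_mult[symmetric]) auto
      also have "(D * g v / v) * (exp 1 * l * v powr s) = (D * exp 1 * l) * (v powr (s - 1) * g v)"
        using True by (simp add: powr_diff field_simps)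
      also have "ennreal \<dots> = ennreal (D * exp 1 * l) * ennreal (v powr (s - 1) * g v)"
        using D l g0[of v] by (intro ennreal_mult) auto
      finally show ?thesis using True by simp
    qed (simp add: f_def)
  qed
  also have "\<dots> = ennreal (D * exp 1 * l) * (\<integral>\<^sup>+v. ennreal (indicator {0<..} v * (v powr (s - 1) * g v)) \<partial>lborel)"
    by (rule nn_integral_cmult) measurable
  finally have "(\<integral>\<^sup>+x. ennreal (g x) \<partial>K l) \<le>
      2 * (ennreal (D * exp 1 * l) * (\<integral>\<^sup>+v. ennreal (indicator {0<..} v * (v powr (s - 1) * g v)) \<partial>lborel))"
    by (simp add: mult_left_mono)
  also have "\<dots> = ennreal (2 * D * exp 1 * l) * (\<integral>\<^sup>+v. ennreal (indicator {0<..} v * (v powr (s - 1) * g v)) \<partial>lborel)"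
    using ennreal_mult[of 2 "D * exp 1 * l"] D l by (simp add: mult.assoc[symmetric])
  finally show ?thesis .
qed

end

text \<open>Splitting at \<open>v = \<rho>\<close>: below, the integrand is at most
  \<open>v powr a\<close> with \<open>a > -1\<close>; above, it is at most
  \<open>\<rho> powr p * v powr (a - p)\<close> with \<open>a - p < -1\<close>. Both pieces scale
  like \<open>\<rho> powr (a + 1)\<close>.\<close>

lemma nn_integral_powr_min:
  fixes a p \<rho> :: real
  assumes a: "-1 < a" "a + 1 < p" and \<rho>: "0 < \<rho>"
  shows "(\<integral>\<^sup>+v. ennreal (indicator {0<..} v * (v powr a * min 1 ((\<rho> / v) powr p))) \<partial>lborel)
    \<le> ennreal ((1 / (a + 1) + 1 / (p - a - 1)) * \<rho> powr (a + 1))"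
proof -
  have 1: "(\<integral>\<^sup>+v. ennreal (indicator {0..\<rho>} v * v powr a) \<partial>lborel) = ennreal (\<rho> powr (a + 1) / (a + 1))"
    using nn_integral_has_integral_lebesgue[OF _ has_integral_powr_from_0[of a \<rho>]] a \<rho> by simp
  have 2: "(\<integral>\<^sup>+v. ennreal (indicator {\<rho>..} v * v powr (a - p)) \<partial>lborel) = ennreal (- (\<rho> powr (a - p + 1)) / (a - p + 1))"
    using nn_integral_has_integral_lebesgue[OF _ has_integral_powr_to_inf[of "a - p" \<rho>]] a \<rho> by simp
  have "(\<integral>\<^sup>+v. ennreal (indicator {0<..} v * (v powr a * min 1 ((\<rho> / v) powr p))) \<partial>lborel)
      \<le> (\<integral>\<^sup>+v. ennreal (indicator {0..\<rho>} v * v powr a) + ennreal (\<rho> powr p) * ennreal (indicator {\<rho>..} v * v powr (a - p)) \<partial>lborel)"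
  proof (rule nn_integral_mono)
    fix v
    show "ennreal (indicator {0<..} v * (v powr a * min 1 ((\<rho> / v) powr p)))
      \<le> ennreal (indicator {0..\<rho>} v * v powr a) + ennreal (\<rho> powr p) * ennreal (indicator {\<rho>..} v * v powr (a - p))"
    proof (cases "0 < v \<and> v \<le> \<rho>")
      case True
      then have "v powr a * min 1 ((\<rho> / v) powr p) \<le> v powr a" by (intro mult_left_le) auto
      then show ?thesis using True by (auto intro!: add_increasing2 ennreal_leI)
    next
      case F: False
      show ?thesis
      proof (cases "0 < v")
        case True
        then have v: "\<rho> < v" using F by auto
        have "v powr a * min 1 ((\<rho> / v) powr p) \<le> v powr a * (\<rho> / v) powr p" by (intro mult_left_mono) auto
        also have "\<dots> = \<rho> powr p * v powr (a - p)" using True \<rho> by (simp add: powr_divide powr_diff)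
        finally show ?thesis using v True by (simp add: ennreal_mult[symmetric] ennreal_leI)
      qed simp
    qed
  qed
  also have "\<dots> = ennreal (\<rho> powr (a + 1) / (a + 1)) + ennreal (\<rho> powr p) * ennreal (- (\<rho> powr (a - p + 1)) / (a - p + 1))"
    by (subst nn_integral_add) (auto simp: nn_integral_cmult 1 2)
  also have "\<dots> = ennreal (\<rho> powr (a + 1) / (a + 1) + \<rho> powr p * (- (\<rho> powr (a - p + 1)) / (a - p + 1)))"
  proof -
    have "0 \<le> - (\<rho> powr (a - p + 1)) / (a - p + 1)" using a by (intro divide_nonpos_nonpos) auto
    then show ?thesis using a
      by (subst ennreal_plus) (auto simp del: times_divide_eq_right mult_minus_right minus_divide_left[symmetric] intro!: ennreal_mult[symmetric] arg_cong2[of _ _ _ _ "(+)"])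
  qed
  also have "\<rho> powr p * (- (\<rho> powr (a - p + 1)) / (a - p + 1)) = \<rho> powr (a + 1) / (p - a - 1)"
  proof -
    have "\<rho> powr p * \<rho> powr (a - p + 1) = \<rho> powr (a + 1)" by (simp add: powr_add[symmetric])
    moreover have "\<rho> powr p * (- (\<rho> powr (a - p + 1)) / (a - p + 1)) = (\<rho> powr p * \<rho> powr (a - p + 1)) / (p - a - 1)"
      using a by (simp add: field_simps)
    ultimately show ?thesis by simp
  qed
  finally show ?thesis by (simp add: distrib_right)
qed

context stable_density
begin

text \<open>For upper bounds \<open>K l\<close> can be treated as if it had the density
  \<open>v powr (s - 1)\<close>, whence the power \<open>\<rho> powr (s - q)\<close>. Here
  \<open>q < s\<close> gives convergence at zero and \<open>s < q + p\<close> at infinity. The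
  Hoelder and Zygmund bounds are instances with \<open>\<rho>\<close> the square of a Cameron-Martin
  norm.\<close>

lemma K_powr_min:
  assumes l: "0 < l" and q: "0 \<le> q" "q < s" and p: "0 < p" "s < q + p"
  shows "\<exists>C>0. \<forall>\<rho>>0. integrable (K l) (\<lambda>v. v powr (- q) * min 1 ((\<rho> / v) powr p)) \<and>
     (\<integral>v. v powr (- q) * min 1 ((\<rho> / v) powr p) \<partial>K l) \<le> C * \<rho> powr (s - q)"
proof -
  \<comment> \<open>The doubling constant of the integrand: \<open>2 powr q\<close> from the power
    and \<open>2 powr p\<close> from the minimum. The two terms of \<open>c\<close> are those of
    \<open>nn_integral_powr_min\<close> with \<open>a = s - 1 - q\<close>.\<close>
  define D where "D = 2 powr (q + p)"
  define c where "c = 1 / (s - q) + 1 / (p - s + q)"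
  define C where "C = 2 * D * exp 1 * l * c"
  have D: "D > 0" by (simp add: D_def)
  have c: "c > 0" unfolding c_def using q p by (intro add_pos_pos) auto
  have C: "C > 0" using D c l by (simp add: C_def)
  show ?thesis
  proof (intro exI[of _ C] conjI C allI impI)
    fix \<rho> :: real assume \<rho>: "\<rho> > 0"
    let ?g = "\<lambda>v. v powr (- q) * min 1 ((\<rho> / v) powr p)"
    have "(\<integral>\<^sup>+x. ennreal (?g x) \<partial>K l) \<le> ennreal (2 * D * exp 1 * l) *
        (\<integral>\<^sup>+v. ennreal (indicator {0<..} v * (v powr (s - 1) * ?g v)) \<partial>lborel)"
    proof (rule K_nn_bound[OF l])
      fix x v :: real assume xv: "0 < x" "x \<le> v" "v \<le> 2 * x"
      then have v: "v > 0" by simp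
      have 1: "x powr (- q) \<le> 2 powr q * v powr (- q)"
      proof -
        have "v powr q \<le> (2 * x) powr q" using xv v q by (intro powr_mono2) auto
        also have "\<dots> = 2 powr q * x powr q" using xv by (simp add: powr_mult)
        finally show ?thesis using xv v by (simp add: powr_minus field_simps)
      qed
      have 2: "min 1 ((\<rho> / x) powr p) \<le> 2 powr p * min 1 ((\<rho> / v) powr p)"
      proof -
        have "(\<rho> / x) powr p \<le> (2 * (\<rho> / v)) powr p"
          using xv v p \<rho> by (intro powr_mono2) (auto simp: field_simps)
        also have "\<dots> = 2 powr p * (\<rho> / v) powr p" using v \<rho> by (subst powr_mult) auto
        finally have "(\<rho> / x) powr p \<le> 2 powr p * (\<rho> / v) powr p" .
        moreover have "(1::real) \<le> 2 powr p" using p by (simp add: ge_one_powr_ge_zero)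
        ultimately show ?thesis by (auto simp: min_def)
      qed
      have "?g x \<le> (2 powr q * v powr (- q)) * (2 powr p * min 1 ((\<rho> / v) powr p))"
        by (intro mult_mono 1 2) auto
      then show "?g x \<le> D * ?g v" by (simp add: D_def powr_add mult_ac)
    qed (use D in auto)
    also have "(\<integral>\<^sup>+v. ennreal (indicator {0<..} v * (v powr (s - 1) * ?g v)) \<partial>lborel)
        = (\<integral>\<^sup>+v. ennreal (indicator {0<..} v * (v powr (s - 1 - q) * min 1 ((\<rho> / v) powr p))) \<partial>lborel)"
    proof -
      have "v powr (s - 1 - q) = v powr (s - 1) * v powr (- q)" for v :: real
        using powr_add[of v "s - 1" "- q"] by simp
      then show ?thesis by (simp only: mult.assoc)
    qed
    also have "ennreal (2 * D * exp 1 * l) * \<dots> \<le> ennreal (2 * D * exp 1 * l) * ennreal (c * \<rho> powr (s - q))"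
      using nn_integral_powr_min[of "s - 1 - q" p \<rho>] q p \<rho>
      by (intro mult_left_mono) (auto simp: c_def algebra_simps)
    also have "\<dots> = ennreal (C * \<rho> powr (s - q))"
      using D l c by (simp add: ennreal_mult[symmetric] C_def mult.assoc)
    finally have n: "(\<integral>\<^sup>+x. ennreal (?g x) \<partial>K l) \<le> ennreal (C * \<rho> powr (s - q))" .
    have g0: "0 \<le> ?g x" for x by simp
    have m: "?g \<in> borel_measurable (K l)" by measurable
    show i: "integrable (K l) ?g"
    proof (rule integrableI_bounded[OF m])
      have e: "norm (?g x) = ?g x" for x by simp
      show "(\<integral>\<^sup>+x. ennreal (norm (?g x)) \<partial>K l) < \<infinity>"
        unfolding e by (rule le_less_trans[OF n]) simp
    qed
    have "ennreal (\<integral>v. ?g v \<partial>K l) \<le> ennreal (C * \<rho> powr (s - q))"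
      using n nn_integral_eq_integral[OF i] g0 by simp
    then show "(\<integral>v. ?g v \<partial>K l) \<le> C * \<rho> powr (s - q)" using C by (subst (asm) ennreal_le_iff) auto
  qed
qed

text \<open>For \<open>v \<le> 1\<close> the minimum with \<open>\<rho> = 1\<close> equals one, and
  for larger \<open>v\<close> the power itself is at most one. The exponent \<open>s + 1\<close> is
  a convenient \<open>p\<close> with \<open>s < q + p\<close>.\<close>

lemma K_powr_integrable:
  assumes l: "0 < l" and q: "0 \<le> q" "q < s"
  shows "integrable (K l) (\<lambda>v. v powr (- q))"
proof -
  interpret prob_space "K l" by (rule prob_K[OF l])
  have i: "integrable (K l) (\<lambda>v. v powr (- q) * min 1 ((1 / v) powr (s + 1)))"
    using K_powr_min[OF l q, of "s + 1"] q s by fastforce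
  show ?thesis
  proof (rule Bochner_Integration.integrable_bound[OF Bochner_Integration.integrable_add[OF i integrable_const[of 1]]])
    show "AE v in K l. norm (v powr (- q)) \<le> norm (v powr (- q) * min 1 ((1 / v) powr (s + 1)) + 1)"
      using K_pos[OF l]
    proof eventually_elim
      case (elim v)
      show ?case
      proof (cases "v \<le> 1")
        case True
        then have "(1::real) \<le> (1 / v) powr (s + 1)" using elim s by (intro ge_one_powr_ge_zero) auto
        then show ?thesis by simp
      next
        case False
        then have "v powr (- q) \<le> 1" using q by (simp add: powr_minus ge_one_powr_ge_zero inverse_le_1_iff)
        moreover have "0 \<le> v powr (- q) * min 1 ((1 / v) powr (s + 1))" by simp
        ultimately have "v powr (- q) \<le> v powr (- q) * min 1 ((1 / v) powr (s + 1)) + 1" by linarith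
        then have "v powr (- q) \<le> \<bar>v powr (- q) * min 1 ((1 / v) powr (s + 1)) + 1\<bar>"
          by (rule order_trans[OF _ abs_ge_self])
        then show ?thesis by (simp only: real_norm_def abs_of_nonneg[OF powr_ge_zero])
      qed
    qed
  qed measurable
qed

end

section \<open>The positive square root\<close>

definition psd :: "('a::real_inner \<Rightarrow>\<^sub>L 'a) \<Rightarrow> bool" where
  "psd A \<longleftrightarrow> self_adjoint A \<and> positive_op A"

lemma psd_sym: "psd A \<Longrightarrow> blinfun_apply A x \<bullet> y = x \<bullet> blinfun_apply A y"
  and psd_nonneg: "psd A \<Longrightarrow> 0 \<le> blinfun_apply A x \<bullet> x"
  by (auto simp: psd_def self_adjoint_def positive_op_def)

lemma psdI:
  assumes "\<And>x y. blinfun_apply A x \<bullet> y = x \<bullet> blinfun_apply A y" "\<And>x. 0 \<le> blinfun_apply A x \<bullet> x"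
  shows "psd A"
  using assms by (auto simp: psd_def self_adjoint_def positive_op_def)

text \<open>The case \<open>c = 0\<close> matters, because the quadratic forms to which this is
  applied may be degenerate.\<close>

lemma nonneg_quadratic_discriminant:
  fixes a b c :: real
  assumes "\<And>t. 0 \<le> a + 2 * t * b + t\<^sup>2 * c" and "0 \<le> c"
  shows "b\<^sup>2 \<le> a * c"
proof (cases "c = 0")
  case True
  have "b = 0"
  proof (rule ccontr)
    assume "b \<noteq> 0"
    \<comment> \<open>At this \<open>t\<close> the affine function \<open>a + 2 * t * b\<close>
      takes the value \<open>- 1\<close>.\<close>
    with assms(1)[of "- (a + 1) / (2 * b)"] True show False by (simp add: field_simps)
  qed
  then show ?thesis using True by simp
next
  case False
  then have c: "c > 0" using assms(2) by simp
  have "0 \<le> a + 2 * (- b / c) * b + (- b / c)\<^sup>2 * c" by (rule assms)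
  also have "\<dots> = a - b\<^sup>2 / c" using c by (simp add: field_simps power2_eq_square)
  finally show ?thesis using c by (simp add: field_simps)
qed

lemma psd_Cauchy_Schwarz:
  assumes "psd A"
  shows "(blinfun_apply A x \<bullet> y)\<^sup>2 \<le> (blinfun_apply A x \<bullet> x) * (blinfun_apply A y \<bullet> y)"
proof (rule nonneg_quadratic_discriminant)
  fix t :: real
  have "0 \<le> blinfun_apply A (x + t *\<^sub>R y) \<bullet> (x + t *\<^sub>R y)"
    using psd_nonneg[OF assms] .
  also have "\<dots> = (blinfun_apply A x \<bullet> x) + 2 * t * (blinfun_apply A x \<bullet> y) + t\<^sup>2 * (blinfun_apply A y \<bullet> y)"
    using psd_sym[OF assms, of y x] inner_commute[of y "blinfun_apply A x"]
    by (simp add: blinfun.bilinear_simps inner_add power2_eq_square algebra_simps)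
  finally show "0 \<le> \<dots>" .
qed (rule psd_nonneg[OF assms])

text \<open>Cauchy-Schwarz for the form of \<open>A\<close> with \<open>y = A x\<close>, then
  division by the squared norm of \<open>A x\<close>. With \<open>K = 1\<close> it turns convergence
  of quadratic forms into convergence of vectors.\<close>

lemma psd_norm_bound:
  assumes "psd A" and K: "\<And>y. blinfun_apply A y \<bullet> y \<le> K * (y \<bullet> y)"
  shows "(norm (blinfun_apply A x))\<^sup>2 \<le> K * (blinfun_apply A x \<bullet> x)"
proof (cases "blinfun_apply A x = 0")
  case False
  let ?y = "blinfun_apply A x"
  have "(?y \<bullet> ?y)\<^sup>2 \<le> (?y \<bullet> x) * (blinfun_apply A ?y \<bullet> ?y)"
    by (rule psd_Cauchy_Schwarz[OF assms(1)])
  also have "\<dots> \<le> (?y \<bullet> x) * (K * (?y \<bullet> ?y))"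
    by (intro mult_left_mono K psd_nonneg assms)
  finally have "(?y \<bullet> ?y) * (?y \<bullet> ?y) \<le> (K * (?y \<bullet> x)) * (?y \<bullet> ?y)"
    by (simp add: power2_eq_square mult_ac)
  moreover have "?y \<bullet> ?y > 0" using False by simp
  ultimately show ?thesis by (simp add: power2_norm_eq_inner)
qed simp

lemma psd_apply_eq_0:
  assumes "psd A" "blinfun_apply A x \<bullet> x = 0"
  shows "blinfun_apply A x = 0"
  using psd_Cauchy_Schwarz[OF assms(1), of x "blinfun_apply A x"] assms(2) by simp

section \<open>Polynomials with nonnegative coefficients in a positive operator\<close>

primrec blinfun_pow :: "('a::real_normed_vector \<Rightarrow>\<^sub>L 'a) \<Rightarrow> nat \<Rightarrow> 'a \<Rightarrow>\<^sub>L 'a" where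
  "blinfun_pow B 0 = id_blinfun"
| "blinfun_pow B (Suc k) = B o\<^sub>L blinfun_pow B k"

lemma blinfun_pow_add: "blinfun_pow B (j + k) = blinfun_pow B j o\<^sub>L blinfun_pow B k"
  by (induction j) (auto intro!: blinfun_eqI)

text \<open>That a product of commuting positive operators is positive is usually derived from
  square roots, which are still to be built. Polynomials with nonnegative coefficients in one
  positive operator avoid the circle: they commute, are closed under sums and composition, and are
  positive term by term.\<close>

inductive_set nonneg_polys :: "('a::real_normed_vector \<Rightarrow>\<^sub>L 'a) \<Rightarrow> ('a \<Rightarrow>\<^sub>L 'a) set" for B where
  zero: "0 \<in> nonneg_polys B"
| step: "p \<in> nonneg_polys B \<Longrightarrow> 0 \<le> c \<Longrightarrow> c *\<^sub>R blinfun_pow B k + p \<in> nonneg_polys B"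

lemma nonneg_polys_add:
  assumes "p \<in> nonneg_polys B" "q \<in> nonneg_polys B"
  shows "p + q \<in> nonneg_polys B"
  using assms(1)
  by (induction) (auto simp: assms(2) add.assoc intro: nonneg_polys.step)

lemma nonneg_polys_scale:
  assumes "p \<in> nonneg_polys B" "0 \<le> c"
  shows "c *\<^sub>R p \<in> nonneg_polys B"
  using assms(1)
proof induction
  case zero
  then show ?case by (simp add: nonneg_polys.zero)
next
  case (step p d k)
  have "(c * d) *\<^sub>R blinfun_pow B k + c *\<^sub>R p \<in> nonneg_polys B"
    using step assms(2) by (intro nonneg_polys.step) auto
  then show ?case by (simp add: scaleR_add_right)
qed

lemma nonneg_polys_pow: "blinfun_pow B k \<in> nonneg_polys B"
  using nonneg_polys.step[OF nonneg_polys.zero, of 1 B k] by simp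

lemma nonneg_polys_pow_compose:
  assumes "p \<in> nonneg_polys B"
  shows "blinfun_pow B k o\<^sub>L p \<in> nonneg_polys B" "p o\<^sub>L blinfun_pow B k = blinfun_pow B k o\<^sub>L p"
  using assms
proof (induction)
  case zero
  { case 1 then show ?case
by (metis bounded_bilinear.zero_right bounded_bilinear_blinfun_compose nonneg_polys.zero)
  next
    case 2 then show ?case by simp }
next
  case (step p c j)
  have e: "blinfun_pow B k o\<^sub>L (c *\<^sub>R blinfun_pow B j + p) = c *\<^sub>R blinfun_pow B (k + j) + (blinfun_pow B k o\<^sub>L p)"
    by (intro blinfun_eqI) (simp add: blinfun_pow_add blinfun.bilinear_simps)
  { case 1 show ?case unfolding e using step by (intro nonneg_polys.step)
  next
    case 2
    have "(c *\<^sub>R blinfun_pow B j + p) o\<^sub>L blinfun_pow B k = c *\<^sub>R blinfun_pow B (j + k) + (p o\<^sub>L blinfun_pow B k)"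
      by (intro blinfun_eqI) (simp add: blinfun_pow_add blinfun.bilinear_simps)
    then show ?case unfolding e using step by (simp add: add.commute) }
qed

lemma nonneg_polys_compose:
  assumes p: "p \<in> nonneg_polys B" and q: "q \<in> nonneg_polys B"
  shows "p o\<^sub>L q \<in> nonneg_polys B" "p o\<^sub>L q = q o\<^sub>L p"
  using p
proof (induction)
  case zero
  { case 1 then show ?case by (simp add: nonneg_polys.zero)
  next
    case 2 then show ?case by simp }
next
  case (step p c j)
  have e: "(c *\<^sub>R blinfun_pow B j + p) o\<^sub>L q = c *\<^sub>R (blinfun_pow B j o\<^sub>L q) + (p o\<^sub>L q)"
    by (intro blinfun_eqI) (simp add: blinfun.bilinear_simps)
  { case 1 show ?case unfolding e
      by (intro nonneg_polys_add nonneg_polys_scale nonneg_polys_pow_compose step q)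
  next
    case 2
    have "q o\<^sub>L (c *\<^sub>R blinfun_pow B j + p) = c *\<^sub>R (q o\<^sub>L blinfun_pow B j) + (q o\<^sub>L p)"
      by (intro blinfun_eqI) (simp add: blinfun.bilinear_simps)
    then show ?case unfolding e using step nonneg_polys_pow_compose(2)[OF q] by simp }
qed

text \<open>Even powers have the form \<open>B\<^sup>j B\<^sup>j\<close> and odd ones
  \<open>B\<^sup>j B B\<^sup>j\<close>, so symmetry moves \<open>j\<close> factors to the other side
  of the inner product.\<close>

lemma psd_blinfun_pow:
  assumes "psd B"
  shows "psd (blinfun_pow B k)"
proof -
  have sym: "blinfun_apply (blinfun_pow B k) x \<bullet> y = x \<bullet> blinfun_apply (blinfun_pow B k) y" for k x y
  proof (induction k arbitrary: x y)
    case (Suc k)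
    have "blinfun_apply (blinfun_pow B k) (blinfun_apply B y) = blinfun_apply B (blinfun_apply (blinfun_pow B k) y)"
      by (induction k) simp_all
    then show ?case using psd_sym[OF assms] Suc by simp
  qed simp
  have "0 \<le> blinfun_apply (blinfun_pow B k) x \<bullet> x" for x
  proof (cases "even k")
    case True
    then obtain j where j: "k = j + j" by (metis evenE mult_2)
    show ?thesis unfolding j blinfun_pow_add using sym[of j "blinfun_apply (blinfun_pow B j) x" x] by simp
  next
    case False
    then obtain j where j: "k = j + Suc j" by (metis oddE add_Suc_right mult_2 Suc_eq_plus1)
    show ?thesis unfolding j blinfun_pow_add
      using sym[of j "blinfun_apply (blinfun_pow B (Suc j)) x" x] psd_nonneg[OF assms] by simp
  qed
  with sym show ?thesis by (intro psdI) auto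
qed

lemma psd_nonneg_polys:
  assumes "psd B" "p \<in> nonneg_polys B"
  shows "psd p"
  using assms(2)
proof induction
  case (step p c k)
  then show ?case
    using psd_blinfun_pow[OF assms(1), of k]
    by (intro psdI)
      (simp add: blinfun.bilinear_simps inner_add psd_sym,
       simp add: blinfun.bilinear_simps inner_add psd_nonneg)
qed (auto intro: psdI)

text \<open>With \<open>B = 1 - A\<close>, a fixed point \<open>Y\<close> satisfies
  \<open>2 Y = B + Y\<^sup>2\<close>, that is \<open>(1 - Y)\<^sup>2 = A\<close>. Starting from
  \<open>0\<close> keeps all coefficients nonnegative, which makes the sequence increase.\<close>

primrec sqrt_iter :: "('a::real_normed_vector \<Rightarrow>\<^sub>L 'a) \<Rightarrow> nat \<Rightarrow> 'a \<Rightarrow>\<^sub>L 'a" where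
  "sqrt_iter B 0 = 0"
| "sqrt_iter B (Suc n) = (1/2) *\<^sub>R (B + (sqrt_iter B n o\<^sub>L sqrt_iter B n))"

lemma nonneg_polys_self: "B \<in> nonneg_polys B"
proof -
  have "blinfun_pow B 1 = B" by (intro blinfun_eqI) simp
  then show ?thesis using nonneg_polys_pow[of B 1] by simp
qed

lemma sqrt_iter_polys: "sqrt_iter B n \<in> nonneg_polys B"
  by (induction n) (auto simp del: scaleR_add_right simp: nonneg_polys.zero nonneg_polys_self
      intro!: nonneg_polys_scale nonneg_polys_add nonneg_polys_compose)

text \<open>By commutativity the next increment is half of the composition of the sum and the
  difference of two consecutive iterates, and both belong to the cone.\<close>

lemma sqrt_iter_Suc_diff: "sqrt_iter B (Suc n) - sqrt_iter B n \<in> nonneg_polys B"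
proof (induction n)
  case 0
  have "(1/2) *\<^sub>R B \<in> nonneg_polys B" by (intro nonneg_polys_scale nonneg_polys_self) auto
  moreover have "sqrt_iter B (Suc 0) - sqrt_iter B 0 = (1/2) *\<^sub>R B"
    by (intro blinfun_eqI) (simp add: blinfun.bilinear_simps)
  ultimately show ?case by simp
next
  case (Suc n)
  let ?Y = "sqrt_iter B"
  have c: "?Y (Suc n) o\<^sub>L ?Y n = ?Y n o\<^sub>L ?Y (Suc n)"
    by (rule nonneg_polys_compose[OF sqrt_iter_polys sqrt_iter_polys])
  have "?Y (Suc (Suc n)) - ?Y (Suc n) = (1/2) *\<^sub>R ((?Y (Suc n) o\<^sub>L ?Y (Suc n)) - (?Y n o\<^sub>L ?Y n))"
    unfolding sqrt_iter.simps(2)[of B "Suc n"] 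
    by (subst (3) sqrt_iter.simps(2)) (simp add: scaleR_diff_right[symmetric] del: sqrt_iter.simps)
  also have "\<dots> = (1/2) *\<^sub>R ((?Y (Suc n) + ?Y n) o\<^sub>L (?Y (Suc n) - ?Y n))"
    using arg_cong[OF c, of blinfun_apply]
    by (intro blinfun_eqI) (auto simp: blinfun.bilinear_simps fun_eq_iff simp del: sqrt_iter.simps)
  also have "\<dots> \<in> nonneg_polys B"
    by (intro nonneg_polys_scale nonneg_polys_compose nonneg_polys_add sqrt_iter_polys Suc) auto
  finally show ?case .
qed

lemma sqrt_iter_diff: "n \<le> m \<Longrightarrow> sqrt_iter B m - sqrt_iter B n \<in> nonneg_polys B"
proof (induction m rule: dec_induct)
  case base
  then show ?case by (simp add: nonneg_polys.zero)
next
  case (step m)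
  have "(sqrt_iter B (Suc m) - sqrt_iter B m) + (sqrt_iter B m - sqrt_iter B n) \<in> nonneg_polys B"
    by (intro nonneg_polys_add sqrt_iter_Suc_diff step)
  then show ?case by simp
qed

lemma norm_sqrt_iter: "norm B \<le> 1 \<Longrightarrow> norm (sqrt_iter B n) \<le> 1"
proof (induction n)
  case (Suc n)
  have "norm (sqrt_iter B n o\<^sub>L sqrt_iter B n) \<le> norm (sqrt_iter B n) * norm (sqrt_iter B n)"
    by (rule norm_blinfun_compose)
  also have "\<dots> \<le> 1 * 1" using Suc by (intro mult_mono) auto
  finally show ?case using Suc norm_triangle_ineq[of B "sqrt_iter B n o\<^sub>L sqrt_iter B n"] by simp
qed simp

text \<open>The iterates increase and have norm at most one, so their quadratic forms converge, and
  \<open>psd_norm_bound\<close> makes the vectors Cauchy. Commutation with everything that commutes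
  with \<open>A\<close> survives the limit; the uniqueness of the root rests on it.\<close>

lemma psd_contraction_sqrt:
  fixes A :: "'a::{real_inner, complete_space} \<Rightarrow>\<^sub>L 'a"
  assumes A: "psd A" and A1: "\<And>x. blinfun_apply A x \<bullet> x \<le> x \<bullet> x"
  shows "\<exists>R. psd R \<and> R o\<^sub>L R = A \<and> (\<forall>S. S o\<^sub>L A = A o\<^sub>L S \<longrightarrow> S o\<^sub>L R = R o\<^sub>L S)"
proof -
  define B where "B = id_blinfun - A"
  have B_app: "blinfun_apply B x = x - blinfun_apply A x" for x
    by (simp add: B_def blinfun.bilinear_simps)
  have B: "psd B"
    using A1 psd_sym[OF A] by (intro psdI) (auto simp: B_app inner_diff)
  have B1: "blinfun_apply B x \<bullet> x \<le> x \<bullet> x" for x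
    using psd_nonneg[OF A, of x] by (simp add: B_app inner_diff)
  have nB: "norm B \<le> 1"
  proof (rule norm_blinfun_bound)
    fix x
    have "(norm (blinfun_apply B x))\<^sup>2 \<le> 1 * (blinfun_apply B x \<bullet> x)"
      using B1 by (intro psd_norm_bound B) simp
    also have "\<dots> \<le> (norm x)\<^sup>2" using B1[of x] by (simp add: power2_norm_eq_inner)
    finally show "norm (blinfun_apply B x) \<le> 1 * norm x" by (simp add: power2_le_iff_abs_le)
  qed simp
  let ?Y = "\<lambda>n. blinfun_apply (sqrt_iter B n)"
  have Y: "psd (sqrt_iter B n)" for n
    by (rule psd_nonneg_polys[OF B sqrt_iter_polys])
  have nY: "norm (?Y n x) \<le> norm x" for n x
    using norm_blinfun[of "sqrt_iter B n" x] mult_right_mono[OF norm_sqrt_iter[OF nB, of n], of "norm x"] by simp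
  have Y1: "?Y n x \<bullet> x \<le> x \<bullet> x" for n x
    using norm_cauchy_schwarz[of "?Y n x" x] mult_right_mono[OF nY[of n x], of "norm x"]
    by (simp add: power2_norm_eq_inner[symmetric] power2_eq_square)
  have D: "psd (sqrt_iter B m - sqrt_iter B n)" if "n \<le> m" for m n
    by (rule psd_nonneg_polys[OF B sqrt_iter_diff[OF that]])
  have DY: "(norm (?Y m x - ?Y n x))\<^sup>2 \<le> ?Y m x \<bullet> x - ?Y n x \<bullet> x" if "n \<le> m" for m n x
  proof -
    have "(norm (blinfun_apply (sqrt_iter B m - sqrt_iter B n) x))\<^sup>2
        \<le> 1 * (blinfun_apply (sqrt_iter B m - sqrt_iter B n) x \<bullet> x)"
    proof (intro psd_norm_bound D that)
      fix y show "blinfun_apply (sqrt_iter B m - sqrt_iter B n) y \<bullet> y \<le> 1 * (y \<bullet> y)"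
        using Y1[of m y] psd_nonneg[OF Y, of n y] by (simp add: blinfun.bilinear_simps inner_diff)
    qed
    then show ?thesis by (simp add: blinfun.bilinear_simps inner_diff)
  qed
  have conv: "convergent (\<lambda>n. ?Y n x)" for x
  proof -
    have "incseq (\<lambda>n. ?Y n x \<bullet> x)"
    proof (rule incseq_SucI)
      fix n
      have "0 \<le> (norm (?Y (Suc n) x - ?Y n x))\<^sup>2" by simp
      also have "\<dots> \<le> ?Y (Suc n) x \<bullet> x - ?Y n x \<bullet> x" by (rule DY) simp
      finally show "?Y n x \<bullet> x \<le> ?Y (Suc n) x \<bullet> x" by simp
    qed
    moreover have "Bseq (\<lambda>n. ?Y n x \<bullet> x)"
      using Y1 psd_nonneg[OF Y] by (intro BseqI'[of _ "x \<bullet> x"]) simp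
    ultimately have "Cauchy (\<lambda>n. ?Y n x \<bullet> x)"
      by (meson Bseq_monoseq_convergent convergent_Cauchy incseq_imp_monoseq)
    have "Cauchy (\<lambda>n. ?Y n x)"
    proof (rule metric_CauchyI)
      fix e :: real assume e: "e > 0"
      then obtain M where M: "\<And>m n. m \<ge> M \<Longrightarrow> n \<ge> M \<Longrightarrow> \<bar>?Y m x \<bullet> x - ?Y n x \<bullet> x\<bar> < e\<^sup>2"
        using CauchyD[OF \<open>Cauchy (\<lambda>n. ?Y n x \<bullet> x)\<close>, of "e\<^sup>2"] by auto
      have *: "dist (?Y m x) (?Y n x) < e" if "m \<ge> n" "n \<ge> M" for m n
      proof -
        have "(norm (?Y m x - ?Y n x))\<^sup>2 < e\<^sup>2"
          using DY[OF that(1), of x] M[of m n] that by simp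
        then show ?thesis using e by (simp add: dist_norm power_less_imp_less_base)
      qed
      show "\<exists>M. \<forall>m\<ge>M. \<forall>n\<ge>M. dist (?Y m x) (?Y n x) < e"
        using * by (metis dist_commute nle_le)
    qed
    then show ?thesis by (simp add: Cauchy_convergent)
  qed
  define z where "z x = lim (\<lambda>n. ?Y n x)" for x
  have z: "(\<lambda>n. ?Y n x) \<longlonglongrightarrow> z x" for x
    using conv by (simp add: z_def convergent_LIMSEQ_iff)
  have "bounded_linear z"
  proof (rule bounded_linear_intro[where K = 1])
    fix x y :: 'a and c :: real
    show "z (x + y) = z x + z y"
      using tendsto_add[OF z[of x] z[of y]] z[of "x + y"]
      by (simp add: blinfun.bilinear_simps LIMSEQ_unique)
    show "z (c *\<^sub>R x) = c *\<^sub>R z x"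
      using tendsto_scaleR[OF tendsto_const z[of x], of c] z[of "c *\<^sub>R x"]
      by (simp add: blinfun.bilinear_simps LIMSEQ_unique)
    show "norm (z x) \<le> norm x * 1"
      using LIMSEQ_le_const2[OF tendsto_norm[OF z[of x]], of "norm x"] nY by auto
  qed
  then obtain Z where Z: "blinfun_apply Z = z" by (metis bounded_linear_Blinfun_apply)
  have Zt: "(\<lambda>n. ?Y n x) \<longlonglongrightarrow> blinfun_apply Z x" for x using z Z by simp
  have ZZ: "blinfun_apply Z (blinfun_apply Z x) = 2 *\<^sub>R blinfun_apply Z x - blinfun_apply B x" for x
  proof -
    have "(\<lambda>n. ?Y n (?Y n x - blinfun_apply Z x)) \<longlonglongrightarrow> 0"
    proof (rule Lim_null_comparison)
      show "\<forall>\<^sub>F n in sequentially. norm (?Y n (?Y n x - blinfun_apply Z x)) \<le> norm (?Y n x - blinfun_apply Z x)"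
        using nY by simp
      show "(\<lambda>n. norm (?Y n x - blinfun_apply Z x)) \<longlonglongrightarrow> 0"
        using Zt[of x] by (simp add: LIM_zero_iff tendsto_norm_zero_iff)
    qed
    from tendsto_add[OF this Zt[of "blinfun_apply Z x"]]
    have "(\<lambda>n. ?Y n (?Y n x)) \<longlonglongrightarrow> blinfun_apply Z (blinfun_apply Z x)"
      by (simp add: blinfun.bilinear_simps)
    moreover have "(\<lambda>n. 2 *\<^sub>R ?Y (Suc n) x - blinfun_apply B x) \<longlonglongrightarrow> 2 *\<^sub>R blinfun_apply Z x - blinfun_apply B x"
      by (intro tendsto_diff tendsto_scaleR tendsto_const LIMSEQ_Suc[OF Zt])
    then have "(\<lambda>n. ?Y n (?Y n x)) \<longlonglongrightarrow> 2 *\<^sub>R blinfun_apply Z x - blinfun_apply B x"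
      by (simp add: blinfun.bilinear_simps scaleR_add_right)
    ultimately show ?thesis by (rule LIMSEQ_unique)
  qed
  define R where "R = id_blinfun - Z"
  have R_app: "blinfun_apply R x = x - blinfun_apply Z x" for x
    by (simp add: R_def blinfun.bilinear_simps)
  have Zsym: "blinfun_apply Z x \<bullet> y = x \<bullet> blinfun_apply Z y" for x y
  proof (rule LIMSEQ_unique)
    show "(\<lambda>n. ?Y n x \<bullet> y) \<longlonglongrightarrow> blinfun_apply Z x \<bullet> y" by (intro tendsto_intros Zt)
    show "(\<lambda>n. ?Y n x \<bullet> y) \<longlonglongrightarrow> x \<bullet> blinfun_apply Z y"
      unfolding psd_sym[OF Y] by (intro tendsto_intros Zt)
  qed
  have Z1: "blinfun_apply Z x \<bullet> x \<le> x \<bullet> x" for x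
    by (rule LIMSEQ_le_const2[OF tendsto_inner[OF Zt tendsto_const]]) (use Y1 in auto)
  have "psd R" using Zsym Z1 by (intro psdI) (auto simp: R_app inner_diff)
  moreover have "R o\<^sub>L R = A"
    by (intro blinfun_eqI) (simp add: R_app blinfun.bilinear_simps ZZ B_app scaleR_2)
  moreover have "S o\<^sub>L R = R o\<^sub>L S" if S: "S o\<^sub>L A = A o\<^sub>L S" for S
  proof -
    have SA: "blinfun_apply S (blinfun_apply A x) = blinfun_apply A (blinfun_apply S x)" for x
      using S by (metis blinfun_apply_blinfun_compose)
    have SY: "blinfun_apply S (?Y n x) = ?Y n (blinfun_apply S x)" for n x
      by (induction n arbitrary: x) (simp_all add: blinfun.bilinear_simps B_app SA)
    have "blinfun_apply S (blinfun_apply Z x) = blinfun_apply Z (blinfun_apply S x)" for x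
    proof (rule LIMSEQ_unique)
      show "(\<lambda>n. blinfun_apply S (?Y n x)) \<longlonglongrightarrow> blinfun_apply S (blinfun_apply Z x)"
        by (intro tendsto_intros Zt)
      show "(\<lambda>n. blinfun_apply S (?Y n x)) \<longlonglongrightarrow> blinfun_apply Z (blinfun_apply S x)"
        unfolding SY by (rule Zt)
    qed
    then show ?thesis by (intro blinfun_eqI) (simp add: R_app blinfun.bilinear_simps)
  qed
  ultimately show ?thesis by blast
qed

lemma psd_sqrt_exists:
  fixes Q :: "'a::{real_inner, complete_space} \<Rightarrow>\<^sub>L 'a"
  assumes Q: "psd Q"
  shows "\<exists>R. psd R \<and> R o\<^sub>L R = Q \<and> (\<forall>S. S o\<^sub>L Q = Q o\<^sub>L S \<longrightarrow> S o\<^sub>L R = R o\<^sub>L S)"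
proof -
  \<comment> \<open>Division by \<open>K\<close> brings the quadratic form of \<open>Q\<close> below
    that of the identity; the added \<open>1\<close> keeps \<open>K\<close> positive when
    \<open>Q = 0\<close>.\<close>
  define K where "K = norm Q + 1"
  have K: "K > 0" by (simp add: K_def add_nonneg_pos)
  define A where "A = (1 / K) *\<^sub>R Q"
  have A: "psd A" using Q K
    by (intro psdI) (simp add: A_def blinfun.bilinear_simps psd_sym, simp add: A_def blinfun.bilinear_simps psd_nonneg)
  have "blinfun_apply A x \<bullet> x \<le> x \<bullet> x" for x
  proof -
    have "blinfun_apply Q x \<bullet> x \<le> norm (blinfun_apply Q x) * norm x" by (rule norm_cauchy_schwarz)
    also have "\<dots> \<le> norm Q * norm x * norm x" by (intro mult_right_mono norm_blinfun) auto
    also have "\<dots> \<le> K * (x \<bullet> x)"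
      by (simp add: K_def power2_norm_eq_inner[symmetric] power2_eq_square mult.assoc mult_right_mono)
    finally show ?thesis using K by (simp add: A_def blinfun.bilinear_simps field_simps)
  qed
  from psd_contraction_sqrt[OF A this] obtain R where R: "psd R" "R o\<^sub>L R = A"
    "\<And>S. S o\<^sub>L A = A o\<^sub>L S \<Longrightarrow> S o\<^sub>L R = R o\<^sub>L S" by blast
  have RR: "blinfun_apply R (blinfun_apply R x) = (1 / K) *\<^sub>R blinfun_apply Q x" for x
    using R(2) by (metis A_def blinfun_apply_blinfun_compose scaleR_blinfun.rep_eq)
  have "psd (sqrt K *\<^sub>R R)"
    using R(1) K by (intro psdI) (simp add: blinfun.bilinear_simps psd_sym, simp add: blinfun.bilinear_simps psd_nonneg)
  moreover have "(sqrt K *\<^sub>R R) o\<^sub>L (sqrt K *\<^sub>R R) = Q"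
    using K by (intro blinfun_eqI) (simp add: blinfun.bilinear_simps RR)
  moreover have "S o\<^sub>L (sqrt K *\<^sub>R R) = (sqrt K *\<^sub>R R) o\<^sub>L S" if "S o\<^sub>L Q = Q o\<^sub>L S" for S
  proof -
    have *: "blinfun_apply S (blinfun_apply Q x) = blinfun_apply Q (blinfun_apply S x)" for x
      using that by (metis blinfun_apply_blinfun_compose)
    have "S o\<^sub>L A = A o\<^sub>L S"
      unfolding A_def by (intro blinfun_eqI) (simp add: blinfun.bilinear_simps *)
    from R(3)[OF this] have "blinfun_apply S (blinfun_apply R x) = blinfun_apply R (blinfun_apply S x)" for x
      by (metis blinfun_apply_blinfun_compose)
    then show ?thesis by (intro blinfun_eqI) (simp add: blinfun.bilinear_simps)
  qed
  ultimately show ?thesis by blast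
qed

text \<open>For \<open>y = R x - S x\<close>, commutativity gives
  \<open>(R + S) y = (R\<^sup>2 - S\<^sup>2) x = 0\<close>. Both forms are nonnegative, so
  \<open>R y = S y = 0\<close>, and then
  \<open>y \<bullet> y = x \<bullet> (R y - S y) = 0\<close>.\<close>

lemma psd_sqrt_unique:
  assumes R: "psd R" "R o\<^sub>L R = Q" and S: "psd S" "S o\<^sub>L S = Q" and c: "S o\<^sub>L R = R o\<^sub>L S"
  shows "R = S"
proof (rule blinfun_eqI)
  fix x
  have c': "blinfun_apply S (blinfun_apply R y) = blinfun_apply R (blinfun_apply S y)" for y
    using c by (metis blinfun_apply_blinfun_compose)
  have RS: "blinfun_apply R (blinfun_apply R y) = blinfun_apply S (blinfun_apply S y)" for y
    using R S by (metis blinfun_apply_blinfun_compose)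
  define y where "y = blinfun_apply R x - blinfun_apply S x"
  have "blinfun_apply R y + blinfun_apply S y = 0"
    unfolding y_def using RS c' by (simp add: blinfun.bilinear_simps)
  then have "blinfun_apply R y \<bullet> y + blinfun_apply S y \<bullet> y = 0"
    by (metis inner_add_left inner_zero_left)
  with psd_nonneg[OF R(1), of y] psd_nonneg[OF S(1), of y]
  have "blinfun_apply R y = 0" "blinfun_apply S y = 0"
    using R(1) S(1) by (auto intro: psd_apply_eq_0)
  then have "y \<bullet> y = 0"
    by (subst (2) y_def) (simp add: inner_diff_right psd_sym[OF R(1), symmetric] psd_sym[OF S(1), symmetric])
  then show "blinfun_apply R x = blinfun_apply S x" by (simp add: y_def)
qed

text \<open>An arbitrary root \<open>S\<close> commutes with \<open>S\<^sup>2 = Q\<close>, hence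
  with the constructed root, so that \<open>psd_sqrt_unique\<close> applies and the definite
  description denotes.\<close>

lemma sqrt_op:
  fixes Q :: "'a::{real_inner, complete_space} \<Rightarrow>\<^sub>L 'a"
  assumes Q: "psd Q"
  shows "psd (sqrt_op Q)" "sqrt_op Q o\<^sub>L sqrt_op Q = Q"
proof -
  obtain R where R: "psd R" "R o\<^sub>L R = Q" "\<And>S. S o\<^sub>L Q = Q o\<^sub>L S \<Longrightarrow> S o\<^sub>L R = R o\<^sub>L S"
    using psd_sqrt_exists[OF Q] by blast
  have "\<exists>!R. self_adjoint R \<and> positive_op R \<and> R o\<^sub>L R = Q"
  proof (rule ex1I[of _ R])
    show "self_adjoint R \<and> positive_op R \<and> R o\<^sub>L R = Q" using R(1,2) by (simp add: psd_def)
    fix S :: "'a \<Rightarrow>\<^sub>L 'a" assume S: "self_adjoint S \<and> positive_op S \<and> S o\<^sub>L S = Q"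
    have "S o\<^sub>L (S o\<^sub>L S) = (S o\<^sub>L S) o\<^sub>L S" by (intro blinfun_eqI) simp
    with S have "S o\<^sub>L Q = Q o\<^sub>L S" by simp
    from R(3)[OF this] show "S = R"
      using psd_sqrt_unique[OF R(1,2), of S] S by (simp add: psd_def)
  qed
  from theI'[OF this] have "self_adjoint (sqrt_op Q) \<and> positive_op (sqrt_op Q) \<and> sqrt_op Q o\<^sub>L sqrt_op Q = Q"
    unfolding sqrt_op_def .
  then show "psd (sqrt_op Q)" "sqrt_op Q o\<^sub>L sqrt_op Q = Q" by (auto simp: psd_def)
qed

section \<open>Cameron-Martin norm\<close>

text \<open>A norm minimizing sequence of preimages is Cauchy by the parallelogram law, and
  minimality of the limit along kernel vectors forces orthogonality. Two solutions differ by a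
  kernel vector that is orthogonal to itself.\<close>

lemma min_norm_preimage:
  fixes R :: "'a::{real_inner, complete_space} \<Rightarrow>\<^sub>L 'a"
  assumes "h \<in> range (blinfun_apply R)"
  shows "\<exists>!x. blinfun_apply R x = h \<and> (\<forall>y. blinfun_apply R y = 0 \<longrightarrow> x \<bullet> y = 0)"
proof -
  define S where "S = {x. blinfun_apply R x = h}"
  define d where "d = Inf (norm ` S)"
  have ne: "S \<noteq> {}" using assms by (auto simp: S_def)
  have bdd: "bdd_below (norm ` S)" by (auto intro: bdd_belowI[of _ 0])
  have d_le: "d \<le> norm x" if "x \<in> S" for x
    unfolding d_def using that bdd by (intro cInf_lower) auto
  have d0: "0 \<le> d" unfolding d_def using ne by (intro cInf_greatest) auto
  have "\<exists>x\<in>S. norm x < d + 1 / real (Suc n)" for n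
  proof -
    have "Inf (norm ` S) < d + 1 / real (Suc n)" by (simp add: d_def)
    then show ?thesis using cInf_lessD[of "norm ` S"] ne by auto
  qed
  then obtain X where X: "\<And>n. X n \<in> S" "\<And>n. norm (X n) < d + 1 / real (Suc n)" by metis
  have par: "(norm (X m - X n))\<^sup>2 \<le> 2 * (norm (X m))\<^sup>2 + 2 * (norm (X n))\<^sup>2 - 4 * d\<^sup>2" for m n
  proof -
    have "(1/2) *\<^sub>R (X m + X n) \<in> S"
      using X(1)[of m] X(1)[of n]
      by (simp add: S_def blinfun.bilinear_simps scaleR_add_right[symmetric] scaleR_2[symmetric] del: scaleR_add_right)
    from d_le[OF this] have "d\<^sup>2 \<le> ((1/2) * norm (X m + X n))\<^sup>2"
      using d0 by (intro power_mono) auto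
    then have "4 * d\<^sup>2 \<le> (norm (X m + X n))\<^sup>2" by (simp add: power_divide)
    moreover have "(norm (X m - X n))\<^sup>2 + (norm (X m + X n))\<^sup>2 = 2 * (norm (X m))\<^sup>2 + 2 * (norm (X n))\<^sup>2"
      by (simp add: power2_norm_eq_inner inner_add inner_diff)
    ultimately show ?thesis by linarith
  qed
  have lim1: "(\<lambda>n. d + 1 / real (Suc n)) \<longlonglongrightarrow> d + 0"
    by (intro tendsto_add tendsto_const) (rule LIMSEQ_Suc[OF lim_1_over_n])
  have lim: "(\<lambda>n. (d + 1 / real (Suc n))\<^sup>2) \<longlonglongrightarrow> (d + 0)\<^sup>2"
    by (rule tendsto_power[OF lim1])
  have "Cauchy X"
  proof (rule metric_CauchyI)
    fix e :: real assume e: "e > 0"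
    have "\<forall>\<^sub>F n in sequentially. (d + 1 / real (Suc n))\<^sup>2 < d\<^sup>2 + e\<^sup>2 / 4"
      using lim e by (intro order_tendstoD(2)) auto
    then obtain N where N: "\<And>n. n \<ge> N \<Longrightarrow> (d + 1 / real (Suc n))\<^sup>2 < d\<^sup>2 + e\<^sup>2 / 4"
      by (auto simp: eventually_sequentially)
    have N': "(norm (X n))\<^sup>2 < d\<^sup>2 + e\<^sup>2 / 4" if "n \<ge> N" for n
      using N[OF that] power_mono[OF less_imp_le[OF X(2)[of n]] norm_ge_zero, of 2] by linarith
    show "\<exists>M. \<forall>m\<ge>M. \<forall>n\<ge>M. dist (X m) (X n) < e"
    proof (intro exI allI impI)
      fix m n assume "m \<ge> N" "n \<ge> N"
      then have "(norm (X m - X n))\<^sup>2 < e\<^sup>2" using par[of m n] N'[of m] N'[of n] by linarith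
      then show "dist (X m) (X n) < e" using e by (simp add: dist_norm power_less_imp_less_base)
    qed
  qed
  then obtain x where x: "X \<longlonglongrightarrow> x" using Cauchy_convergent convergent_def by blast
  have Rx: "blinfun_apply R x = h"
  proof (rule LIMSEQ_unique)
    show "(\<lambda>n. blinfun_apply R (X n)) \<longlonglongrightarrow> blinfun_apply R x" by (intro tendsto_intros x)
    show "(\<lambda>n. blinfun_apply R (X n)) \<longlonglongrightarrow> h" using X(1) by (simp add: S_def)
  qed
  have nx: "norm x \<le> d"
  proof (rule LIMSEQ_le[OF tendsto_norm[OF x]])
    show "(\<lambda>n. d + 1 / real (Suc n)) \<longlonglongrightarrow> d"
      using lim1 by simp
    show "\<exists>N. \<forall>n\<ge>N. norm (X n) \<le> d + 1 / real (Suc n)" using X(2) less_imp_le by blast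
  qed
  have orth: "x \<bullet> y = 0" if y: "blinfun_apply R y = 0" for y
  proof -
    have "0 \<le> 0 + 2 * t * (x \<bullet> y) + t\<^sup>2 * (y \<bullet> y)" for t
    proof -
      have "x + t *\<^sub>R y \<in> S" using Rx y by (simp add: S_def blinfun.bilinear_simps)
      from d_le[OF this] nx have "(norm x)\<^sup>2 \<le> (norm (x + t *\<^sub>R y))\<^sup>2" by (intro power_mono) auto
      then have "x \<bullet> x \<le> (x + t *\<^sub>R y) \<bullet> (x + t *\<^sub>R y)" by (simp add: power2_norm_eq_inner)
      then show ?thesis
        by (simp add: inner_add inner_commute[of y x] power2_eq_square algebra_simps)
    qed
    from nonneg_quadratic_discriminant[OF this] show ?thesis by simp
  qed
  show ?thesis
  proof (rule ex1I[of _ x])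
    show "blinfun_apply R x = h \<and> (\<forall>y. blinfun_apply R y = 0 \<longrightarrow> x \<bullet> y = 0)" using Rx orth by blast
    fix x' assume x': "blinfun_apply R x' = h \<and> (\<forall>y. blinfun_apply R y = 0 \<longrightarrow> x' \<bullet> y = 0)"
    have "blinfun_apply R (x' - x) = 0" using x' Rx by (simp add: blinfun.bilinear_simps)
    then have "(x' - x) \<bullet> (x' - x) = 0" using x' orth by (subst inner_diff_left) simp
    then show "x' = x" by simp
  qed
qed

text \<open>The class \<open>polish_space\<close> supplies completeness and separability, so the
  type is a separable real Hilbert space.\<close>

locale cov_op =
  fixes Q :: "'a::{real_inner, polish_space} \<Rightarrow>\<^sub>L 'a"
  assumes sa: "self_adjoint Q" and pos: "positive_op Q" and tr: "finite_trace Q"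
begin

lemma psdQ: "psd Q" using sa pos by (simp add: psd_def)

lemma pseudo_inverse:
  assumes "h \<in> CM_space Q"
  shows "blinfun_apply (sqrt_op Q) (pseudo_inverse (sqrt_op Q) h) = h"
    and "blinfun_apply (sqrt_op Q) y = 0 \<Longrightarrow> pseudo_inverse (sqrt_op Q) h \<bullet> y = 0"
  using theI'[OF min_norm_preimage[of h "sqrt_op Q"]] assms
  by (auto simp: CM_space_def pseudo_inverse_def)

lemma pseudo_inverse_unique:
  assumes "blinfun_apply (sqrt_op Q) x = h" "\<And>y. blinfun_apply (sqrt_op Q) y = 0 \<Longrightarrow> x \<bullet> y = 0"
  shows "pseudo_inverse (sqrt_op Q) h = x"
  unfolding pseudo_inverse_def
  by (rule the1_equality[OF min_norm_preimage]) (use assms in auto)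

lemma subspace_CM: "subspace (CM_space Q)"
  unfolding CM_space_def by (intro linear_subspace_image bounded_linear.linear blinfun.bounded_linear_right subspace_UNIV)

lemmas CM_add = subspace_add[OF subspace_CM]
  and CM_scale = subspace_scale[OF subspace_CM]
  and CM_0 = subspace_0[OF subspace_CM]

lemma CM_norm_nonneg: "0 \<le> CM_norm Q h" by (simp add: CM_norm_def)

lemma CM_norm_scale:
  assumes "h \<in> CM_space Q"
  shows "CM_norm Q (c *\<^sub>R h) = \<bar>c\<bar> * CM_norm Q h"
proof -
  have "pseudo_inverse (sqrt_op Q) (c *\<^sub>R h) = c *\<^sub>R pseudo_inverse (sqrt_op Q) h"
    by (rule pseudo_inverse_unique) (use pseudo_inverse[OF assms] in \<open>auto simp: blinfun.bilinear_simps\<close>)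
  then show ?thesis by (simp add: CM_norm_def)
qed

lemma CM_norm_0 [simp]: "CM_norm Q 0 = 0"
  using CM_norm_scale[OF CM_0, of 0] by simp

lemma CM_norm_eq_0: "h \<in> CM_space Q \<Longrightarrow> CM_norm Q h = 0 \<Longrightarrow> h = 0"
  using pseudo_inverse(1)[of h] by (simp add: CM_norm_def blinfun.bilinear_simps)

lemma CM_norm_pos: "h \<in> CM_space Q \<Longrightarrow> h \<noteq> 0 \<Longrightarrow> 0 < CM_norm Q h"
  using CM_norm_eq_0[of h] CM_norm_nonneg[of h] by linarith

text \<open>Writing \<open>h\<close> as the image of its pseudo-inverse under the square root moves
  the root to \<open>x\<close>, and Cauchy-Schwarz follows. For \<open>CM_norm Q h \<le> 1\<close>
  this says that \<open>Q\<close> dominates the rank one form of \<open>h\<close>, which allows that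
  direction to be split off.\<close>

lemma CM_inner_bound:
  assumes "h \<in> CM_space Q"
  shows "(h \<bullet> x)\<^sup>2 \<le> (CM_norm Q h)\<^sup>2 * (blinfun_apply Q x \<bullet> x)"
proof -
  let ?k = "pseudo_inverse (sqrt_op Q) h" and ?R = "blinfun_apply (sqrt_op Q)"
  have R: "?R a \<bullet> b = a \<bullet> ?R b" for a b by (rule psd_sym[OF sqrt_op(1)[OF psdQ]])
  have "?R (?R x) = blinfun_apply Q x" using sqrt_op(2)[OF psdQ] by (metis blinfun_apply_blinfun_compose)
  then have "(norm (?R x))\<^sup>2 = blinfun_apply Q x \<bullet> x" by (metis R power2_norm_eq_inner)
  moreover have "h \<bullet> x = ?k \<bullet> ?R x" using R[of ?k x] pseudo_inverse(1)[OF assms] by simp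
  then have "\<bar>h \<bullet> x\<bar> \<le> norm ?k * norm (?R x)" by (simp add: Cauchy_Schwarz_ineq2)
  then have "(h \<bullet> x)\<^sup>2 \<le> (norm ?k * norm (?R x))\<^sup>2" by (metis abs_ge_zero power2_abs power_mono)
  ultimately show ?thesis by (simp add: CM_norm_def power_mult_distrib)
qed

end

section \<open>Square roots of the covariance as sequences\<close>

text \<open>Completing the square in the coefficients. The choice \<open>c e = x \<bullet> e\<close>
  yields Bessel's inequality, and an arbitrary \<open>c\<close> together with density of the span
  yields Parseval's identity.\<close>

lemma orthonormal_sum_dist:
  fixes E :: "'a::real_inner set"
  assumes "finite F" "pairwise orthogonal F" "\<forall>e\<in>F. norm e = 1"
  shows "(norm (x - (\<Sum>e\<in>F. c e *\<^sub>R e)))\<^sup>2 = (norm x)\<^sup>2 - (\<Sum>e\<in>F. (x \<bullet> e)\<^sup>2) + (\<Sum>e\<in>F. (c e - x \<bullet> e)\<^sup>2)"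
proof -
  have "(norm (\<Sum>e\<in>F. c e *\<^sub>R e))\<^sup>2 = (\<Sum>e\<in>F. (norm (c e *\<^sub>R e))\<^sup>2)"
    using assms by (intro norm_sum_Pythagorean) (auto simp: pairwise_def orthogonal_def)
  also have "\<dots> = (\<Sum>e\<in>F. (c e)\<^sup>2)" using assms by (intro sum.cong) auto
  finally have 1: "(\<Sum>e\<in>F. c e *\<^sub>R e) \<bullet> (\<Sum>e\<in>F. c e *\<^sub>R e) = (\<Sum>e\<in>F. (c e)\<^sup>2)"
    by (simp add: power2_norm_eq_inner)
  have 2: "x \<bullet> (\<Sum>e\<in>F. c e *\<^sub>R e) = (\<Sum>e\<in>F. c e * (x \<bullet> e))" by (simp add: inner_sum_right)
  have "(norm (x - (\<Sum>e\<in>F. c e *\<^sub>R e)))\<^sup>2 = x \<bullet> x - 2 * (x \<bullet> (\<Sum>e\<in>F. c e *\<^sub>R e)) + (\<Sum>e\<in>F. c e *\<^sub>R e) \<bullet> (\<Sum>e\<in>F. c e *\<^sub>R e)"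
  proof -
    have "(norm (x - y))\<^sup>2 = x \<bullet> x - 2 * (x \<bullet> y) + y \<bullet> y" for y
      by (simp add: power2_norm_eq_inner inner_diff inner_commute[of y x])
    then show ?thesis .
  qed
  also have "\<dots> = (norm x)\<^sup>2 - (\<Sum>e\<in>F. (x \<bullet> e)\<^sup>2) + (\<Sum>e\<in>F. (c e - x \<bullet> e)\<^sup>2)"
    unfolding 1 2 by (simp add: power2_norm_eq_inner power2_diff sum.distrib sum_subtractf sum_distrib_left mult_ac)
  finally show ?thesis .
qed

lemma orthonormal_basis_subset:
  assumes "orthonormal_basis E" "F \<subseteq> E"
  shows "pairwise orthogonal F" "\<forall>e\<in>F. norm e = 1"
proof -
  show "pairwise orthogonal F"
    by (rule pairwise_subset[OF _ assms(2)]) (use assms(1) in \<open>simp add: orthonormal_basis_def\<close>)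
  show "\<forall>e\<in>F. norm e = 1" using assms by (auto simp: orthonormal_basis_def)
qed

lemma parseval:
  fixes E :: "'a::real_inner set"
  assumes E: "orthonormal_basis E"
  shows "((\<lambda>e. (x \<bullet> e)\<^sup>2) has_sum (norm x)\<^sup>2) E"
  unfolding has_sum_def tendsto_iff eventually_finite_subsets_at_top
proof (intro allI impI)
  have fin: "(\<Sum>e\<in>F. (x \<bullet> e)\<^sup>2) \<le> (norm x)\<^sup>2" if "finite F" "F \<subseteq> E" for F
  proof -
    have "0 \<le> (norm (x - (\<Sum>e\<in>F. (x \<bullet> e) *\<^sub>R e)))\<^sup>2" by simp
    also have "\<dots> = (norm x)\<^sup>2 - (\<Sum>e\<in>F. (x \<bullet> e)\<^sup>2)"
      by (subst orthonormal_sum_dist[OF that(1) orthonormal_basis_subset[OF E that(2)]]) simp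
    finally have "0 \<le> (norm x)\<^sup>2 - (\<Sum>e\<in>F. (x \<bullet> e)\<^sup>2)" .
    then show ?thesis by simp
  qed
  fix e :: real assume e: "e > 0"
  have "x \<in> closure (span E)" using E by (simp add: orthonormal_basis_def)
  then obtain y where y: "y \<in> span E" "dist y x < sqrt e"
    using e closure_approachable[of x "span E"] real_sqrt_gt_zero by blast
  then obtain F c where F: "finite F" "F \<subseteq> E" "y = (\<Sum>a\<in>F. c a *\<^sub>R a)"
    unfolding span_explicit by blast
  show "\<exists>X. finite X \<and> X \<subseteq> E \<and> (\<forall>Y. finite Y \<and> X \<subseteq> Y \<and> Y \<subseteq> E \<longrightarrow> dist (\<Sum>e\<in>Y. (x \<bullet> e)\<^sup>2) ((norm x)\<^sup>2) < e)"
  proof (intro exI[of _ F] conjI F allI impI)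
    fix Y assume Y: "finite Y \<and> F \<subseteq> Y \<and> Y \<subseteq> E"
    from orthonormal_sum_dist[OF F(1) orthonormal_basis_subset[OF E F(2)], of x c]
    have "(norm x)\<^sup>2 - (\<Sum>e\<in>F. (x \<bullet> e)\<^sup>2) \<le> (norm (x - y))\<^sup>2"
      by (simp add: F(3) sum_nonneg)
    also have "\<dots> < (sqrt e)\<^sup>2"
      using y(2) by (intro power_strict_mono) (auto simp: dist_norm norm_minus_commute)
    finally have "(norm x)\<^sup>2 - (\<Sum>e\<in>F. (x \<bullet> e)\<^sup>2) < e" using e by simp
    moreover have "(\<Sum>e\<in>F. (x \<bullet> e)\<^sup>2) \<le> (\<Sum>e\<in>Y. (x \<bullet> e)\<^sup>2)"
      using Y by (intro sum_mono2) auto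
    ultimately show "dist (\<Sum>e\<in>Y. (x \<bullet> e)\<^sup>2) ((norm x)\<^sup>2) < e"
      using fin[of Y] Y by (auto simp: dist_real_def)
  qed
qed

text \<open>Indices that are not hit carry \<open>None\<close>, so finite and infinite sets are
  treated alike and every sum becomes a sum over the naturals.\<close>

lemma has_sum_countable_enum:
  assumes "countable E"
  obtains d :: "nat \<Rightarrow> 'a option" where
    "\<And>f :: 'a \<Rightarrow> real. \<And>s. (f has_sum s) E \<longleftrightarrow> ((\<lambda>n. case d n of None \<Rightarrow> 0 | Some e \<Rightarrow> f e) has_sum s) UNIV"
proof -
  define g where "g = to_nat_on E"
  have g: "inj_on g E" unfolding g_def using assms by (rule inj_on_to_nat_on)
  define d where "d n = (if n \<in> g ` E then Some (inv_into E g n) else None)" for n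
  show thesis
  proof (rule that[of d])
    fix f :: "'a \<Rightarrow> real" and s
    have "((\<lambda>n. case d n of None \<Rightarrow> 0 | Some e \<Rightarrow> f e) has_sum s) UNIV \<longleftrightarrow>
        ((\<lambda>n. case d n of None \<Rightarrow> 0 | Some e \<Rightarrow> f e) has_sum s) (g ` E)"
      by (intro has_sum_cong_neutral) (auto simp: d_def)
    also have "\<dots> \<longleftrightarrow> (((\<lambda>n. case d n of None \<Rightarrow> 0 | Some e \<Rightarrow> f e) \<circ> g) has_sum s) E"
      by (rule has_sum_reindex[OF g])
    also have "\<dots> \<longleftrightarrow> (f has_sum s) E"
      using g by (intro has_sum_cong) (auto simp: d_def)
    finally show "(f has_sum s) E \<longleftrightarrow> ((\<lambda>n. case d n of None \<Rightarrow> 0 | Some e \<Rightarrow> f e) has_sum s) UNIV" by simp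
  qed
qed

context cov_op
begin

text \<open>The nonzero vectors are the images under the square root of the basis vectors it does
  not annihilate, countably many because the trace is a convergent sum. Their squared norms add up
  to the trace, and Parseval at the image of \<open>h\<close> gives the second sum. They will be the
  coefficients of a random series.\<close>

lemma covariance_sequence:
  "\<exists>v :: nat \<Rightarrow> 'a. summable (\<lambda>n. (norm (v n))\<^sup>2) \<and>
     (\<forall>h. (\<lambda>n. (h \<bullet> v n)\<^sup>2) sums (blinfun_apply Q h \<bullet> h))"
proof -
  let ?R = "blinfun_apply (sqrt_op Q)"
  have Rsym: "?R a \<bullet> b = a \<bullet> ?R b" for a b by (rule psd_sym[OF sqrt_op(1)[OF psdQ]])
  have "?R (?R x) = blinfun_apply Q x" for x using sqrt_op(2)[OF psdQ] by (metis blinfun_apply_blinfun_compose)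
  then have RQ: "(norm (?R x))\<^sup>2 = blinfun_apply Q x \<bullet> x" for x by (metis Rsym power2_norm_eq_inner)
  obtain E where E: "orthonormal_basis E" "(\<lambda>e. blinfun_apply Q e \<bullet> e) summable_on E"
    using tr by (auto simp: finite_trace_def)
  define E0 where "E0 = {e\<in>E. (norm (?R e))\<^sup>2 \<noteq> 0}"
  have sE: "(\<lambda>e. (norm (?R e))\<^sup>2) summable_on E" using E(2) by (simp add: RQ)
  then have "countable E0" unfolding E0_def by (rule summable_countable_real)
  then obtain d :: "nat \<Rightarrow> 'a option" where d:
    "\<And>f :: 'a \<Rightarrow> real. \<And>s. (f has_sum s) E0 \<longleftrightarrow> ((\<lambda>n. case d n of None \<Rightarrow> 0 | Some e \<Rightarrow> f e) has_sum s) UNIV"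
    using has_sum_countable_enum by blast
  define v where "v n = (case d n of None \<Rightarrow> 0 | Some e \<Rightarrow> ?R e)" for n
  have 1: "(h \<bullet> v n)\<^sup>2 = (case d n of None \<Rightarrow> 0 | Some e \<Rightarrow> (?R h \<bullet> e)\<^sup>2)" for n h
    by (cases "d n") (auto simp: v_def Rsym)
  have 2: "(norm (v n))\<^sup>2 = (case d n of None \<Rightarrow> 0 | Some e \<Rightarrow> (norm (?R e))\<^sup>2)" for n
    by (cases "d n") (auto simp: v_def)
  have "((\<lambda>e. (?R h \<bullet> e)\<^sup>2) has_sum (norm (?R h))\<^sup>2) E0" for h
  proof -
    have "((\<lambda>e. (?R h \<bullet> e)\<^sup>2) has_sum (norm (?R h))\<^sup>2) E0 \<longleftrightarrow> ((\<lambda>e. (?R h \<bullet> e)\<^sup>2) has_sum (norm (?R h))\<^sup>2) E"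
      by (rule has_sum_cong_neutral) (auto simp: E0_def Rsym)
    then show ?thesis using parseval[OF E(1)] by blast
  qed
  then have "((\<lambda>n. (h \<bullet> v n)\<^sup>2) has_sum (norm (?R h))\<^sup>2) UNIV" for h
    unfolding 1 using d by blast
  then have A: "(\<lambda>n. (h \<bullet> v n)\<^sup>2) sums (blinfun_apply Q h \<bullet> h)" for h
    using has_sum_imp_sums RQ by metis
  have "(\<lambda>e. (norm (?R e))\<^sup>2) summable_on E0"
    using sE by (rule summable_on_subset_banach) (auto simp: E0_def)
  then obtain S where "((\<lambda>e. (norm (?R e))\<^sup>2) has_sum S) E0" by (auto simp: summable_on_def)
  then have "((\<lambda>n. (norm (v n))\<^sup>2) has_sum S) UNIV" unfolding 2 using d by blast
  then have "summable (\<lambda>n. (norm (v n))\<^sup>2)" using has_sum_imp_sums sums_summable by blast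
  with A show ?thesis by blast
qed

text \<open>The rank one operator \<open>T\<close> of \<open>h\<close> is subtracted. Positivity of
  \<open>Q - T\<close> is \<open>CM_inner_bound\<close>, and its trace is finite by comparison with
  \<open>Q\<close> on the same basis.\<close>

lemma cov_op_minus_direction:
  assumes h: "h \<in> CM_space Q" "CM_norm Q h \<le> 1"
  shows "\<exists>Q'. cov_op Q' \<and> (\<forall>k. blinfun_apply Q' k \<bullet> k = blinfun_apply Q k \<bullet> k - (h \<bullet> k)\<^sup>2)"
proof -
  define T where "T = Blinfun (\<lambda>x. (x \<bullet> h) *\<^sub>R h)"
  have T: "blinfun_apply T x = (x \<bullet> h) *\<^sub>R h" for x
    unfolding T_def by (subst bounded_linear_Blinfun_apply) (auto intro!: bounded_linear_intros)
  have q: "blinfun_apply (Q - T) k \<bullet> k = blinfun_apply Q k \<bullet> k - (h \<bullet> k)\<^sup>2" for k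
    by (simp add: blinfun.bilinear_simps T inner_diff power2_eq_square inner_commute)
  have nn: "0 \<le> blinfun_apply Q k \<bullet> k" for k by (rule psd_nonneg[OF psdQ])
  have le: "(h \<bullet> k)\<^sup>2 \<le> blinfun_apply Q k \<bullet> k" for k
  proof -
    have "(CM_norm Q h)\<^sup>2 * (blinfun_apply Q k \<bullet> k) \<le> 1 * (blinfun_apply Q k \<bullet> k)"
      using h(2) nn by (intro mult_right_mono) (auto simp: CM_norm_nonneg power_le_one)
    then show ?thesis using CM_inner_bound[OF h(1), of k] by simp
  qed
  obtain E where E: "orthonormal_basis E" "(\<lambda>e. blinfun_apply Q e \<bullet> e) summable_on E"
    using tr by (auto simp: finite_trace_def)
  have "(\<lambda>e. blinfun_apply (Q - T) e \<bullet> e) summable_on E"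
    by (rule summable_on_comparison_test[OF E(2)]) (use le q in auto)
  then have "cov_op (Q - T)"
    using E(1) psd_sym[OF psdQ] le q
    by (auto simp: cov_op_def finite_trace_def self_adjoint_def positive_op_def blinfun.bilinear_simps T inner_diff inner_commute)
  then show ?thesis using q by blast
qed

end

section \<open>Uniqueness of characteristic functions\<close>

lemma borel_measurable_cis [measurable]: "cis \<in> borel_measurable borel"
  by (intro borel_measurable_continuous_onI continuous_intros)

lemma integral_complex_split:
  assumes "integrable M a" "integrable M b"
  shows "(\<integral>x. complex_of_real (a x) + \<i> * complex_of_real (b x) \<partial>M) =
    complex_of_real (\<integral>x. a x \<partial>M) + \<i> * complex_of_real (\<integral>x. b x \<partial>M)"
  using assms by (subst Bochner_Integration.integral_add) auto

text \<open>With \<open>w\<close> normalised to a probability density, the images on the line under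
  \<open>e\<close> have characteristic functions given by the weighted cosine and sine integrals,
  and Levy's uniqueness theorem identifies them. With cylinder functions as weights, this adds one
  coordinate at a time. Zero total weight is separate because it cannot be normalised.\<close>

lemma weighted_marginal_eq:
  fixes \<mu> \<nu> :: "'a::{real_inner, second_countable_topology} measure" and w :: "'a \<Rightarrow> real"
  assumes P: "prob_space \<mu>" "prob_space \<nu>" and [measurable_cong]: "sets \<mu> = sets borel" "sets \<nu> = sets borel"
    and w[measurable]: "w \<in> borel_measurable borel" and w0: "\<And>x. 0 \<le> w x" "\<And>x. w x \<le> B"
    and c: "\<And>t. (\<integral>x. w x * cos (t * (e \<bullet> x)) \<partial>\<mu>) = (\<integral>x. w x * cos (t * (e \<bullet> x)) \<partial>\<nu>)"
    and s: "\<And>t. (\<integral>x. w x * sin (t * (e \<bullet> x)) \<partial>\<mu>) = (\<integral>x. w x * sin (t * (e \<bullet> x)) \<partial>\<nu>)"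
    and A[measurable]: "A \<in> sets borel"
  shows "(\<integral>x. w x * indicator A (e \<bullet> x) \<partial>\<mu>) = (\<integral>x. w x * indicator A (e \<bullet> x) \<partial>\<nu>)"
proof -
  define m where "m = (\<integral>x. w x \<partial>\<mu>)"
  have m': "m = (\<integral>x. w x \<partial>\<nu>)" using c[of 0] by (simp add: m_def)
  have int: "integrable M (\<lambda>x. w x * f x)" "integrable M w"
    if M: "prob_space M" and s[measurable_cong]: "sets M = sets borel"
    and [measurable]: "f \<in> borel_measurable borel" and f: "\<And>x. \<bar>f x\<bar> \<le> (1::real)" for M f
  proof -
    interpret prob_space M by (rule M)
    show "integrable M (\<lambda>x. w x * f x)"
    proof (rule integrable_const_bound[of _ B])
      show "AE x in M. norm (w x * f x) \<le> B"
      proof (intro AE_I2)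
        fix x
        have "w x * \<bar>f x\<bar> \<le> w x * 1" by (intro mult_left_mono f w0)
        then show "norm (w x * f x) \<le> B" using w0[of x] by (simp add: abs_mult)
      qed
    qed measurable
    show "integrable M w" by (rule integrable_const_bound[of _ B]) (use w0 in auto)
  qed
  have m0: "m \<ge> 0" unfolding m_def using w0 by (simp add: integral_nonneg_AE)
  show ?thesis
  proof (cases "m = 0")
    case True
    have "(\<integral>x. w x * indicator A (e \<bullet> x) \<partial>M) = 0"
      if M: "prob_space M" and s[measurable_cong]: "sets M = sets borel" and z: "(\<integral>x. w x \<partial>M) = 0" for M
    proof -
      have "AE x in M. w x = 0"
        using integral_nonneg_eq_0_iff_AE[OF int(2)[OF M s, of "\<lambda>_. 0"]] z w0 by auto
      then have "AE x in M. w x * indicator A (e \<bullet> x) = 0" by eventually_elim simp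
      then show ?thesis by (rule integral_eq_zero_AE)
    qed
    then show ?thesis using P assms(3,4) True m' by (simp add: m_def)
  next
    case False
    then have mp: "m > 0" using m0 by simp
    define D where "D M = distr (density M (\<lambda>x. ennreal (w x / m))) borel (\<lambda>x. e \<bullet> x)" for M
    have I: "(\<integral>y. f y \<partial>D M) = (\<integral>x. (w x / m) *\<^sub>R f (e \<bullet> x) \<partial>M)"
      if s[measurable_cong]: "sets M = sets borel" and [measurable]: "f \<in> borel_measurable borel"
      for M and f :: "real \<Rightarrow> 'b::{banach, second_countable_topology}"
      unfolding D_def using mp w0 by (simp add: integral_distr integral_density)
    have R: "real_distribution (D M)"
      if M: "prob_space M" and s[measurable_cong]: "sets M = sets borel" and z: "(\<integral>x. w x \<partial>M) = m" for M
    proof -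
      have "emeasure (density M (\<lambda>x. ennreal (w x / m))) (space M) = (\<integral>\<^sup>+x. ennreal (w x / m) \<partial>M)"
        by (simp add: emeasure_density cong: nn_integral_cong)
      also have "\<dots> = ennreal (\<integral>x. w x / m \<partial>M)"
        using int(2)[OF M s, of "\<lambda>_. 0"] w0 mp by (intro nn_integral_eq_integral) auto
      also have "\<dots> = 1" using z mp by simp
      finally have "prob_space (density M (\<lambda>x. ennreal (w x / m)))" by (intro prob_spaceI) simp
      then have "prob_space (D M)" unfolding D_def by (rule prob_space.prob_space_distr) measurable
      then show ?thesis by (simp add: real_distribution_def real_distribution_axioms_def D_def)
    qed
    have ch: "char (D M) t = complex_of_real ((1 / m) * (\<integral>x. w x * cos (t * (e \<bullet> x)) \<partial>M))
        + \<i> * complex_of_real ((1 / m) * (\<integral>x. w x * sin (t * (e \<bullet> x)) \<partial>M))"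
      if M: "prob_space M" and s[measurable_cong]: "sets M = sets borel" for M t
    proof -
      have "char (D M) t = (\<integral>x. (w x / m) *\<^sub>R iexp (t * (e \<bullet> x)) \<partial>M)"
        unfolding char_def by (rule I[OF s]) measurable
      also have "\<dots> = (\<integral>x. complex_of_real ((1 / m) * (w x * cos (t * (e \<bullet> x))))
          + \<i> * complex_of_real ((1 / m) * (w x * sin (t * (e \<bullet> x)))) \<partial>M)"
      proof (intro Bochner_Integration.integral_cong refl)
        fix x
        define y where "y = t * (e \<bullet> x)"
        have "iexp y = complex_of_real (cos y) + \<i> * complex_of_real (sin y)"
          by (simp add: exp_Euler cos_of_real sin_of_real)
        then show "(w x / m) *\<^sub>R iexp (t * (e \<bullet> x)) = complex_of_real ((1 / m) * (w x * cos (t * (e \<bullet> x))))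
          + \<i> * complex_of_real ((1 / m) * (w x * sin (t * (e \<bullet> x))))"
          unfolding y_def[symmetric] by (simp only:) (simp add: complex_eq_iff)
      qed
      also have "\<dots> = complex_of_real ((1 / m) * (\<integral>x. w x * cos (t * (e \<bullet> x)) \<partial>M))
        + \<i> * complex_of_real ((1 / m) * (\<integral>x. w x * sin (t * (e \<bullet> x)) \<partial>M))"
        using int(1)[OF M s, of "\<lambda>x. cos (t * (e \<bullet> x))"] int(1)[OF M s, of "\<lambda>x. sin (t * (e \<bullet> x))"]
        by (subst integral_complex_split) auto
      finally show ?thesis .
    qed
    have "D \<mu> = D \<nu>"
      by (rule Levy_uniqueness) (use R P assms(3,4) m' m_def ch c s in auto)
    then have "(\<integral>y. indicator A y \<partial>D \<mu>) = (\<integral>y. (indicator A y :: real) \<partial>D \<nu>)" by simp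
    then have "(\<integral>x. (w x / m) *\<^sub>R indicator A (e \<bullet> x) \<partial>\<mu>) = (\<integral>x. (w x / m) *\<^sub>R (indicator A (e \<bullet> x) :: real) \<partial>\<nu>)"
      using I[OF assms(3), of "indicator A :: real \<Rightarrow> real"] I[OF assms(4), of "indicator A :: real \<Rightarrow> real"]
      by simp
    then show ?thesis using mp by simp
  qed
qed

section \<open>Cylinder functions and cylinder sets\<close>

definition cyl :: "('a::real_inner \<times> real set) list \<Rightarrow> 'a \<Rightarrow> real" where
  "cyl ps x = (\<Prod>(e, A)\<leftarrow>ps. indicator A (e \<bullet> x))"

lemma cyl_simps [simp]: "cyl [] x = 1" "cyl ((e, A) # ps) x = indicator A (e \<bullet> x) * cyl ps x"
  by (simp_all add: cyl_def)

lemma cyl_range: "0 \<le> cyl ps x \<and> cyl ps x \<le> 1"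
  by (induction ps) (auto split: split_indicator)

lemma cyl_measurable:
  fixes ps :: "('a::{real_inner, second_countable_topology} \<times> real set) list"
  assumes "\<And>e A. (e, A) \<in> set ps \<Longrightarrow> A \<in> sets borel"
  shows "cyl ps \<in> borel_measurable borel"
  using assms
proof (induction ps)
  case Nil
  have "cyl [] = (\<lambda>x::'a. 1)" by auto
  then show ?case by simp
next
  case (Cons p ps)
  obtain e A where p: "p = (e, A)" by force
  have [measurable]: "A \<in> sets borel" using Cons.prems p by auto
  have [measurable]: "cyl ps \<in> borel_measurable borel" using Cons by auto
  have "cyl (p # ps) = (\<lambda>x. indicator A (e \<bullet> x) * cyl ps x)" by (auto simp: p)
  then show ?case by simp
qed

text \<open>Induction on the number of constraints, with all frequencies \<open>h\<close> carried
  along. Weights have to be nonnegative, so \<open>cos\<close> and \<open>sin\<close> enter as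
  \<open>1 + cos\<close> and \<open>1 + sin\<close>, and the case of the plain cylinder function is
  subtracted afterwards.\<close>

lemma cyl_integral_eq:
  fixes \<mu> \<nu> :: "'a::{real_inner, second_countable_topology} measure"
  assumes P: "prob_space \<mu>" "prob_space \<nu>" and [measurable_cong]: "sets \<mu> = sets borel" "sets \<nu> = sets borel"
    and ch: "\<And>h. (\<integral>x. cis (h \<bullet> x) \<partial>\<mu>) = (\<integral>x. cis (h \<bullet> x) \<partial>\<nu>)"
    and A: "\<And>e A. (e, A) \<in> set ps \<Longrightarrow> A \<in> sets borel"
  shows "(\<integral>x. cyl ps x * cos (h \<bullet> x) \<partial>\<mu>) = (\<integral>x. cyl ps x * cos (h \<bullet> x) \<partial>\<nu>) \<and>
    (\<integral>x. cyl ps x * sin (h \<bullet> x) \<partial>\<mu>) = (\<integral>x. cyl ps x * sin (h \<bullet> x) \<partial>\<nu>)"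
  using A
proof (induction ps arbitrary: h)
  case Nil
  have i: "(\<integral>x. cis (h \<bullet> x) \<partial>M) = Complex (\<integral>x. cos (h \<bullet> x) \<partial>M) (\<integral>x. sin (h \<bullet> x) \<partial>M)"
    if M: "prob_space M" and [measurable_cong]: "sets M = sets borel" for M
  proof -
    interpret prob_space M by (rule M)
    have "(\<integral>x. cis (h \<bullet> x) \<partial>M) = (\<integral>x. complex_of_real (cos (h \<bullet> x)) + \<i> * complex_of_real (sin (h \<bullet> x)) \<partial>M)"
      by (intro Bochner_Integration.integral_cong) (auto simp: complex_eq_iff)
    also have "\<dots> = complex_of_real (\<integral>x. cos (h \<bullet> x) \<partial>M) + \<i> * complex_of_real (\<integral>x. sin (h \<bullet> x) \<partial>M)"
    proof -
      have "integrable M (\<lambda>x. cos (h \<bullet> x))" "integrable M (\<lambda>x. sin (h \<bullet> x))"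
        by (rule integrable_const_bound[of _ 1]; simp)+
      then show ?thesis by (subst Bochner_Integration.integral_add) auto
    qed
    finally show ?thesis by (simp add: complex_eq_iff)
  qed
  show ?case using ch[of h] i P assms(3,4) by simp
next
  case (Cons p ps)
  obtain e A where p: "p = (e, A)" by force
  have A[measurable]: "A \<in> sets borel" using Cons.prems p by auto
  have W[measurable]: "cyl ps \<in> borel_measurable borel" by (rule cyl_measurable) (use Cons.prems in auto)
  have IH: "(\<integral>x. cyl ps x * cos (k \<bullet> x) \<partial>\<mu>) = (\<integral>x. cyl ps x * cos (k \<bullet> x) \<partial>\<nu>)"
    "(\<integral>x. cyl ps x * sin (k \<bullet> x) \<partial>\<mu>) = (\<integral>x. cyl ps x * sin (k \<bullet> x) \<partial>\<nu>)" for k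
    using Cons by auto
  have int: "integrable M (\<lambda>x. cyl ps x * f x)"
    if M: "prob_space M" and s[measurable_cong]: "sets M = sets borel"
    and [measurable]: "f \<in> borel_measurable borel" and f: "\<And>x. \<bar>f x\<bar> \<le> (1::real)" for M f
  proof -
    interpret prob_space M by (rule M)
    show ?thesis
    proof (rule integrable_const_bound[of _ 1])
      show "AE x in M. norm (cyl ps x * f x) \<le> 1"
        using cyl_range[of ps] f by (intro AE_I2) (auto simp: abs_mult intro!: mult_le_one)
    qed measurable
  qed
  note int' = int[OF P(1) assms(3)] int[OF P(2) assms(4)]
  have comb: "(\<integral>x. cyl ps x * (f1 x + f2 x / 2 + f3 x / 2) \<partial>\<mu>) = (\<integral>x. cyl ps x * (f1 x + f2 x / 2 + f3 x / 2) \<partial>\<nu>)"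
    if "f1 \<in> borel_measurable borel" "\<And>x. \<bar>f1 x\<bar> \<le> (1::real)" "(\<integral>x. cyl ps x * f1 x \<partial>\<mu>) = (\<integral>x. cyl ps x * f1 x \<partial>\<nu>)"
      "f2 \<in> borel_measurable borel" "\<And>x. \<bar>f2 x\<bar> \<le> (1::real)" "(\<integral>x. cyl ps x * f2 x \<partial>\<mu>) = (\<integral>x. cyl ps x * f2 x \<partial>\<nu>)"
      "f3 \<in> borel_measurable borel" "\<And>x. \<bar>f3 x\<bar> \<le> (1::real)" "(\<integral>x. cyl ps x * f3 x \<partial>\<mu>) = (\<integral>x. cyl ps x * f3 x \<partial>\<nu>)"
    for f1 f2 f3
    using int'(1)[OF that(1,2)] int'(2)[OF that(1,2)] int'(1)[OF that(4,5)] int'(2)[OF that(4,5)]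
      int'(1)[OF that(7,8)] int'(2)[OF that(7,8)] that(3,6,9)
    by (simp add: distrib_left)
  have mc: "(\<lambda>x. cos (k \<bullet> x)) \<in> borel_measurable borel" "(\<lambda>x. sin (k \<bullet> x)) \<in> borel_measurable borel"
    "(\<lambda>x. - cos (k \<bullet> x)) \<in> borel_measurable borel" for k :: 'a by measurable
  have trig: "cos (t * (e \<bullet> x)) = cos ((t *\<^sub>R e) \<bullet> x)" "sin (t * (e \<bullet> x)) = sin ((t *\<^sub>R e) \<bullet> x)" for t x by simp_all
  have IHm: "(\<integral>x. cyl ps x * - cos (k \<bullet> x) \<partial>\<mu>) = (\<integral>x. cyl ps x * - cos (k \<bullet> x) \<partial>\<nu>)" for k
    using IH(1)[of k] by simp
  have abm: "\<bar>- cos y\<bar> \<le> 1" for y :: real by simp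
  \<comment> \<open>A weight of frequency \<open>h\<close> times a wave of frequency
    \<open>t *\<^sub>R e\<close> becomes a combination of single waves, to which the induction
    hypothesis applies.\<close>
  have prodsum: "(1 + cos a) * cos b = cos b + cos (a - b) / 2 + cos (a + b) / 2"
    "(1 + cos a) * sin b = sin b + sin (b - a) / 2 + sin (a + b) / 2"
    "(1 + sin a) * cos b = cos b + sin (a - b) / 2 + sin (a + b) / 2"
    "(1 + sin a) * sin b = sin b + cos (a - b) / 2 + (- cos (a + b)) / 2" for a b :: real
    by (simp_all add: cos_add cos_diff sin_add sin_diff field_simps)
  note wm = weighted_marginal_eq[OF P assms(3,4) _ _ _ _ _ A, where e = e and B = 2]
  have 0: "(\<integral>x. cyl ps x * indicator A (e \<bullet> x) \<partial>\<mu>) = (\<integral>x. cyl ps x * indicator A (e \<bullet> x) \<partial>\<nu>)"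
  proof (rule wm)
    fix x show "cyl ps x \<le> 2" "0 \<le> cyl ps x" using cyl_range[of ps x] by linarith+
  next
    fix t
    show "(\<integral>x. cyl ps x * cos (t * (e \<bullet> x)) \<partial>\<mu>) = (\<integral>x. cyl ps x * cos (t * (e \<bullet> x)) \<partial>\<nu>)"
      unfolding trig by (rule IH)
    show "(\<integral>x. cyl ps x * sin (t * (e \<bullet> x)) \<partial>\<mu>) = (\<integral>x. cyl ps x * sin (t * (e \<bullet> x)) \<partial>\<nu>)"
      unfolding trig by (rule IH)
  qed (rule W)
  have 1: "(\<integral>x. (cyl ps x * (1 + cos (h \<bullet> x))) * indicator A (e \<bullet> x) \<partial>\<mu>) =
      (\<integral>x. (cyl ps x * (1 + cos (h \<bullet> x))) * indicator A (e \<bullet> x) \<partial>\<nu>)"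
  proof (rule wm)
    fix x show "0 \<le> cyl ps x * (1 + cos (h \<bullet> x))"
      using cyl_range[of ps x] cos_ge_minus_one[of "h \<bullet> x"] by (intro mult_nonneg_nonneg) linarith+
    have "cyl ps x * (1 + cos (h \<bullet> x)) \<le> 1 * 2"
      using cyl_range[of ps x] cos_le_one[of "h \<bullet> x"] cos_ge_minus_one[of "h \<bullet> x"] by (intro mult_mono) linarith+
    then show "cyl ps x * (1 + cos (h \<bullet> x)) \<le> 2" by simp
  next
    fix t
    have e1: "cyl ps x * (1 + cos (h \<bullet> x)) * cos (t * (e \<bullet> x)) =
        cyl ps x * (cos ((t *\<^sub>R e) \<bullet> x) + cos ((h - t *\<^sub>R e) \<bullet> x) / 2 + cos ((h + t *\<^sub>R e) \<bullet> x) / 2)" for x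
      by (simp only: inner_add_left inner_diff_left inner_scaleR_left mult.assoc prodsum)
    show "(\<integral>x. cyl ps x * (1 + cos (h \<bullet> x)) * cos (t * (e \<bullet> x)) \<partial>\<mu>) =
        (\<integral>x. cyl ps x * (1 + cos (h \<bullet> x)) * cos (t * (e \<bullet> x)) \<partial>\<nu>)"
      unfolding e1 by (rule comb) (rule mc abs_cos_le_one abs_sin_le_one abm IH IHm)+
    have e2: "cyl ps x * (1 + cos (h \<bullet> x)) * sin (t * (e \<bullet> x)) =
        cyl ps x * (sin ((t *\<^sub>R e) \<bullet> x) + sin ((t *\<^sub>R e - h) \<bullet> x) / 2 + sin ((h + t *\<^sub>R e) \<bullet> x) / 2)" for x
      by (simp only: inner_add_left inner_diff_left inner_scaleR_left mult.assoc prodsum)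
    show "(\<integral>x. cyl ps x * (1 + cos (h \<bullet> x)) * sin (t * (e \<bullet> x)) \<partial>\<mu>) =
        (\<integral>x. cyl ps x * (1 + cos (h \<bullet> x)) * sin (t * (e \<bullet> x)) \<partial>\<nu>)"
      unfolding e2 by (rule comb) (rule mc abs_cos_le_one abs_sin_le_one abm IH IHm)+
  qed (use W in measurable)
  have 2: "(\<integral>x. (cyl ps x * (1 + sin (h \<bullet> x))) * indicator A (e \<bullet> x) \<partial>\<mu>) =
      (\<integral>x. (cyl ps x * (1 + sin (h \<bullet> x))) * indicator A (e \<bullet> x) \<partial>\<nu>)"
  proof (rule wm)
    fix x show "0 \<le> cyl ps x * (1 + sin (h \<bullet> x))"
      using cyl_range[of ps x] sin_ge_minus_one[of "h \<bullet> x"] by (intro mult_nonneg_nonneg) linarith+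
    have "cyl ps x * (1 + sin (h \<bullet> x)) \<le> 1 * 2"
      using cyl_range[of ps x] sin_le_one[of "h \<bullet> x"] sin_ge_minus_one[of "h \<bullet> x"] by (intro mult_mono) linarith+
    then show "cyl ps x * (1 + sin (h \<bullet> x)) \<le> 2" by simp
  next
    fix t
    have e1: "cyl ps x * (1 + sin (h \<bullet> x)) * cos (t * (e \<bullet> x)) =
        cyl ps x * (cos ((t *\<^sub>R e) \<bullet> x) + sin ((h - t *\<^sub>R e) \<bullet> x) / 2 + sin ((h + t *\<^sub>R e) \<bullet> x) / 2)" for x
      by (simp only: inner_add_left inner_diff_left inner_scaleR_left mult.assoc prodsum)
    show "(\<integral>x. cyl ps x * (1 + sin (h \<bullet> x)) * cos (t * (e \<bullet> x)) \<partial>\<mu>) =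
        (\<integral>x. cyl ps x * (1 + sin (h \<bullet> x)) * cos (t * (e \<bullet> x)) \<partial>\<nu>)"
      unfolding e1 by (rule comb) (rule mc abs_cos_le_one abs_sin_le_one abm IH IHm)+
    have e2: "cyl ps x * (1 + sin (h \<bullet> x)) * sin (t * (e \<bullet> x)) =
        cyl ps x * (sin ((t *\<^sub>R e) \<bullet> x) + cos ((h - t *\<^sub>R e) \<bullet> x) / 2 + (- cos ((h + t *\<^sub>R e) \<bullet> x)) / 2)" for x
      by (simp only: inner_add_left inner_diff_left inner_scaleR_left mult.assoc prodsum)
    show "(\<integral>x. cyl ps x * (1 + sin (h \<bullet> x)) * sin (t * (e \<bullet> x)) \<partial>\<mu>) =
        (\<integral>x. cyl ps x * (1 + sin (h \<bullet> x)) * sin (t * (e \<bullet> x)) \<partial>\<nu>)"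
      unfolding e2 by (rule comb) (rule mc abs_cos_le_one abs_sin_le_one abm IH IHm)+
  qed (use W in measurable)
  have diff: "(\<integral>x. cyl (p # ps) x * f x \<partial>M) =
      (\<integral>x. (cyl ps x * (1 + f x)) * indicator A (e \<bullet> x) \<partial>M) - (\<integral>x. cyl ps x * indicator A (e \<bullet> x) \<partial>M)"
    if M: "prob_space M" and s[measurable_cong]: "sets M = sets borel"
    and f[measurable]: "f \<in> borel_measurable borel" and f1: "\<And>x. \<bar>f x\<bar> \<le> (1::real)" for M f
  proof -
    have "integrable M (\<lambda>x. cyl ps x * (f x * indicator A (e \<bullet> x)))"
      by (rule int[OF M s]) (use f1 in \<open>auto simp: abs_mult split: split_indicator\<close>)
    moreover have "integrable M (\<lambda>x. cyl ps x * indicator A (e \<bullet> x))"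
      by (rule int[OF M s]) (auto split: split_indicator)
    ultimately show ?thesis
      by (simp add: p algebra_simps)
  qed
  have mc': "(\<lambda>x. cos (h \<bullet> x)) \<in> borel_measurable borel" "(\<lambda>x. sin (h \<bullet> x)) \<in> borel_measurable borel"
    by measurable
  show ?case
    using diff[OF P(1) assms(3) mc'(1)] diff[OF P(2) assms(4) mc'(1)]
      diff[OF P(1) assms(3) mc'(2)] diff[OF P(2) assms(4) mc'(2)] 0 1 2 by simp
qed

definition cyl_sets :: "'a::real_inner set set" where
  "cyl_sets = {{x. \<forall>(e, A)\<in>set ps. e \<bullet> x \<in> A} | ps. \<forall>(e, A)\<in>set ps. A \<in> sets borel}"

lemma cyl_setsI:
  assumes "\<forall>(e, A)\<in>set ps. A \<in> sets borel" "X = {x. \<forall>(e, A)\<in>set ps. e \<bullet> x \<in> A}"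
  shows "X \<in> cyl_sets"
  unfolding cyl_sets_def mem_Collect_eq by (rule exI[of _ ps], rule conjI, rule assms(2), rule assms(1))

text \<open>If \<open>norm y > r\<close>, then the strict inequality
  \<open>r * norm d < d \<bullet> y\<close> holds at \<open>d = y\<close>; being an open condition
  on \<open>d\<close>, it also holds somewhere in the dense set. For countable \<open>D\<close>,
  balls are thus cut out by countably many half-spaces.\<close>

lemma norm_le_iff_inner_dense:
  fixes y :: "'a::real_inner"
  assumes D: "\<And>X::'a set. open X \<Longrightarrow> X \<noteq> {} \<Longrightarrow> \<exists>d\<in>D. d \<in> X" and r: "0 \<le> r"
  shows "norm y \<le> r \<longleftrightarrow> (\<forall>d\<in>D. d \<bullet> y \<le> r * norm d)"
proof
  assume "norm y \<le> r"
  then show "\<forall>d\<in>D. d \<bullet> y \<le> r * norm d"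
    by (metis mult.commute mult_right_mono norm_cauchy_schwarz norm_ge_zero order_trans)
next
  assume *: "\<forall>d\<in>D. d \<bullet> y \<le> r * norm d"
  show "norm y \<le> r"
  proof (rule ccontr)
    assume "\<not> norm y \<le> r"
    then have "r * norm y < norm y * norm y" using r by (intro mult_strict_right_mono) auto
    then have "y \<in> {d. r * norm d < d \<bullet> y}" by (simp add: power2_norm_eq_inner[symmetric] power2_eq_square)
    moreover have "open {d. r * norm d < d \<bullet> y}" by (intro open_Collect_less continuous_intros)
    ultimately obtain d where "d \<in> D" "r * norm d < d \<bullet> y" using D by blast
    then show False using * by auto
  qed
qed

text \<open>Closed balls are countable intersections of half-spaces, and open sets are countable
  unions of closed balls with centres in a countable dense set and rational radii.\<close>

lemma sets_borel_cyl:
  "sets (borel :: 'a::{real_inner, second_countable_topology} measure) = sigma_sets UNIV cyl_sets"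
proof -
  let ?N = "sigma UNIV (cyl_sets :: 'a set set)"
  have sN: "sets ?N = sigma_sets UNIV cyl_sets" by (simp add: sets_measure_of)
  have spN: "space ?N = UNIV" by simp
  have inner_m: "(\<lambda>x. e \<bullet> x) \<in> borel_measurable ?N" for e :: 'a
  proof (rule measurableI)
    fix A :: "real set" assume "A \<in> sets borel"
    then have "(\<lambda>x. e \<bullet> x) -` A \<in> cyl_sets" by (intro cyl_setsI[of "[(e, A)]"]) auto
    then show "(\<lambda>x. e \<bullet> x) -` A \<inter> space ?N \<in> sets ?N"
      unfolding sN spN by (simp add: sigma_sets.Basic)
  qed simp
  obtain D :: "'a set" where D: "countable D" "\<And>X. open X \<Longrightarrow> X \<noteq> {} \<Longrightarrow> \<exists>d\<in>D. d \<in> X"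
    using countable_dense_exists by blast
  have cb: "cball a r \<in> sets ?N" if r: "0 \<le> r" for a r
  proof -
    have "cball a r = {x \<in> space ?N. \<forall>d\<in>D. d \<bullet> x - d \<bullet> a \<le> r * norm d}"
      using norm_le_iff_inner_dense[OF D(2) r]
      by (auto simp: dist_norm norm_minus_commute inner_diff_right)
    also have "\<dots> = space ?N - (\<Union>d\<in>D. {x \<in> space ?N. r * norm d < d \<bullet> x - d \<bullet> a})"
      by (auto simp: not_less)
    also have "\<dots> \<in> sets ?N"
    proof -
      have "{x \<in> space ?N. r * norm d < d \<bullet> x - d \<bullet> a} \<in> sets ?N" for d
      proof -
        have [measurable]: "(\<lambda>x. d \<bullet> x) \<in> borel_measurable ?N" by (rule inner_m)
        show ?thesis by measurable
      qed
      then show ?thesis by (intro sets.compl_sets sets.countable_UN'[OF D(1)]) auto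
    qed
    finally show ?thesis .
  qed
  have op: "U \<in> sets ?N" if U: "open U" for U
  proof -
    define I where "I = {(d, q). d \<in> D \<and> q \<in> \<rat> \<and> 0 \<le> q \<and> cball d q \<subseteq> U}"
    have "I \<subseteq> D \<times> \<rat>" by (auto simp: I_def)
    then have cI: "countable I" using D(1) countable_rat by (blast intro: countable_subset countable_SIGMA)
    have "U = (\<Union>(d, q)\<in>I. cball d q)"
    proof (intro equalityI subsetI)
      fix x assume "x \<in> U"
      then obtain r where r: "r > 0" "ball x r \<subseteq> U" using U open_contains_ball by blast
      \<comment> \<open>The centre will lie within \<open>r / 3 < q\<close> of \<open>x\<close>, so
        the ball contains \<open>x\<close>; its points are within \<open>r / 3 + r / 2 < r\<close>
        of \<open>x\<close>, so it stays in \<open>U\<close>.\<close>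
      obtain q where q: "q \<in> \<rat>" "r / 3 < q" "q < r / 2" using Rats_dense_in_real[of "r / 3" "r / 2"] r by auto
      obtain d where d: "d \<in> D" "d \<in> ball x (r / 3)" using D(2)[of "ball x (r / 3)"] r by auto
      have "cball d q \<subseteq> U"
      proof
        fix z assume "z \<in> cball d q"
        then have "dist x z < r" using dist_triangle[of x z d] d q r by auto
        then show "z \<in> U" using r by auto
      qed
      then have "(d, q) \<in> I" using d q r by (auto simp: I_def)
      moreover have "x \<in> cball d q" using d q by (auto simp: dist_commute)
      ultimately show "x \<in> (\<Union>(d, q)\<in>I. cball d q)" by blast
    qed (auto simp: I_def)
    also have "\<dots> \<in> sets ?N" using cI cb by (intro sets.countable_UN') (auto simp: I_def)
    finally show ?thesis .
  qed
  show ?thesis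
  proof
    have "sigma_sets (space ?N) {S::'a set. open S} \<subseteq> sets ?N"
      using op by (intro sets.sigma_sets_subset) auto
    moreover have "sets (borel :: 'a measure) = sigma_sets UNIV {S. open S}" by (simp add: borel_def)
    ultimately show "sets (borel :: 'a measure) \<subseteq> sigma_sets UNIV cyl_sets" unfolding sN spN by blast
    show "sigma_sets UNIV cyl_sets \<subseteq> sets (borel :: 'a measure)"
    proof -
      have "sigma_sets (space borel) cyl_sets \<subseteq> sets (borel :: 'a measure)"
      proof (rule sets.sigma_sets_subset)
      show "cyl_sets \<subseteq> sets (borel :: 'a measure)"
      proof
        fix X :: "'a set" assume "X \<in> cyl_sets"
        then obtain ps where ps: "\<forall>(e, A)\<in>set ps. A \<in> sets borel" "X = {x. \<forall>(e, A)\<in>set ps. e \<bullet> x \<in> A}"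
          by (auto simp: cyl_sets_def)
        have "X = {x \<in> space borel. \<forall>p\<in>set ps. fst p \<bullet> x \<in> snd p}" using ps(2) by (auto simp: case_prod_beta)
        also have "\<dots> \<in> sets borel"
        proof (intro sets.sets_Collect_finite_All)
          fix p assume "p \<in> set ps"
          then have [measurable]: "snd p \<in> sets borel" using ps(1) by (auto simp: case_prod_beta)
          show "{x \<in> space borel. fst p \<bullet> x \<in> snd p} \<in> sets borel" by measurable
        qed simp
        finally show "X \<in> sets borel" .
      qed
      qed
      then show ?thesis by simp
    qed
  qed
qed

text \<open>At frequency \<open>0\<close> the cosine integrals of cylinder functions are the
  measures of cylinder sets, which form an intersection-stable generator.\<close>

lemma measure_eqI_char:
  fixes \<mu> \<nu> :: "'a::{real_inner, second_countable_topology} measure"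
  assumes P: "prob_space \<mu>" "prob_space \<nu>" and s: "sets \<mu> = sets borel" "sets \<nu> = sets borel"
    and ch: "\<And>h. (\<integral>x. cis (h \<bullet> x) \<partial>\<mu>) = (\<integral>x. cis (h \<bullet> x) \<partial>\<nu>)"
  shows "\<mu> = \<nu>"
proof (rule measure_eqI_generator_eq[where E = cyl_sets and \<Omega> = UNIV and A = "\<lambda>_. UNIV"])
  show "Int_stable (cyl_sets :: 'a set set)"
  proof (rule Int_stableI)
    fix a b :: "'a set" assume "a \<in> cyl_sets" "b \<in> cyl_sets"
    then obtain ps qs where
      "\<forall>(e, A)\<in>set ps. A \<in> sets borel" "a = {x. \<forall>(e, A)\<in>set ps. e \<bullet> x \<in> A}"
      "\<forall>(e, A)\<in>set qs. A \<in> sets borel" "b = {x. \<forall>(e, A)\<in>set qs. e \<bullet> x \<in> A}"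
      by (auto simp: cyl_sets_def)
    then have "a \<inter> b = {x. \<forall>(e, A)\<in>set (ps @ qs). e \<bullet> x \<in> A}" "\<forall>(e, A)\<in>set (ps @ qs). A \<in> sets borel"
      by auto
    then show "a \<inter> b \<in> cyl_sets" by (intro cyl_setsI[of "ps @ qs"])
  qed
  show "sets \<mu> = sigma_sets UNIV cyl_sets" "sets \<nu> = sigma_sets UNIV cyl_sets"
    using s sets_borel_cyl by auto
  have "(UNIV :: 'a set) \<in> cyl_sets" by (rule cyl_setsI[of "[]"]) simp_all
  then show "range (\<lambda>_. UNIV :: 'a set) \<subseteq> cyl_sets" by auto
  show "emeasure \<mu> UNIV \<noteq> \<infinity>" using P(1) by (simp add: finite_measure.emeasure_finite prob_space.finite_measure)
  fix X :: "'a set" assume "X \<in> cyl_sets"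
  then obtain ps where ps: "\<forall>(e, A)\<in>set ps. A \<in> sets borel" "X = {x. \<forall>(e, A)\<in>set ps. e \<bullet> x \<in> A}"
    by (auto simp: cyl_sets_def)
  have "cyl ps x = indicator {x. \<forall>(e, A)\<in>set ps. e \<bullet> x \<in> A} x" for x
  proof (induction ps)
    case (Cons p ps)
    show ?case by (cases p) (simp add: Cons indicator_def)
  qed simp
  then have cylX: "cyl ps x = indicator X x" for x using ps(2) by simp
  have cy: "\<And>e A. (e, A) \<in> set ps \<Longrightarrow> A \<in> sets borel" using ps(1) by auto
  have "(\<integral>x. cyl ps x * cos (0 \<bullet> x) \<partial>\<mu>) = (\<integral>x. cyl ps x * cos (0 \<bullet> x) \<partial>\<nu>)"
    using cyl_integral_eq[OF P s ch, of ps 0] cy by blast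
  then have "(\<integral>x. indicator X x \<partial>\<mu>) = (\<integral>x. (indicator X x :: real) \<partial>\<nu>)" by (simp add: cylX)
  moreover have "space \<mu> = UNIV" "space \<nu> = UNIV" using s[THEN sets_eq_imp_space_eq] by simp_all
  ultimately have "measure \<mu> X = measure \<nu> X" by simp
  then show "emeasure \<mu> X = emeasure \<nu> X"
    using P by (simp add: finite_measure.emeasure_eq_measure prob_space.finite_measure)
qed auto

lemma gaussian_eqI: "is_centered_gaussian Q (\<mu> :: 'a::{real_inner, polish_space} measure) \<Longrightarrow> gaussian Q = \<mu>"
  unfolding gaussian_def
  by (rule the_equality) (auto simp: is_centered_gaussian_def intro: measure_eqI_char)


section \<open>Existence of Gaussian measures\<close>

abbreviation (input) std :: "real measure" where "std \<equiv> std_normal_distribution"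

definition iid :: "(nat \<Rightarrow> real) measure" where
  "iid = PiM UNIV (\<lambda>_. std)"

lemma prob_std: "prob_space std"
  using real_dist_normal_dist by (simp add: real_distribution_def)

lemma prob_iid: "prob_space iid"
  unfolding iid_def by (intro prob_space_PiM prob_std)

lemma iid_component_measurable [measurable]: "(\<lambda>\<omega>. \<omega> n) \<in> borel_measurable iid"
  unfolding iid_def by measurable

lemma distr_iid: "distr iid borel (\<lambda>\<omega>. \<omega> n) = std"
proof -
  have "distr iid borel (\<lambda>\<omega>. \<omega> n) = distr iid std (\<lambda>\<omega>. \<omega> n)" by (rule distr_cong) auto
  also have "\<dots> = std" unfolding iid_def by (rule distr_PiM_component) (auto intro: prob_std)
  finally show ?thesis .
qed

lemma indep_iid: "prob_space.indep_vars iid (\<lambda>_. borel) (\<lambda>n \<omega>. \<omega> n) UNIV"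
proof -
  interpret prob_space iid by (rule prob_iid)
  have "sets (PiM UNIV (\<lambda>_::nat. borel :: real measure)) = sets iid"
    unfolding iid_def by (intro sets_PiM_cong) auto
  from distr_id2[OF this] have d: "distr iid (PiM UNIV (\<lambda>_. borel)) (\<lambda>x. \<lambda>i\<in>UNIV. x i) = iid"
    by (simp add: restrict_def)
  show ?thesis
    by (subst indep_vars_iff_distr_eq_PiM) (simp_all add: d distr_iid iid_def[symmetric])
qed

lemma iid_moments:
  "integrable iid (\<lambda>\<omega>. \<omega> m * \<omega> n)" "(\<integral>\<omega>. \<omega> m * \<omega> n \<partial>iid) = (if m = n then 1 else 0)"
proof -
  interpret prob_space iid by (rule prob_iid)
  have 1: "integrable iid (\<lambda>\<omega>. \<omega> k)" "(\<integral>\<omega>. \<omega> k \<partial>iid) = 0" for k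
  proof -
    have "integrable std (\<lambda>x. x)" using integrable_std_normal_distribution_moment[of 1] by simp
    then have "integrable (distr iid borel (\<lambda>\<omega>. \<omega> k)) (\<lambda>x. x)" by (simp only: distr_iid)
    then show "integrable iid (\<lambda>\<omega>. \<omega> k)" by (subst (asm) integrable_distr_eq) auto
    have "(\<integral>x. x \<partial>std) = 0" using integral_std_normal_distribution_moment_odd[of 1] by simp
    then have "(\<integral>x. x \<partial>distr iid borel (\<lambda>\<omega>. \<omega> k)) = 0" by (simp only: distr_iid)
    then show "(\<integral>\<omega>. \<omega> k \<partial>iid) = 0" by (subst (asm) integral_distr) auto
  qed
  have 2: "integrable iid (\<lambda>\<omega>. (\<omega> k)\<^sup>2)" "(\<integral>\<omega>. (\<omega> k)\<^sup>2 \<partial>iid) = 1" for k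
  proof -
    have "integrable std (\<lambda>x. x\<^sup>2)" by (rule integrable_std_normal_distribution_moment)
    then have "integrable (distr iid borel (\<lambda>\<omega>. \<omega> k)) (\<lambda>x. x\<^sup>2)" by (simp only: distr_iid)
    then show "integrable iid (\<lambda>\<omega>. (\<omega> k)\<^sup>2)" by (subst (asm) integrable_distr_eq) auto
    have "(\<integral>x. x\<^sup>2 \<partial>std) = 1" using std_normal_distribution_even_moments(1)[of 1] by simp
    then have "(\<integral>x. x\<^sup>2 \<partial>distr iid borel (\<lambda>\<omega>. \<omega> k)) = 1" by (simp only: distr_iid)
    then show "(\<integral>\<omega>. (\<omega> k)\<^sup>2 \<partial>iid) = 1" by (subst (asm) integral_distr) auto
  qed
  have "integrable iid (\<lambda>\<omega>. \<omega> m * \<omega> n) \<and> (\<integral>\<omega>. \<omega> m * \<omega> n \<partial>iid) = (if m = n then 1 else 0)"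
  proof (cases "m = n")
    case True
    then show ?thesis using 2[of n] by (simp add: power2_eq_square)
  next
    case False
    have "indep_vars (\<lambda>_. borel) (\<lambda>n \<omega>. \<omega> n) {m, n}"
      by (rule indep_vars_subset[OF indep_iid]) simp
    from indep_vars_lebesgue_integral[OF _ this 1(1)] indep_vars_integrable[OF _ this 1(1)]
    show ?thesis using False 1(2) by simp
  qed
  then show "integrable iid (\<lambda>\<omega>. \<omega> m * \<omega> n)" "(\<integral>\<omega>. \<omega> m * \<omega> n \<partial>iid) = (if m = n then 1 else 0)" by auto
qed

lemma iid_sum_norm2:
  fixes v :: "nat \<Rightarrow> 'a::{real_inner, second_countable_topology}"
  assumes "finite I"
  shows "integrable iid (\<lambda>\<omega>. (norm (\<Sum>k\<in>I. \<omega> k *\<^sub>R v k))\<^sup>2)"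
    and "(\<integral>\<omega>. (norm (\<Sum>k\<in>I. \<omega> k *\<^sub>R v k))\<^sup>2 \<partial>iid) = (\<Sum>k\<in>I. (norm (v k))\<^sup>2)"
proof -
  have e: "(norm (\<Sum>k\<in>I. \<omega> k *\<^sub>R v k))\<^sup>2 = (\<Sum>i\<in>I. \<Sum>j\<in>I. (\<omega> i * \<omega> j) * (v i \<bullet> v j))" for \<omega> :: "nat \<Rightarrow> real"
    unfolding power2_norm_eq_inner inner_sum_left inner_sum_right
    by (intro sum.cong refl) (simp add: inner_commute mult_ac)
  show "integrable iid (\<lambda>\<omega>. (norm (\<Sum>k\<in>I. \<omega> k *\<^sub>R v k))\<^sup>2)"
    unfolding e by (intro Bochner_Integration.integrable_sum integrable_mult_left iid_moments)
  have "(\<integral>\<omega>. (norm (\<Sum>k\<in>I. \<omega> k *\<^sub>R v k))\<^sup>2 \<partial>iid) = (\<Sum>i\<in>I. \<Sum>j\<in>I. (\<integral>\<omega>. (\<omega> i * \<omega> j) * (v i \<bullet> v j) \<partial>iid))"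
    unfolding e
    by (subst Bochner_Integration.integral_sum, intro Bochner_Integration.integrable_sum integrable_mult_left iid_moments,
        intro sum.cong refl Bochner_Integration.integral_sum integrable_mult_left iid_moments)
  also have "\<dots> = (\<Sum>i\<in>I. \<Sum>j\<in>I. (if i = j then v i \<bullet> v j else 0))"
    by (intro sum.cong refl) (simp add: iid_moments)
  also have "\<dots> = (\<Sum>k\<in>I. (norm (v k))\<^sup>2)"
    using assms by (simp add: power2_norm_eq_inner)
  finally show "(\<integral>\<omega>. (norm (\<Sum>k\<in>I. \<omega> k *\<^sub>R v k))\<^sup>2 \<partial>iid) = (\<Sum>k\<in>I. (norm (v k))\<^sup>2)" .
qed

text \<open>The pointwise inequality \<open>S \<le> S\<^sup>2 / (2 * c) + c / 2\<close>, integrated,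
  bounds the first moment by the second.\<close>

lemma iid_sum_norm:
  fixes v :: "nat \<Rightarrow> 'a::{real_inner, second_countable_topology}"
  assumes "finite I" and c: "(\<Sum>k\<in>I. (norm (v k))\<^sup>2) \<le> c\<^sup>2" "0 < c"
  shows "(\<integral>\<^sup>+\<omega>. ennreal (norm (\<Sum>k\<in>I. \<omega> k *\<^sub>R v k)) \<partial>iid) \<le> ennreal c"
proof -
  interpret prob_space iid by (rule prob_iid)
  let ?S = "\<lambda>\<omega>. norm (\<Sum>k\<in>I. \<omega> k *\<^sub>R v k)"
  note i2 = iid_sum_norm2[OF assms(1), of v]
  have b: "?S \<omega> \<le> (?S \<omega>)\<^sup>2 / (2 * c) + c / 2" for \<omega>
  proof -
    have "0 \<le> (?S \<omega> - c)\<^sup>2 / (2 * c)" using c by simp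
    also have "\<dots> = (?S \<omega>)\<^sup>2 / (2 * c) + c / 2 - ?S \<omega>" using c by (simp add: power2_eq_square field_simps)
    finally show ?thesis by simp
  qed
  have "(\<integral>\<^sup>+\<omega>. ennreal (?S \<omega>) \<partial>iid) \<le> (\<integral>\<^sup>+\<omega>. ennreal ((?S \<omega>)\<^sup>2 / (2 * c) + c / 2) \<partial>iid)"
    using b by (intro nn_integral_mono ennreal_leI)
  also have "\<dots> = ennreal (\<integral>\<omega>. (?S \<omega>)\<^sup>2 / (2 * c) + c / 2 \<partial>iid)"
    using i2(1) c by (intro nn_integral_eq_integral) auto
  also have "(\<integral>\<omega>. (?S \<omega>)\<^sup>2 / (2 * c) + c / 2 \<partial>iid) = (\<Sum>k\<in>I. (norm (v k))\<^sup>2) / (2 * c) + c / 2"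
    using i2 by (simp add: prob_space)
  also have "ennreal \<dots> \<le> ennreal c"
  proof (rule ennreal_leI)
    have "(\<Sum>k\<in>I. (norm (v k))\<^sup>2) / (2 * c) \<le> c\<^sup>2 / (2 * c)" using c by (intro divide_right_mono) auto
    then show "(\<Sum>k\<in>I. (norm (v k))\<^sup>2) / (2 * c) + c / 2 \<le> c" using c by (simp add: power2_eq_square)
  qed
  finally show ?thesis .
qed

lemma iid_char:
  fixes c :: "nat \<Rightarrow> real"
  assumes "finite I"
  shows "(\<integral>\<omega>. cis (\<Sum>k\<in>I. \<omega> k * c k) \<partial>iid) = complex_of_real (exp (- (\<Sum>k\<in>I. (c k)\<^sup>2) / 2))"
proof -
  interpret prob_space iid by (rule prob_iid)
  have ie: "iexp y = cis y" for y by (simp add: cis_conv_exp)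
  have "indep_vars (\<lambda>_. borel) (\<lambda>n \<omega>. \<omega> n) I" by (rule indep_vars_subset[OF indep_iid]) simp
  then have ind: "indep_vars (\<lambda>_. borel) (\<lambda>n \<omega>. \<omega> n * c n) I"
    by (rule indep_vars_compose2) measurable
  have "(\<integral>\<omega>. cis (\<Sum>k\<in>I. \<omega> k * c k) \<partial>iid) = char (distr iid borel (\<lambda>\<omega>. \<Sum>k\<in>I. \<omega> k * c k)) 1"
    unfolding char_def ie by (subst integral_distr) auto
  also have "\<dots> = (\<Prod>k\<in>I. char (distr iid borel (\<lambda>\<omega>. \<omega> k * c k)) 1)"
    by (rule char_distr_sum[OF ind])
  also have "\<dots> = (\<Prod>k\<in>I. complex_of_real (exp (- ((c k)\<^sup>2) / 2)))"
  proof (intro prod.cong refl)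
    fix k
    have "char (distr iid borel (\<lambda>\<omega>. \<omega> k * c k)) 1 = (\<integral>\<omega>. cis (c k * \<omega> k) \<partial>iid)"
      unfolding char_def ie by (subst integral_distr) (auto simp: mult.commute)
    also have "\<dots> = char (distr iid borel (\<lambda>\<omega>. \<omega> k)) (c k)"
      unfolding char_def ie by (subst integral_distr) auto
    also have "\<dots> = complex_of_real (exp (- ((c k)\<^sup>2) / 2))"
      by (simp add: distr_iid char_std_normal_distribution)
    finally show "char (distr iid borel (\<lambda>\<omega>. \<omega> k * c k)) 1 = complex_of_real (exp (- ((c k)\<^sup>2) / 2))" .
  qed
  also have "\<dots> = complex_of_real (exp (- (\<Sum>k\<in>I. (c k)\<^sup>2) / 2))"
    using assms by (simp add: exp_sum[symmetric] sum_negf sum_divide_distrib[symmetric] flip: of_real_prod)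
  finally show ?thesis .
qed

text \<open>The measure is the law of the random series of the vectors \<open>v k\<close> with
  independent standard normal coefficients. Along a subsequence whose expected increments are at
  most \<open>(1/2) ^ j\<close> the partial sums are almost surely Cauchy, and the characteristic
  functions pass to the limit.\<close>

lemma exists_gaussian_of_sequence:
  fixes v :: "nat \<Rightarrow> 'a::{real_inner, polish_space}"
  assumes sm: "summable (\<lambda>n. (norm (v n))\<^sup>2)" and q: "\<And>h. (\<lambda>n. (h \<bullet> v n)\<^sup>2) sums q h"
  shows "\<exists>\<mu> :: 'a measure. prob_space \<mu> \<and> sets \<mu> = sets borel \<and>
    (\<forall>h. (\<integral>x. cis (h \<bullet> x) \<partial>\<mu>) = complex_of_real (exp (- q h / 2)))"
proof -
  interpret prob_space iid by (rule prob_iid)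
  define S where "S n \<omega> = (\<Sum>k<n. \<omega> k *\<^sub>R v k)" for n and \<omega> :: "nat \<Rightarrow> real"
  have S_m[measurable]: "S n \<in> borel_measurable iid" for n unfolding S_def by measurable
  have "\<exists>n. \<forall>m\<ge>n. (\<Sum>k\<in>{n..<m}. (norm (v k))\<^sup>2) \<le> ((1/2) ^ j)\<^sup>2" for j
  proof -
    have "\<exists>N. \<forall>m\<ge>N. \<forall>n. norm (\<Sum>k\<in>{m..<n}. (norm (v k))\<^sup>2) < ((1/2) ^ j)\<^sup>2"
      using sm[unfolded summable_Cauchy] by (auto dest: spec[of _ "((1/2) ^ j)\<^sup>2"])
    then obtain N where N: "\<And>n. norm (\<Sum>k\<in>{N..<n}. (norm (v k))\<^sup>2) < ((1/2) ^ j)\<^sup>2" by blast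
    have "(\<Sum>k\<in>{N..<m}. (norm (v k))\<^sup>2) \<le> ((1/2) ^ j)\<^sup>2" for m
      using N[of m] abs_ge_self[of "\<Sum>k\<in>{N..<m}. (norm (v k))\<^sup>2"] unfolding real_norm_def by linarith
    then show ?thesis by blast
  qed
  then obtain n0 where n0: "\<And>j m. m \<ge> n0 j \<Longrightarrow> (\<Sum>k\<in>{n0 j..<m}. (norm (v k))\<^sup>2) \<le> ((1/2) ^ j)\<^sup>2" by metis
  \<comment> \<open>The sum dominates \<open>n0 j\<close>, and the added \<open>j\<close> makes the
    sequence strictly increasing.\<close>
  define r where "r j = (\<Sum>i\<le>j. n0 i) + j" for j
  have r_ge: "n0 j \<le> r j" for j
  proof -
    have "n0 j \<le> (\<Sum>i\<le>j. n0 i)" by (rule member_le_sum) auto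
    then show ?thesis by (simp add: r_def)
  qed
  have r_mono: "r j < r (Suc j)" for j by (simp add: r_def)
  then have r_strict: "strict_mono r" by (simp add: strict_mono_Suc_iff)
  define b where "b j \<omega> = norm (S (r (Suc j)) \<omega> - S (r j) \<omega>)" for j \<omega>
  have b_m[measurable]: "b j \<in> borel_measurable iid" for j unfolding b_def by measurable
  have b_int: "(\<integral>\<^sup>+\<omega>. ennreal (b j \<omega>) \<partial>iid) \<le> ennreal ((1/2) ^ j)" for j
  proof -
    have "S (r (Suc j)) \<omega> - S (r j) \<omega> = (\<Sum>k\<in>{r j..<r (Suc j)}. \<omega> k *\<^sub>R v k)" for \<omega>
      using sum_diff_nat_ivl[of 0 "r j" "r (Suc j)" "\<lambda>k. \<omega> k *\<^sub>R v k"] r_mono[of j]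
      by (simp add: S_def atLeast0LessThan)
    moreover have "(\<Sum>k\<in>{r j..<r (Suc j)}. (norm (v k))\<^sup>2) \<le> (\<Sum>k\<in>{n0 j..<r (Suc j)}. (norm (v k))\<^sup>2)"
      using r_ge[of j] by (intro sum_mono2) auto
    ultimately show ?thesis unfolding b_def
      using n0[of j "r (Suc j)"] r_ge[of j] r_mono[of j] by (simp only:) (intro iid_sum_norm, auto)
  qed
  have "(\<integral>\<^sup>+\<omega>. (\<Sum>j. ennreal (b j \<omega>)) \<partial>iid) = (\<Sum>j. \<integral>\<^sup>+\<omega>. ennreal (b j \<omega>) \<partial>iid)"
    by (rule nn_integral_suminf) measurable
  also have "\<dots> \<le> (\<Sum>j. ennreal ((1/2) ^ j))" by (intro suminf_le b_int) auto
  also have "\<dots> = ennreal (\<Sum>j. (1/2) ^ j)" by (rule suminf_ennreal2) auto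
  also have "\<dots> < \<infinity>" by simp
  finally have "AE \<omega> in iid. (\<Sum>j. ennreal (b j \<omega>)) \<noteq> \<infinity>"
    by (intro nn_integral_PInf_AE) (auto simp: less_top)
  then have AE_C: "AE \<omega> in iid. Cauchy (\<lambda>j. S (r j) \<omega>)"
  proof eventually_elim
    case (elim \<omega>)
    have sb: "summable (\<lambda>j. b j \<omega>)"
      using elim by (intro summable_suminf_not_top) (auto simp: b_def)
    have d: "dist (S (r (j + i)) \<omega>) (S (r j) \<omega>) \<le> (\<Sum>k\<in>{j..<j + i}. b k \<omega>)" for i j
    proof (induction i)
      case (Suc i)
      have "dist (S (r (j + Suc i)) \<omega>) (S (r j) \<omega>) \<le> dist (S (r (j + Suc i)) \<omega>) (S (r (j + i)) \<omega>) + dist (S (r (j + i)) \<omega>) (S (r j) \<omega>)"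
        by (rule dist_triangle)
      then show ?case using Suc by (simp add: b_def dist_norm)
    qed simp
    show ?case
    proof (rule metric_CauchyI)
      fix e :: real assume "e > 0"
      then obtain N where N: "\<And>m n. m \<ge> N \<Longrightarrow> norm (\<Sum>k\<in>{m..<n}. b k \<omega>) < e"
        using sb unfolding summable_Cauchy by blast
      have *: "dist (S (r m) \<omega>) (S (r n) \<omega>) < e" if "n \<ge> N" "m \<ge> n" for m n
        using d[of n "m - n"] N[of n m] that by simp
      show "\<exists>M. \<forall>m\<ge>M. \<forall>n\<ge>M. dist (S (r m) \<omega>) (S (r n) \<omega>) < e"
        using * by (metis dist_commute nle_le)
    qed
  qed
  \<comment> \<open>Set to zero off the event of convergence, so that the limit exists at every
    \<open>\<omega>\<close> and is measurable.\<close>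
  define f where "f j \<omega> = (if Cauchy (\<lambda>j. S (r j) \<omega>) then S (r j) \<omega> else 0)" for j \<omega>
  define Y where "Y \<omega> = lim (\<lambda>j. f j \<omega>)" for \<omega>
  have f_m[measurable]: "f j \<in> borel_measurable iid" for j unfolding f_def by measurable
  have fY: "(\<lambda>j. f j \<omega>) \<longlonglongrightarrow> Y \<omega>" for \<omega>
  proof (cases "Cauchy (\<lambda>j. S (r j) \<omega>)")
    case True
    then show ?thesis unfolding Y_def f_def by (simp add: Cauchy_convergent convergent_LIMSEQ_iff[symmetric])
  qed (simp add: Y_def f_def)
  have Y_m[measurable]: "Y \<in> borel_measurable iid"
    by (rule borel_measurable_LIMSEQ_metric[OF f_m fY])
  have ch: "(\<integral>\<omega>. cis (h \<bullet> Y \<omega>) \<partial>iid) = complex_of_real (exp (- q h / 2))" for h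
  proof (rule LIMSEQ_unique)
    show "(\<lambda>j. \<integral>\<omega>. cis (h \<bullet> f j \<omega>) \<partial>iid) \<longlonglongrightarrow> (\<integral>\<omega>. cis (h \<bullet> Y \<omega>) \<partial>iid)"
    proof (rule integral_dominated_convergence[where w = "\<lambda>_. 1"])
      have "continuous_on UNIV cis" by (intro continuous_intros)
      then have "isCont cis y" for y by (simp add: continuous_on_eq_continuous_at)
      then show "AE \<omega> in iid. (\<lambda>j. cis (h \<bullet> f j \<omega>)) \<longlonglongrightarrow> cis (h \<bullet> Y \<omega>)"
        by (intro AE_I2 isCont_tendsto_compose[of _ cis] tendsto_intros fY)
    qed auto
    have "(\<integral>\<omega>. cis (h \<bullet> f j \<omega>) \<partial>iid) = complex_of_real (exp (- (\<Sum>k<r j. (h \<bullet> v k)\<^sup>2) / 2))" for j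
    proof -
      have "(\<integral>\<omega>. cis (h \<bullet> f j \<omega>) \<partial>iid) = (\<integral>\<omega>. cis (\<Sum>k<r j. \<omega> k * (h \<bullet> v k)) \<partial>iid)"
      proof (rule integral_cong_AE)
        show "AE \<omega> in iid. cis (h \<bullet> f j \<omega>) = cis (\<Sum>k<r j. \<omega> k * (h \<bullet> v k))"
          using AE_C by eventually_elim (simp add: f_def S_def inner_sum_right)
      qed measurable
      then show ?thesis by (simp add: iid_char)
    qed
    moreover have "(\<lambda>j. \<Sum>k<r j. (h \<bullet> v k)\<^sup>2) \<longlonglongrightarrow> q h"
      using LIMSEQ_subseq_LIMSEQ[OF q[unfolded sums_def] r_strict] by (simp add: o_def)
    then have "(\<lambda>j. complex_of_real (exp (- (\<Sum>k<r j. (h \<bullet> v k)\<^sup>2) / 2))) \<longlonglongrightarrow> complex_of_real (exp (- q h / 2))"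
      by (intro tendsto_of_real tendsto_exp tendsto_divide tendsto_minus tendsto_const) auto
    ultimately show "(\<lambda>j. \<integral>\<omega>. cis (h \<bullet> f j \<omega>) \<partial>iid) \<longlonglongrightarrow> complex_of_real (exp (- q h / 2))" by simp
  qed
  show ?thesis
  proof (intro exI[of _ "distr iid borel Y"] conjI allI)
    show "prob_space (distr iid borel Y)" by (rule prob_space_distr) measurable
    fix h show "(\<integral>x. cis (h \<bullet> x) \<partial>distr iid borel Y) = complex_of_real (exp (- q h / 2))"
      by (subst integral_distr) (auto simp: ch)
  qed simp
qed

lemma (in cov_op) is_centered_gaussian: "is_centered_gaussian Q (gaussian Q)"
proof -
  obtain v :: "nat \<Rightarrow> 'a" where v: "summable (\<lambda>n. (norm (v n))\<^sup>2)"
    "\<And>h. (\<lambda>n. (h \<bullet> v n)\<^sup>2) sums (blinfun_apply Q h \<bullet> h)"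
    using covariance_sequence by blast
  from exists_gaussian_of_sequence[OF v] obtain \<mu> :: "'a measure" where "is_centered_gaussian Q \<mu>"
    by (auto simp: is_centered_gaussian_def)
  then show ?thesis using gaussian_eqI[of Q \<mu>] by simp
qed

declare iid_component_measurable [measurable del]

section \<open>Differentiation under the integral\<close>

text \<open>The bound on the derivative is uniform in a neighbourhood of \<open>t0\<close>, so by
  the mean value inequality it dominates the difference quotients, and dominated convergence along
  sequences applies.\<close>

lemma has_real_derivative_integral:
  fixes g g' :: "'b \<Rightarrow> real \<Rightarrow> real"
  assumes e: "e > 0"
    and int: "\<And>t. \<bar>t - t0\<bar> < e \<Longrightarrow> integrable M (\<lambda>y. g y t)"
    and deriv: "\<And>y t. \<bar>t - t0\<bar> < e \<Longrightarrow> (g y has_real_derivative g' y t) (at t)"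
    and bound: "\<And>y t. \<bar>t - t0\<bar> < e \<Longrightarrow> \<bar>g' y t\<bar> \<le> w y"
    and w: "integrable M w" and m: "(\<lambda>y. g' y t0) \<in> borel_measurable M"
  shows "((\<lambda>t. \<integral>y. g y t \<partial>M) has_real_derivative (\<integral>y. g' y t0 \<partial>M)) (at t0)"
  unfolding has_field_derivative_iff
proof (subst tendsto_at_iff_sequentially, intro allI impI)
  fix X :: "nat \<Rightarrow> real"
  assume X0: "\<forall>i. X i \<in> UNIV - {t0}" and X: "X \<longlonglongrightarrow> t0"
  have "\<forall>\<^sub>F i in sequentially. dist (X i) t0 < e" using X e by (rule tendstoD)
  then obtain N where N: "\<And>i. i \<ge> N \<Longrightarrow> \<bar>X i - t0\<bar> < e"
    by (auto simp: eventually_sequentially dist_real_def)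
  let ?q = "\<lambda>i y. (g y (X (i + N)) - g y t0) / (X (i + N) - t0)"
  have XN: "\<bar>X (i + N) - t0\<bar> < e" "X (i + N) \<noteq> t0" for i using N[of "i + N"] X0 by auto
  have iq: "integrable M (\<lambda>y. ?q i y)" for i
    using int[OF XN(1)] int[of t0] e by (intro integrable_divide Bochner_Integration.integrable_diff) auto
  have "(\<lambda>i. \<integral>y. ?q i y \<partial>M) \<longlonglongrightarrow> (\<integral>y. g' y t0 \<partial>M)"
  proof (rule integral_dominated_convergence[OF m _ w])
    fix i
    show "(\<lambda>y. ?q i y) \<in> borel_measurable M" using iq by (rule borel_measurable_integrable)
    show "AE y in M. norm (?q i y) \<le> w y"
    proof (intro AE_I2)
      fix y
      have "norm (g y (X (i + N)) - g y t0) \<le> w y * norm (X (i + N) - t0)"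
      proof (rule field_differentiable_bound[of "ball t0 e"])
        fix z assume "z \<in> ball t0 e"
        then have z: "\<bar>z - t0\<bar> < e" by (simp add: dist_real_def abs_minus_commute)
        show "(g y has_real_derivative g' y z) (at z within ball t0 e)"
          using deriv[OF z] by (rule has_field_derivative_at_within)
        show "norm (g' y z) \<le> w y" using bound[OF z] by simp
      qed (use XN e in \<open>auto simp: dist_real_def abs_minus_commute\<close>)
      then show "norm (?q i y) \<le> w y" using XN(2)[of i] by (simp add: divide_le_eq)
    qed
  next
    show "AE y in M. (\<lambda>i. ?q i y) \<longlonglongrightarrow> g' y t0"
    proof (intro AE_I2)
      fix y
      have "((\<lambda>t. (g y t - g y t0) / (t - t0)) \<longlongrightarrow> g' y t0) (at t0)"
        using deriv[of t0 y] e by (simp add: has_field_derivative_iff)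
      then have "((\<lambda>t. (g y t - g y t0) / (t - t0)) \<circ> X) \<longlonglongrightarrow> g' y t0"
        using X0 X by (subst (asm) tendsto_at_iff_sequentially) blast
      from LIMSEQ_ignore_initial_segment[OF this, of N]
      show "(\<lambda>i. ?q i y) \<longlonglongrightarrow> g' y t0" by (simp add: o_def)
    qed
  qed
  moreover have "(\<integral>y. ?q i y \<partial>M) = ((\<lambda>t. ((\<integral>y. g y t \<partial>M) - (\<integral>y. g y t0 \<partial>M)) / (t - t0)) \<circ> X) (i + N)" for i
    using int[OF XN(1)[of i]] int[of t0] e by simp
  ultimately have "(\<lambda>i. ((\<lambda>t. ((\<integral>y. g y t \<partial>M) - (\<integral>y. g y t0 \<partial>M)) / (t - t0)) \<circ> X) (i + N)) \<longlonglongrightarrow> (\<integral>y. g' y t0 \<partial>M)"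
    by (simp only:)
  then show "((\<lambda>t. ((\<integral>y. g y t \<partial>M) - (\<integral>y. g y t0 \<partial>M)) / (t - t0)) \<circ> X) \<longlonglongrightarrow> (\<integral>y. g' y t0 \<partial>M)"
    by (rule LIMSEQ_offset)
qed

section \<open>The one-dimensional heat semigroup\<close>

text \<open>From \<open>b\<^sup>2 / 2 - t\<^sup>2 \<le> (b - t)\<^sup>2\<close> the shifted density
  is dominated, uniformly in \<open>t\<close>, by a multiple of the density with variance
  \<open>2\<close>. The right-hand side is the integrable majorant for differentiating the heat
  kernel in its shift.\<close>

lemma std_density_shift_bound:
  fixes b t :: real
  assumes "\<bar>t\<bar> \<le> 1"
  shows "\<bar>b - t\<bar> * std_normal_density (b - t) \<le> exp 1 * sqrt 2 * (normal_density 0 (sqrt 2) b * \<bar>b\<bar> ^ 1 + normal_density 0 (sqrt 2) b)"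
proof -
  have "b\<^sup>2 / 2 - t\<^sup>2 \<le> (b - t)\<^sup>2"
  proof -
    have "0 \<le> (b / 2 - t)\<^sup>2 * 2" by simp
    also have "\<dots> = (b - t)\<^sup>2 - (b\<^sup>2 / 2 - t\<^sup>2)" by (simp add: power2_eq_square field_simps)
    finally show ?thesis by simp
  qed
  moreover have "t\<^sup>2 \<le> 1" using assms by (simp add: abs_square_le_1)
  ultimately have "- (b - t)\<^sup>2 / 2 \<le> 1 + - b\<^sup>2 / 4" by simp
  then have "exp (- (b - t)\<^sup>2 / 2) \<le> exp (1 + - b\<^sup>2 / 4)" by simp
  then have 1: "exp (- (b - t)\<^sup>2 / 2) \<le> exp 1 * exp (- b\<^sup>2 / 4)" by (simp only: exp_add)
  have "std_normal_density (b - t) \<le> exp 1 * sqrt 2 * normal_density 0 (sqrt 2) b"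
  proof -
    have "std_normal_density (b - t) = (1 / sqrt (2 * pi)) * exp (- (b - t)\<^sup>2 / 2)" by (simp add: std_normal_density_def)
    also have "\<dots> \<le> (1 / sqrt (2 * pi)) * (exp 1 * exp (- b\<^sup>2 / 4))" by (intro mult_left_mono 1) auto
    also have "\<dots> = exp 1 * sqrt 2 * normal_density 0 (sqrt 2) b"
      by (simp add: normal_density_def real_sqrt_mult field_simps)
    finally show ?thesis .
  qed
  moreover have "\<bar>b - t\<bar> \<le> \<bar>b\<bar> + 1" using assms by linarith
  ultimately have "\<bar>b - t\<bar> * std_normal_density (b - t) \<le> (\<bar>b\<bar> + 1) * (exp 1 * sqrt 2 * normal_density 0 (sqrt 2) b)"
    by (intro mult_mono) auto
  then show ?thesis by (simp add: algebra_simps)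
qed

lemma integral_std:
  fixes f :: "real \<Rightarrow> real"
  assumes "f \<in> borel_measurable borel"
  shows "(\<integral>x. f x \<partial>std) = (\<integral>x. std_normal_density x * f x \<partial>lborel)"
  using assms by (subst integral_density) (auto simp: normal_density_nonneg)

lemma std_moments:
  "integrable std (\<lambda>x. x)" "(\<integral>x. x \<partial>std) = 0" "integrable std (\<lambda>x. x\<^sup>2)" "(\<integral>x. x\<^sup>2 \<partial>std) = 1"
  using integrable_std_normal_distribution_moment[of 1] integrable_std_normal_distribution_moment[of 2]
    integral_std_normal_distribution_moment_odd[of 1] std_normal_distribution_even_moments(1)[of 1]
  by simp_all

text \<open>A substitution moves the shift from \<open>G\<close> to the Gaussian density, so bounded
  measurable \<open>G\<close> is enough; the factor \<open>x\<close> is the logarithmic derivative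
  of the shifted density. The derivative at other points follows by translating
  \<open>G\<close>.\<close>

lemma heat_deriv:
  fixes G :: "real \<Rightarrow> real"
  assumes G[measurable]: "G \<in> borel_measurable borel" and B: "\<And>x. \<bar>G x\<bar> \<le> B"
  shows "((\<lambda>c. \<integral>x. G (c + x) \<partial>std) has_real_derivative (\<integral>x. x * G (c + x) \<partial>std)) (at c)"
proof -
  have zero: "((\<lambda>c. \<integral>x. G (c + x) \<partial>std) has_real_derivative (\<integral>x. x * G x \<partial>std)) (at 0)"
    if G[measurable]: "G \<in> borel_measurable borel" and B: "\<And>x. \<bar>G x\<bar> \<le> B" for G :: "real \<Rightarrow> real"
  proof -
    have B0: "B \<ge> 0" using B[of 0] by linarith
    have shift: "(\<integral>x. G (c + x) \<partial>std) = (\<integral>b. std_normal_density (b - c) * G b \<partial>lborel)" for c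
    proof -
      have "(\<integral>x. G (c + x) \<partial>std) = (\<integral>x. std_normal_density x * G (c + x) \<partial>lborel)"
        by (rule integral_std) measurable
      also have "\<dots> = (\<integral>b. std_normal_density (b - c) * G b \<partial>lborel)"
        by (subst lborel_integral_real_affine[of 1 _ "- c"]) auto
      finally show ?thesis .
    qed
    have "((\<lambda>c. \<integral>b. std_normal_density (b - c) * G b \<partial>lborel) has_real_derivative
        (\<integral>b. (b - 0) * std_normal_density (b - 0) * G b \<partial>lborel)) (at 0)"
    proof (rule has_real_derivative_integral[where e = 1 and g' = "\<lambda>b t. (b - t) * std_normal_density (b - t) * G b" and
          w = "\<lambda>b. (exp 1 * sqrt 2 * (normal_density 0 (sqrt 2) b * \<bar>b\<bar> ^ 1 + normal_density 0 (sqrt 2) b)) * B"])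
      fix t :: real
      have "integrable lborel (\<lambda>b. std_normal_density (b - t))"
        using lborel_integrable_real_affine[OF integrable_normal_density[of 1 0], of 1 "- t"] by simp
      then show "integrable lborel (\<lambda>b. std_normal_density (b - t) * G b)"
      proof (rule Bochner_Integration.integrable_bound[OF integrable_mult_left[of B]])
        show "AE b in lborel. norm (std_normal_density (b - t) * G b) \<le> norm (std_normal_density (b - t) * B)"
          using B B0 by (intro AE_I2) (auto simp: abs_mult intro!: mult_left_mono)
      qed measurable
    next
      fix y t :: real assume t: "\<bar>t - 0\<bar> < 1"
      show "((\<lambda>t. std_normal_density (y - t) * G y) has_real_derivative (y - t) * std_normal_density (y - t) * G y) (at t)"
      proof -
        define C where "C = 1 / sqrt (2 * pi)"
        have sd: "std_normal_density z = C * exp (- (z\<^sup>2 / 2))" for z by (simp add: std_normal_density_def C_def)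
        show ?thesis unfolding sd by (auto intro!: derivative_eq_intros simp: field_simps)
      qed
      have "\<bar>(y - t) * std_normal_density (y - t) * G y\<bar> = (\<bar>y - t\<bar> * std_normal_density (y - t)) * \<bar>G y\<bar>"
        by (simp add: abs_mult)
      also have "\<dots> \<le> (exp 1 * sqrt 2 * (normal_density 0 (sqrt 2) y * \<bar>y\<bar> ^ 1 + normal_density 0 (sqrt 2) y)) * B"
        by (rule mult_mono) (use t B B0 std_density_shift_bound[of t y] in \<open>auto intro!: mult_nonneg_nonneg add_nonneg_nonneg\<close>)
      finally show "\<bar>(y - t) * std_normal_density (y - t) * G y\<bar> \<le> \<dots>" .
    next
      show "integrable lborel (\<lambda>b. (exp 1 * sqrt 2 * (normal_density 0 (sqrt 2) b * \<bar>b\<bar> ^ 1 + normal_density 0 (sqrt 2) b)) * B)"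
        using integrable_normal_moment_abs[of "sqrt 2" 0 1] integrable_normal_density[of "sqrt 2" 0]
        by (intro integrable_mult_left integrable_mult_right Bochner_Integration.integrable_add) auto
    qed (simp, measurable)
    moreover have "(\<integral>b. (b - 0) * std_normal_density (b - 0) * G b \<partial>lborel) = (\<integral>x. x * G x \<partial>std)"
      by (subst integral_std) (auto simp: mult_ac)
    ultimately show ?thesis unfolding shift by simp
  qed
  have "((\<lambda>t. \<integral>x. G (c + (t + x)) \<partial>std) has_real_derivative (\<integral>x. x * G (c + x) \<partial>std)) (at 0)"
    by (rule zero[of "\<lambda>x. G (c + x)"]) (use B in auto)
  then have "((\<lambda>t. (\<lambda>c. \<integral>x. G (c + x) \<partial>std) (t + c)) has_real_derivative (\<integral>x. x * G (c + x) \<partial>std)) (at 0)"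
    by (simp add: add_ac)
  then show ?thesis using DERIV_shift[of "\<lambda>c. \<integral>x. G (c + x) \<partial>std" "\<integral>x. x * G (c + x) \<partial>std" 0 c] by simp
qed

section \<open>The heat semigroup of a Gaussian measure\<close>

text \<open>Characteristic functions of independent summands multiply, independence being encoded by
  the product measure. The semigroup law and the splitting of a direction are both
  instances.\<close>

lemma law_sum:
  fixes X :: "'b \<Rightarrow> 'a::{real_inner, second_countable_topology}" and f :: "'a \<Rightarrow> real"
  assumes P: "prob_space M" "prob_space N" "prob_space L"
    and X[measurable]: "X \<in> borel_measurable M" and Y[measurable]: "Y \<in> borel_measurable N"
    and Z[measurable]: "Z \<in> borel_measurable L"
    and ch: "\<And>h. (\<integral>m. cis (h \<bullet> X m) \<partial>M) * (\<integral>n. cis (h \<bullet> Y n) \<partial>N) = (\<integral>z. cis (h \<bullet> Z z) \<partial>L)"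
    and f[measurable]: "f \<in> borel_measurable borel" and B: "\<And>x. \<bar>f x\<bar> \<le> B"
  shows "(\<integral>m. (\<integral>n. f (X m + Y n) \<partial>N) \<partial>M) = (\<integral>z. f (Z z) \<partial>L)"
proof -
  interpret M: prob_space M by (rule P)
  interpret N: prob_space N by (rule P)
  interpret L: prob_space L by (rule P)
  interpret pair_prob_space M N ..
  have "distr (M \<Otimes>\<^sub>M N) borel (\<lambda>(m, n). X m + Y n) = distr L borel Z"
  proof (rule measure_eqI_char)
    fix h
    have i: "integrable (M \<Otimes>\<^sub>M N) (\<lambda>(m, n). cis (h \<bullet> X m) * cis (h \<bullet> Y n))"
      by (rule P.integrable_const_bound[of _ 1]) (auto simp: norm_mult)
    have "(\<integral>x. cis (h \<bullet> x) \<partial>distr (M \<Otimes>\<^sub>M N) borel (\<lambda>(m, n). X m + Y n)) = (\<integral>p. (\<lambda>(m, n). cis (h \<bullet> X m) * cis (h \<bullet> Y n)) p \<partial>(M \<Otimes>\<^sub>M N))"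
      by (subst integral_distr) (auto simp: case_prod_beta inner_add_right cis_mult intro!: Bochner_Integration.integral_cong)
    also have "\<dots> = (\<integral>m. (\<integral>n. cis (h \<bullet> X m) * cis (h \<bullet> Y n) \<partial>N) \<partial>M)"
      using integral_fst[OF i] by simp
    also have "\<dots> = (\<integral>m. cis (h \<bullet> X m) \<partial>M) * (\<integral>n. cis (h \<bullet> Y n) \<partial>N)" by simp
    also have "\<dots> = (\<integral>x. cis (h \<bullet> x) \<partial>distr L borel Z)"
      unfolding ch by (subst integral_distr) auto
    finally show "(\<integral>x. cis (h \<bullet> x) \<partial>distr (M \<Otimes>\<^sub>M N) borel (\<lambda>(m, n). X m + Y n)) = (\<integral>x. cis (h \<bullet> x) \<partial>distr L borel Z)" .
  qed (auto intro!: P.prob_space_distr L.prob_space_distr)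
  then have e: "(\<integral>x. f x \<partial>distr (M \<Otimes>\<^sub>M N) borel (\<lambda>(m, n). X m + Y n)) = (\<integral>z. f (Z z) \<partial>L)"
    by (simp add: integral_distr)
  have i: "integrable (M \<Otimes>\<^sub>M N) (\<lambda>(m, n). f (X m + Y n))"
    by (rule P.integrable_const_bound[of _ B]) (use B in auto)
  have "(\<integral>x. f x \<partial>distr (M \<Otimes>\<^sub>M N) borel (\<lambda>(m, n). X m + Y n)) = (\<integral>p. (\<lambda>(m, n). f (X m + Y n)) p \<partial>(M \<Otimes>\<^sub>M N))"
    by (subst integral_distr) (auto simp: case_prod_unfold)
  also have "\<dots> = (\<integral>m. (\<integral>n. f (X m + Y n) \<partial>N) \<partial>M)" using integral_fst[OF i] by simp
  finally show ?thesis using e by simp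
qed

section \<open>Stability properties of bounded continuous functions\<close>

lemma bcontfun_measurable:
  fixes f :: "'a::topological_space \<Rightarrow> real"
  shows "f \<in> bcontfun \<Longrightarrow> f \<in> borel_measurable borel"
  by (intro borel_measurable_continuous_onI) (simp add: bcontfun_def)

lemma bcontfun_bound:
  fixes f :: "'a::topological_space \<Rightarrow> real"
  assumes "f \<in> bcontfun"
  obtains B where "\<And>x. \<bar>f x\<bar> \<le> B" "B \<ge> 0"
proof -
  obtain B where "\<forall>x. \<bar>f x\<bar> \<le> B" using assms by (auto simp: bcontfun_def bounded_iff)
  moreover from this have "B \<ge> 0" using abs_ge_zero order_trans by blast
  ultimately show thesis using that by blast
qed

lemma bcontfunI':
  fixes f :: "'a::topological_space \<Rightarrow> real"
  assumes "continuous_on UNIV f" "\<And>x. \<bar>f x\<bar> \<le> B"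
  shows "f \<in> bcontfun"
  using assms by (auto simp: bcontfun_def bounded_iff)

lemma bcontfun_lincomb:
  fixes f g :: "'a::topological_space \<Rightarrow> real"
  assumes "f \<in> bcontfun" "g \<in> bcontfun"
  shows "(\<lambda>x. a * f x + g x) \<in> bcontfun"
proof -
  obtain A B where "\<And>x. \<bar>f x\<bar> \<le> A" "\<And>x. \<bar>g x\<bar> \<le> B" using bcontfun_bound assms by metis
  then have "\<bar>a * f x + g x\<bar> \<le> \<bar>a\<bar> * A + B" for x
    by (intro order_trans[OF abs_triangle_ineq] add_mono) (simp_all add: abs_mult mult_left_mono)
  then show ?thesis using assms by (intro bcontfunI' continuous_intros) (auto simp: bcontfun_def)
qed

lemma bcontfun_shift:
  fixes f :: "'a::real_normed_vector \<Rightarrow> real"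
  assumes "f \<in> bcontfun"
  shows "(\<lambda>x. f (x + z)) \<in> bcontfun"
proof -
  obtain B where "\<And>x. \<bar>f x\<bar> \<le> B" using bcontfun_bound assms by metis
  moreover have "continuous_on UNIV (\<lambda>x. f (x + z))"
    by (rule continuous_on_compose2[of UNIV f]) (use assms in \<open>auto simp: bcontfun_def intro!: continuous_intros\<close>)
  ultimately show ?thesis by (intro bcontfunI')
qed

lemma bcontfun_square:
  fixes f :: "'a::topological_space \<Rightarrow> real"
  assumes "f \<in> bcontfun"
  shows "(\<lambda>x. (f x)\<^sup>2) \<in> bcontfun"
proof -
  obtain B where "\<And>x. \<bar>f x\<bar> \<le> B" using bcontfun_bound assms by metis
  then have "\<bar>(f x)\<^sup>2\<bar> \<le> B\<^sup>2" for x by (metis abs_ge_zero abs_power2 power2_abs power_mono)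
  then show ?thesis using assms by (intro bcontfunI' continuous_intros) (auto simp: bcontfun_def)
qed

lemma bcontfun_tendsto:
  fixes f :: "'a::metric_space \<Rightarrow> real"
  assumes "f \<in> bcontfun" "X \<longlonglongrightarrow> x"
  shows "(\<lambda>n. f (X n)) \<longlonglongrightarrow> f x"
  using assms by (intro isCont_tendsto_compose[of x f]) (auto simp: bcontfun_def continuous_on_eq_continuous_at)

context cov_op
begin

abbreviation \<gamma> :: "'a measure" where "\<gamma> \<equiv> gaussian Q"

lemma prob_\<gamma>: "prob_space \<gamma>" and sets_\<gamma> [simp, measurable_cong]: "sets \<gamma> = sets borel"
  and char_\<gamma>: "(\<integral>x. cis (h \<bullet> x) \<partial>\<gamma>) = complex_of_real (exp (- (blinfun_apply Q h \<bullet> h) / 2))"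
  using is_centered_gaussian by (auto simp: is_centered_gaussian_def)

lemma char_\<gamma>_scale:
  "(\<integral>x. cis (h \<bullet> (c *\<^sub>R x)) \<partial>\<gamma>) = complex_of_real (exp (- (c\<^sup>2 * (blinfun_apply Q h \<bullet> h)) / 2))"
  using char_\<gamma>[of "c *\<^sub>R h"] by (simp add: blinfun.bilinear_simps power2_eq_square mult_ac)

text \<open>Scaling the variable instead of the covariance keeps one measure for all times. Joint
  continuity in \<open>t\<close> and \<open>x\<close> is then dominated convergence, and time
  \<open>0\<close> gives \<open>f\<close> itself.\<close>

definition P :: "real \<Rightarrow> ('a \<Rightarrow> real) \<Rightarrow> 'a \<Rightarrow> real" where
  "P t f x = (\<integral>y. f (x + sqrt t *\<^sub>R y) \<partial>\<gamma>)"

lemma P_sg_eq: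
  assumes t: "0 < t" and f: "f \<in> bcontfun"
  shows "P_sg Q t f x = P t f x"
proof -
  interpret prob_space \<gamma> by (rule prob_\<gamma>)
  have [measurable]: "f \<in> borel_measurable borel" by (rule bcontfun_measurable[OF f])
  have "is_centered_gaussian (t *\<^sub>R Q) (distr \<gamma> borel (\<lambda>y. sqrt t *\<^sub>R y))"
    unfolding is_centered_gaussian_def
  proof (intro conjI allI)
    show "prob_space (distr \<gamma> borel (\<lambda>y. sqrt t *\<^sub>R y))" by (rule prob_space_distr) measurable
    fix h
    show "(\<integral>x. cis (h \<bullet> x) \<partial>distr \<gamma> borel (\<lambda>y. sqrt t *\<^sub>R y)) = complex_of_real (exp (- (blinfun_apply (t *\<^sub>R Q) h \<bullet> h) / 2))"
      using t by (subst integral_distr) (auto simp only: char_\<gamma>_scale, auto simp: blinfun.bilinear_simps)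
  qed simp
  from gaussian_eqI[OF this] show ?thesis
    unfolding P_sg_def P_def by (simp add: integral_distr)
qed

lemma P_integrable:
  fixes f :: "'a \<Rightarrow> real"
  assumes f: "f \<in> bcontfun"
  shows "integrable \<gamma> (\<lambda>y. f (x + c *\<^sub>R y))"
proof -
  interpret prob_space \<gamma> by (rule prob_\<gamma>)
  have [measurable]: "f \<in> borel_measurable borel" by (rule bcontfun_measurable[OF f])
  obtain B where "\<And>x. \<bar>f x\<bar> \<le> B" using bcontfun_bound[OF f] by metis
  then show ?thesis by (intro integrable_const_bound[of _ B]) auto
qed

lemma P_mono:
  assumes "f \<in> bcontfun" "g \<in> bcontfun" "\<And>x. f x \<le> g x"
  shows "P t f x \<le> P t g x"
  unfolding P_def by (intro integral_mono P_integrable assms)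

lemma P_nonneg: "(\<And>x. 0 \<le> f x) \<Longrightarrow> 0 \<le> P t f x"
  unfolding P_def by (simp add: integral_nonneg_AE)

lemma P_const: "P t (\<lambda>_. c) x = c"
proof -
  interpret prob_space \<gamma> by (rule prob_\<gamma>)
  show ?thesis by (simp add: P_def prob_space)
qed

lemma P_lincomb:
  assumes "f \<in> bcontfun" "g \<in> bcontfun"
  shows "P t (\<lambda>x. a * f x + g x) x = a * P t f x + P t g x"
  unfolding P_def using P_integrable[OF assms(1)] P_integrable[OF assms(2)] by simp

lemma P_shift: "P t (\<lambda>x. f (x + z)) x = P t f (x + z)"
  by (simp add: P_def add_ac)

lemma P_abs_le:
  assumes "f \<in> bcontfun" "\<And>x. \<bar>f x\<bar> \<le> B"
  shows "\<bar>P t f x\<bar> \<le> B"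
proof -
  have c: "(\<lambda>_. c) \<in> bcontfun" for c :: real by (intro bcontfunI'[of _ "\<bar>c\<bar>"]) auto
  have "P t f x \<le> P t (\<lambda>_. B) x" "P t (\<lambda>_. - B) x \<le> P t f x"
    by (intro P_mono assms c; use assms(2) in \<open>auto simp: abs_le_iff minus_le_iff\<close>)+
  then show ?thesis by (simp add: P_const abs_le_iff)
qed

lemma P_tendsto:
  assumes f: "f \<in> bcontfun" and T: "T \<longlonglongrightarrow> t" and X: "X \<longlonglongrightarrow> x"
  shows "(\<lambda>n. P (T n) f (X n)) \<longlonglongrightarrow> P t f x"
proof -
  interpret prob_space \<gamma> by (rule prob_\<gamma>)
  have [measurable]: "f \<in> borel_measurable borel" by (rule bcontfun_measurable[OF f])
  obtain B where B: "\<And>x. \<bar>f x\<bar> \<le> B" using bcontfun_bound[OF f] by metis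
  show ?thesis unfolding P_def
    by (rule integral_dominated_convergence[where w = "\<lambda>_. B"])
      (use B in \<open>auto intro!: AE_I2 bcontfun_tendsto[OF f] tendsto_intros T X\<close>)
qed

lemma P_bcontfun:
  assumes f: "f \<in> bcontfun"
  shows "P t f \<in> bcontfun"
proof -
  obtain B where B: "\<And>x. \<bar>f x\<bar> \<le> B" using bcontfun_bound[OF f] by metis
  have "continuous_on UNIV (P t f)"
    by (auto simp: continuous_on_sequentially o_def intro!: P_tendsto f)
  then show ?thesis using P_abs_le[OF f B] by (rule bcontfunI')
qed

lemma P_continuous_time:
  assumes f: "f \<in> bcontfun"
  shows "continuous_on UNIV (\<lambda>t. P t f x)"
  by (auto simp: continuous_on_sequentially o_def intro!: P_tendsto f)

lemma P_add:
  assumes f: "f \<in> bcontfun" and st: "0 \<le> s" "0 \<le> t"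
  shows "P s (P t f) x = P (s + t) f x"
proof -
  have m[measurable]: "f \<in> borel_measurable borel" by (rule bcontfun_measurable[OF f])
  obtain B where B: "\<And>x. \<bar>f x\<bar> \<le> B" using bcontfun_bound[OF f] by metis
  have "(\<integral>y. (\<integral>z. (\<lambda>w. f (x + w)) (sqrt s *\<^sub>R y + sqrt t *\<^sub>R z) \<partial>\<gamma>) \<partial>\<gamma>) = (\<integral>y. (\<lambda>w. f (x + w)) (sqrt (s + t) *\<^sub>R y) \<partial>\<gamma>)"
  proof (rule law_sum[where B = B])
    fix h
    show "(\<integral>y. cis (h \<bullet> (sqrt s *\<^sub>R y)) \<partial>\<gamma>) * (\<integral>z. cis (h \<bullet> (sqrt t *\<^sub>R z)) \<partial>\<gamma>) = (\<integral>y. cis (h \<bullet> (sqrt (s + t) *\<^sub>R y)) \<partial>\<gamma>)"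
      unfolding char_\<gamma>_scale using st
      by (simp add: exp_add[symmetric] add_divide_distrib[symmetric] distrib_right flip: of_real_mult)
  qed (use prob_\<gamma> B in auto)
  then show ?thesis by (simp add: P_def add_ac)
qed

text \<open>The second factor is the Gaussian measure with the direction \<open>h\<close> removed
  from the covariance; the two quadratic forms in the exponents add up to that of
  \<open>Q\<close>.\<close>

lemma direction_decomposition:
  assumes h: "h \<in> CM_space Q" "CM_norm Q h \<le> 1"
  obtains \<gamma>' :: "'a measure" where "prob_space \<gamma>'" "sets \<gamma>' = sets borel"
    "\<And>f B. f \<in> borel_measurable borel \<Longrightarrow> (\<And>x. \<bar>f x\<bar> \<le> B) \<Longrightarrow>
      (\<integral>\<xi>. (\<integral>y. f (\<xi> *\<^sub>R h + y) \<partial>\<gamma>') \<partial>std) = (\<integral>y. f y \<partial>\<gamma> :: real)"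
proof -
  obtain Q' where Q': "cov_op Q'" "\<And>k. blinfun_apply Q' k \<bullet> k = blinfun_apply Q k \<bullet> k - (h \<bullet> k)\<^sup>2"
    using cov_op_minus_direction[OF h] by blast
  interpret Q': cov_op Q' by (rule Q'(1))
  show thesis
  proof (rule that[OF Q'.prob_\<gamma> Q'.sets_\<gamma>])
    fix f :: "'a \<Rightarrow> real" and B assume f: "f \<in> borel_measurable borel" "\<And>x. \<bar>f x\<bar> \<le> B"
    show "(\<integral>\<xi>. (\<integral>y. f (\<xi> *\<^sub>R h + y) \<partial>gaussian Q') \<partial>std) = (\<integral>y. f y \<partial>\<gamma>)"
    proof (rule law_sum[OF prob_std Q'.prob_\<gamma> prob_\<gamma> _ _ _ _ f])
      fix k
      have "(\<integral>\<xi>. cis (k \<bullet> (\<xi> *\<^sub>R h)) \<partial>std) = char std (h \<bullet> k)"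
        unfolding char_def by (simp add: cis_conv_exp inner_commute mult_ac)
      also have "\<dots> = complex_of_real (exp (- ((h \<bullet> k)\<^sup>2) / 2))" by (simp add: char_std_normal_distribution)
      finally show "(\<integral>\<xi>. cis (k \<bullet> (\<xi> *\<^sub>R h)) \<partial>std) * (\<integral>y. cis (k \<bullet> y) \<partial>gaussian Q') = (\<integral>y. cis (k \<bullet> y) \<partial>\<gamma>)"
        unfolding char_\<gamma> Q'.char_\<gamma> Q'(2)
        by (simp add: exp_add[symmetric] diff_divide_distrib flip: of_real_mult)
    qed measurable
  qed
qed

subsection \<open>Derivatives along the Cameron-Martin space\<close>

text \<open>Defined as a derivative because the Gaussian formula for it involves a measure that
  depends on \<open>h\<close>. Additivity in \<open>h\<close> is therefore proved
  separately.\<close>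

definition dP :: "real \<Rightarrow> 'a \<Rightarrow> ('a \<Rightarrow> real) \<Rightarrow> 'a \<Rightarrow> real" where
  "dP t h f x = deriv (\<lambda>a. P t f (x + a *\<^sub>R h)) 0"

text \<open>In the direction of \<open>h\<close> the heat semigroup acts as a one-dimensional heat semigroup on
  the average of \<open>f\<close> over the remaining directions.\<close>

lemma dP_formula:
  assumes h: "h \<in> CM_space Q" "CM_norm Q h \<le> 1" and t: "0 < t"
  obtains \<gamma>' :: "'a measure" where "prob_space \<gamma>'" "sets \<gamma>' = sets borel"
    "\<And>f x. f \<in> bcontfun \<Longrightarrow> P t f x = (\<integral>\<xi>. (\<integral>y. f (x + sqrt t *\<^sub>R (\<xi> *\<^sub>R h + y)) \<partial>\<gamma>') \<partial>std)"
    "\<And>f x. f \<in> bcontfun \<Longrightarrow> ((\<lambda>a. P t f (x + a *\<^sub>R h)) has_real_derivative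
      (1 / sqrt t) * (\<integral>\<xi>. \<xi> * (\<integral>y. f (x + sqrt t *\<^sub>R (\<xi> *\<^sub>R h + y)) \<partial>\<gamma>') \<partial>std)) (at 0)"
proof -
  obtain \<gamma>' :: "'a measure" where g: "prob_space \<gamma>'" "sets \<gamma>' = sets borel"
    "\<And>f B. f \<in> borel_measurable borel \<Longrightarrow> (\<And>x. \<bar>f x\<bar> \<le> B) \<Longrightarrow>
      (\<integral>\<xi>. (\<integral>y. f (\<xi> *\<^sub>R h + y) \<partial>\<gamma>') \<partial>std) = (\<integral>y. f y \<partial>\<gamma> :: real)"
    using direction_decomposition[OF h] by metis
  note [measurable_cong] = g(2)
  interpret g: prob_space \<gamma>' by (rule g(1))
  have rep: "P t f x = (\<integral>\<xi>. (\<integral>y. f (x + sqrt t *\<^sub>R (\<xi> *\<^sub>R h + y)) \<partial>\<gamma>') \<partial>std)" if f: "f \<in> bcontfun" for f x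
  proof -
    have [measurable]: "f \<in> borel_measurable borel" by (rule bcontfun_measurable[OF f])
    obtain B where B: "\<And>x. \<bar>f x\<bar> \<le> B" using bcontfun_bound[OF f] by metis
    show ?thesis unfolding P_def by (rule g(3)[symmetric, where B = B]) (use B in auto)
  qed
  show thesis
  proof (rule that[OF g(1,2) rep])
    fix f :: "'a \<Rightarrow> real" and x assume f: "f \<in> bcontfun"
    have [measurable]: "f \<in> borel_measurable borel" by (rule bcontfun_measurable[OF f])
    obtain B where B: "\<And>x. \<bar>f x\<bar> \<le> B" using bcontfun_bound[OF f] by metis
    define G where "G c = (\<integral>y. f (x + sqrt t *\<^sub>R (c *\<^sub>R h + y)) \<partial>\<gamma>')" for c
    have Gm: "G \<in> borel_measurable borel" unfolding G_def by measurable
    have GB: "\<bar>G c\<bar> \<le> B" for c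
    proof -
      have "\<bar>G c\<bar> \<le> (\<integral>y. \<bar>f (x + sqrt t *\<^sub>R (c *\<^sub>R h + y))\<bar> \<partial>\<gamma>')" unfolding G_def by (rule integral_abs_bound)
      also have "\<dots> \<le> (\<integral>y. B \<partial>\<gamma>')"
        by (intro integral_mono g.integrable_const_bound[of _ B]) (use B order_trans[OF abs_ge_zero B[of 0]] in auto)
      finally show ?thesis by (simp add: g.prob_space)
    qed
    have r: "sqrt t > 0" using t by simp
    have Peq: "P t f (x + a *\<^sub>R h) = (\<integral>\<xi>. G (a / sqrt t + \<xi>) \<partial>std)" for a
    proof -
      have e: "(x + a *\<^sub>R h) + sqrt t *\<^sub>R (\<xi> *\<^sub>R h + y) = x + sqrt t *\<^sub>R ((a / sqrt t + \<xi>) *\<^sub>R h + y)" for \<xi> y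
        using r by (simp add: algebra_simps)
      show ?thesis unfolding rep[OF f] G_def by (simp only: e)
    qed
    have "((\<lambda>a. \<integral>\<xi>. G (a / sqrt t + \<xi>) \<partial>std) has_real_derivative (\<integral>\<xi>. \<xi> * G (0 + \<xi>) \<partial>std) * (1 / sqrt t)) (at 0)"
    proof (rule DERIV_chain2[of "\<lambda>c. \<integral>\<xi>. G (c + \<xi>) \<partial>std"])
      show "((\<lambda>c. \<integral>\<xi>. G (c + \<xi>) \<partial>std) has_real_derivative (\<integral>\<xi>. \<xi> * G (0 + \<xi>) \<partial>std)) (at (0 / sqrt t))"
        using heat_deriv[OF Gm GB, of 0] by simp
      show "((\<lambda>a. a / sqrt t) has_real_derivative 1 / sqrt t) (at 0)"
        by (rule DERIV_cdivide[OF DERIV_ident])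
    qed
    then show "((\<lambda>a. P t f (x + a *\<^sub>R h)) has_real_derivative
      (1 / sqrt t) * (\<integral>\<xi>. \<xi> * (\<integral>y. f (x + sqrt t *\<^sub>R (\<xi> *\<^sub>R h + y)) \<partial>\<gamma>') \<partial>std)) (at 0)"
      unfolding Peq G_def by (simp add: mult.commute)
  qed
qed

lemma P_has_derivative:
  assumes h: "h \<in> CM_space Q" and t: "0 < t" and f: "f \<in> bcontfun"
  shows "((\<lambda>a. P t f (x + a *\<^sub>R h)) has_real_derivative dP t h f (x + b *\<^sub>R h)) (at b)"
proof -
  \<comment> \<open>The added \<open>1\<close> avoids division by zero at \<open>h = 0\<close>, and
    \<open>k\<close> still lies in the unit ball.\<close>
  define r where "r = CM_norm Q h + 1"
  have r: "r > 0" using CM_norm_nonneg[of h] by (simp add: r_def)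
  define k where "k = (1 / r) *\<^sub>R h"
  have k: "k \<in> CM_space Q" "CM_norm Q k \<le> 1"
  proof -
    show "k \<in> CM_space Q" unfolding k_def by (rule CM_scale[OF h])
    have "CM_norm Q k = CM_norm Q h / r" using r by (simp add: k_def CM_norm_scale[OF h])
    also have "\<dots> \<le> 1" using r by (simp add: r_def)
    finally show "CM_norm Q k \<le> 1" .
  qed
  obtain D where D: "((\<lambda>a. P t f ((x + b *\<^sub>R h) + a *\<^sub>R k)) has_real_derivative D) (at 0)"
  proof (rule dP_formula[OF k t])
    fix \<gamma>' :: "'a measure"
    assume "\<And>f x. f \<in> bcontfun \<Longrightarrow> ((\<lambda>a. P t f (x + a *\<^sub>R k)) has_real_derivative
      (1 / sqrt t) * (\<integral>\<xi>. \<xi> * (\<integral>y. f (x + sqrt t *\<^sub>R (\<xi> *\<^sub>R k + y)) \<partial>\<gamma>') \<partial>std)) (at 0)"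
    from that[OF this[OF f]] show ?thesis .
  qed
  have "((\<lambda>a. P t f ((x + b *\<^sub>R h) + (r * a) *\<^sub>R k)) has_real_derivative D * r) (at 0)"
    by (rule DERIV_chain2[of "\<lambda>a. P t f ((x + b *\<^sub>R h) + a *\<^sub>R k)"]) (use D in \<open>auto intro!: derivative_eq_intros\<close>)
  then have 0: "((\<lambda>a. P t f ((x + b *\<^sub>R h) + a *\<^sub>R h)) has_real_derivative D * r) (at 0)"
    using r by (simp add: k_def)
  then have "dP t h f (x + b *\<^sub>R h) = D * r" unfolding dP_def by (rule DERIV_imp_deriv)
  moreover have "((\<lambda>a. (\<lambda>a. P t f (x + a *\<^sub>R h)) (a + b)) has_real_derivative D * r) (at 0)"
    using 0 by (simp add: algebra_simps)
  ultimately show ?thesis using DERIV_shift[of "\<lambda>a. P t f (x + a *\<^sub>R h)" "D * r" 0 b] by simp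
qed

lemma dP_scale:
  assumes h: "h \<in> CM_space Q" and t: "0 < t" and f: "f \<in> bcontfun"
  shows "dP t (c *\<^sub>R h) f x = c * dP t h f x"
proof -
  have "((\<lambda>a. P t f (x + (c * a) *\<^sub>R h)) has_real_derivative dP t h f x * c) (at 0)"
    by (rule DERIV_chain2[of "\<lambda>a. P t f (x + a *\<^sub>R h)"])
      (use P_has_derivative[OF h t f, of x 0] in \<open>auto intro!: derivative_eq_intros\<close>)
  then show ?thesis unfolding dP_def[of t "c *\<^sub>R h"]
    by (intro DERIV_imp_deriv) (simp add: mult_ac)
qed

lemma dP_lincomb:
  assumes h: "h \<in> CM_space Q" and t: "0 < t" and f: "f \<in> bcontfun" "g \<in> bcontfun"
  shows "dP t h (\<lambda>x. c * f x + g x) x = c * dP t h f x + dP t h g x"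
proof -
  have "((\<lambda>a. P t (\<lambda>x. c * f x + g x) (x + a *\<^sub>R h)) has_real_derivative c * dP t h f x + dP t h g x) (at 0)"
    unfolding P_lincomb[OF f]
    using P_has_derivative[OF h t f(1), of x 0] P_has_derivative[OF h t f(2), of x 0]
    by (auto intro!: derivative_eq_intros)
  then show ?thesis unfolding dP_def[of t h "\<lambda>x. c * f x + g x"] by (rule DERIV_imp_deriv)
qed

lemma dP_shift: "dP t h (\<lambda>x. f (x + z)) x = dP t h f (x + z)"
  unfolding dP_def P_shift by (simp add: add_ac)

text \<open>Cauchy-Schwarz bounds are obtained by integrating a pointwise inequality with a free
  parameter; the optimal \<open>c\<close> is \<open>sqrt A\<close>, and for \<open>A = 0\<close> the
  parameter tends to zero.\<close>

lemma abs_le_sqrt_if_AMGM: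
  fixes X A :: real
  assumes "\<And>c. c > 0 \<Longrightarrow> \<bar>X\<bar> \<le> A / (2 * c) + c / 2" "0 \<le> A"
  shows "\<bar>X\<bar> \<le> sqrt A"
proof (cases "A = 0")
  case True
  have "\<bar>X\<bar> \<le> 0"
  proof (rule field_le_epsilon)
    fix e :: real assume "e > 0"
    then show "\<bar>X\<bar> \<le> 0 + e" using assms(1)[of "2 * e"] True by simp
  qed
  then show ?thesis using True by simp
next
  case False
  then have s: "sqrt A > 0" using assms(2) by simp
  have "A / (2 * sqrt A) = sqrt A / 2" using assms(2) s by (simp add: field_simps)
  then show ?thesis using assms(1)[OF s] by simp
qed

text \<open>The derivative is \<open>1 / sqrt t\<close> times the mean of
  \<open>\<xi> * G \<xi>\<close>. Cauchy-Schwarz and the unit variance of \<open>\<xi>\<close> give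
  the first bound. For the second, \<open>\<xi>\<close> has mean zero, so \<open>G 0\<close> can be
  subtracted; the Hoelder bound on \<open>G \<xi> - G 0\<close> then leaves a moment of order
  \<open>1 + \<theta>\<close>, which is at most \<open>2\<close>.\<close>

lemma dP_bounds_unit:
  assumes h: "h \<in> CM_space Q" "CM_norm Q h \<le> 1" and t: "0 < t" and f: "f \<in> bcontfun"
  shows "\<bar>dP t h f x\<bar> \<le> sqrt (P t (\<lambda>x. (f x)\<^sup>2) x) / sqrt t"
    and "0 \<le> \<theta> \<Longrightarrow> \<theta> < 1 \<Longrightarrow> 0 \<le> M \<Longrightarrow> (\<And>z k. k \<in> CM_space Q \<Longrightarrow> \<bar>f (z + k) - f z\<bar> \<le> M * CM_norm Q k powr \<theta>) \<Longrightarrow>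
      \<bar>dP t h f x\<bar> \<le> 2 * M * t powr ((\<theta> - 1) / 2)"
proof -
  obtain \<gamma>' :: "'a measure" where g: "prob_space \<gamma>'" "sets \<gamma>' = sets borel"
    and rep: "\<And>f x. f \<in> bcontfun \<Longrightarrow> P t f x = (\<integral>\<xi>. (\<integral>y. f (x + sqrt t *\<^sub>R (\<xi> *\<^sub>R h + y)) \<partial>\<gamma>') \<partial>std)"
    and der: "\<And>f x. f \<in> bcontfun \<Longrightarrow> ((\<lambda>a. P t f (x + a *\<^sub>R h)) has_real_derivative
      (1 / sqrt t) * (\<integral>\<xi>. \<xi> * (\<integral>y. f (x + sqrt t *\<^sub>R (\<xi> *\<^sub>R h + y)) \<partial>\<gamma>') \<partial>std)) (at 0)"
    by (rule dP_formula[OF h t]) (rule that)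
  note [measurable_cong] = g(2)
  interpret g: prob_space \<gamma>' by (rule g(1))
  interpret n: prob_space std by (rule prob_std)
  let ?p = "\<lambda>\<xi> y. x + sqrt t *\<^sub>R (\<xi> *\<^sub>R h + y)"
  have r: "sqrt t > 0" using t by simp
  have [measurable]: "f \<in> borel_measurable borel" by (rule bcontfun_measurable[OF f])
  obtain B where B: "\<And>x. \<bar>f x\<bar> \<le> B" "B \<ge> 0" using bcontfun_bound[OF f] by metis
  define G where "G \<xi> = (\<integral>y. f (?p \<xi> y) \<partial>\<gamma>')" for \<xi>
  have [measurable]: "G \<in> borel_measurable borel" unfolding G_def by measurable
  have fi: "integrable \<gamma>' (\<lambda>y. f (?p \<xi> y))" for \<xi>
    by (rule g.integrable_const_bound[of _ B]) (use B in auto)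
  have f2: "(f z)\<^sup>2 \<le> B\<^sup>2" for z using B(1)[of z] by (metis abs_ge_zero power2_abs power_mono)
  have f2i: "integrable \<gamma>' (\<lambda>y. (f (?p \<xi> y))\<^sup>2)" for \<xi>
    by (rule g.integrable_const_bound[of _ "B\<^sup>2"]) (use f2 in auto)
  define G2 where "G2 \<xi> = (\<integral>y. (f (?p \<xi> y))\<^sup>2 \<partial>\<gamma>')" for \<xi>
  have [measurable]: "G2 \<in> borel_measurable borel" unfolding G2_def by measurable
  have G2B: "\<bar>G2 \<xi>\<bar> \<le> B\<^sup>2" for \<xi>
  proof -
    have "G2 \<xi> \<le> (\<integral>y. B\<^sup>2 \<partial>\<gamma>')" unfolding G2_def by (intro integral_mono f2i) (use f2 in auto)
    moreover have "0 \<le> G2 \<xi>" unfolding G2_def by (simp add: integral_nonneg_AE)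
    ultimately show ?thesis by (simp add: g.prob_space)
  qed
  have G2i: "integrable std G2" by (rule n.integrable_const_bound[of _ "B\<^sup>2"]) (use G2B in auto)
  have dPG: "dP t h f x = (1 / sqrt t) * (\<integral>\<xi>. \<xi> * G \<xi> \<partial>std)"
    unfolding dP_def G_def by (rule DERIV_imp_deriv[OF der[OF f]])
  have GG: "\<bar>\<xi> * G \<xi>\<bar> \<le> G2 \<xi> / (2 * c) + c / 2 * \<xi>\<^sup>2" if c: "c > 0" for \<xi> c
  proof -
    have "\<bar>\<xi> * f z\<bar> \<le> (f z)\<^sup>2 / (2 * c) + c / 2 * \<xi>\<^sup>2" for z
    proof -
      have "0 \<le> (\<bar>f z\<bar> - c * \<bar>\<xi>\<bar>)\<^sup>2 / (2 * c)" using c by simp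
      also have "\<dots> = (f z)\<^sup>2 / (2 * c) + c / 2 * \<xi>\<^sup>2 - \<bar>\<xi> * f z\<bar>"
        using c by (simp add: power2_diff power_mult_distrib abs_mult field_simps) (simp add: power2_eq_square)
      finally show ?thesis by simp
    qed
    then have "(\<integral>y. \<bar>\<xi> * f (?p \<xi> y)\<bar> \<partial>\<gamma>') \<le> (\<integral>y. (f (?p \<xi> y))\<^sup>2 / (2 * c) + c / 2 * \<xi>\<^sup>2 \<partial>\<gamma>')"
      using fi f2i by (intro integral_mono) auto
    also have "\<dots> = G2 \<xi> / (2 * c) + c / 2 * \<xi>\<^sup>2"
      using f2i by (simp add: G2_def g.prob_space)
    finally have "(\<integral>y. \<bar>\<xi> * f (?p \<xi> y)\<bar> \<partial>\<gamma>') \<le> G2 \<xi> / (2 * c) + c / 2 * \<xi>\<^sup>2" .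
    moreover have "\<bar>\<xi> * G \<xi>\<bar> \<le> (\<integral>y. \<bar>\<xi> * f (?p \<xi> y)\<bar> \<partial>\<gamma>')"
      unfolding G_def integral_mult_right_zero[symmetric] by (rule integral_abs_bound)
    ultimately show ?thesis by linarith
  qed
  have Gi: "integrable std (\<lambda>\<xi>. \<xi> * G \<xi>)"
  proof (rule Bochner_Integration.integrable_bound)
    show "integrable std (\<lambda>\<xi>. G2 \<xi> / (2 * 1) + 1 / 2 * \<xi>\<^sup>2)" using G2i std_moments(3) by simp
    have "0 \<le> G2 \<xi>" for \<xi> unfolding G2_def by (simp add: integral_nonneg_AE)
    then show "AE \<xi> in std. norm (\<xi> * G \<xi>) \<le> norm (G2 \<xi> / (2 * 1) + 1 / 2 * \<xi>\<^sup>2)"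
      using GG[of 1] by (intro AE_I2) (auto simp: abs_of_nonneg)
  qed measurable
  have "\<bar>\<integral>\<xi>. \<xi> * G \<xi> \<partial>std\<bar> \<le> sqrt (P t (\<lambda>x. (f x)\<^sup>2) x)"
  proof (rule abs_le_sqrt_if_AMGM)
    fix c :: real assume c: "c > 0"
    have "\<bar>\<integral>\<xi>. \<xi> * G \<xi> \<partial>std\<bar> \<le> (\<integral>\<xi>. \<bar>\<xi> * G \<xi>\<bar> \<partial>std)" by (rule integral_abs_bound)
    also have "\<dots> \<le> (\<integral>\<xi>. G2 \<xi> / (2 * c) + c / 2 * \<xi>\<^sup>2 \<partial>std)"
      using GG[OF c] Gi G2i std_moments(3) by (intro integral_mono) auto
    also have "\<dots> = (\<integral>\<xi>. G2 \<xi> \<partial>std) / (2 * c) + c / 2" using G2i std_moments(3,4) by simp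
    also have "(\<integral>\<xi>. G2 \<xi> \<partial>std) = P t (\<lambda>x. (f x)\<^sup>2) x"
      unfolding rep[OF bcontfun_square[OF f]] G2_def ..
    finally show "\<bar>\<integral>\<xi>. \<xi> * G \<xi> \<partial>std\<bar> \<le> P t (\<lambda>x. (f x)\<^sup>2) x / (2 * c) + c / 2" .
  qed (simp add: P_nonneg)
  then show "\<bar>dP t h f x\<bar> \<le> sqrt (P t (\<lambda>x. (f x)\<^sup>2) x) / sqrt t"
    unfolding dPG using r by (simp add: abs_mult divide_right_mono)
  assume \<theta>: "0 \<le> \<theta>" "\<theta> < 1" and M: "0 \<le> M"
    and H: "\<And>z k. k \<in> CM_space Q \<Longrightarrow> \<bar>f (z + k) - f z\<bar> \<le> M * CM_norm Q k powr \<theta>"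
  have G0: "\<bar>G \<xi> - G 0\<bar> \<le> M * (sqrt t * \<bar>\<xi>\<bar>) powr \<theta>" for \<xi>
  proof -
    have pt: "\<bar>f (?p \<xi> y) - f (?p 0 y)\<bar> \<le> M * (sqrt t * \<bar>\<xi>\<bar>) powr \<theta>" for y
    proof -
      let ?k = "(sqrt t * \<xi>) *\<^sub>R h"
      have "?p \<xi> y = ?p 0 y + ?k" by (simp add: scaleR_add_right)
      then have "\<bar>f (?p \<xi> y) - f (?p 0 y)\<bar> \<le> M * CM_norm Q ?k powr \<theta>"
        using H[OF CM_scale[OF h(1)]] by metis
      also have "CM_norm Q ?k = (sqrt t * \<bar>\<xi>\<bar>) * CM_norm Q h"
        using t by (simp add: CM_norm_scale[OF h(1)] abs_mult)
      also have "M * ((sqrt t * \<bar>\<xi>\<bar>) * CM_norm Q h) powr \<theta> \<le> M * (sqrt t * \<bar>\<xi>\<bar>) powr \<theta>"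
        using t M \<theta> h(2) CM_norm_nonneg[of h] by (intro mult_left_mono powr_mono2 mult_left_le) auto
      finally show ?thesis .
    qed
    have "\<bar>G \<xi> - G 0\<bar> = \<bar>\<integral>y. f (?p \<xi> y) - f (?p 0 y) \<partial>\<gamma>'\<bar>"
      unfolding G_def using fi[of \<xi>] fi[of 0] by simp
    also have "\<dots> \<le> (\<integral>y. \<bar>f (?p \<xi> y) - f (?p 0 y)\<bar> \<partial>\<gamma>')" by (rule integral_abs_bound)
    also have "\<dots> \<le> (\<integral>y. M * (sqrt t * \<bar>\<xi>\<bar>) powr \<theta> \<partial>\<gamma>')"
      using fi[of \<xi>] fi[of 0] by (intro integral_mono pt) auto
    finally show ?thesis by (simp add: g.prob_space)
  qed
  have mono: "\<bar>\<xi>\<bar> * \<bar>\<xi>\<bar> powr \<theta> \<le> 1 + \<xi>\<^sup>2" for \<xi> :: real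
  proof (cases "\<bar>\<xi>\<bar> \<le> 1")
    case True
    then have "\<bar>\<xi>\<bar> * \<bar>\<xi>\<bar> powr \<theta> \<le> 1 * 1" using \<theta> by (intro mult_mono powr_le1) auto
    then show ?thesis by (simp add: add_increasing2)
  next
    case False
    then have "\<bar>\<xi>\<bar> powr \<theta> \<le> \<bar>\<xi>\<bar> powr 1" using \<theta> by (intro powr_mono) auto
    then have "\<bar>\<xi>\<bar> * \<bar>\<xi>\<bar> powr \<theta> \<le> \<bar>\<xi>\<bar> * \<bar>\<xi>\<bar>" using False by (intro mult_left_mono) auto
    then show ?thesis by (simp add: power2_eq_square add_increasing)
  qed
  have "(\<integral>\<xi>. \<xi> * G \<xi> \<partial>std) = (\<integral>\<xi>. \<xi> * (G \<xi> - G 0) \<partial>std)"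
    using Gi std_moments(1,2) by (simp add: right_diff_distrib)
  then have "\<bar>\<integral>\<xi>. \<xi> * G \<xi> \<partial>std\<bar> \<le> (\<integral>\<xi>. \<bar>\<xi> * (G \<xi> - G 0)\<bar> \<partial>std)"
    using integral_abs_bound[of std "\<lambda>\<xi>. \<xi> * (G \<xi> - G 0)"] by simp
  also have "\<dots> \<le> (\<integral>\<xi>. M * sqrt t powr \<theta> * (1 + \<xi>\<^sup>2) \<partial>std)"
  proof (rule integral_mono)
    show "integrable std (\<lambda>\<xi>. \<bar>\<xi> * (G \<xi> - G 0)\<bar>)"
      using Gi std_moments(1) by (simp add: right_diff_distrib)
    show "integrable std (\<lambda>\<xi>. M * sqrt t powr \<theta> * (1 + \<xi>\<^sup>2))" using std_moments(3) by simp
    fix \<xi>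
    have "\<bar>\<xi> * (G \<xi> - G 0)\<bar> \<le> \<bar>\<xi>\<bar> * (M * (sqrt t * \<bar>\<xi>\<bar>) powr \<theta>)"
      unfolding abs_mult by (intro mult_left_mono G0) auto
    also have "\<dots> = M * sqrt t powr \<theta> * (\<bar>\<xi>\<bar> * \<bar>\<xi>\<bar> powr \<theta>)" using t by (simp add: powr_mult)
    also have "\<dots> \<le> M * sqrt t powr \<theta> * (1 + \<xi>\<^sup>2)" using M by (intro mult_left_mono mono) auto
    finally show "\<bar>\<xi> * (G \<xi> - G 0)\<bar> \<le> M * sqrt t powr \<theta> * (1 + \<xi>\<^sup>2)" .
  qed
  also have "\<dots> = M * sqrt t powr \<theta> * (\<integral>\<xi>. 1 + \<xi>\<^sup>2 \<partial>std)" by simp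
  also have "(\<integral>\<xi>. 1 + \<xi>\<^sup>2 \<partial>std) = 2"
    using std_moments(3,4) n.prob_space by (subst Bochner_Integration.integral_add) auto
  finally have "\<bar>\<integral>\<xi>. \<xi> * G \<xi> \<partial>std\<bar> \<le> M * sqrt t powr \<theta> * 2" .
  then have "\<bar>dP t h f x\<bar> \<le> (1 / sqrt t) * (M * sqrt t powr \<theta> * 2)"
    unfolding dPG using r by (simp add: abs_mult mult_left_mono divide_right_mono)
  also have "\<dots> = 2 * M * (sqrt t powr \<theta> / sqrt t)" by simp
  also have "sqrt t powr \<theta> / sqrt t = t powr ((\<theta> - 1) / 2)"
  proof -
    have "sqrt t powr \<theta> / sqrt t = sqrt t powr (\<theta> - 1)" using r by (simp add: powr_diff)
    then show ?thesis using t by (simp add: powr_half_sqrt[symmetric] powr_powr)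
  qed
  finally show "\<bar>dP t h f x\<bar> \<le> 2 * M * t powr ((\<theta> - 1) / 2)" .
qed

lemma dP_bound_L2:
  assumes h: "h \<in> CM_space Q" and t: "0 < t" and f: "f \<in> bcontfun"
  shows "\<bar>dP t h f x\<bar> \<le> CM_norm Q h * sqrt (P t (\<lambda>x. (f x)\<^sup>2) x) / sqrt t"
    and "0 \<le> \<theta> \<Longrightarrow> \<theta> < 1 \<Longrightarrow> 0 \<le> M \<Longrightarrow> (\<And>z k. k \<in> CM_space Q \<Longrightarrow> \<bar>f (z + k) - f z\<bar> \<le> M * CM_norm Q k powr \<theta>) \<Longrightarrow>
      \<bar>dP t h f x\<bar> \<le> 2 * M * CM_norm Q h * t powr ((\<theta> - 1) / 2)"
proof -
  define k where "k = (if h = 0 then 0 else (1 / CM_norm Q h) *\<^sub>R h)"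
  have k: "k \<in> CM_space Q" "CM_norm Q k \<le> 1" and hk: "h = CM_norm Q h *\<^sub>R k"
    using h CM_norm_pos[OF h] CM_norm_eq_0[OF h] by (auto simp: k_def CM_0 CM_scale CM_norm_scale)
  have e: "\<bar>dP t h f x\<bar> = CM_norm Q h * \<bar>dP t k f x\<bar>"
    using dP_scale[OF k(1) t f, of "CM_norm Q h" x] hk CM_norm_nonneg[of h] by (simp add: abs_mult)
  show "\<bar>dP t h f x\<bar> \<le> CM_norm Q h * sqrt (P t (\<lambda>x. (f x)\<^sup>2) x) / sqrt t"
    unfolding e times_divide_eq_right[symmetric] by (intro mult_left_mono dP_bounds_unit(1) k t f CM_norm_nonneg)
  assume "0 \<le> \<theta>" "\<theta> < 1" "0 \<le> M" "\<And>z k. k \<in> CM_space Q \<Longrightarrow> \<bar>f (z + k) - f z\<bar> \<le> M * CM_norm Q k powr \<theta>"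
  from mult_left_mono[OF dP_bounds_unit(2)[OF k t f this] CM_norm_nonneg[of h]]
  show "\<bar>dP t h f x\<bar> \<le> 2 * M * CM_norm Q h * t powr ((\<theta> - 1) / 2)"
    unfolding e by (simp add: mult_ac)
qed

text \<open>Translates of \<open>f\<close> need not converge uniformly, but they converge in mean
  square under the Gaussian measure centred at a fixed \<open>x\<close>. Together with the mean
  square bounds on derivatives this yields continuity of the derivatives.\<close>

lemma P_square_diff_tendsto:
  assumes f: "f \<in> bcontfun" and z: "z \<longlonglongrightarrow> 0"
  shows "(\<lambda>n. P t (\<lambda>y. (f (y + z n) - f y)\<^sup>2) x) \<longlonglongrightarrow> 0"
proof -
  interpret prob_space \<gamma> by (rule prob_\<gamma>)
  have [measurable]: "f \<in> borel_measurable borel" by (rule bcontfun_measurable[OF f])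
  obtain B where B: "\<And>x. \<bar>f x\<bar> \<le> B" using bcontfun_bound[OF f] by metis
  have "(\<lambda>n. \<integral>y. (f (x + sqrt t *\<^sub>R y + z n) - f (x + sqrt t *\<^sub>R y))\<^sup>2 \<partial>\<gamma>) \<longlonglongrightarrow> (\<integral>y. 0 \<partial>\<gamma>)"
  proof (rule integral_dominated_convergence[where w = "\<lambda>_. (2 * B)\<^sup>2"])
    show "AE y in \<gamma>. (\<lambda>n. (f (x + sqrt t *\<^sub>R y + z n) - f (x + sqrt t *\<^sub>R y))\<^sup>2) \<longlonglongrightarrow> 0"
    proof (intro AE_I2)
      fix y
      have "(\<lambda>n. x + sqrt t *\<^sub>R y + z n) \<longlonglongrightarrow> x + sqrt t *\<^sub>R y + 0" by (intro tendsto_intros z)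
      from bcontfun_tendsto[OF f this]
      have "(\<lambda>n. (f (x + sqrt t *\<^sub>R y + z n) - f (x + sqrt t *\<^sub>R y))\<^sup>2) \<longlonglongrightarrow> (f (x + sqrt t *\<^sub>R y + 0) - f (x + sqrt t *\<^sub>R y))\<^sup>2"
        by (intro tendsto_intros)
      then show "(\<lambda>n. (f (x + sqrt t *\<^sub>R y + z n) - f (x + sqrt t *\<^sub>R y))\<^sup>2) \<longlonglongrightarrow> 0" by simp
    qed
    fix n
    show "AE y in \<gamma>. norm ((f (x + sqrt t *\<^sub>R y + z n) - f (x + sqrt t *\<^sub>R y))\<^sup>2) \<le> (2 * B)\<^sup>2"
    proof (intro AE_I2)
      fix y
      have "\<bar>f (x + sqrt t *\<^sub>R y + z n) - f (x + sqrt t *\<^sub>R y)\<bar> \<le> 2 * B"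
        using B[of "x + sqrt t *\<^sub>R y + z n"] B[of "x + sqrt t *\<^sub>R y"] by linarith
      then have "\<bar>f (x + sqrt t *\<^sub>R y + z n) - f (x + sqrt t *\<^sub>R y)\<bar>\<^sup>2 \<le> (2 * B)\<^sup>2" by (intro power_mono) auto
      then show "norm ((f (x + sqrt t *\<^sub>R y + z n) - f (x + sqrt t *\<^sub>R y))\<^sup>2) \<le> (2 * B)\<^sup>2" by simp
    qed
  qed auto
  then show ?thesis by (simp add: P_def)
qed

lemma shift_diff_bcontfun:
  fixes f :: "'a \<Rightarrow> real"
  assumes "f \<in> bcontfun"
  shows "(\<lambda>y. f (y + z) - f y) \<in> bcontfun"
  using bcontfun_lincomb[OF assms bcontfun_shift[OF assms, of z], of "- 1"] by simp

lemma dP_bcontfun: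
  assumes h: "h \<in> CM_space Q" and t: "0 < t" and f: "f \<in> bcontfun"
  shows "dP t h f \<in> bcontfun"
proof -
  obtain B where B: "\<And>x. \<bar>f x\<bar> \<le> B" "B \<ge> 0" using bcontfun_bound[OF f] by metis
  have "\<bar>dP t h f x\<bar> \<le> CM_norm Q h * B / sqrt t" for x
  proof -
    have "P t (\<lambda>x. (f x)\<^sup>2) x \<le> B\<^sup>2"
      using P_abs_le[OF bcontfun_square[OF f], of "B\<^sup>2" t x] B(1) by (auto simp: abs_le_square_iff[symmetric] B(2))
    then have "sqrt (P t (\<lambda>x. (f x)\<^sup>2) x) \<le> B" using B(2) by (metis real_sqrt_le_mono real_sqrt_abs abs_of_nonneg)
    then have "CM_norm Q h * sqrt (P t (\<lambda>x. (f x)\<^sup>2) x) / sqrt t \<le> CM_norm Q h * B / sqrt t"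
      using t by (intro divide_right_mono mult_left_mono CM_norm_nonneg) auto
    then show ?thesis using dP_bound_L2(1)[OF h t f, of x] by linarith
  qed
  moreover have "continuous_on UNIV (dP t h f)"
    unfolding continuous_on_sequentially
  proof (intro allI ballI impI, elim conjE)
    fix X :: "nat \<Rightarrow> 'a" and x assume X: "X \<longlonglongrightarrow> x"
    have z: "(\<lambda>n. X n - x) \<longlonglongrightarrow> 0" using X by (simp add: LIM_zero)
    have b: "norm (dP t h f (X n) - dP t h f x) \<le> CM_norm Q h * sqrt (P t (\<lambda>y. (f (y + (X n - x)) - f y)\<^sup>2) x) / sqrt t" for n
    proof -
      have "dP t h (\<lambda>y. f (y + (X n - x)) - f y) x = dP t h (\<lambda>y. (-1) * f y + f (y + (X n - x))) x" by simp
      also have "\<dots> = dP t h f (X n) - dP t h f x"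
        by (subst dP_lincomb[OF h t f bcontfun_shift[OF f]]) (simp add: dP_shift)
      finally show ?thesis using dP_bound_L2(1)[OF h t shift_diff_bcontfun[OF f], of "X n - x" x] by simp
    qed
    have "(\<lambda>n. CM_norm Q h * sqrt (P t (\<lambda>y. (f (y + (X n - x)) - f y)\<^sup>2) x) / sqrt t) \<longlonglongrightarrow> CM_norm Q h * sqrt 0 / sqrt t"
      by (intro tendsto_intros P_square_diff_tendsto[OF f z]) (use t in auto)
    then have "(\<lambda>n. dP t h f (X n) - dP t h f x) \<longlonglongrightarrow> 0"
      by (intro Lim_null_comparison[OF always_eventually[OF allI[OF b]]]) simp
    then show "(dP t h f \<circ> X) \<longlonglongrightarrow> dP t h f x" by (simp add: o_def LIM_zero_iff)
  qed
  ultimately show ?thesis by (intro bcontfunI')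
qed

text \<open>Differentiation passes under the Gaussian average, and \<open>P s (P t f)\<close>,
  \<open>P t (P s f)\<close> and \<open>P (s + t) f\<close> are the same function.\<close>

lemma P_dP:
  assumes h: "h \<in> CM_space Q" and t: "0 < t" "0 \<le> s" and f: "f \<in> bcontfun"
  shows "P s (dP t h f) x = dP t h (P s f) x" "P s (dP t h f) x = dP (s + t) h f x"
proof -
  interpret prob_space \<gamma> by (rule prob_\<gamma>)
  obtain B where B: "\<And>x. \<bar>dP t h f x\<bar> \<le> B" using bcontfun_bound[OF dP_bcontfun[OF h t(1) f]] by metis
  have [measurable]: "dP t h f \<in> borel_measurable borel" by (rule bcontfun_measurable[OF dP_bcontfun[OF h t(1) f]])
  have "((\<lambda>a. \<integral>y. P t f ((x + sqrt s *\<^sub>R y) + a *\<^sub>R h) \<partial>\<gamma>) has_real_derivative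
      (\<integral>y. dP t h f ((x + sqrt s *\<^sub>R y) + 0 *\<^sub>R h) \<partial>\<gamma>)) (at 0)"
  proof (rule has_real_derivative_integral[where e = 1 and w = "\<lambda>_. B" and
        g' = "\<lambda>y a. dP t h f ((x + sqrt s *\<^sub>R y) + a *\<^sub>R h)"])
    fix a :: real
    show "integrable \<gamma> (\<lambda>y. P t f ((x + sqrt s *\<^sub>R y) + a *\<^sub>R h))"
      using P_integrable[OF P_bcontfun[OF f, of t], of "x + a *\<^sub>R h" "sqrt s"] by (simp add: add_ac)
  qed (use P_has_derivative[OF h t(1) f] B in auto)
  then have D: "((\<lambda>a. P s (P t f) (x + a *\<^sub>R h)) has_real_derivative P s (dP t h f) x) (at 0)"
    by (simp add: P_def add_ac)
  have "P s (P t f) y = P t (P s f) y" for y using P_add[OF f] t by (simp add: add.commute)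
  with D show "P s (dP t h f) x = dP t h (P s f) x"
    unfolding dP_def by (intro DERIV_imp_deriv[symmetric]) simp
  show "P s (dP t h f) x = dP (s + t) h f x"
    using D P_add[OF f] t unfolding dP_def by (intro DERIV_imp_deriv[symmetric]) simp
qed

text \<open>Additivity is not visible in the Gaussian formula, whose second measure changes with the
  direction. The increment is split at \<open>x + a *\<^sub>R h\<close>; the mean value theorem and
  continuity of the derivative along \<open>k\<close> handle the part that starts there.\<close>

lemma dP_add_direction:
  assumes h: "h \<in> CM_space Q" "k \<in> CM_space Q" and t: "0 < t" and f: "f \<in> bcontfun"
  shows "dP t (h + k) f x = dP t h f x + dP t k f x"
proof -
  let ?F = "P t f"
  have hk: "h + k \<in> CM_space Q" by (rule CM_add[OF h])
  have D0: "((\<lambda>a. (?F (x + a *\<^sub>R v) - ?F x) / a) \<longlongrightarrow> dP t v f x) (at 0)" if v: "v \<in> CM_space Q" for v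
    using P_has_derivative[OF v t f, of x 0] by (simp add: has_field_derivative_iff)
  have "((\<lambda>a. (?F (x + a *\<^sub>R h + a *\<^sub>R k) - ?F (x + a *\<^sub>R h)) / a) \<longlongrightarrow> dP t k f x) (at 0)"
    unfolding tendsto_at_iff_sequentially
  proof (intro allI impI)
    fix X :: "nat \<Rightarrow> real" assume X0: "\<forall>i. X i \<in> UNIV - {0}" and X: "X \<longlonglongrightarrow> 0"
    have "\<exists>c. \<bar>c\<bar> \<le> \<bar>X i\<bar> \<and> (?F (x + X i *\<^sub>R h + X i *\<^sub>R k) - ?F (x + X i *\<^sub>R h)) / X i = dP t k f (x + X i *\<^sub>R h + c *\<^sub>R k)" for i
    proof -
      let ?g = "\<lambda>a. ?F (x + X i *\<^sub>R h + a *\<^sub>R k)"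
      have d: "(?g has_real_derivative dP t k f (x + X i *\<^sub>R h + a *\<^sub>R k)) (at a)" for a
        by (rule P_has_derivative[OF h(2) t f])
      show ?thesis
      proof (cases "X i > 0")
        case True
        obtain c where "0 < c" "c < X i" "?g (X i) - ?g 0 = (X i - 0) * dP t k f (x + X i *\<^sub>R h + c *\<^sub>R k)"
          using MVT2[OF True d] by blast
        then show ?thesis using True by (intro exI[of _ c]) (simp add: field_simps)
      next
        case False
        then have n: "X i < 0" using X0 by (metis DiffD2 insertCI linorder_neqE_linordered_idom)
        obtain c where "X i < c" "c < 0" "?g 0 - ?g (X i) = (0 - X i) * dP t k f (x + X i *\<^sub>R h + c *\<^sub>R k)"
          using MVT2[OF n d] by blast
        then show ?thesis using n by (intro exI[of _ c]) (simp add: field_simps)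
      qed
    qed
    then obtain c where c: "\<And>i. \<bar>c i\<bar> \<le> \<bar>X i\<bar>" and e:
      "\<And>i. (?F (x + X i *\<^sub>R h + X i *\<^sub>R k) - ?F (x + X i *\<^sub>R h)) / X i = dP t k f (x + X i *\<^sub>R h + c i *\<^sub>R k)"
      by metis
    have "c \<longlonglongrightarrow> 0"
      by (rule Lim_null_comparison[OF _ tendsto_rabs_zero[OF X]]) (use c in auto)
    then have "(\<lambda>i. x + X i *\<^sub>R h + c i *\<^sub>R k) \<longlonglongrightarrow> x + 0 *\<^sub>R h + 0 *\<^sub>R k"
      by (intro tendsto_intros X)
    from bcontfun_tendsto[OF dP_bcontfun[OF h(2) t f] this]
    show "((\<lambda>a. (?F (x + a *\<^sub>R h + a *\<^sub>R k) - ?F (x + a *\<^sub>R h)) / a) \<circ> X) \<longlonglongrightarrow> dP t k f x"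
      by (simp add: o_def e)
  qed
  from tendsto_add[OF this D0[OF h(1)]]
  have "((\<lambda>a. (?F (x + a *\<^sub>R (h + k)) - ?F x) / a) \<longlongrightarrow> dP t k f x + dP t h f x) (at 0)"
    by (simp add: scaleR_add_right add_divide_distrib[symmetric] add.assoc)
  from tendsto_unique[OF _ D0[OF hk] this] show ?thesis by simp
qed

end

section \<open>Iterated derivatives of the heat semigroup\<close>

context cov_op
begin

lemma P_le_sqrt_P_square:
  assumes f: "f \<in> bcontfun"
  shows "\<bar>P t f x\<bar> \<le> sqrt (P t (\<lambda>x. (f x)\<^sup>2) x)"
proof (rule abs_le_sqrt_if_AMGM)
  fix c :: real assume c: "c > 0"
  have am: "\<bar>a\<bar> \<le> (1 / (2 * c)) * a\<^sup>2 + c / 2" for a :: real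
  proof -
    have "0 \<le> (\<bar>a\<bar> - c)\<^sup>2 / (2 * c)" using c by simp
    also have "\<dots> = (1 / (2 * c)) * a\<^sup>2 + c / 2 - \<bar>a\<bar>" using c by (simp add: power2_diff power2_eq_square field_simps)
    finally show ?thesis by simp
  qed
  have k: "(\<lambda>_. c / 2) \<in> bcontfun" for c :: real by (intro bcontfunI'[of _ "\<bar>c / 2\<bar>"]) auto
  have "\<bar>P t f x\<bar> \<le> (\<integral>y. \<bar>f (x + sqrt t *\<^sub>R y)\<bar> \<partial>\<gamma>)" unfolding P_def by (rule integral_abs_bound)
  also have "\<dots> \<le> P t (\<lambda>z. (1 / (2 * c)) * (f z)\<^sup>2 + c / 2) x"
    unfolding P_def by (intro integral_mono integrable_abs P_integrable f bcontfun_lincomb bcontfun_square k am)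
  also have "\<dots> = P t (\<lambda>x. (f x)\<^sup>2) x / (2 * c) + c / 2"
    by (subst P_lincomb[OF bcontfun_square[OF f] k]) (simp add: P_const)
  finally show "\<bar>P t f x\<bar> \<le> P t (\<lambda>x. (f x)\<^sup>2) x / (2 * c) + c / 2" .
qed (simp add: P_nonneg)

lemma dP_sup_bound:
  assumes h: "h \<in> CM_space Q" and t: "0 < t" and f: "f \<in> bcontfun" and S: "\<And>y. \<bar>f y\<bar> \<le> S"
  shows "\<bar>dP t h f x\<bar> \<le> CM_norm Q h * S / sqrt t"
proof -
  have S0: "0 \<le> S" using order_trans[OF abs_ge_zero S] .
  have "\<bar>(f y)\<^sup>2\<bar> \<le> S\<^sup>2" for y using S[of y] S0 by (simp add: abs_le_square_iff[symmetric])
  from P_abs_le[OF bcontfun_square[OF f] this] have "P t (\<lambda>x. (f x)\<^sup>2) x \<le> S\<^sup>2" by (simp add: abs_le_iff)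
  then have "sqrt (P t (\<lambda>x. (f x)\<^sup>2) x) \<le> S" using S0 real_le_lsqrt by blast
  then have "CM_norm Q h * sqrt (P t (\<lambda>x. (f x)\<^sup>2) x) / sqrt t \<le> CM_norm Q h * S / sqrt t"
    using t by (intro divide_right_mono mult_left_mono CM_norm_nonneg) auto
  then show ?thesis using dP_bound_L2(1)[OF h t f, of x] by linarith
qed

text \<open>Each derivative consumes half of the remaining time, since
  \<open>P t = P (t / 2) \<circ> P (t / 2)\<close>; so bounds on first derivatives iterate.\<close>

primrec DP :: "'a list \<Rightarrow> real \<Rightarrow> ('a \<Rightarrow> real) \<Rightarrow> 'a \<Rightarrow> real" where
  "DP [] t f = P t f"
| "DP (h # hs) t f = dP (t / 2) h (DP hs (t / 2) f)"

abbreviation nrm :: "'a list \<Rightarrow> real" where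
  "nrm hs \<equiv> prod_list (map (CM_norm Q) hs)"

lemma nrm_nonneg: "0 \<le> nrm hs"
  by (induction hs) (auto simp: CM_norm_nonneg)

lemma DP_bcontfun:
  "set hs \<subseteq> CM_space Q \<Longrightarrow> 0 < t \<Longrightarrow> f \<in> bcontfun \<Longrightarrow> DP hs t f \<in> bcontfun"
  by (induction hs arbitrary: t) (auto intro: P_bcontfun dP_bcontfun)

lemma DP_lincomb:
  "set hs \<subseteq> CM_space Q \<Longrightarrow> 0 < t \<Longrightarrow> f \<in> bcontfun \<Longrightarrow> g \<in> bcontfun \<Longrightarrow>
    DP hs t (\<lambda>x. c * f x + g x) = (\<lambda>x. c * DP hs t f x + DP hs t g x)"
proof (induction hs arbitrary: t)
  case Nil
  then show ?case by (auto simp: P_lincomb)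
next
  case (Cons h hs)
  have "DP (h # hs) t (\<lambda>x. c * f x + g x) = dP (t / 2) h (\<lambda>x. c * DP hs (t / 2) f x + DP hs (t / 2) g x)"
    using Cons by simp
  also have "\<dots> = (\<lambda>x. c * DP (h # hs) t f x + DP (h # hs) t g x)"
    using Cons.prems by (intro ext) (simp, intro dP_lincomb DP_bcontfun, auto)
  finally show ?case .
qed

lemma DP_shift: "DP hs t (\<lambda>x. f (x + z)) = (\<lambda>x. DP hs t f (x + z))"
  by (induction hs arbitrary: t) (auto simp: P_shift dP_shift)

text \<open>Heat flow can be moved through the derivatives, so the total time is what counts. The
  induction reallocates time between the outer and the inner factors until each carries half of
  \<open>s + t\<close>.\<close>

lemma P_DP:
  "set hs \<subseteq> CM_space Q \<Longrightarrow> 0 < t \<Longrightarrow> 0 \<le> s \<Longrightarrow> f \<in> bcontfun \<Longrightarrow> P s (DP hs t f) = DP hs (s + t) f"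
proof (induction hs arbitrary: s t)
  case Nil
  then show ?case by (auto simp: P_add)
next
  case (Cons h hs)
  let ?g = "DP hs (t / 2) f"
  have h: "h \<in> CM_space Q" and g: "?g \<in> bcontfun" using Cons.prems by (auto intro: DP_bcontfun)
  have "P (s / 2) ?g = DP hs (s / 2 + t / 2) f" using Cons by simp
  then have IH: "DP hs ((s + t) / 2) f = P (s / 2) ?g" by (simp add: add_divide_distrib)
  show ?case
  proof
    fix x
    have "P s (DP (h # hs) t f) x = dP (s + t / 2) h ?g x"
      using P_dP(2)[OF h _ _ g, of "t / 2" s] Cons.prems by simp
    \<comment> \<open>The outer time is split so that exactly \<open>(s + t) / 2\<close> is left for
      the derivative along \<open>h\<close>, as the recursion for \<open>DP\<close> demands.\<close>
    also have "s + t / 2 = s / 2 + (s + t) / 2" by (simp add: field_simps)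
    also have "dP \<dots> h ?g x = P (s / 2) (dP ((s + t) / 2) h ?g) x"
      using P_dP(2)[OF h _ _ g, of "(s + t) / 2" "s / 2"] Cons.prems by simp
    also have "\<dots> = dP ((s + t) / 2) h (P (s / 2) ?g) x"
      using P_dP(1)[OF h _ _ g, of "(s + t) / 2" "s / 2"] Cons.prems by simp
    finally show "P s (DP (h # hs) t f) x = DP (h # hs) (s + t) f x" by (simp add: IH)
  qed
qed

lemma DP_derivative:
  assumes "set hs \<subseteq> CM_space Q" "h \<in> CM_space Q" "0 < t" "f \<in> bcontfun"
  shows "((\<lambda>a. DP hs t f (x + a *\<^sub>R h)) has_real_derivative DP (h # hs) t f (x + b *\<^sub>R h)) (at b)"
proof -
  have "DP hs t f = P (t / 2) (DP hs (t / 2) f)" using P_DP[of hs "t / 2" "t / 2" f] assms by simp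
  then show ?thesis
    using P_has_derivative[OF assms(2) _ DP_bcontfun[OF assms(1) _ assms(4)], of "t / 2" "t / 2" x b] assms(3) by simp
qed

lemma half_powr: "0 < (t::real) \<Longrightarrow> (t / 2) powr (- a) = 2 powr a * t powr (- a)"
  by (simp add: powr_divide powr_minus field_simps)

text \<open>Halving the time multiplies the constant by \<open>2 powr a\<close> with
  \<open>a \<le> n + 1\<close>. Squares as exponents absorb this, since consecutive ones differ by
  \<open>2 * n + 1\<close>.\<close>

lemma two_powr_le:
  fixes n :: nat and a :: real
  assumes "a \<le> real n + 1"
  shows "2 ^ (n * n) * 2 powr a \<le> (2::real) ^ (Suc n * Suc n)"
proof -
  have "(2::real) powr a \<le> 2 powr real (2 * n + 1)" using assms by (intro powr_mono) auto
  then have "2 ^ (n * n) * 2 powr a \<le> 2 ^ (n * n) * (2::real) ^ (2 * n + 1)" by (simp only: powr_realpow) (simp add: powr_realpow)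
  also have "\<dots> = 2 ^ (n * n + (2 * n + 1))" by (simp only: power_add)
  also have "n * n + (2 * n + 1) = Suc n * Suc n" by simp
  finally show ?thesis .
qed

text \<open>The mean square bound reproduces itself: the squared inner derivative is at most
  \<open>C\<^sup>2\<close> times \<open>P (t / 2)\<close> of the square of \<open>f\<close>, and the
  outer average over another \<open>t / 2\<close> turns this into \<open>P t\<close>.\<close>

lemma DP_bound_L2:
  "set hs \<subseteq> CM_space Q \<Longrightarrow> 0 < t \<Longrightarrow> f \<in> bcontfun \<Longrightarrow>
    \<bar>DP hs t f x\<bar> \<le> 2 ^ (length hs * length hs) * nrm hs * t powr (- (real (length hs) / 2)) * sqrt (P t (\<lambda>x. (f x)\<^sup>2) x)"
proof (induction hs arbitrary: t x)
  case Nil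
  then show ?case using P_le_sqrt_P_square by simp
next
  case (Cons h hs)
  let ?n = "length hs" and ?g = "DP hs (t / 2) f" and ?f2 = "\<lambda>x. (f x)\<^sup>2"
  define C where "C = 2 ^ (?n * ?n) * nrm hs * (t / 2) powr (- (real ?n / 2))"
  have C: "C \<ge> 0" unfolding C_def using nrm_nonneg by simp
  have h: "h \<in> CM_space Q" and t: "t / 2 > 0" and g: "?g \<in> bcontfun"
    using Cons.prems by (auto intro: DP_bcontfun)
  note f2 = bcontfun_square[OF Cons.prems(3)]
  have "(?g y)\<^sup>2 \<le> C\<^sup>2 * P (t / 2) ?f2 y" for y
  proof -
    have "\<bar>?g y\<bar> \<le> C * sqrt (P (t / 2) ?f2 y)" using Cons by (simp add: C_def)
    then have "\<bar>?g y\<bar>\<^sup>2 \<le> (C * sqrt (P (t / 2) ?f2 y))\<^sup>2" by (intro power_mono) auto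
    also have "\<dots> = C\<^sup>2 * P (t / 2) ?f2 y" using P_nonneg[of ?f2 "t / 2" y] by (simp add: power_mult_distrib)
    finally show ?thesis by simp
  qed
  then have "P (t / 2) (\<lambda>x. (?g x)\<^sup>2) x \<le> P (t / 2) (\<lambda>y. C\<^sup>2 * P (t / 2) ?f2 y + 0) x"
    by (intro P_mono bcontfun_square g bcontfun_lincomb P_bcontfun f2 bcontfunI'[of _ 0]) auto
  also have "\<dots> = C\<^sup>2 * P (t / 2) (P (t / 2) ?f2) x + P (t / 2) (\<lambda>_. 0) x"
    by (intro P_lincomb P_bcontfun f2 bcontfunI'[of _ 0]) auto
  also have "\<dots> = C\<^sup>2 * P t ?f2 x"
    using P_add[OF f2, of "t / 2" "t / 2" x] t by (simp add: P_const)
  finally have "sqrt (P (t / 2) (\<lambda>x. (?g x)\<^sup>2) x) \<le> sqrt (C\<^sup>2 * P t ?f2 x)" by simp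
  also have "\<dots> = C * sqrt (P t ?f2 x)" using C by (simp add: real_sqrt_mult)
  finally have "\<bar>dP (t / 2) h ?g x\<bar> \<le> CM_norm Q h * (C * sqrt (P t ?f2 x)) / sqrt (t / 2)"
    using dP_bound_L2(1)[OF h t g, of x] t CM_norm_nonneg[of h]
    by (elim order_trans) (intro divide_right_mono mult_left_mono, auto)
  also have "\<dots> = CM_norm Q h * nrm hs * sqrt (P t ?f2 x) * (2 ^ (?n * ?n) * ((t / 2) powr (- (real ?n / 2)) / sqrt (t / 2)))"
    by (simp add: C_def mult_ac)
  also have "(t / 2) powr (- (real ?n / 2)) / sqrt (t / 2) = (t / 2) powr (- ((real ?n + 1) / 2))"
    using t by (simp add: powr_half_sqrt[symmetric] powr_diff[symmetric] add_divide_distrib)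
  also have "\<dots> = 2 powr ((real ?n + 1) / 2) * t powr (- ((real ?n + 1) / 2))"
    using t by (intro half_powr) simp
  also have "CM_norm Q h * nrm hs * sqrt (P t ?f2 x) * (2 ^ (?n * ?n) * (2 powr ((real ?n + 1) / 2) * t powr (- ((real ?n + 1) / 2))))
      = (CM_norm Q h * nrm hs * sqrt (P t ?f2 x) * t powr (- ((real ?n + 1) / 2))) * (2 ^ (?n * ?n) * 2 powr ((real ?n + 1) / 2))"
    by (simp add: mult_ac)
  also have "\<dots> \<le> (CM_norm Q h * nrm hs * sqrt (P t ?f2 x) * t powr (- ((real ?n + 1) / 2))) * 2 ^ (Suc ?n * Suc ?n)"
    using CM_norm_nonneg[of h] nrm_nonneg[of hs] P_nonneg[of ?f2 t x]
    by (intro mult_left_mono two_powr_le mult_nonneg_nonneg) auto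
  finally show ?case by (simp add: mult_ac add_divide_distrib add.commute)
qed

text \<open>For \<open>\<theta> = 0\<close> this bounds the oscillation along the Cameron-Martin
  space, so bounded functions are included. The convention \<open>0 powr 0 = 0\<close> is harmless
  because the difference vanishes at \<open>k = 0\<close>.\<close>

definition holderH :: "real \<Rightarrow> real \<Rightarrow> ('a \<Rightarrow> real) \<Rightarrow> bool" where
  "holderH \<theta> M f \<longleftrightarrow> 0 \<le> M \<and> (\<forall>z. \<forall>k\<in>CM_space Q. \<bar>f (z + k) - f z\<bar> \<le> M * CM_norm Q k powr \<theta>)"

lemma P_holder:
  assumes f: "f \<in> bcontfun" and H: "holderH \<theta> M f"
  shows "holderH \<theta> M (P t f)"
  unfolding holderH_def
proof (intro conjI allI ballI)
  show "0 \<le> M" using H by (simp add: holderH_def)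
  fix z k assume k: "k \<in> CM_space Q"
  have "P t (\<lambda>y. (-1) * f y + f (y + k)) z = (-1) * P t f z + P t f (z + k)"
    by (subst P_lincomb[OF f bcontfun_shift[OF f]]) (simp add: P_shift)
  moreover have "\<bar>P t (\<lambda>y. (-1) * f y + f (y + k)) z\<bar> \<le> M * CM_norm Q k powr \<theta>"
    by (rule P_abs_le[OF bcontfun_lincomb[OF f bcontfun_shift[OF f]]]) (use H k in \<open>auto simp: holderH_def\<close>)
  ultimately show "\<bar>P t f (z + k) - P t f z\<bar> \<le> M * CM_norm Q k powr \<theta>" by simp
qed

text \<open>The innermost derivative uses the Hoelder bound and gains
  \<open>t powr (\<theta> / 2)\<close>; each further one costs \<open>t powr (- 1 / 2)\<close>
  through the sup bound. The list is nonempty because \<open>P t f\<close> itself gains nothing. The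
  \<open>+ 1\<close> in the exponent of the constant is the factor \<open>2\<close> of the first
  derivative.\<close>

lemma DP_bound_holder:
  assumes f: "f \<in> bcontfun" and H: "holderH \<theta> M f" and \<theta>: "0 \<le> \<theta>" "\<theta> < 1"
  shows "set hs \<subseteq> CM_space Q \<Longrightarrow> hs \<noteq> [] \<Longrightarrow> 0 < t \<Longrightarrow>
    \<bar>DP hs t f x\<bar> \<le> 2 ^ (length hs * length hs + 1) * M * nrm hs * t powr (- ((real (length hs) - \<theta>) / 2))"
proof (induction hs arbitrary: t x)
  case (Cons h hs)
  let ?n = "length hs" and ?g = "DP hs (t / 2) f"
  have M: "M \<ge> 0" using H by (simp add: holderH_def)
  have h: "h \<in> CM_space Q" and t: "t / 2 > 0" and g: "?g \<in> bcontfun"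
    using Cons.prems f by (auto intro: DP_bcontfun)
  have "\<bar>dP (t / 2) h ?g x\<bar> \<le> 2 * 2 ^ (?n * ?n) * M * nrm (h # hs) * (t / 2) powr (- ((real ?n + 1 - \<theta>) / 2))"
  proof (cases "hs = []")
    case True
    define e where "e = (\<theta> - 1) / 2"
    have "\<bar>dP (t / 2) h (P (t / 2) f) x\<bar> \<le> 2 * M * CM_norm Q h * (t / 2) powr e"
      unfolding e_def
      using P_holder[OF f H, of "t / 2"]
      by (intro dP_bound_L2(2)[OF h t P_bcontfun[OF f] \<theta>]) (auto simp: holderH_def)
    moreover have "- ((real ?n + 1 - \<theta>) / 2) = e" using True by (simp add: e_def minus_divide_left)
    ultimately show ?thesis using True by (simp only:) simp
  next
    case False
    have "\<bar>?g y\<bar> \<le> 2 ^ (?n * ?n + 1) * M * nrm hs * (t / 2) powr (- ((real ?n - \<theta>) / 2))" for y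
      using Cons False by simp
    from dP_sup_bound[OF h t g this, of x]
    have "\<bar>dP (t / 2) h ?g x\<bar> \<le> 2 * 2 ^ (?n * ?n) * M * nrm (h # hs) * ((t / 2) powr (- ((real ?n - \<theta>) / 2)) / sqrt (t / 2))"
      by (simp add: mult_ac)
    also have "(t / 2) powr (- ((real ?n - \<theta>) / 2)) / sqrt (t / 2) = (t / 2) powr (- ((real ?n + 1 - \<theta>) / 2))"
    proof -
      have "(t / 2) powr (- ((real ?n - \<theta>) / 2)) / (t / 2) powr (1 / 2) = (t / 2) powr (- ((real ?n - \<theta>) / 2) - 1 / 2)"
        by (rule powr_diff[symmetric])
      also have "- ((real ?n - \<theta>) / 2) - 1 / 2 = - ((real ?n + 1 - \<theta>) / 2)"
        by (simp add: diff_divide_distrib add_divide_distrib)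
      finally show ?thesis using t by (simp add: powr_half_sqrt)
    qed
    finally show ?thesis .
  qed
  also have "(t / 2) powr (- ((real ?n + 1 - \<theta>) / 2)) = 2 powr ((real ?n + 1 - \<theta>) / 2) * t powr (- ((real ?n + 1 - \<theta>) / 2))"
    using t by (intro half_powr) simp
  also have "2 * 2 ^ (?n * ?n) * M * nrm (h # hs) * (2 powr ((real ?n + 1 - \<theta>) / 2) * t powr (- ((real ?n + 1 - \<theta>) / 2)))
      = (2 * M * nrm (h # hs) * t powr (- ((real ?n + 1 - \<theta>) / 2))) * (2 ^ (?n * ?n) * 2 powr ((real ?n + 1 - \<theta>) / 2))"
    by (simp add: mult_ac)
  also have "\<dots> \<le> (2 * M * nrm (h # hs) * t powr (- ((real ?n + 1 - \<theta>) / 2))) * 2 ^ (Suc ?n * Suc ?n)"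
    using M nrm_nonneg[of "h # hs"] \<theta>
    by (intro mult_left_mono two_powr_le mult_nonneg_nonneg) (auto simp: field_simps)
  finally show ?case by (simp add: mult_ac add.commute)
qed simp

section \<open>Multilinearity and measurability in time of the iterated derivatives\<close>

lemma DP_add_slot:
  "set hs \<subseteq> CM_space Q \<Longrightarrow> i < length hs \<Longrightarrow> a \<in> CM_space Q \<Longrightarrow> b \<in> CM_space Q \<Longrightarrow> 0 < t \<Longrightarrow> f \<in> bcontfun \<Longrightarrow>
    DP (hs[i := a + b]) t f = (\<lambda>x. DP (hs[i := a]) t f x + DP (hs[i := b]) t f x)"
proof (induction hs arbitrary: i t)
  case (Cons h hs)
  show ?case
  proof (cases i)
    case 0
    then show ?thesis using Cons.prems by (auto intro!: ext dP_add_direction DP_bcontfun)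
  next
    case (Suc j)
    have sub: "set (hs[j := c]) \<subseteq> CM_space Q" if "c \<in> CM_space Q" for c
      using Cons.prems(1) that set_update_subset_insert[of hs j c] by auto
    have "DP (hs[j := a + b]) (t / 2) f = (\<lambda>x. 1 * DP (hs[j := a]) (t / 2) f x + DP (hs[j := b]) (t / 2) f x)"
      using Cons Suc by simp
    moreover have "dP (t / 2) h (\<lambda>x. 1 * DP (hs[j := a]) (t / 2) f x + DP (hs[j := b]) (t / 2) f x) x =
        1 * dP (t / 2) h (DP (hs[j := a]) (t / 2) f) x + dP (t / 2) h (DP (hs[j := b]) (t / 2) f) x" for x
      using Cons.prems sub by (intro dP_lincomb DP_bcontfun) auto
    ultimately show ?thesis using Suc by auto
  qed
qed simp

lemma DP_scale_slot:
  "set hs \<subseteq> CM_space Q \<Longrightarrow> i < length hs \<Longrightarrow> a \<in> CM_space Q \<Longrightarrow> 0 < t \<Longrightarrow> f \<in> bcontfun \<Longrightarrow>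
    DP (hs[i := c *\<^sub>R a]) t f = (\<lambda>x. c * DP (hs[i := a]) t f x)"
proof (induction hs arbitrary: i t)
  case (Cons h hs)
  show ?case
  proof (cases i)
    case 0
    then show ?thesis using Cons.prems by (auto intro!: ext dP_scale DP_bcontfun)
  next
    case (Suc j)
    have sub: "set (hs[j := a]) \<subseteq> CM_space Q"
      using Cons.prems set_update_subset_insert[of hs j a] by auto
    have z: "(\<lambda>_::'a. 0::real) \<in> bcontfun" by (intro bcontfunI'[of _ 0]) auto
    have z0: "dP (t / 2) h (\<lambda>_. 0) x = 0" for x
      using dP_sup_bound[of h "t / 2" "\<lambda>_. 0" 0 x] Cons.prems z by simp
    have "DP (hs[j := c *\<^sub>R a]) (t / 2) f = (\<lambda>x. c * DP (hs[j := a]) (t / 2) f x + 0)"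
      using Cons Suc by simp
    moreover have "dP (t / 2) h (\<lambda>x. c * DP (hs[j := a]) (t / 2) f x + 0) x =
        c * dP (t / 2) h (DP (hs[j := a]) (t / 2) f) x + dP (t / 2) h (\<lambda>_. 0) x" for x
      using Cons.prems sub z by (intro dP_lincomb DP_bcontfun) auto
    ultimately show ?thesis using Suc z0 by auto
  qed
qed simp

text \<open>Each derivative is a limit of difference quotients with steps
  \<open>1 / (j + 1)\<close>, so measurability in \<open>t\<close> is inherited from the continuity
  of \<open>P t f x\<close> in \<open>t\<close>. The indicator restricts to the times at which the
  derivative is known to exist.\<close>

lemma DP_measurable:
  "set hs \<subseteq> CM_space Q \<Longrightarrow> f \<in> bcontfun \<Longrightarrow> (\<lambda>t. indicator {0<..} t * DP hs t f x) \<in> borel_measurable borel"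
proof (induction hs arbitrary: x)
  case Nil
  have [measurable]: "(\<lambda>t. P t f x) \<in> borel_measurable borel"
    by (intro borel_measurable_continuous_onI P_continuous_time Nil)
  show ?case by simp
next
  case (Cons h hs)
  have [measurable]: "(\<lambda>t. indicator {0<..} t * DP hs t f x) \<in> borel_measurable borel" for x
    using Cons by auto
  show ?case
  proof (rule borel_measurable_LIMSEQ_real)
    fix t :: real
    let ?q = "\<lambda>j. (indicator {0<..} t * DP hs t f (x + (1 / real (Suc j)) *\<^sub>R h) - indicator {0<..} t * DP hs t f x) / (1 / real (Suc j))"
    show "?q \<longlonglongrightarrow> indicator {0<..} t * DP (h # hs) t f x"
    proof (cases "t > 0")
      case True
      have "((\<lambda>a. (DP hs t f (x + a *\<^sub>R h) - DP hs t f x) / a) \<longlongrightarrow> DP (h # hs) t f x) (at 0)"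
        using DP_derivative[of hs h t f x 0] Cons.prems True by (simp add: has_field_derivative_iff)
      moreover have "(\<lambda>j. 1 / real (Suc j)) \<longlonglongrightarrow> 0" by (rule LIMSEQ_Suc[OF lim_1_over_n])
      ultimately have "((\<lambda>a. (DP hs t f (x + a *\<^sub>R h) - DP hs t f x) / a) \<circ> (\<lambda>j. 1 / real (Suc j))) \<longlonglongrightarrow> DP (h # hs) t f x"
        by (subst (asm) tendsto_at_iff_sequentially) auto
      then show ?thesis using True by (simp add: o_def)
    qed simp
    show "(\<lambda>t. (indicator {0<..} t * DP hs t f (x + (1 / real (Suc j)) *\<^sub>R h) - indicator {0<..} t * DP hs t f x) / (1 / real (Suc j))) \<in> borel_measurable borel" for j
      by measurable
  qed
qed

end

section \<open>The resolvent of the fractional power\<close>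

locale frac_op = cov_op Q + stable_density s \<eta>
  for Q :: "'a::{real_inner, polish_space} \<Rightarrow>\<^sub>L 'a" and s :: real and \<eta> :: "real \<Rightarrow> real \<Rightarrow> real"
begin

definition U :: "real \<Rightarrow> ('a \<Rightarrow> real) \<Rightarrow> 'a \<Rightarrow> real" where
  "U l f x = (1 / l) * (\<integral>\<sigma>. P \<sigma> f x \<partial>K l)"

lemma P_time:
  assumes f: "f \<in> bcontfun"
  shows "continuous_on UNIV (\<lambda>t. P t f x)" "(\<lambda>t. P t f x) \<in> borel_measurable borel"
  using P_continuous_time[OF f] by (auto intro: borel_measurable_continuous_onI)

lemma K_integrable_P:
  assumes l: "0 < l" and f: "f \<in> bcontfun"
  shows "integrable (K l) (\<lambda>\<sigma>. P \<sigma> f x)"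
proof -
  interpret prob_space "K l" by (rule prob_K[OF l])
  obtain B where B: "\<And>x. \<bar>f x\<bar> \<le> B" using bcontfun_bound[OF f] by metis
  show ?thesis by (rule integrable_const_bound[of _ B]) (use P_abs_le[OF f B] P_time(2)[OF f] in auto)
qed

lemma S_resolvent_eq:
  assumes l: "0 < l" and f: "f \<in> bcontfun"
  shows "(LBINT t:{0<..}. exp (- l * t) * S_sg Q \<eta> t f x) = U l f x"
proof -
  obtain B where B: "\<And>x. \<bar>f x\<bar> \<le> B" using bcontfun_bound[OF f] by metis
  have "S_sg Q \<eta> t f x = (\<integral>\<sigma>. P (t powr (1 / s) * \<sigma>) f x \<partial>N 1)" if t: "t > 0" for t
  proof -
    have "S_sg Q \<eta> t f x = (LBINT \<sigma>:{0<..}. P \<sigma> f x * \<eta> t \<sigma>)"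
      using t unfolding S_sg_def set_lebesgue_integral_def
      by (auto intro!: Bochner_Integration.integral_cong simp: P_sg_eq[OF _ f] split: split_indicator)
    also have "\<dots> = (\<integral>\<sigma>. P (t powr (1 / s) * \<sigma>) f x \<partial>N 1)"
      by (rule stable_integral[OF t P_time(1)[OF f] P_abs_le[OF f B]])
    finally show ?thesis .
  qed
  then have "(LBINT t:{0<..}. exp (- l * t) * S_sg Q \<eta> t f x) =
      (LBINT t:{0<..}. exp (- l * t) * (\<integral>\<sigma>. P (t powr (1 / s) * \<sigma>) f x \<partial>N 1))"
    unfolding set_lebesgue_integral_def
    by (intro Bochner_Integration.integral_cong) (auto split: split_indicator)
  also have "\<dots> = U l f x"
    unfolding U_def by (rule K_resolvent[OF l P_time(1)[OF f] P_abs_le[OF f B]])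
  finally show ?thesis .
qed

lemma U_abs_le:
  assumes l: "0 < l" and f: "f \<in> bcontfun" and B: "\<And>x. \<bar>f x\<bar> \<le> B"
  shows "\<bar>U l f x\<bar> \<le> B / l"
proof -
  interpret prob_space "K l" by (rule prob_K[OF l])
  have "\<bar>\<integral>\<sigma>. P \<sigma> f x \<partial>K l\<bar> \<le> (\<integral>\<sigma>. \<bar>P \<sigma> f x\<bar> \<partial>K l)" by (rule integral_abs_bound)
  also have "\<dots> \<le> (\<integral>\<sigma>. B \<partial>K l)"
    using K_integrable_P[OF l f] P_abs_le[OF f B] by (intro integral_mono) auto
  finally show ?thesis using l by (simp add: U_def prob_space abs_mult divide_right_mono)
qed

lemma U_bcontfun:
  assumes l: "0 < l" and f: "f \<in> bcontfun"
  shows "U l f \<in> bcontfun"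
proof -
  interpret prob_space "K l" by (rule prob_K[OF l])
  obtain B where B: "\<And>x. \<bar>f x\<bar> \<le> B" using bcontfun_bound[OF f] by metis
  have [measurable]: "(\<lambda>t. P t f x) \<in> borel_measurable borel" for x by (rule P_time(2)[OF f])
  have "continuous_on UNIV (U l f)"
    unfolding continuous_on_sequentially
  proof (intro allI ballI impI, elim conjE)
    fix X :: "nat \<Rightarrow> 'a" and x assume X: "X \<longlonglongrightarrow> x"
    have "(\<lambda>n. \<integral>\<sigma>. P \<sigma> f (X n) \<partial>K l) \<longlonglongrightarrow> (\<integral>\<sigma>. P \<sigma> f x \<partial>K l)"
      by (rule integral_dominated_convergence[where w = "\<lambda>_. B"])
        (use P_abs_le[OF f B] P_tendsto[OF f tendsto_const X] in auto)
    then show "(U l f \<circ> X) \<longlonglongrightarrow> U l f x" unfolding U_def o_def by (intro tendsto_mult_left)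
  qed
  then show ?thesis using U_abs_le[OF l f B] by (rule bcontfunI')
qed

lemma U_lincomb:
  assumes l: "0 < l" and f: "f \<in> bcontfun" "g \<in> bcontfun"
  shows "U l (\<lambda>x. c * f x + g x) x = c * U l f x + U l g x"
  unfolding U_def P_lincomb[OF f] using K_integrable_P[OF l f(1)] K_integrable_P[OF l f(2)]
  by (simp add: algebra_simps add_divide_distrib)

text \<open>Fubini for the Gaussian measure and \<open>K m\<close>, followed by the semigroup law:
  the composition averages the heat semigroup over the convolution of \<open>K l\<close> and
  \<open>K m\<close>.\<close>

lemma U_U:
  assumes l: "0 < l" and m: "0 < m" and f: "f \<in> bcontfun"
  shows "U l (U m f) x = (1 / (l * m)) * (\<integral>\<sigma>. (\<integral>\<tau>. P (\<sigma> + \<tau>) f x \<partial>K m) \<partial>K l)"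
proof -
  interpret g: prob_space \<gamma> by (rule prob_\<gamma>)
  interpret Km: prob_space "K m" by (rule prob_K[OF m])
  interpret gK: pair_prob_space \<gamma> "K m" ..
  have [measurable]: "f \<in> borel_measurable borel" by (rule bcontfun_measurable[OF f])
  obtain B where B: "\<And>x. \<bar>f x\<bar> \<le> B" using bcontfun_bound[OF f] by metis
  have [measurable]: "(\<lambda>t. P t f x) \<in> borel_measurable borel" for x by (rule P_time(2)[OF f])
  have "P \<sigma> (U m f) x = (1 / m) * (\<integral>\<tau>. P (\<sigma> + \<tau>) f x \<partial>K m)" if \<sigma>: "0 < \<sigma>" for \<sigma>
  proof -
    have i: "integrable (\<gamma> \<Otimes>\<^sub>M K m) (\<lambda>(y, \<tau>). P \<tau> f (x + sqrt \<sigma> *\<^sub>R y))"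
    proof (rule gK.P.integrable_const_bound[of _ B])
      show "(\<lambda>(y, \<tau>). P \<tau> f (x + sqrt \<sigma> *\<^sub>R y)) \<in> borel_measurable (\<gamma> \<Otimes>\<^sub>M K m)"
        unfolding P_def by measurable
    qed (use P_abs_le[OF f B] in auto)
    have "P \<sigma> (U m f) x = (1 / m) * (\<integral>y. (\<integral>\<tau>. P \<tau> f (x + sqrt \<sigma> *\<^sub>R y) \<partial>K m) \<partial>\<gamma>)"
      by (simp add: P_def[of \<sigma>] U_def)
    also have "(\<integral>y. (\<integral>\<tau>. P \<tau> f (x + sqrt \<sigma> *\<^sub>R y) \<partial>K m) \<partial>\<gamma>) = (\<integral>\<tau>. (\<integral>y. P \<tau> f (x + sqrt \<sigma> *\<^sub>R y) \<partial>\<gamma>) \<partial>K m)"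
      using gK.Fubini_integral[OF i] by simp
    also have "\<dots> = (\<integral>\<tau>. P (\<sigma> + \<tau>) f x \<partial>K m)"
    proof (rule integral_cong_AE)
      show "AE \<tau> in K m. (\<integral>y. P \<tau> f (x + sqrt \<sigma> *\<^sub>R y) \<partial>\<gamma>) = P (\<sigma> + \<tau>) f x"
        using K_pos[OF m] by eventually_elim (use P_add[OF f, of \<sigma> _ x] \<sigma> in \<open>simp add: P_def[of \<sigma> "P _ f"]\<close>)
      show "(\<lambda>\<tau>. \<integral>y. P \<tau> f (x + sqrt \<sigma> *\<^sub>R y) \<partial>\<gamma>) \<in> borel_measurable (K m)"
        unfolding P_def by measurable
    qed measurable
    finally show ?thesis .
  qed
  then have "AE \<sigma> in K l. P \<sigma> (U m f) x = (1 / m) * (\<integral>\<tau>. P (\<sigma> + \<tau>) f x \<partial>K m)"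
    using K_pos[OF l] by (auto elim!: eventually_mono)
  moreover have "(\<lambda>\<sigma>. (1 / m) * (\<integral>\<tau>. P (\<sigma> + \<tau>) f x \<partial>K m)) \<in> borel_measurable (K l)" by measurable
  moreover have "(\<lambda>\<sigma>. P \<sigma> (U m f) x) \<in> borel_measurable (K l)"
    using P_time(2)[OF U_bcontfun[OF m f]] by simp
  ultimately have "(\<integral>\<sigma>. P \<sigma> (U m f) x \<partial>K l) = (\<integral>\<sigma>. (1 / m) * (\<integral>\<tau>. P (\<sigma> + \<tau>) f x \<partial>K m) \<partial>K l)"
    by (intro integral_cong_AE)
  then show ?thesis by (simp add: U_def[of l])
qed

text \<open>A linear relation between \<open>K l\<close>, \<open>K m\<close> and their convolution,
  verified on Laplace transforms: with \<open>A = a powr s\<close> it is the partial fraction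
  identity \<open>1 / (l + A) - 1 / (m + A) = (m - l) / ((l + A) * (m + A))\<close>.\<close>

lemma resolvent_identity:
  assumes l: "0 < l" and m: "0 < m" and f: "f \<in> bcontfun"
  shows "U l f x - U m f x = (m - l) * U l (U m f) x"
proof -
  interpret Kl: prob_space "K l" by (rule prob_K[OF l])
  interpret Km: prob_space "K m" by (rule prob_K[OF m])
  interpret KK: pair_prob_space "K l" "K m" ..
  obtain B where B: "\<And>x. \<bar>f x\<bar> \<le> B" using bcontfun_bound[OF f] by metis
  have [measurable]: "(\<lambda>t. P t f x) \<in> borel_measurable borel" by (rule P_time(2)[OF f])
  define C where "C = distr (K l \<Otimes>\<^sub>M K m) borel (\<lambda>(\<sigma>, \<tau>). \<sigma> + \<tau>)"
  have Cint: "(\<integral>x. g x \<partial>C) = (\<integral>\<sigma>. (\<integral>\<tau>. g (\<sigma> + \<tau>) \<partial>K m) \<partial>K l)"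
    if g[measurable]: "g \<in> borel_measurable borel" and b: "AE p in K l \<Otimes>\<^sub>M K m. \<bar>g (fst p + snd p)\<bar> \<le> bd" for g :: "real \<Rightarrow> real" and bd :: real
  proof -
    have i: "integrable (K l \<Otimes>\<^sub>M K m) (\<lambda>(\<sigma>, \<tau>). g (\<sigma> + \<tau>))"
      by (rule KK.P.integrable_const_bound[of _ bd]) (use b in \<open>auto simp: case_prod_unfold\<close>)
    have "(\<integral>x. g x \<partial>C) = (\<integral>p. (\<lambda>(\<sigma>, \<tau>). g (\<sigma> + \<tau>)) p \<partial>(K l \<Otimes>\<^sub>M K m))"
      unfolding C_def by (subst integral_distr) (auto simp: case_prod_unfold)
    then show ?thesis using KK.integral_fst[OF i] by simp
  qed
  have pp: "AE p in K l \<Otimes>\<^sub>M K m. 0 < fst p + snd p"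
  proof (rule KK.AE_pair_measure)
    show "AE x in K l. AE y in K m. 0 < fst (x, y) + snd (x, y)"
      using K_pos[OF l]
    proof eventually_elim
      case (elim x)
      show ?case using K_pos[OF m] by eventually_elim (use elim in simp)
    qed
  qed measurable
  define M where "M i = (if i = 0 then K l else if i = 1 then K m else C)" for i :: nat
  \<comment> \<open>The denominators \<open>l\<close>, \<open>m\<close> and \<open>l * m\<close>
    cancel the numerators of the three Laplace transforms.\<close>
  define c where "c i = (if i = 0 then 1 / l else if i = 1 then - 1 / m else - (m - l) / (l * m))" for i :: nat
  have "(\<Sum>i\<in>{0, 1, 2}. c i * (\<integral>\<sigma>. P \<sigma> f x \<partial>M i)) = 0"
  proof (rule laplace_unique[where B = B])
    fix i :: nat assume "i \<in> {0, 1, 2}"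
    have "prob_space C" unfolding C_def by (rule KK.P.prob_space_distr) measurable
    then have "prob_space (M i)" using prob_K l m by (simp add: M_def)
    then show "finite_measure (M i)" by (rule prob_space.finite_measure)
    show "sets (M i) = sets borel" by (simp add: M_def C_def)
    have "AE x in C. 0 < x" unfolding C_def using pp by (subst AE_distr_iff) (auto simp: case_prod_unfold)
    moreover have "M i = K l \<or> M i = K m \<or> M i = C" by (simp add: M_def)
    ultimately show "AE x in M i. 0 < x" using K_pos[OF l] K_pos[OF m] by metis
  next
    fix k :: nat
    let ?a = "real k powr s"
    have b1: "AE p in K l \<Otimes>\<^sub>M K m. \<bar>exp (- (real k * (fst p + snd p)))\<bar> \<le> 1"
      using pp by eventually_elim simp
    have "(\<integral>x. exp (- (real k * x)) \<partial>C) = (\<integral>\<sigma>. (\<integral>\<tau>. exp (- (real k * (\<sigma> + \<tau>))) \<partial>K m) \<partial>K l)"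
      by (rule Cint[OF _ b1]) measurable
    also have "\<dots> = (\<integral>\<sigma>. (\<integral>\<tau>. exp (- (real k * \<sigma>)) * exp (- (real k * \<tau>)) \<partial>K m) \<partial>K l)"
      by (simp add: exp_add[symmetric] distrib_left)
    also have "\<dots> = (l / (l + ?a)) * (m / (m + ?a))" by (simp add: K_laplace l m)
    finally have C': "(\<integral>x. exp (- (real k * x)) \<partial>C) = (l / (l + ?a)) * (m / (m + ?a))" .
    have p: "l + ?a > 0" "m + ?a > 0" using l m by (simp_all add: add_pos_nonneg)
    have "(1 / l) * (l / (l + ?a)) + (- 1 / m) * (m / (m + ?a)) + (- (m - l) / (l * m)) * ((l / (l + ?a)) * (m / (m + ?a))) = 0"
    proof -
      have "(1 / l) * (l / (l + ?a)) = 1 / (l + ?a)" "(- 1 / m) * (m / (m + ?a)) = - 1 / (m + ?a)"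
        "(- (m - l) / (l * m)) * ((l / (l + ?a)) * (m / (m + ?a))) = - (m - l) / ((l + ?a) * (m + ?a))"
        using l m by simp_all
      moreover have "1 / (l + ?a) + - 1 / (m + ?a) + - (m - l) / ((l + ?a) * (m + ?a)) = 0"
      proof -
        have "1 / X + - 1 / Y + - (Y - X) / (X * Y) = 0" if "X > 0" "Y > 0" for X Y :: real
          using that by (simp add: field_simps)
        from this[OF p] show ?thesis by (simp only: add_diff_cancel_right)
      qed
      ultimately show ?thesis by (simp only:)
    qed
    then show "(\<Sum>i\<in>{0, 1, 2}. c i * (\<integral>x. exp (- (real k * x)) \<partial>M i)) = 0"
      by (simp add: c_def M_def C' K_laplace l m add.assoc)
  qed (use P_time(1)[OF f] P_abs_le[OF f B] in auto)
  then have "(1 / l) * (\<integral>\<sigma>. P \<sigma> f x \<partial>K l) + ((- 1 / m) * (\<integral>\<sigma>. P \<sigma> f x \<partial>K m) +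
      (- (m - l) / (l * m)) * (\<integral>\<sigma>. P \<sigma> f x \<partial>C)) = 0"
    by (simp add: c_def M_def)
  moreover have "(- 1 / m) * Y = - ((1 / m) * Y)" "(- (m - l) / (l * m)) * Y = - (((m - l) / (l * m)) * Y)" for Y
    by (simp_all only: minus_divide_left[symmetric] mult_minus_left)
  ultimately have "(1 / l) * (\<integral>\<sigma>. P \<sigma> f x \<partial>K l) - (1 / m) * (\<integral>\<sigma>. P \<sigma> f x \<partial>K m) = ((m - l) / (l * m)) * (\<integral>\<sigma>. P \<sigma> f x \<partial>C)"
    by linarith
  moreover have "AE p in K l \<Otimes>\<^sub>M K m. \<bar>P (fst p + snd p) f x\<bar> \<le> B"
    using P_abs_le[OF f B] by (intro AE_I2)
  then have "(\<integral>\<sigma>. P \<sigma> f x \<partial>C) = (\<integral>\<sigma>. (\<integral>\<tau>. P (\<sigma> + \<tau>) f x \<partial>K m) \<partial>K l)"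
    by (intro Cint) measurable
  ultimately show ?thesis unfolding U_U[OF l m f] by (simp add: U_def)
qed

text \<open>By the resolvent identity all resolvents of \<open>f\<close> vanish. As \<open>l\<close>
  grows, \<open>K l\<close> concentrates at \<open>0\<close>, and since
  \<open>P \<sigma> f x\<close> is continuous in \<open>\<sigma>\<close>, its averages recover
  \<open>f x\<close>. The argument is pointwise because the convergence as \<open>\<sigma>\<close>
  tends to \<open>0\<close> need not be uniform in \<open>x\<close>.\<close>

lemma U_injective:
  assumes f: "f \<in> bcontfun" and z: "\<And>x. U 1 f x = 0"
  shows "f x = 0"
proof -
  obtain B where B: "\<And>x. \<bar>f x\<bar> \<le> B" "B \<ge> 0" using bcontfun_bound[OF f] by metis
  let ?g = "\<lambda>\<sigma>. P \<sigma> f x"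
  have zl: "(\<integral>\<sigma>. ?g \<sigma> \<partial>K l) = 0" if l: "0 < l" for l
  proof -
    have "U 1 f = (\<lambda>_. 0)" using z by auto
    then have "U l (U 1 f) x = 0" by (simp add: U_def P_const)
    then have "U l f x = 0" using resolvent_identity[OF l zero_less_one f, of x] z by simp
    then show ?thesis using l by (simp add: U_def)
  qed
  have g0: "?g 0 = f x"
  proof -
    interpret prob_space \<gamma> by (rule prob_\<gamma>)
    show ?thesis by (simp add: P_def prob_space)
  qed
  have "\<bar>f x\<bar> \<le> 0"
  proof (rule field_le_epsilon)
    fix e :: real assume e: "e > 0"
    have "isCont ?g 0" using P_time(1)[OF f] by (simp add: continuous_on_eq_continuous_at)
    then obtain v where v: "v > 0" "\<And>\<sigma>. \<bar>\<sigma>\<bar> < v \<Longrightarrow> \<bar>?g \<sigma> - ?g 0\<bar> < e / 2"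
      using e unfolding isCont_def LIM_eq by (metis half_gt_zero diff_zero abs_zero diff_self real_norm_def)
    \<comment> \<open>For \<open>\<sigma> \<ge> v\<close> the difference is at most
      \<open>2 * B\<close>, and \<open>c\<close> scales \<open>1 - exp (- \<sigma>)\<close> so as to
      dominate it. The mean of this majorant under \<open>K l\<close> is \<open>c / (l + 1)\<close>,
      at most \<open>e / 2\<close> for the \<open>l\<close> chosen later.\<close>
    define c where "c = 2 * B / (1 - exp (- v))"
    have ev: "1 - exp (- v) > 0" using v by simp
    have c: "c \<ge> 0" unfolding c_def using B ev by (intro divide_nonneg_pos) auto
    have pt: "\<bar>?g \<sigma> - f x\<bar> \<le> e / 2 + c * (1 - exp (- (1 * \<sigma>)))" if \<sigma>: "0 < \<sigma>" for \<sigma>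
    proof (cases "\<sigma> < v")
      case True
      then have "\<bar>?g \<sigma> - f x\<bar> < e / 2" using v(2)[of \<sigma>] \<sigma> g0 by simp
      moreover have "0 \<le> c * (1 - exp (- (1 * \<sigma>)))" using c \<sigma> by (intro mult_nonneg_nonneg) auto
      ultimately show ?thesis by linarith
    next
      case False
      have "\<bar>?g \<sigma> - f x\<bar> \<le> 2 * B" using P_abs_le[OF f B(1), of \<sigma> x] B(1)[of x] by linarith
      also have "\<dots> = c * (1 - exp (- v))" using ev by (simp add: c_def)
      also have "\<dots> \<le> c * (1 - exp (- (1 * \<sigma>)))" using False c by (intro mult_left_mono) auto
      finally show ?thesis using e by linarith
    qed
    define l where "l = 2 * c / e + 1"
    have l: "l > 0" using c e by (simp add: l_def add_nonneg_pos)
    interpret K: prob_space "K l" by (rule prob_K[OF l])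
    have ie: "integrable (K l) (\<lambda>\<sigma>. exp (- (1 * \<sigma>)))"
      by (rule K.integrable_const_bound[of _ 1]) (use K_pos[OF l] in \<open>auto elim!: eventually_mono\<close>)
    have "\<bar>f x\<bar> = \<bar>\<integral>\<sigma>. ?g \<sigma> - f x \<partial>K l\<bar>"
      using zl[OF l] K_integrable_P[OF l f] by (simp add: K.prob_space)
    also have "\<dots> \<le> (\<integral>\<sigma>. \<bar>?g \<sigma> - f x\<bar> \<partial>K l)" by (rule integral_abs_bound)
    also have "\<dots> \<le> (\<integral>\<sigma>. e / 2 + c * (1 - exp (- (1 * \<sigma>))) \<partial>K l)"
    proof (rule integral_mono_AE)
      show "AE \<sigma> in K l. \<bar>?g \<sigma> - f x\<bar> \<le> e / 2 + c * (1 - exp (- (1 * \<sigma>)))"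
        using K_pos[OF l] by eventually_elim (rule pt)
    qed (use K_integrable_P[OF l f] ie in auto)
    also have "\<dots> = e / 2 + c * (1 - l / (l + 1))"
    proof -
      have "(\<integral>\<sigma>. exp (- (1 * \<sigma>)) \<partial>K l) = l / (l + 1)" using K_laplace[OF l, of 1] by simp
      then show ?thesis using ie by (simp add: K.prob_space)
    qed
    also have "\<dots> = e / 2 + c / (l + 1)" using l by (simp add: field_simps)
    also have "\<dots> \<le> 0 + e"
    proof -
      have "c \<le> (e / 2) * (l + 1)" using e c by (simp add: l_def field_simps)
      then have "c / (l + 1) \<le> e / 2" using l by (simp add: divide_le_eq)
      then show ?thesis by linarith
    qed
    finally show "\<bar>f x\<bar> \<le> 0 + e" .
  qed
  then show ?thesis by simp
qed

section \<open>The operator with the given resolvent\<close>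

definition R :: "real \<Rightarrow> ('a \<Rightarrow>\<^sub>C real) \<Rightarrow> ('a \<Rightarrow>\<^sub>C real)" where
  "R = S_resolvent Q \<eta>"

lemma bcf: "apply_bcontfun f \<in> bcontfun" by (rule apply_bcontfun)

lemma R_apply:
  assumes l: "0 < l"
  shows "apply_bcontfun (R l f) = U l (apply_bcontfun f)"
  unfolding R_def S_resolvent_def S_resolvent_eq[OF l bcf]
  using Bcontfun_inverse[OF U_bcontfun[OF l bcf]] by simp

lemma R_lincomb:
  assumes l: "0 < l"
  shows "R l (c *\<^sub>R f + g) = c *\<^sub>R R l f + R l g"
proof (rule bcontfun_eqI)
  fix x
  have "apply_bcontfun (c *\<^sub>R f + g) = (\<lambda>x. c * apply_bcontfun f x + apply_bcontfun g x)" by auto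
  then show "apply_bcontfun (R l (c *\<^sub>R f + g)) x = apply_bcontfun (c *\<^sub>R R l f + R l g) x"
    by (simp add: R_apply[OF l] U_lincomb[OF l bcf bcf])
qed

lemma R_add: "0 < l \<Longrightarrow> R l (f + g) = R l f + R l g" using R_lincomb[of l 1 f g] by simp

lemma R_0: "0 < l \<Longrightarrow> R l 0 = 0" using R_lincomb[of l 1 0 0] by simp

lemma R_scale: "0 < l \<Longrightarrow> R l (c *\<^sub>R f) = c *\<^sub>R R l f" using R_lincomb[of l c f 0] R_0[of l] by simp

lemma R_norm:
  assumes l: "0 < l"
  shows "norm (R l f) \<le> norm f / l"
proof (rule norm_bound)
  fix x
  have "\<bar>apply_bcontfun f x\<bar> \<le> norm f" for x using norm_bounded[of f x] by simp
  from U_abs_le[OF l bcf this, of x] show "norm (apply_bcontfun (R l f) x) \<le> norm f / l"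
    by (simp add: R_apply[OF l])
qed

lemma R_identity:
  assumes l: "0 < l" and m: "0 < m"
  shows "R l f - R m f = (m - l) *\<^sub>R R l (R m f)"
  by (rule bcontfun_eqI) (simp add: R_apply l m resolvent_identity[OF l m bcf])

lemma R_injective: "R 1 f = 0 \<Longrightarrow> f = 0"
  using U_injective[OF bcf, of f] R_apply[of 1 f] by (intro bcontfun_eqI) (auto simp: fun_eq_iff)

text \<open>A pair \<open>(u, v)\<close> lies in the graph exactly if \<open>R 1\<close> maps
  \<open>u - v\<close> to \<open>u\<close>. Injectivity of \<open>R 1\<close> makes the graph single
  valued, boundedness makes it closed, and the resolvent identity carries the characterisation from
  \<open>1\<close> to every \<open>l\<close>.\<close>

lemma closed_op_R: "closed_op_with_resolvent {(u, v). u = R 1 (u - v)} R"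
proof -
  have bl: "bounded_linear (R 1)"
    by (rule bounded_linear_intro[where K = 1]) (use R_add R_scale R_norm[of 1] in auto)
  let ?A = "{(u, v). u = R 1 (u - v)}"
  have "subspace ?A"
    unfolding subspace_def
  proof (intro conjI ballI allI)
    show "0 \<in> ?A" by (simp add: zero_prod_def R_0)
  next
    fix p q assume "p \<in> ?A" "q \<in> ?A"
    then have "fst p + fst q = R 1 ((fst p - snd p) + (fst q - snd q))"
      by (subst R_add) auto
    then show "p + q \<in> ?A" by (simp add: case_prod_unfold algebra_simps)
  next
    fix c :: real and p assume "p \<in> ?A"
    then have "c *\<^sub>R fst p = R 1 (c *\<^sub>R (fst p - snd p))" by (subst R_scale) auto
    then show "c *\<^sub>R p \<in> ?A" by (simp add: case_prod_unfold scaleR_diff_right)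
  qed
  moreover have "single_valued ?A"
  proof (rule single_valuedI)
    fix u v w assume "(u, v) \<in> ?A" "(u, w) \<in> ?A"
    then have "R 1 (u - v) = R 1 (u - w)" by simp
    then have "R 1 ((u - v) - (u - w)) = 0"
      using linear_diff[OF bounded_linear.linear[OF bl], of "u - v" "u - w"] by (simp only: diff_self)
    then have "(u - v) - (u - w) = 0" by (rule R_injective)
    then show "v = w" by simp
  qed
  moreover have "closed ?A"
  proof -
    have "?A = {p. fst p = R 1 (fst p - snd p)}" by auto
    moreover have "closed {p. fst p = R 1 (fst p - snd p)}"
      by (intro closed_Collect_eq continuous_intros bounded_linear.continuous_on[OF bl])
    ultimately show ?thesis by simp
  qed
  moreover have "(u, l *\<^sub>R u - f) \<in> ?A \<longleftrightarrow> u = R l f" if l: "l > 0" for l f u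
  proof
    assume "(u, l *\<^sub>R u - f) \<in> ?A"
    then have u: "u = R 1 (u - (l *\<^sub>R u - f))" by simp
    define g where "g = u - (l *\<^sub>R u - f)"
    have ug: "u = R 1 g" using u g_def by simp
    have "f = (- (1 - l)) *\<^sub>R u + g" by (simp add: g_def algebra_simps)
    then have "R l f = (- (1 - l)) *\<^sub>R R l u + R l g" using R_lincomb[OF l] by simp
    moreover have "R l g - R 1 g = (1 - l) *\<^sub>R R l (R 1 g)" by (rule R_identity[OF l]) simp
    ultimately have "R l f = R 1 g" using ug by (simp add: algebra_simps)
    then show "u = R l f" using ug by simp
  next
    assume u: "u = R l f"
    have e: "u - (l *\<^sub>R u - f) = (1 - l) *\<^sub>R u + f" by (simp add: algebra_simps)
    have "R 1 (u - (l *\<^sub>R u - f)) = (1 - l) *\<^sub>R R 1 u + R 1 f" unfolding e by (rule R_lincomb) simp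
    moreover have "R 1 f - R l f = (l - 1) *\<^sub>R R 1 (R l f)" by (rule R_identity[OF _ l]) simp
    ultimately have "u = R 1 (u - (l *\<^sub>R u - f))" using u by (simp add: algebra_simps)
    then show "(u, l *\<^sub>R u - f) \<in> ?A" by simp
  qed
  ultimately show ?thesis unfolding closed_op_with_resolvent_def by blast
qed

text \<open>The resolvent condition at \<open>1\<close> already determines the graph, so the
  definite description is the operator of \<open>closed_op_R\<close>; existence and uniqueness of
  solutions follow at once.\<close>

lemma solves_iff:
  assumes l: "0 < l"
  shows "solves Q \<eta> l f u \<longleftrightarrow> u = R l f"
proof -
  have A: "neg_frac_power Q \<eta> = {(u, v). u = R 1 (u - v)}"
    unfolding neg_frac_power_def R_def[symmetric]
  proof (rule the_equality[where P = "\<lambda>A. closed_op_with_resolvent A R"], rule closed_op_R)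
    fix A assume "closed_op_with_resolvent A R"
    then have "\<forall>l>0. \<forall>f u. (u, l *\<^sub>R u - f) \<in> A \<longleftrightarrow> u = R l f"
      unfolding closed_op_with_resolvent_def by (elim conjE)
    from this[rule_format, of 1] have *: "(u, u - f) \<in> A \<longleftrightarrow> u = R 1 f" for f u by simp
    have "(u, v) \<in> A \<longleftrightarrow> u = R 1 (u - v)" for u v using *[of u "u - v"] by simp
    then show "A = {(u, v). u = R 1 (u - v)}" by auto
  qed
  have "solves Q \<eta> l f u \<longleftrightarrow> (u, l *\<^sub>R u - f) \<in> {(u, v). u = R 1 (u - v)}"
  proof -
    have "l *\<^sub>R u - v = f \<longleftrightarrow> v = l *\<^sub>R u - f" for v by (auto simp: algebra_simps)
    then show ?thesis unfolding solves_def A by simp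
  qed
  also have "\<dots> \<longleftrightarrow> u = R l f" using closed_op_R l unfolding closed_op_with_resolvent_def by blast
  finally show ?thesis .
qed

end

section \<open>Forms and derivatives along the Cameron-Martin space\<close>

lemma ennreal_tendsto_0I:
  fixes f :: "'b \<Rightarrow> ennreal"
  assumes "\<And>e. 0 < e \<Longrightarrow> \<forall>\<^sub>F t in F. f t \<le> ennreal e"
  shows "(f \<longlongrightarrow> 0) F"
proof (rule order_tendstoI)
  fix a :: ennreal assume "a < 0"
  then show "\<forall>\<^sub>F x in F. a < f x" by simp
next
  fix a :: ennreal assume "0 < a"
  then obtain b where b: "0 < b" "b < a" using dense by blast
  then have "b < top" using top.not_eq_extremum by fastforce
  then obtain r where r: "b = ennreal r" "0 < r" using b(1) by (cases b) auto
  from assms[OF r(2)] show "\<forall>\<^sub>F x in F. f x < a"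
    by eventually_elim (use b r in \<open>auto intro: le_less_trans\<close>)
qed

context cov_op
begin

lemma H_argsD: "hs \<in> H_args Q k \<Longrightarrow> length hs = k" "hs \<in> H_args Q k \<Longrightarrow> set hs \<subseteq> CM_space Q"
  by (auto simp: H_args_def)

lemma H_args_Cons: "h # hs \<in> H_args Q (Suc k) \<longleftrightarrow> h \<in> CM_space Q \<and> hs \<in> H_args Q k"
  by (auto simp: H_args_def)

lemma H_args_update: "hs \<in> H_args Q k \<Longrightarrow> a \<in> CM_space Q \<Longrightarrow> hs[i := a] \<in> H_args Q k"
  using set_update_subset_insert[of hs i a] by (auto simp: H_args_def)

lemma nrm_pos: "set hs \<subseteq> CM_space Q \<Longrightarrow> 0 \<notin> set hs \<Longrightarrow> 0 < nrm hs"
  by (induction hs) (auto intro!: mult_pos_pos CM_norm_pos)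

lemma form_norm_le:
  assumes C: "0 \<le> C" and T: "\<And>hs. hs \<in> H_args Q n \<Longrightarrow> \<bar>T hs\<bar> \<le> C * nrm hs"
  shows "form_norm Q n T \<le> ennreal C"
  unfolding form_norm_def
proof (rule SUP_least)
  fix hs assume "hs \<in> {hs \<in> H_args Q n. 0 \<notin> set hs}"
  then have hs: "hs \<in> H_args Q n" "0 < nrm hs" using nrm_pos[OF H_argsD(2)] by auto
  then show "ennreal (\<bar>T hs\<bar> / nrm hs) \<le> ennreal C"
    using T[OF hs(1)] by (intro ennreal_leI) (simp add: divide_le_eq)
qed

lemma form_norm_upper:
  assumes "hs \<in> H_args Q n" "0 \<notin> set hs"
  shows "ennreal (\<bar>T hs\<bar> / nrm hs) \<le> form_norm Q n T"
  unfolding form_norm_def by (rule SUP_upper) (use assms in auto)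

text \<open>\<open>form_norm\<close> ranges over lists of nonzero vectors; lists with a zero entry
  are settled by multilinearity instead.\<close>

lemma form_zero:
  assumes T: "T \<in> forms Q n" and hs: "hs \<in> H_args Q n" and z: "0 \<in> set hs"
  shows "T hs = 0"
proof -
  obtain i where i: "i < n" "hs ! i = 0" using z H_argsD(1)[OF hs] by (auto simp: in_set_conv_nth)
  have "T (hs[i := 0 *\<^sub>R 0]) = 0 * T (hs[i := 0])"
    using T hs i(1) CM_0 unfolding forms_def by blast
  moreover have "hs[i := 0 *\<^sub>R 0] = hs" using i by (metis list_update_id scaleR_zero_left)
  ultimately show ?thesis by simp
qed

text \<open>Triangle inequality for the two limits, tested on lists without zero entries; on all
  other lists of the right length both forms vanish by \<open>form_zero\<close>. With this, the
  definite description in \<open>H_deriv\<close> can be evaluated.\<close>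

lemma has_H_derivative_unique:
  assumes G: "has_H_derivative Q n F G x" and G': "has_H_derivative Q n F G' x"
  shows "G = G'"
proof
  fix hs
  have forms: "G \<in> forms Q (Suc n)" "G' \<in> forms Q (Suc n)"
    using G G' by (auto simp: has_H_derivative_def)
  show "G hs = G' hs"
  proof (cases "hs \<in> H_args Q (Suc n) \<and> 0 \<notin> set hs")
    case False
    then show ?thesis using forms form_zero[of G "Suc n" hs] form_zero[of G' "Suc n" hs]
      by (cases "hs \<in> H_args Q (Suc n)") (auto simp: forms_def)
  next
    case True
    then obtain h ks where hs: "hs = h # ks" by (cases hs) (auto simp: H_args_def)
    have h: "h \<in> CM_space Q" and ks: "ks \<in> H_args Q n" "0 \<notin> set ks"
      using True by (auto simp: hs H_args_Cons)
    have np: "0 < nrm ks" using nrm_pos[OF H_argsD(2)] ks by blast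
    define A where "A t ls = (F (x + t *\<^sub>R h) ls - F x ls) / t" for t ls
    have lim: "((\<lambda>t. form_norm Q n (\<lambda>ls. A t ls - G (h # ls))) \<longlongrightarrow> 0) (at 0)"
      "((\<lambda>t. form_norm Q n (\<lambda>ls. A t ls - G' (h # ls))) \<longlongrightarrow> 0) (at 0)"
      using G G' h unfolding has_H_derivative_def A_def by auto
    have "ennreal (\<bar>G hs - G' hs\<bar> / nrm ks) \<le> 0 + 0"
    proof (rule tendsto_lowerbound[OF tendsto_add[OF lim]])
      have "ennreal (\<bar>G hs - G' hs\<bar> / nrm ks) \<le>
          form_norm Q n (\<lambda>ls. A t ls - G (h # ls)) + form_norm Q n (\<lambda>ls. A t ls - G' (h # ls))" for t
      proof -
        have "\<bar>G hs - G' hs\<bar> / nrm ks \<le> \<bar>A t ks - G hs\<bar> / nrm ks + \<bar>A t ks - G' hs\<bar> / nrm ks"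
          using np by (simp add: add_divide_distrib[symmetric] divide_right_mono)
        then have "ennreal (\<bar>G hs - G' hs\<bar> / nrm ks) \<le> ennreal (\<bar>A t ks - G hs\<bar> / nrm ks) + ennreal (\<bar>A t ks - G' hs\<bar> / nrm ks)"
          using np by (simp add: ennreal_plus[symmetric] ennreal_leI del: ennreal_plus)
        also have "\<dots> \<le> form_norm Q n (\<lambda>ls. A t ls - G (h # ls)) + form_norm Q n (\<lambda>ls. A t ls - G' (h # ls))"
          unfolding hs
          using form_norm_upper[OF ks, of "\<lambda>ls. A t ls - G (h # ls)"] form_norm_upper[OF ks, of "\<lambda>ls. A t ls - G' (h # ls)"]
          by (rule add_mono)
        finally show ?thesis .
      qed
      then show "\<forall>\<^sub>F t in at 0. ennreal (\<bar>G hs - G' hs\<bar> / nrm ks) \<le>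
          form_norm Q n (\<lambda>ls. A t ls - G (h # ls)) + form_norm Q n (\<lambda>ls. A t ls - G' (h # ls))"
        by simp
    qed simp
    then have "\<bar>G hs - G' hs\<bar> / nrm ks \<le> 0" by (simp add: ennreal_eq_0_iff)
    then show ?thesis using np by (simp add: divide_le_0_iff)
  qed
qed

lemma mvt_le:
  fixes g :: "real \<Rightarrow> real"
  assumes "\<And>b. (g has_real_derivative g' b) (at b)"
  shows "\<exists>c. \<bar>c\<bar> \<le> \<bar>t\<bar> \<and> g t - g 0 = t * g' c"
proof -
  consider "t > 0" | "t < 0" | "t = 0" by linarith
  then show ?thesis
  proof cases
    case 1
    obtain c where "0 < c" "c < t" "g t - g 0 = (t - 0) * g' c" using MVT2[OF 1, of g g'] assms by blast
    then show ?thesis by (intro exI[of _ c]) auto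
  next
    case 2
    obtain c where "t < c" "c < 0" "g 0 - g t = (0 - t) * g' c" using MVT2[OF 2, of g g'] assms by blast
    then show ?thesis by (intro exI[of _ c]) (auto simp: algebra_simps)
  qed auto
qed

lemma directional_diff_le:
  fixes g g' :: "'a \<Rightarrow> real"
  assumes d: "\<And>x b. ((\<lambda>a. g (x + a *\<^sub>R h)) has_real_derivative g' (x + b *\<^sub>R h)) (at b)"
    and S: "\<And>y. \<bar>g' y\<bar> \<le> S"
  shows "\<bar>g (x + h) - g x\<bar> \<le> S"
proof -
  obtain c where "g (x + 1 *\<^sub>R h) - g (x + 0 *\<^sub>R h) = 1 * g' (x + c *\<^sub>R h)"
    using mvt_le[of "\<lambda>a. g (x + a *\<^sub>R h)" "\<lambda>b. g' (x + b *\<^sub>R h)" 1, OF d] by blast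
  then show ?thesis using S[of "x + c *\<^sub>R h"] by simp
qed

text \<open>Continuity in the norm of forms, stated with real inequalities for all lists, those with
  zero entries included.\<close>

definition locally_uniform :: "nat \<Rightarrow> ('a \<Rightarrow> 'a list \<Rightarrow> real) \<Rightarrow> bool" where
  "locally_uniform k F \<longleftrightarrow> (\<forall>x. \<forall>e>0. \<exists>d>0. \<forall>y. dist y x < d \<longrightarrow> (\<forall>hs\<in>H_args Q k. \<bar>F y hs - F x hs\<bar> \<le> e * nrm hs))"

text \<open>The derivative is required in the norm of forms, hence uniformly in the remaining
  arguments. The mean value theorem is applied to each list separately, and local uniformity of
  \<open>G\<close> controls the intermediate points of all lists at once.\<close>

lemma H_derivI:
  assumes d: "\<And>x b hs h. hs \<in> H_args Q k \<Longrightarrow> h \<in> CM_space Q \<Longrightarrow>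
      ((\<lambda>a. F (x + a *\<^sub>R h) hs) has_real_derivative G (x + b *\<^sub>R h) (h # hs)) (at b)"
    and G: "\<And>x. G x \<in> forms Q (Suc k)" and c: "locally_uniform (Suc k) G"
  shows "has_H_derivative Q k F (G x) x"
  unfolding has_H_derivative_def
proof (intro conjI ballI G)
  fix h assume h: "h \<in> CM_space Q"
  show "((\<lambda>t. form_norm Q k (\<lambda>hs. (F (x + t *\<^sub>R h) hs - F x hs) / t - G x (h # hs))) \<longlongrightarrow> 0) (at 0)"
  proof (rule ennreal_tendsto_0I)
    fix e :: real assume e: "0 < e"
    \<comment> \<open>Adding \<open>1\<close> avoids division by zero at \<open>h = 0\<close>;
      likewise for \<open>\<delta>'\<close>.\<close>
    define e' where "e' = e / (CM_norm Q h + 1)"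
    have h1: "0 < CM_norm Q h + 1" using CM_norm_nonneg[of h] by linarith
    have e': "e' > 0" using e h1 by (simp add: e'_def)
    obtain \<delta> where \<delta>: "\<delta> > 0" "\<And>y hs. dist y x < \<delta> \<Longrightarrow> hs \<in> H_args Q (Suc k) \<Longrightarrow> \<bar>G y hs - G x hs\<bar> \<le> e' * nrm hs"
      using c e' unfolding locally_uniform_def by blast
    define \<delta>' where "\<delta>' = \<delta> / (norm h + 1)"
    have nh: "0 < norm h + 1" using norm_ge_zero[of h] by linarith
    have "\<delta>' > 0" using \<delta> nh by (simp add: \<delta>'_def)
    moreover have "form_norm Q k (\<lambda>hs. (F (x + t *\<^sub>R h) hs - F x hs) / t - G x (h # hs)) \<le> ennreal e"
      if t: "t \<noteq> 0" "dist t 0 < \<delta>'" for t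
    proof (rule form_norm_le)
      fix hs assume hs: "hs \<in> H_args Q k"
      obtain s where s: "\<bar>s\<bar> \<le> \<bar>t\<bar>" "F (x + t *\<^sub>R h) hs - F (x + 0 *\<^sub>R h) hs = t * G (x + s *\<^sub>R h) (h # hs)"
        using mvt_le[of "\<lambda>a. F (x + a *\<^sub>R h) hs" "\<lambda>b. G (x + b *\<^sub>R h) (h # hs)" t, OF d[OF hs h]] by blast
      have "\<bar>s\<bar> * norm h \<le> \<bar>t\<bar> * (norm h + 1)" using s(1) by (intro mult_mono) auto
      also have "\<dots> < \<delta>" using t nh by (simp add: \<delta>'_def less_divide_eq)
      finally have "dist (x + s *\<^sub>R h) x < \<delta>" by (simp add: dist_norm)
      then have "\<bar>G (x + s *\<^sub>R h) (h # hs) - G x (h # hs)\<bar> \<le> e' * nrm (h # hs)"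
        using hs h by (intro \<delta>(2)) (auto simp: H_args_Cons)
      also have "\<dots> = (e' * CM_norm Q h) * nrm hs" by simp
      also have "\<dots> \<le> e * nrm hs"
      proof (rule mult_right_mono[OF _ nrm_nonneg])
        have "e' * CM_norm Q h \<le> e' * (CM_norm Q h + 1)" using e' by simp
        also have "\<dots> = e" using h1 by (simp add: e'_def)
        finally show "e' * CM_norm Q h \<le> e" .
      qed
      finally show "\<bar>(F (x + t *\<^sub>R h) hs - F x hs) / t - G x (h # hs)\<bar> \<le> e * nrm hs"
        using s(2) t by simp
    qed (use e in simp)
    ultimately show "\<forall>\<^sub>F t in at 0. form_norm Q k (\<lambda>hs. (F (x + t *\<^sub>R h) hs - F x hs) / t - G x (h # hs)) \<le> ennreal e"
      unfolding eventually_at by blast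
  qed
qed

text \<open>\<open>H_deriv\<close> is a nested definite description, so the candidates
  \<open>F k\<close> are identified with it by induction on the order, each step making the next
  derivative meaningful.\<close>

lemma H_deriv_chain:
  assumes F0: "\<And>x. F 0 x = H_deriv Q 0 u x"
    and d: "\<And>k x b hs h. k < n \<Longrightarrow> hs \<in> H_args Q k \<Longrightarrow> h \<in> CM_space Q \<Longrightarrow>
      ((\<lambda>a. F k (x + a *\<^sub>R h) hs) has_real_derivative F (Suc k) (x + b *\<^sub>R h) (h # hs)) (at b)"
    and G: "\<And>k x. k < n \<Longrightarrow> F (Suc k) x \<in> forms Q (Suc k)" and c: "\<And>k. k < n \<Longrightarrow> locally_uniform (Suc k) (F (Suc k))"
  shows "k \<le> n \<Longrightarrow> H_deriv Q k u = F k"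
    and "k < n \<Longrightarrow> has_H_derivative Q k (H_deriv Q k u) (F (Suc k) x) x"
proof -
  have *: "k \<le> n \<Longrightarrow> H_deriv Q k u = F k" for k
  proof (induction k)
    case 0
    show ?case using F0 by auto
  next
    case (Suc k)
    then have k: "k < n" by simp
    have h: "has_H_derivative Q k (H_deriv Q k u) (F (Suc k) x) x" for x
      using Suc d[OF k] G[OF k] c[OF k] by (simp del: H_deriv.simps) (intro H_derivI)
    show ?case
      using the_equality[of "\<lambda>G. has_H_derivative Q k (H_deriv Q k u) G _", OF h] has_H_derivative_unique[OF _ h] by auto
  qed
  then show "k \<le> n \<Longrightarrow> H_deriv Q k u = F k" .
  show "has_H_derivative Q k (H_deriv Q k u) (F (Suc k) x) x" if k: "k < n"
    using *[of k] d[OF k] G[OF k] c[OF k] k by (simp del: H_deriv.simps) (intro H_derivI)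
qed

end

section \<open>Regularity of the resolvent\<close>

text \<open>\<open>\<theta>\<close> is the Hoelder exponent of the right-hand side, \<open>0\<close>
  for bounded functions and \<open>\<alpha>\<close> for Hoelder data; both halves of the theorem run
  through this locale.\<close>

locale frac_res = frac_op Q s \<eta>
  for Q :: "'a::{real_inner, polish_space} \<Rightarrow>\<^sub>L 'a" and s :: real and \<eta> :: "real \<Rightarrow> real \<Rightarrow> real" +
  fixes l \<theta> :: real
  assumes l: "0 < l" and \<theta>: "0 \<le> \<theta>" "\<theta> < 1"
begin

definition W :: "('a \<Rightarrow> real) \<Rightarrow> 'a list \<Rightarrow> 'a \<Rightarrow> real \<Rightarrow> real" where
  "W f hs x t = indicator {0<..} t * DP hs t f x"

text \<open>The candidate for the derivative of order \<open>k\<close> of \<open>U l f\<close>,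
  obtained by differentiating under the integral over \<open>K l\<close>.\<close>

definition Fd :: "('a \<Rightarrow> real) \<Rightarrow> nat \<Rightarrow> 'a \<Rightarrow> 'a list \<Rightarrow> real" where
  "Fd f k x hs = (if hs \<in> H_args Q k then (1 / l) * (\<integral>t. W f hs x t \<partial>K l) else 0)"

text \<open>The derivative of order \<open>k\<close> of \<open>P t f\<close> is of size at most a
  constant times \<open>t powr (- q k)\<close>. The condition \<open>q k < s\<close>, which makes
  this power integrable under \<open>K l\<close>, is the same as
  \<open>k < \<theta> + 2 * s\<close>.\<close>

definition q :: "nat \<Rightarrow> real" where "q k = (real k - \<theta>) / 2"

definition bc :: "nat \<Rightarrow> real" where "bc k = 2 ^ (k * k + 1)"

lemma bc_nonneg: "0 \<le> bc k" by (simp add: bc_def)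

lemma bc_mono: "j \<le> k \<Longrightarrow> bc j \<le> bc k"
  unfolding bc_def by (intro power_increasing add_mono mult_mono) auto

lemma q_Suc: "q (Suc k) = q k + 1 / 2" by (simp add: q_def field_simps)

lemma q_nonneg: "1 \<le> k \<Longrightarrow> 0 \<le> q k" using \<theta> by (simp add: q_def)

lemma q_mono: "j \<le> k \<Longrightarrow> q j \<le> q k" by (simp add: q_def)

lemma W_measurable: "f \<in> bcontfun \<Longrightarrow> hs \<in> H_args Q k \<Longrightarrow> W f hs x \<in> borel_measurable borel"
  using DP_measurable[OF H_argsD(2)] by (simp add: W_def[abs_def])

lemma W_bound:
  assumes f: "f \<in> bcontfun" "holderH \<theta> M f" and hs: "hs \<in> H_args Q k" and k: "1 \<le> k"
  shows "\<bar>W f hs x t\<bar> \<le> bc k * M * nrm hs * t powr (- q k)"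
proof (cases "t > 0")
  case True
  have "hs \<noteq> []" using H_argsD(1)[OF hs] k by auto
  from DP_bound_holder[OF f \<theta> H_argsD(2)[OF hs] this True, of x]
  show ?thesis using True H_argsD(1)[OF hs] by (simp add: W_def bc_def q_def)
next
  case False
  have "0 \<le> M" using f by (simp add: holderH_def)
  then show ?thesis using False bc_nonneg[of k] nrm_nonneg[of hs] by (simp add: W_def)
qed

lemma W_integrable:
  assumes f: "f \<in> bcontfun" "holderH \<theta> M f" and hs: "hs \<in> H_args Q k" and k: "k = 0 \<or> q k < s"
  shows "integrable (K l) (W f hs x)"
proof (cases "k = 0")
  case True
  interpret prob_space "K l" by (rule prob_K[OF l])
  obtain B where B: "\<And>x. \<bar>f x\<bar> \<le> B" "0 \<le> B" using bcontfun_bound[OF f(1)] by metis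
  have "hs = []" using H_argsD(1)[OF hs] True by simp
  then have "\<bar>W f hs x t\<bar> \<le> B" for t
    using P_abs_le[OF f(1) B(1), of t x] B(2) by (simp add: W_def split: split_indicator)
  then show ?thesis using W_measurable[OF f(1) hs] by (intro integrable_const_bound[of _ B]) auto
next
  case False
  then have q: "0 \<le> q k" "q k < s" using k q_nonneg[of k] by auto
  have M: "0 \<le> M" using f by (simp add: holderH_def)
  show ?thesis
  proof (rule Bochner_Integration.integrable_bound)
    show "integrable (K l) (\<lambda>t. bc k * M * nrm hs * t powr (- q k))"
      by (intro integrable_mult_right K_powr_integrable l q)
    show "AE t in K l. norm (W f hs x t) \<le> norm (bc k * M * nrm hs * t powr (- q k))"
      using W_bound[OF f hs] False M bc_nonneg[of k] nrm_nonneg[of hs]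
      by (intro AE_I2) (simp add: abs_of_nonneg)
  qed (use W_measurable[OF f(1) hs] in simp)
qed

definition J :: "nat \<Rightarrow> real" where "J k = bc k * (\<integral>t. t powr (- q k) \<partial>K l) / l"

lemma J_nonneg: "0 \<le> J k"
  unfolding J_def using l bc_nonneg[of k] by (intro divide_nonneg_pos mult_nonneg_nonneg) (auto intro!: integral_nonneg_AE)

lemma Fd_bound:
  assumes f: "f \<in> bcontfun" "holderH \<theta> M f" and hs: "hs \<in> H_args Q k" and k: "1 \<le> k" "q k < s"
  shows "\<bar>Fd f k x hs\<bar> \<le> J k * M * nrm hs"
proof -
  have "\<bar>\<integral>t. W f hs x t \<partial>K l\<bar> \<le> (\<integral>t. \<bar>W f hs x t\<bar> \<partial>K l)" by (rule integral_abs_bound)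
  also have "\<dots> \<le> (\<integral>t. bc k * M * nrm hs * t powr (- q k) \<partial>K l)"
    using W_integrable[OF f hs] k q_nonneg
    by (intro integral_mono W_bound[OF f hs] integrable_mult_right K_powr_integrable l integrable_abs) auto
  finally have "\<bar>\<integral>t. W f hs x t \<partial>K l\<bar> \<le> bc k * M * nrm hs * (\<integral>t. t powr (- q k) \<partial>K l)" by simp
  then have "(1 / l) * \<bar>\<integral>t. W f hs x t \<partial>K l\<bar> \<le> (1 / l) * (bc k * M * nrm hs * (\<integral>t. t powr (- q k) \<partial>K l))"
    using l by (intro mult_left_mono) auto
  then show ?thesis using hs l by (simp add: Fd_def J_def abs_mult mult_ac)
qed

lemma Fd_0:
  assumes f: "f \<in> bcontfun"
  shows "Fd f 0 x = H_deriv Q 0 (U l f) x"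
proof
  fix hs
  have [measurable]: "(\<lambda>t. P t f x) \<in> borel_measurable borel" by (rule P_time(2)[OF f])
  have "(\<integral>t. indicator {0<..} t * P t f x \<partial>K l) = (\<integral>t. P t f x \<partial>K l)"
  proof (rule integral_cong_AE)
    show "AE t in K l. indicator {0<..} t * P t f x = P t f x" using K_pos[OF l] by eventually_elim simp
  qed auto
  then show "Fd f 0 x hs = H_deriv Q 0 (U l f) x hs"
    by (auto simp: Fd_def W_def[abs_def] U_def H_args_def)
qed

lemma Fd_derivative:
  assumes f: "f \<in> bcontfun" "holderH \<theta> M f" and hs: "hs \<in> H_args Q k" and h: "h \<in> CM_space Q" and k: "q (Suc k) < s"
  shows "((\<lambda>a. Fd f k (x + a *\<^sub>R h) hs) has_real_derivative Fd f (Suc k) (x + b *\<^sub>R h) (h # hs)) (at b)"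
proof -
  have hhs: "h # hs \<in> H_args Q (Suc k)" using h hs by (simp add: H_args_Cons)
  have k0: "k = 0 \<or> q k < s" using k q_Suc[of k] by auto
  have "((\<lambda>a. \<integral>t. W f hs (x + a *\<^sub>R h) t \<partial>K l) has_real_derivative (\<integral>t. W f (h # hs) (x + b *\<^sub>R h) t \<partial>K l)) (at b)"
  proof (rule has_real_derivative_integral[where e = 1 and g' = "\<lambda>t a. W f (h # hs) (x + a *\<^sub>R h) t" and
        w = "\<lambda>t. bc (Suc k) * M * nrm (h # hs) * t powr (- q (Suc k))"])
    fix a :: real
    show "integrable (K l) (\<lambda>t. W f hs (x + a *\<^sub>R h) t)" by (rule W_integrable[OF f hs k0])
    fix t :: real
    show "((\<lambda>a. W f hs (x + a *\<^sub>R h) t) has_real_derivative W f (h # hs) (x + a *\<^sub>R h) t) (at a)"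
    proof (cases "t > 0")
      case True
      then show ?thesis using DP_derivative[OF H_argsD(2)[OF hs] h True f(1), of x a] by (simp add: W_def)
    qed (simp add: W_def)
    show "\<bar>W f (h # hs) (x + a *\<^sub>R h) t\<bar> \<le> bc (Suc k) * M * nrm (h # hs) * t powr (- q (Suc k))"
      by (rule W_bound[OF f hhs]) simp
  next
    show "integrable (K l) (\<lambda>t. bc (Suc k) * M * nrm (h # hs) * t powr (- q (Suc k)))"
      by (intro integrable_mult_right K_powr_integrable l q_nonneg k) simp
    show "(\<lambda>t. W f (h # hs) (x + b *\<^sub>R h) t) \<in> borel_measurable (K l)"
      using W_measurable[OF f(1) hhs] by simp
  qed simp
  from DERIV_cmult[OF this, of "1 / l"] show ?thesis using hs hhs by (simp add: Fd_def)
qed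

lemma Fd_forms:
  assumes f: "f \<in> bcontfun" "holderH \<theta> M f" and k: "1 \<le> k" "q k < s"
  shows "Fd f k x \<in> forms Q k"
  unfolding forms_def mem_Collect_eq
proof (intro conjI)
  show "\<forall>hs. hs \<notin> H_args Q k \<longrightarrow> Fd f k x hs = 0" by (simp add: Fd_def)
  have M: "0 \<le> M" using f by (simp add: holderH_def)
  have "form_norm Q k (Fd f k x) \<le> ennreal (J k * M)"
    by (intro form_norm_le Fd_bound f k mult_nonneg_nonneg J_nonneg M)
  then show "form_norm Q k (Fd f k x) < \<infinity>" by (rule le_less_trans) simp
  show "\<forall>hs\<in>H_args Q k. \<forall>i<k. \<forall>a\<in>CM_space Q. \<forall>b\<in>CM_space Q. \<forall>c.
      Fd f k x (hs[i := a + b]) = Fd f k x (hs[i := a]) + Fd f k x (hs[i := b]) \<and>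
      Fd f k x (hs[i := c *\<^sub>R a]) = c * Fd f k x (hs[i := a])"
  proof (intro ballI allI impI)
    fix hs i a b c assume hs: "hs \<in> H_args Q k" and i: "i < k" and a: "a \<in> CM_space Q" and b: "b \<in> CM_space Q"
    have il: "i < length hs" using i H_argsD(1)[OF hs] by simp
    note u = H_args_update[OF hs]
    have 1: "W f (hs[i := a + b]) x = (\<lambda>t. W f (hs[i := a]) x t + W f (hs[i := b]) x t)"
      using DP_add_slot[OF H_argsD(2)[OF hs] il a b _ f(1)]
      by (auto simp: W_def distrib_left split: split_indicator)
    have 2: "W f (hs[i := c *\<^sub>R a]) x = (\<lambda>t. c * W f (hs[i := a]) x t)"
      using DP_scale_slot[OF H_argsD(2)[OF hs] il a _ f(1)]
      by (auto simp: W_def split: split_indicator)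
    have I: "integrable (K l) (W f (hs[i := c]) x)" if "c \<in> CM_space Q" for c
      by (rule W_integrable[OF f u[OF that]]) (use k in simp)
    show "Fd f k x (hs[i := a + b]) = Fd f k x (hs[i := a]) + Fd f k x (hs[i := b]) \<and>
      Fd f k x (hs[i := c *\<^sub>R a]) = c * Fd f k x (hs[i := a])"
      using u[OF a] u[OF b] u[OF CM_add[OF a b]] u[OF CM_scale[OF a]] I[OF a] I[OF b]
      by (simp add: Fd_def 1 2 distrib_left)
  qed
qed

lemma Fd_diff:
  assumes f: "f \<in> bcontfun" "holderH \<theta> M f" and hs: "hs \<in> H_args Q k" and k: "k = 0 \<or> q k < s"
  shows "Fd f k y hs - Fd f k x hs = (1 / l) * (\<integral>t. W f hs y t - W f hs x t \<partial>K l)"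
  using W_integrable[OF f hs k] hs by (simp add: Fd_def right_diff_distrib)

text \<open>Of the two bounds in the minimum \<open>m\<close>, the first tends to \<open>0\<close>
  with the shift for each \<open>t\<close>, but its power \<open>t powr (- (k / 2))\<close> may fail
  to be integrable; the second is integrable because \<open>q k < s\<close>, but does not get small.
  Dominated convergence applies to the minimum, in which the list does not occur, so the estimate is
  uniform over lists.\<close>

lemma Fd_locally_uniform:
  assumes f: "f \<in> bcontfun" "holderH \<theta> M f" and k: "1 \<le> k" "q k < s"
  shows "locally_uniform k (Fd f k)"
  unfolding locally_uniform_def
proof (intro allI impI)
  fix x and e :: real assume e: "0 < e"
  have M: "0 \<le> M" using f by (simp add: holderH_def)
  let ?D = "\<lambda>z y. (f (y + z) - f y)\<^sup>2"
  define m where "m z t = min (bc k * t powr (- (real k / 2)) * sqrt (P t (?D z) x)) (2 * bc k * M * t powr (- q k))" for z t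
  have Db: "?D z \<in> bcontfun" for z by (intro bcontfun_square shift_diff_bcontfun f)
  have [measurable]: "(\<lambda>t. P t (?D z) x) \<in> borel_measurable borel" for z by (rule P_time(2)[OF Db])
  have m_m: "m z \<in> borel_measurable borel" for z unfolding m_def by measurable
  have m0: "0 \<le> m z t" for z t
    unfolding m_def using bc_nonneg[of k] M P_nonneg[of "?D z" t x] by auto
  have mb: "m z t \<le> 2 * bc k * M * t powr (- q k)" for z t by (simp add: m_def)
  have Ji: "integrable (K l) (\<lambda>t. 2 * bc k * M * t powr (- q k))"
    by (intro integrable_mult_right K_powr_integrable l q_nonneg k)
  have mi: "integrable (K l) (m z)" for z
    by (rule Bochner_Integration.integrable_bound[OF Ji]) (use m_m m0 mb in \<open>auto intro: order_trans[OF mb abs_ge_self]\<close>)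
  have diff: "\<bar>Fd f k y hs - Fd f k x hs\<bar> \<le> (1 / l) * (\<integral>t. m (y - x) t \<partial>K l) * nrm hs" if hs: "hs \<in> H_args Q k" for y hs
  proof -
    have pt: "\<bar>W f hs y t - W f hs x t\<bar> \<le> m (y - x) t * nrm hs" for t
    proof (cases "t > 0")
      case True
      let ?g = "\<lambda>z. (-1) * f z + f (z + (y - x))"
      have gb: "?g \<in> bcontfun" by (rule bcontfun_lincomb[OF f(1) bcontfun_shift[OF f(1)]])
      have "DP hs t ?g x = DP hs t f y - DP hs t f x"
        using DP_lincomb[OF H_argsD(2)[OF hs] True f(1) bcontfun_shift[OF f(1), of "y - x"], of "-1"] by (simp add: DP_shift)
      moreover have "\<bar>DP hs t ?g x\<bar> \<le> 2 ^ (k * k) * nrm hs * t powr (- (real k / 2)) * sqrt (P t (\<lambda>z. (?g z)\<^sup>2) x)"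
        using DP_bound_L2[OF H_argsD(2)[OF hs] True gb, of x] H_argsD(1)[OF hs] by simp
      moreover have "2 ^ (k * k) * nrm hs * t powr (- (real k / 2)) * sqrt (P t (\<lambda>z. (?g z)\<^sup>2) x) \<le>
          bc k * nrm hs * t powr (- (real k / 2)) * sqrt (P t (\<lambda>z. (?g z)\<^sup>2) x)"
        using nrm_nonneg[of hs] P_nonneg[of "\<lambda>z. (?g z)\<^sup>2" t x] by (intro mult_right_mono) (auto simp: bc_def)
      moreover have "(\<lambda>z. (?g z)\<^sup>2) = ?D (y - x)" by auto
      ultimately have 1: "\<bar>W f hs y t - W f hs x t\<bar> \<le> (bc k * t powr (- (real k / 2)) * sqrt (P t (?D (y - x)) x)) * nrm hs"
        using True by (simp add: W_def mult_ac)
      have "\<bar>W f hs y t - W f hs x t\<bar> \<le> (2 * bc k * M * t powr (- q k)) * nrm hs"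
        using W_bound[OF f hs k(1), of x t] W_bound[OF f hs k(1), of y t] by (simp add: mult_ac)
      then show ?thesis using 1 by (auto simp: m_def min_def)
    qed (use m0[of "y - x" t] nrm_nonneg[of hs] in \<open>simp add: W_def\<close>)
    have "\<bar>Fd f k y hs - Fd f k x hs\<bar> = (1 / l) * \<bar>\<integral>t. W f hs y t - W f hs x t \<partial>K l\<bar>"
      using l k by (subst Fd_diff[OF f hs]) (auto simp: abs_mult)
    also have "\<dots> \<le> (1 / l) * (\<integral>t. \<bar>W f hs y t - W f hs x t\<bar> \<partial>K l)"
      using l by (intro mult_left_mono integral_abs_bound) auto
    also have "\<dots> \<le> (1 / l) * (\<integral>t. m (y - x) t * nrm hs \<partial>K l)"
      using l W_integrable[OF f hs] k mi pt by (intro mult_left_mono integral_mono integrable_abs Bochner_Integration.integrable_diff integrable_mult_left) auto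
    finally show ?thesis by simp
  qed
  have lim: "((\<lambda>y. (1 / l) * (\<integral>t. m (y - x) t \<partial>K l)) \<longlongrightarrow> 0) (at x)"
    unfolding tendsto_at_iff_sequentially
  proof (intro allI impI)
    fix X :: "nat \<Rightarrow> 'a" assume X: "X \<longlonglongrightarrow> x"
    have z: "(\<lambda>n. X n - x) \<longlonglongrightarrow> 0" using X by (simp add: LIM_zero)
    have "(\<lambda>n. \<integral>t. m (X n - x) t \<partial>K l) \<longlonglongrightarrow> (\<integral>t. 0 \<partial>K l)"
    proof (rule integral_dominated_convergence[OF _ _ Ji])
      show "AE t in K l. (\<lambda>n. m (X n - x) t) \<longlonglongrightarrow> 0"
      proof (intro AE_I2)
        fix t
        have "(\<lambda>n. m (X n - x) t) \<longlonglongrightarrow> min (bc k * t powr (- (real k / 2)) * sqrt 0) (2 * bc k * M * t powr (- q k))"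
          unfolding m_def by (intro tendsto_min tendsto_mult tendsto_const tendsto_real_sqrt P_square_diff_tendsto[OF f(1) z])
        moreover have "min (bc k * t powr (- (real k / 2)) * sqrt 0) (2 * bc k * M * t powr (- q k)) = 0"
          using bc_nonneg[of k] M by simp
        ultimately show "(\<lambda>n. m (X n - x) t) \<longlonglongrightarrow> 0" by simp
      qed
      show "AE t in K l. norm (m (X n - x) t) \<le> 2 * bc k * M * t powr (- q k)" for n
        using m0 mb by (intro AE_I2) auto
    qed (use m_m in auto)
    from tendsto_mult_left[OF this, of "1 / l"]
    show "((\<lambda>y. (1 / l) * (\<integral>t. m (y - x) t \<partial>K l)) \<circ> X) \<longlonglongrightarrow> 0" by (simp add: o_def)
  qed
  have "\<forall>\<^sub>F y in at x. (1 / l) * (\<integral>t. m (y - x) t \<partial>K l) < e"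
    using order_tendstoD(2)[OF lim e] .
  then obtain d where d: "d > 0" "\<And>y. y \<noteq> x \<Longrightarrow> dist y x < d \<Longrightarrow> (1 / l) * (\<integral>t. m (y - x) t \<partial>K l) < e"
    unfolding eventually_at by blast
  show "\<exists>d>0. \<forall>y. dist y x < d \<longrightarrow> (\<forall>hs\<in>H_args Q k. \<bar>Fd f k y hs - Fd f k x hs\<bar> \<le> e * nrm hs)"
  proof (intro exI[of _ d] conjI d(1) allI impI ballI)
    fix y hs assume y: "dist y x < d" and hs: "hs \<in> H_args Q k"
    show "\<bar>Fd f k y hs - Fd f k x hs\<bar> \<le> e * nrm hs"
    proof (cases "y = x")
      case True
      then show ?thesis using e nrm_nonneg[of hs] by simp
    next
      case False
      have "(1 / l) * (\<integral>t. m (y - x) t \<partial>K l) * nrm hs \<le> e * nrm hs"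
        using d(2)[OF False y] nrm_nonneg[of hs] by (intro mult_right_mono) auto
      then show ?thesis using diff[OF hs, of y] by linarith
    qed
  qed
qed

lemma Fd_0_locally_uniform:
  assumes f: "f \<in> bcontfun"
  shows "locally_uniform 0 (Fd f 0)"
  unfolding locally_uniform_def
proof (intro allI impI)
  fix x and e :: real assume e: "0 < e"
  have "continuous_on UNIV (U l f)" using U_bcontfun[OF l f] by (simp add: bcontfun_def)
  then obtain d where d: "d > 0" "\<And>y. dist y x < d \<Longrightarrow> dist (U l f y) (U l f x) < e"
    using e unfolding continuous_on_iff by (metis UNIV_I)
  show "\<exists>d>0. \<forall>y. dist y x < d \<longrightarrow> (\<forall>hs\<in>H_args Q 0. \<bar>Fd f 0 y hs - Fd f 0 x hs\<bar> \<le> e * nrm hs)"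
    using d by (intro exI[of _ d]) (auto simp: Fd_0[OF f] H_args_def dist_real_def less_imp_le)
qed

text \<open>\<open>K_powr_min\<close> at \<open>\<rho> = (CM_norm Q h)\<^sup>2\<close>: heat spreads
  over distance \<open>sqrt t\<close> in time \<open>t\<close>, so \<open>t\<close> competes with
  the square of the increment. The constant is fixed before \<open>D\<close>, \<open>h\<close> and
  \<open>c\<close>.\<close>

lemma difference_integral_bound:
  assumes q0: "0 \<le> q0" "q0 < s" and p: "0 < p" "s < q0 + p"
  shows "\<exists>C\<ge>0. \<forall>D h c. h \<in> CM_space Q \<longrightarrow> h \<noteq> 0 \<longrightarrow> 0 \<le> c \<longrightarrow> integrable (K l) D \<longrightarrow>
    (\<forall>t>0. \<bar>D t\<bar> \<le> c * (t powr (- q0) * min 1 (((CM_norm Q h)\<^sup>2 / t) powr p))) \<longrightarrow>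
    \<bar>(1 / l) * (\<integral>t. D t \<partial>K l)\<bar> \<le> C * c * CM_norm Q h powr (2 * s - 2 * q0)"
proof -
  obtain C where C: "C > 0" and CI: "\<And>\<rho>. \<rho> > 0 \<Longrightarrow> integrable (K l) (\<lambda>v. v powr (- q0) * min 1 ((\<rho> / v) powr p))"
    "\<And>\<rho>. \<rho> > 0 \<Longrightarrow> (\<integral>v. v powr (- q0) * min 1 ((\<rho> / v) powr p) \<partial>K l) \<le> C * \<rho> powr (s - q0)"
    using K_powr_min[OF l q0 p] by blast
  show ?thesis
  proof (intro exI[of _ "C / l"] conjI allI impI)
    show "0 \<le> C / l" using C l by simp
    fix D h c assume h: "h \<in> CM_space Q" "h \<noteq> 0" and c: "0 \<le> (c::real)" and D: "integrable (K l) D"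
      and b: "\<forall>t>0. \<bar>D t\<bar> \<le> c * (t powr (- q0) * min 1 (((CM_norm Q h)\<^sup>2 / t) powr p))"
    have hp: "CM_norm Q h > 0" by (rule CM_norm_pos[OF h])
    then have \<rho>: "(CM_norm Q h)\<^sup>2 > 0" by simp
    have "\<bar>\<integral>t. D t \<partial>K l\<bar> \<le> (\<integral>t. \<bar>D t\<bar> \<partial>K l)" by (rule integral_abs_bound)
    also have "\<dots> \<le> (\<integral>t. c * (t powr (- q0) * min 1 (((CM_norm Q h)\<^sup>2 / t) powr p)) \<partial>K l)"
    proof (rule integral_mono_AE)
      show "AE t in K l. \<bar>D t\<bar> \<le> c * (t powr (- q0) * min 1 (((CM_norm Q h)\<^sup>2 / t) powr p))"
        using K_pos[OF l] by eventually_elim (use b in blast)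
    qed (use D CI(1)[OF \<rho>] in auto)
    also have "\<dots> = c * (\<integral>t. t powr (- q0) * min 1 (((CM_norm Q h)\<^sup>2 / t) powr p) \<partial>K l)" by simp
    also have "\<dots> \<le> c * (C * ((CM_norm Q h)\<^sup>2) powr (s - q0))" by (intro mult_left_mono CI(2) \<rho> c)
    also have "((CM_norm Q h)\<^sup>2) powr (s - q0) = CM_norm Q h powr (2 * s - 2 * q0)"
      using hp powr_powr[of "CM_norm Q h" 2 "s - q0"] by (simp add: right_diff_distrib)
    finally have "(1 / l) * \<bar>\<integral>t. D t \<partial>K l\<bar> \<le> (1 / l) * (c * (C * CM_norm Q h powr (2 * s - 2 * q0)))"
      using l by (intro mult_left_mono) auto
    then show "\<bar>(1 / l) * (\<integral>t. D t \<partial>K l)\<bar> \<le> C / l * c * CM_norm Q h powr (2 * s - 2 * q0)"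
      using l by (simp add: abs_mult mult_ac)
  qed
qed

section \<open>First and second differences along the Cameron-Martin space\<close>

lemma powr_ratio:
  assumes "0 < h" "0 < (t::real)"
  shows "h powr (2 * p) * t powr (- p) = (h\<^sup>2 / t) powr p"
proof -
  have "(h\<^sup>2 / t) powr p = (h\<^sup>2) powr p / t powr p" using assms by (simp add: powr_divide)
  moreover have "(h\<^sup>2) powr p = h powr (2 * p)" using assms powr_powr[of h 2 p] by simp
  ultimately show ?thesis by (simp add: powr_minus divide_inverse)
qed

text \<open>By the mean value theorem a difference along \<open>h\<close> is a derivative along
  \<open>h\<close> at an intermediate point, so it gains a factor \<open>CM_norm Q h\<close> at the
  price of \<open>sqrt t\<close>. For second differences the argument is applied twice, the outer
  time to the first difference as a function of \<open>x\<close>.\<close>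

lemma W_diff_le:
  assumes f: "f \<in> bcontfun" "holderH \<theta> M f" and hs: "hs \<in> H_args Q k" and h: "h \<in> CM_space Q" and t: "0 < t"
  shows "\<bar>W f hs (x + h) t - W f hs x t\<bar> \<le> bc (Suc k) * M * CM_norm Q h * nrm hs * t powr (- q (Suc k))"
    and "\<bar>W f hs (x + 2 *\<^sub>R h) t - 2 * W f hs (x + h) t + W f hs x t\<bar> \<le>
      bc (Suc (Suc k)) * M * (CM_norm Q h)\<^sup>2 * nrm hs * t powr (- q (Suc (Suc k)))"
proof -
  have hhs: "h # hs \<in> H_args Q (Suc k)" "h # h # hs \<in> H_args Q (Suc (Suc k))" using h hs by (simp_all add: H_args_Cons)
  have d: "((\<lambda>a. W f ls (x + a *\<^sub>R h) t) has_real_derivative W f (h # ls) (x + b *\<^sub>R h) t) (at b)"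
    if "ls \<in> H_args Q j" for ls j x b
    using DP_derivative[OF H_argsD(2)[OF that] h t f(1), of x b] t by (simp add: W_def)
  have b1: "\<bar>W f (h # hs) y t\<bar> \<le> bc (Suc k) * M * CM_norm Q h * nrm hs * t powr (- q (Suc k))" for y
    using W_bound[OF f hhs(1), of y t] by (simp add: mult_ac)
  have b2: "\<bar>W f (h # h # hs) y t\<bar> \<le> bc (Suc (Suc k)) * M * (CM_norm Q h)\<^sup>2 * nrm hs * t powr (- q (Suc (Suc k)))" for y
    using W_bound[OF f hhs(2), of y t] by (simp add: mult_ac power2_eq_square)
  show "\<bar>W f hs (x + h) t - W f hs x t\<bar> \<le> bc (Suc k) * M * CM_norm Q h * nrm hs * t powr (- q (Suc k))"
    by (rule directional_diff_le[of "\<lambda>x. W f hs x t" h "\<lambda>x. W f (h # hs) x t", OF d[OF hs] b1])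
  have b2': "\<bar>W f (h # hs) (y + h) t - W f (h # hs) y t\<bar> \<le> bc (Suc (Suc k)) * M * (CM_norm Q h)\<^sup>2 * nrm hs * t powr (- q (Suc (Suc k)))" for y
    by (rule directional_diff_le[of "\<lambda>x. W f (h # hs) x t" h "\<lambda>x. W f (h # h # hs) x t", OF d[OF hhs(1)] b2])
  have "((\<lambda>a. W f hs ((x + a *\<^sub>R h) + h) t - W f hs (x + a *\<^sub>R h) t) has_real_derivative
      W f (h # hs) ((x + b *\<^sub>R h) + h) t - W f (h # hs) (x + b *\<^sub>R h) t) (at b)" for x b
    using DERIV_diff[OF d[OF hs, of "x + h" b] d[OF hs, of x b]] by (simp add: add_ac)
  from directional_diff_le[of "\<lambda>x. W f hs (x + h) t - W f hs x t" h "\<lambda>x. W f (h # hs) (x + h) t - W f (h # hs) x t", OF this b2', of x]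
  show "\<bar>W f hs (x + 2 *\<^sub>R h) t - 2 * W f hs (x + h) t + W f hs x t\<bar> \<le>
      bc (Suc (Suc k)) * M * (CM_norm Q h)\<^sup>2 * nrm hs * t powr (- q (Suc (Suc k)))"
    by (simp add: scaleR_2 add.assoc algebra_simps)
qed

text \<open>For \<open>n = 0\<close> the Hoelder continuity of \<open>f\<close> is not spent on a power of \<open>t\<close>: it stays as the
  factor \<open>CM_norm Q h powr \<theta>\<close> of the difference.\<close>

definition e0 :: "nat \<Rightarrow> real" where "e0 n = (if n = 0 then \<theta> else 0)"
definition q0 :: "nat \<Rightarrow> real" where "q0 n = (if n = 0 then 0 else q n)"

text \<open>The bound for increments that are large compared with \<open>sqrt t\<close>: for
  \<open>n \<ge> 1\<close> the two values are bounded separately, for \<open>n = 0\<close> the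
  Hoelder condition on \<open>P t f\<close> is used, and the constant \<open>2 * bc 0 = 4\<close>
  leaves room.\<close>

lemma W_diff_trivial:
  assumes f: "f \<in> bcontfun" "holderH \<theta> M f" and hs: "hs \<in> H_args Q n" and h: "h \<in> CM_space Q" "h \<noteq> 0" and t: "0 < t"
  shows "\<bar>W f hs (x + h) t - W f hs x t\<bar> \<le> 2 * bc n * M * CM_norm Q h powr (e0 n) * nrm hs * t powr (- q0 n)"
proof (cases "n = 0")
  case True
  have M: "0 \<le> M" using f by (simp add: holderH_def)
  have "hs = []" using H_argsD(1)[OF hs] True by simp
  then have "\<bar>W f hs (x + h) t - W f hs x t\<bar> = \<bar>P t f (x + h) - P t f x\<bar>" using t by (simp add: W_def)
  also have "\<dots> \<le> M * CM_norm Q h powr \<theta>" using P_holder[OF f, of t] h by (simp add: holderH_def)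
  also have "\<dots> \<le> 4 * (M * CM_norm Q h powr \<theta>)" using M by simp
  finally show ?thesis using True \<open>hs = []\<close> t by (simp add: e0_def q0_def bc_def)
next
  case False
  then have n: "1 \<le> n" by simp
  show ?thesis using W_bound[OF f hs n, of "x + h" t] W_bound[OF f hs n, of x t] False CM_norm_pos[OF h]
    by (simp add: e0_def q0_def)
qed

text \<open>The exponent \<open>p\<close> is the one for which the bound by \<open>j\<close> further
  derivatives equals the trivial bound times \<open>(h\<^sup>2 / t) powr p\<close>; combining the
  two bounds then produces the minimum with \<open>1\<close>.\<close>

lemma diff_exponents:
  fixes j n :: nat
  assumes h: "0 < h" and t: "0 < (t::real)" and p_def: "p = (if n = 0 then (real j - \<theta>) / 2 else real j / 2)"
  shows "h ^ j * t powr (- q (n + j)) = h powr (e0 n) * t powr (- q0 n) * ((h\<^sup>2 / t) powr p)"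
proof -
  have "h powr (e0 n) * t powr (- q0 n) * ((h\<^sup>2 / t) powr p) = (h powr (e0 n) * h powr (2 * p)) * (t powr (- q0 n) * t powr (- p))"
    unfolding powr_ratio[OF h t, symmetric] by simp
  also have "h powr (e0 n) * h powr (2 * p) = h powr (real j)"
    unfolding powr_add[symmetric] by (simp add: p_def e0_def diff_divide_distrib)
  also have "h powr (real j) = h ^ j" using h by (simp add: powr_realpow)
  also have "t powr (- q0 n) * t powr (- p) = t powr (- q (n + j))"
    unfolding powr_add[symmetric] by (simp add: p_def q0_def q_def diff_divide_distrib add_divide_distrib diff_diff_eq)
  finally show ?thesis by simp
qed

text \<open>The trivial bound and the derivative bound together give the minimum that
  \<open>difference_integral_bound\<close> asks for. Its condition \<open>s < q0 n + p\<close> is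
  \<open>\<theta> + 2 * s < n + 1\<close> for these exponents, so one difference suffices strictly
  below the integer. The powers of \<open>CM_norm Q h\<close> add up to
  \<open>\<theta> + 2 * s - n\<close>.\<close>

lemma Fd_holder:
  assumes n: "real n < \<theta> + 2 * s" "\<theta> + 2 * s < real n + 1"
  shows "\<exists>C\<ge>0. \<forall>f M x h hs. f \<in> bcontfun \<longrightarrow> holderH \<theta> M f \<longrightarrow> h \<in> CM_space Q \<longrightarrow> h \<noteq> 0 \<longrightarrow> hs \<in> H_args Q n \<longrightarrow>
    \<bar>Fd f n (x + h) hs - Fd f n x hs\<bar> \<le> C * M * CM_norm Q h powr (\<theta> + 2 * s - real n) * nrm hs"
proof -
  define p where "p = (if n = 0 then (real 1 - \<theta>) / 2 else real 1 / 2)"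
  have kn: "n = 0 \<or> q n < s" using n by (auto simp: q_def)
  have q0: "0 \<le> q0 n" "q0 n < s" and p: "0 < p" "s < q0 n + p"
    using n s \<theta> q_nonneg[of n] by (auto simp: q0_def p_def q_def diff_divide_distrib)
  obtain C where C: "C \<ge> 0" and CI: "\<And>D h c. h \<in> CM_space Q \<Longrightarrow> h \<noteq> 0 \<Longrightarrow> 0 \<le> c \<Longrightarrow> integrable (K l) D \<Longrightarrow>
    (\<forall>t>0. \<bar>D t\<bar> \<le> c * (t powr (- q0 n) * min 1 (((CM_norm Q h)\<^sup>2 / t) powr p))) \<Longrightarrow>
    \<bar>(1 / l) * (\<integral>t. D t \<partial>K l)\<bar> \<le> C * c * CM_norm Q h powr (2 * s - 2 * q0 n)"
    using difference_integral_bound[OF q0 p] by blast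
  \<comment> \<open>Dominates the constants \<open>2 * bc n\<close> and \<open>bc (Suc n)\<close> of
    the two bounds.\<close>
  define A where "A = 2 * bc (Suc n)"
  have A: "0 \<le> A" using bc_nonneg by (simp add: A_def)
  show ?thesis
  proof (intro exI[of _ "C * A"] conjI allI impI)
    show "0 \<le> C * A" using C A by simp
    fix f M x h hs assume f: "f \<in> bcontfun" "holderH \<theta> M f" and h: "h \<in> CM_space Q" "h \<noteq> 0" and hs: "hs \<in> H_args Q n"
    have M: "0 \<le> M" using f by (simp add: holderH_def)
    have hp: "CM_norm Q h > 0" by (rule CM_norm_pos[OF h])
    let ?c = "A * M * CM_norm Q h powr (e0 n) * nrm hs"
    have "\<bar>Fd f n (x + h) hs - Fd f n x hs\<bar> \<le> C * ?c * CM_norm Q h powr (2 * s - 2 * q0 n)"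
      unfolding Fd_diff[OF f hs kn]
    proof (rule CI[OF h], goal_cases)
      case 1 show ?case using A M nrm_nonneg[of hs] by simp
    next
      case 2 show ?case using W_integrable[OF f hs kn] by simp
    next
      case 3
      show ?case
      proof (intro allI impI)
        fix t :: real assume t: "0 < t"
        have "\<bar>W f hs (x + h) t - W f hs x t\<bar> \<le> 2 * bc n * (M * CM_norm Q h powr (e0 n) * nrm hs * t powr (- q0 n))"
          using W_diff_trivial[OF f hs h t, of x] by (simp add: mult_ac)
        also have "\<dots> \<le> A * (M * CM_norm Q h powr (e0 n) * nrm hs * t powr (- q0 n))"
          unfolding A_def using M nrm_nonneg[of hs] bc_mono[of n "Suc n"] by (intro mult_right_mono mult_left_mono) auto
        finally have 1: "\<bar>W f hs (x + h) t - W f hs x t\<bar> \<le> ?c * (t powr (- q0 n) * 1)" by (simp add: mult_ac)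
        have "\<bar>W f hs (x + h) t - W f hs x t\<bar> \<le> bc (Suc n) * (M * nrm hs * (CM_norm Q h ^ 1 * t powr (- q (n + 1))))"
          using W_diff_le(1)[OF f hs h(1) t, of x] by (simp add: mult_ac)
        also have "\<dots> \<le> A * (M * nrm hs * (CM_norm Q h ^ 1 * t powr (- q (n + 1))))"
          unfolding A_def using M nrm_nonneg[of hs] bc_nonneg[of "Suc n"] hp by (intro mult_right_mono) auto
        also have "CM_norm Q h ^ 1 * t powr (- q (n + 1)) = CM_norm Q h powr (e0 n) * t powr (- q0 n) * (((CM_norm Q h)\<^sup>2 / t) powr p)"
          by (rule diff_exponents[OF hp t p_def])
        finally have 2: "\<bar>W f hs (x + h) t - W f hs x t\<bar> \<le> ?c * (t powr (- q0 n) * (((CM_norm Q h)\<^sup>2 / t) powr p))"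
          by (simp add: mult_ac)
        show "\<bar>W f hs (x + h) t - W f hs x t\<bar> \<le> ?c * (t powr (- q0 n) * min 1 (((CM_norm Q h)\<^sup>2 / t) powr p))"
          using 1 2 unfolding min_def by (cases "1 \<le> ((CM_norm Q h)\<^sup>2 / t) powr p") (simp_all only: if_True if_False)
      qed
    qed
    also have "C * ?c * CM_norm Q h powr (2 * s - 2 * q0 n) = C * A * M * (CM_norm Q h powr (e0 n) * CM_norm Q h powr (2 * s - 2 * q0 n)) * nrm hs"
      by (simp add: mult_ac)
    also have "CM_norm Q h powr (e0 n) * CM_norm Q h powr (2 * s - 2 * q0 n) = CM_norm Q h powr (\<theta> + 2 * s - real n)"
      unfolding powr_add[symmetric] by (simp add: e0_def q0_def q_def diff_divide_distrib algebra_simps)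
    finally show "\<bar>Fd f n (x + h) hs - Fd f n x hs\<bar> \<le> C * A * M * CM_norm Q h powr (\<theta> + 2 * s - real n) * nrm hs" .
  qed
qed

text \<open>At an integer value of \<open>\<theta> + 2 * s\<close> the condition
  \<open>s < q0 n + p\<close> for one difference fails with equality, the logarithmic borderline. A
  second difference raises \<open>p\<close> by \<open>1 / 2\<close> and restores it, hence a Zygmund
  condition in place of a Lipschitz condition.\<close>

lemma Fd_zygmund:
  assumes n: "\<theta> + 2 * s = real n + 1"
  shows "\<exists>C\<ge>0. \<forall>f M x h hs. f \<in> bcontfun \<longrightarrow> holderH \<theta> M f \<longrightarrow> h \<in> CM_space Q \<longrightarrow> h \<noteq> 0 \<longrightarrow> hs \<in> H_args Q n \<longrightarrow>
    \<bar>Fd f n (x + 2 *\<^sub>R h) hs - 2 * Fd f n (x + h) hs + Fd f n x hs\<bar> \<le> C * M * CM_norm Q h * nrm hs"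
proof -
  define p where "p = (if n = 0 then (real 2 - \<theta>) / 2 else real 2 / 2)"
  have kn: "n = 0 \<or> q n < s" using n by (auto simp: q_def)
  have q0: "0 \<le> q0 n" "q0 n < s" and p: "0 < p" "s < q0 n + p"
    using n s \<theta> q_nonneg[of n] by (auto simp: q0_def p_def q_def diff_divide_distrib)
  obtain C where C: "C \<ge> 0" and CI: "\<And>D h c. h \<in> CM_space Q \<Longrightarrow> h \<noteq> 0 \<Longrightarrow> 0 \<le> c \<Longrightarrow> integrable (K l) D \<Longrightarrow>
    (\<forall>t>0. \<bar>D t\<bar> \<le> c * (t powr (- q0 n) * min 1 (((CM_norm Q h)\<^sup>2 / t) powr p))) \<Longrightarrow>
    \<bar>(1 / l) * (\<integral>t. D t \<partial>K l)\<bar> \<le> C * c * CM_norm Q h powr (2 * s - 2 * q0 n)"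
    using difference_integral_bound[OF q0 p] by blast
  \<comment> \<open>The factor \<open>4\<close> arises because a second difference is a difference
    of two first differences, each with constant \<open>2 * bc n\<close>.\<close>
  define A where "A = 4 * bc (Suc (Suc n))"
  have A: "0 \<le> A" using bc_nonneg by (simp add: A_def)
  show ?thesis
  proof (intro exI[of _ "C * A"] conjI allI impI)
    show "0 \<le> C * A" using C A by simp
    fix f M x h hs assume f: "f \<in> bcontfun" "holderH \<theta> M f" and h: "h \<in> CM_space Q" "h \<noteq> 0" and hs: "hs \<in> H_args Q n"
    have M: "0 \<le> M" using f by (simp add: holderH_def)
    have hp: "CM_norm Q h > 0" by (rule CM_norm_pos[OF h])
    let ?c = "A * M * CM_norm Q h powr (e0 n) * nrm hs"
    let ?D = "\<lambda>t. W f hs (x + 2 *\<^sub>R h) t - 2 * W f hs (x + h) t + W f hs x t"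
    have "Fd f n (x + 2 *\<^sub>R h) hs - 2 * Fd f n (x + h) hs + Fd f n x hs = (1 / l) * (\<integral>t. ?D t \<partial>K l)"
      using W_integrable[OF f hs kn] hs by (simp add: Fd_def algebra_simps add_divide_distrib)
    moreover have "\<bar>(1 / l) * (\<integral>t. ?D t \<partial>K l)\<bar> \<le> C * ?c * CM_norm Q h powr (2 * s - 2 * q0 n)"
    proof (rule CI[OF h], goal_cases)
      case 1 show ?case using A M nrm_nonneg[of hs] by simp
    next
      case 2 show ?case using W_integrable[OF f hs kn] by simp
    next
      case 3
      show ?case
      proof (intro allI impI)
        fix t :: real assume t: "0 < t"
        have e: "?D t = (W f hs ((x + h) + h) t - W f hs (x + h) t) - (W f hs (x + h) t - W f hs x t)"
          by (simp add: scaleR_2 add.assoc)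
        have "\<bar>?D t\<bar> \<le> 4 * bc n * (M * CM_norm Q h powr (e0 n) * nrm hs * t powr (- q0 n))"
          unfolding e using W_diff_trivial[OF f hs h t, of x] W_diff_trivial[OF f hs h t, of "x + h"] by (simp add: mult_ac)
        also have "\<dots> \<le> A * (M * CM_norm Q h powr (e0 n) * nrm hs * t powr (- q0 n))"
          unfolding A_def using M nrm_nonneg[of hs] bc_mono[of n "Suc (Suc n)"] by (intro mult_right_mono mult_left_mono) auto
        finally have 1: "\<bar>?D t\<bar> \<le> ?c * (t powr (- q0 n) * 1)" by (simp add: mult_ac)
        have "\<bar>?D t\<bar> \<le> bc (Suc (Suc n)) * (M * nrm hs * (CM_norm Q h ^ 2 * t powr (- q (n + 2))))"
          using W_diff_le(2)[OF f hs h(1) t, of x] by (simp add: mult_ac)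
        also have "\<dots> \<le> A * (M * nrm hs * (CM_norm Q h ^ 2 * t powr (- q (n + 2))))"
          unfolding A_def using M nrm_nonneg[of hs] bc_nonneg[of "Suc (Suc n)"] hp by (intro mult_right_mono) auto
        also have "CM_norm Q h ^ 2 * t powr (- q (n + 2)) = CM_norm Q h powr (e0 n) * t powr (- q0 n) * (((CM_norm Q h)\<^sup>2 / t) powr p)"
          by (rule diff_exponents[OF hp t p_def])
        finally have 2: "\<bar>?D t\<bar> \<le> ?c * (t powr (- q0 n) * (((CM_norm Q h)\<^sup>2 / t) powr p))"
          by (simp add: mult_ac)
        show "\<bar>?D t\<bar> \<le> ?c * (t powr (- q0 n) * min 1 (((CM_norm Q h)\<^sup>2 / t) powr p))"
          using 1 2 unfolding min_def by (cases "1 \<le> ((CM_norm Q h)\<^sup>2 / t) powr p") (simp_all only: if_True if_False)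
      qed
    qed
    moreover have "C * ?c * CM_norm Q h powr (2 * s - 2 * q0 n) = C * A * M * (CM_norm Q h powr (e0 n) * CM_norm Q h powr (2 * s - 2 * q0 n)) * nrm hs"
      by (simp add: mult_ac)
    moreover have "CM_norm Q h powr (e0 n) * CM_norm Q h powr (2 * s - 2 * q0 n) = CM_norm Q h"
    proof -
      have "CM_norm Q h powr (e0 n) * CM_norm Q h powr (2 * s - 2 * q0 n) = CM_norm Q h powr (\<theta> + 2 * s - real n)"
        unfolding powr_add[symmetric] by (simp add: e0_def q0_def q_def diff_divide_distrib algebra_simps)
      then show ?thesis using n hp by simp
    qed
    ultimately show "\<bar>Fd f n (x + 2 *\<^sub>R h) hs - 2 * Fd f n (x + h) hs + Fd f n x hs\<bar> \<le> C * A * M * CM_norm Q h * nrm hs" by simp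
  qed
qed

section \<open>The resolvent in the function spaces, with norm bounds\<close>

lemma resolvent_CnH:
  assumes H: "holderH \<theta> M (apply_bcontfun f)" and n: "n = 0 \<or> q n < s"
  shows "k \<le> n \<Longrightarrow> H_deriv Q k (apply_bcontfun (R l f)) = Fd (apply_bcontfun f) k"
    and "R l f \<in> CnH Q n"
    and "Fd (apply_bcontfun f) n \<in> Cb_forms Q n"
    and "CnH_norm Q n (R l f) \<le> ennreal (norm f / l + (\<Sum>k=1..n. J k) * M)"
proof -
  let ?f = "apply_bcontfun f"
  have qk: "q k < s" if "1 \<le> k" "k \<le> n" for k using that n q_mono[of k n] by auto
  have M: "0 \<le> M" using H by (simp add: holderH_def)
  have Rf: "apply_bcontfun (R l f) = U l ?f" by (rule R_apply[OF l])
  note chain = H_deriv_chain[where F = "Fd ?f" and u = "apply_bcontfun (R l f)" and n = n]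
  have A: "H_deriv Q k (apply_bcontfun (R l f)) = Fd ?f k" if "k \<le> n" for k
    by (rule chain(1)) (use that Fd_0[OF bcf] Rf Fd_derivative[OF bcf H _ _ qk] Fd_forms[OF bcf H _ qk]
        Fd_locally_uniform[OF bcf H _ qk] in auto)
  have B: "has_H_derivative Q k (H_deriv Q k (apply_bcontfun (R l f))) (Fd ?f (Suc k) x) x" if "k < n" for k x
    by (rule chain(2)) (use that Fd_0[OF bcf] Rf Fd_derivative[OF bcf H _ _ qk] Fd_forms[OF bcf H _ qk]
        Fd_locally_uniform[OF bcf H _ qk] in auto)
  then show "k \<le> n \<Longrightarrow> H_deriv Q k (apply_bcontfun (R l f)) = Fd ?f k" using A by blast
  have lu: "locally_uniform k (Fd ?f k)" if "k \<le> n" for k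
    using Fd_0_locally_uniform[OF bcf] Fd_locally_uniform[OF bcf H _ qk] that by (cases "k = 0") auto
  have bnd: "\<bar>Fd ?f k x hs\<bar> \<le> J k * M * nrm hs" if "1 \<le> k" "k \<le> n" "hs \<in> H_args Q k" for k x hs
    by (rule Fd_bound[OF bcf H that(3,1) qk[OF that(1,2)]])
  have fn: "form_norm Q k (Fd ?f k x) \<le> ennreal (J k * M)" if "1 \<le> k" "k \<le> n" for k x
    by (rule form_norm_le) (use bnd[OF that] J_nonneg[of k] M in auto)
  show "R l f \<in> CnH Q n"
    unfolding CnH_def mem_Collect_eq
  proof (intro conjI allI impI ballI)
    fix k x assume "k < n"
    then show "\<exists>G. has_H_derivative Q k (H_deriv Q k (apply_bcontfun (R l f))) G x" using B by blast
  next
    fix k hs assume k: "k \<in> {1..n}" and hs: "hs \<in> H_args Q k"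
    then have k': "1 \<le> k" "k \<le> n" by auto
    have "continuous_on UNIV (\<lambda>x. Fd ?f k x hs)"
      unfolding continuous_on_iff
    proof (intro ballI allI impI)
      fix x and e :: real assume e: "0 < e"
      define e' where "e' = e / (nrm hs + 1)"
      have np: "0 < nrm hs + 1" using nrm_nonneg[of hs] by linarith
      have e': "e' > 0" using e np by (simp add: e'_def)
      obtain d where d: "d > 0" "\<And>y. dist y x < d \<Longrightarrow> \<bar>Fd ?f k y hs - Fd ?f k x hs\<bar> \<le> e' * nrm hs"
        using lu[OF k'(2)] e' hs unfolding locally_uniform_def by blast
      have "e' * nrm hs < e' * (nrm hs + 1)" using e' by simp
      also have "\<dots> = e" using np by (simp add: e'_def)
      finally have "e' * nrm hs < e" .
      then have "dist y x < d \<Longrightarrow> dist (Fd ?f k y hs) (Fd ?f k x hs) < e" for y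
        using d(2)[of y] by (simp add: dist_real_def)
      then show "\<exists>d>0. \<forall>x'\<in>UNIV. dist x' x < d \<longrightarrow> dist (Fd ?f k x' hs) (Fd ?f k x hs) < e" using d(1) by blast
    qed
    then show "(\<lambda>x. H_deriv Q k (apply_bcontfun (R l f)) x hs) \<in> bcontfun"
      unfolding A[OF k'(2)] using bnd[OF k' hs] by (rule bcontfunI')
  qed
  show "Fd ?f n \<in> Cb_forms Q n"
    unfolding Cb_forms_def mem_Collect_eq
  proof (intro conjI allI)
    fix x
    have B0: "\<bar>Fd ?f 0 x hs\<bar> \<le> norm f / l * nrm hs" if "hs \<in> H_args Q 0" for x hs
      using that norm_bounded[of "R l f" x] R_norm[OF l, of f] by (simp add: Fd_0[OF bcf] Rf H_args_def)
    have fn0: "form_norm Q 0 (Fd ?f 0 x) \<le> ennreal (norm f / l)" for x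
      by (rule form_norm_le) (use B0 l in auto)
    show "Fd ?f n x \<in> forms Q n"
    proof (cases "n = 0")
      case True
      have "form_norm Q 0 (Fd ?f 0 x) < \<infinity>" using le_less_trans[OF fn0] by simp
      then show ?thesis using True by (simp add: forms_def) (simp add: Fd_def)
    next
      case False
      then show ?thesis using n by (intro Fd_forms[OF bcf H]) auto
    qed
    \<comment> \<open>The maximum gives one bound for both cases: order zero is controlled by the
      bound on the resolvent, higher orders by \<open>J\<close>.\<close>
    have "form_norm Q n (Fd ?f n x) \<le> ennreal (max (norm f / l) (J n * M))" for x
    proof (cases "n = 0")
      case True
      have "form_norm Q n (Fd ?f n x) \<le> ennreal (norm f / l)" using fn0[of x] unfolding True .
      also have "\<dots> \<le> ennreal (max (norm f / l) (J n * M))" by (intro ennreal_leI) simp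
      finally show ?thesis .
    next
      case False
      then have "form_norm Q n (Fd ?f n x) \<le> ennreal (J n * M)" using fn[of n x] by simp
      also have "\<dots> \<le> ennreal (max (norm f / l) (J n * M))" by (intro ennreal_leI) simp
      finally show ?thesis .
    qed
    then have "(SUP x. form_norm Q n (Fd ?f n x)) \<le> ennreal (max (norm f / l) (J n * M))" by (rule SUP_least)
    then show "(SUP x. form_norm Q n (Fd ?f n x)) < \<infinity>" by (rule le_less_trans) simp
    show "((\<lambda>y. form_norm Q n (\<lambda>hs. Fd ?f n y hs - Fd ?f n x hs)) \<longlongrightarrow> 0) (at x)"
    proof (rule ennreal_tendsto_0I)
      fix e :: real assume e: "0 < e"
      obtain d where d: "d > 0" "\<And>y hs. dist y x < d \<Longrightarrow> hs \<in> H_args Q n \<Longrightarrow> \<bar>Fd ?f n y hs - Fd ?f n x hs\<bar> \<le> e * nrm hs"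
        using lu[of n] e unfolding locally_uniform_def by blast
      have "form_norm Q n (\<lambda>hs. Fd ?f n y hs - Fd ?f n x hs) \<le> ennreal e" if "dist y x < d" for y
        by (rule form_norm_le) (use d(2)[OF that] e in auto)
      then show "\<forall>\<^sub>F y in at x. form_norm Q n (\<lambda>hs. Fd ?f n y hs - Fd ?f n x hs) \<le> ennreal e"
        unfolding eventually_at using d(1) by blast
    qed
  qed
  have "(\<Sum>k=1..n. SUP x. form_norm Q k (H_deriv Q k (apply_bcontfun (R l f)) x)) \<le> (\<Sum>k=1..n. ennreal (J k * M))"
    using A fn by (intro sum_mono SUP_least) auto
  also have "\<dots> = ennreal (\<Sum>k=1..n. J k * M)" using J_nonneg M by (intro sum_ennreal) auto
  also have "(\<Sum>k=1..n. J k * M) = (\<Sum>k=1..n. J k) * M" by (simp add: sum_distrib_right)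
  finally have "CnH_norm Q n (R l f) \<le> ennreal (norm f / l) + ennreal ((\<Sum>k=1..n. J k) * M)"
    unfolding CnH_norm_def using R_norm[OF l, of f] by (intro add_mono ennreal_leI)
  also have "\<dots> = ennreal (norm f / l + (\<Sum>k=1..n. J k) * M)"
    using l M J_nonneg by (intro ennreal_plus[symmetric] mult_nonneg_nonneg sum_nonneg) auto
  finally show "CnH_norm Q n (R l f) \<le> ennreal (norm f / l + (\<Sum>k=1..n. J k) * M)" .
qed

text \<open>Strictly between integers, \<open>n\<close> is the floor of the exponent and the power
  in \<open>Fd_holder\<close> is its fractional part. The Hoelder constant \<open>M\<close> stays
  explicit, so that \<open>C\<close> is uniform in \<open>f\<close>.\<close>

lemma resolvent_CH:
  assumes r: "real n < \<theta> + 2 * s" "\<theta> + 2 * s < real n + 1"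
  shows "\<exists>C\<ge>0. \<forall>f M. holderH \<theta> M (apply_bcontfun f) \<longrightarrow>
    R l f \<in> CH Q (\<theta> + 2 * s) \<and> CH_norm Q (\<theta> + 2 * s) (R l f) \<le> ennreal (norm f / l + C * M)"
proof -
  have fl: "\<lfloor>\<theta> + 2 * s\<rfloor> = int n" using r by (intro floor_unique) auto
  have fr: "frac (\<theta> + 2 * s) = \<theta> + 2 * s - real n" by (simp add: frac_def fl)
  have kn: "n = 0 \<or> q n < s" using r by (auto simp: q_def)
  obtain C where C: "C \<ge> 0" and CI: "\<And>f M x h hs. f \<in> bcontfun \<Longrightarrow> holderH \<theta> M f \<Longrightarrow> h \<in> CM_space Q \<Longrightarrow> h \<noteq> 0 \<Longrightarrow> hs \<in> H_args Q n \<Longrightarrow>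
    \<bar>Fd f n (x + h) hs - Fd f n x hs\<bar> \<le> C * M * CM_norm Q h powr (\<theta> + 2 * s - real n) * nrm hs"
    using Fd_holder[OF r] by blast
  show ?thesis
  proof (intro exI[of _ "(\<Sum>k=1..n. J k) + C"] conjI allI impI)
    show "0 \<le> (\<Sum>k=1..n. J k) + C" using C J_nonneg by (intro add_nonneg_nonneg sum_nonneg) auto
    fix f M assume H: "holderH \<theta> M (apply_bcontfun f)"
    have M: "0 \<le> M" using H by (simp add: holderH_def)
    let ?F = "Fd (apply_bcontfun f) n"
    have eq: "H_deriv Q n (apply_bcontfun (R l f)) = ?F" by (rule resolvent_CnH(1)[OF H kn]) simp
    have hn: "holder_seminorm Q n (\<theta> + 2 * s - real n) ?F \<le> ennreal (C * M)"
      unfolding holder_seminorm_def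
    proof (intro SUP_least)
      fix x h assume "h \<in> CM_space Q - {0}"
      then have h: "h \<in> CM_space Q" "h \<noteq> 0" by auto
      let ?p = "CM_norm Q h powr (\<theta> + 2 * s - real n)"
      have hp: "?p > 0" using CM_norm_pos[OF h] by simp
      have "form_norm Q n (\<lambda>hs. ?F (x + h) hs - ?F x hs) \<le> ennreal (C * M * ?p)"
        by (rule form_norm_le) (use CI[OF bcf H h] C M in auto)
      then have "form_norm Q n (\<lambda>hs. ?F (x + h) hs - ?F x hs) / ennreal ?p \<le> ennreal (C * M * ?p) / ennreal ?p"
        by (rule divide_right_mono_ennreal)
      also have "\<dots> = ennreal (C * M)" using hp C M by (subst divide_ennreal) auto
      finally show "form_norm Q n (\<lambda>hs. ?F (x + h) hs - ?F x hs) / ennreal ?p \<le> ennreal (C * M)" .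
    qed
    show "R l f \<in> CH Q (\<theta> + 2 * s)"
      using resolvent_CnH(2,3)[OF H kn] le_less_trans[OF hn] by (simp add: CH_def Let_def fl fr eq)
    have "CH_norm Q (\<theta> + 2 * s) (R l f) = CnH_norm Q n (R l f) + holder_seminorm Q n (\<theta> + 2 * s - real n) ?F"
      by (simp add: CH_norm_def Let_def fl fr eq)
    also have "\<dots> \<le> ennreal (norm f / l + (\<Sum>k=1..n. J k) * M) + ennreal (C * M)"
      by (intro add_mono resolvent_CnH(4)[OF H kn] hn)
    also have "\<dots> = ennreal (norm f / l + ((\<Sum>k=1..n. J k) + C) * M)"
      using l M C J_nonneg by (subst ennreal_plus[symmetric]) (auto simp: algebra_simps intro!: add_nonneg_nonneg mult_nonneg_nonneg sum_nonneg)
    finally show "CH_norm Q (\<theta> + 2 * s) (R l f) \<le> ennreal (norm f / l + ((\<Sum>k=1..n. J k) + C) * M)" .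
  qed
qed

lemma resolvent_ZH:
  assumes r: "\<theta> + 2 * s = real n + 1"
  shows "\<exists>C\<ge>0. \<forall>f M. holderH \<theta> M (apply_bcontfun f) \<longrightarrow>
    R l f \<in> ZH Q (n + 1) \<and> ZH_norm Q (n + 1) (R l f) \<le> ennreal (norm f / l + C * M)"
proof -
  have kn: "n = 0 \<or> q n < s" using r by (auto simp: q_def)
  obtain C where C: "C \<ge> 0" and CI: "\<And>f M x h hs. f \<in> bcontfun \<Longrightarrow> holderH \<theta> M f \<Longrightarrow> h \<in> CM_space Q \<Longrightarrow> h \<noteq> 0 \<Longrightarrow> hs \<in> H_args Q n \<Longrightarrow>
    \<bar>Fd f n (x + 2 *\<^sub>R h) hs - 2 * Fd f n (x + h) hs + Fd f n x hs\<bar> \<le> C * M * CM_norm Q h * nrm hs"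
    using Fd_zygmund[OF r] by blast
  show ?thesis
  proof (intro exI[of _ "(\<Sum>k=1..n. J k) + C"] conjI allI impI)
    show "0 \<le> (\<Sum>k=1..n. J k) + C" using C J_nonneg by (intro add_nonneg_nonneg sum_nonneg) auto
    fix f M assume H: "holderH \<theta> M (apply_bcontfun f)"
    have M: "0 \<le> M" using H by (simp add: holderH_def)
    let ?F = "Fd (apply_bcontfun f) n"
    have eq: "H_deriv Q n (apply_bcontfun (R l f)) = ?F" by (rule resolvent_CnH(1)[OF H kn]) simp
    have hn: "zygmund_seminorm Q n ?F \<le> ennreal (C * M)"
      unfolding zygmund_seminorm_def
    proof (intro SUP_least)
      fix x h assume "h \<in> CM_space Q - {0}"
      then have h: "h \<in> CM_space Q" "h \<noteq> 0" by auto
      let ?p = "CM_norm Q h"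
      have hp: "?p > 0" using CM_norm_pos[OF h] by simp
      have "form_norm Q n (\<lambda>hs. ?F (x + 2 *\<^sub>R h) hs - 2 * ?F (x + h) hs + ?F x hs) \<le> ennreal (C * M * ?p)"
        by (rule form_norm_le) (use CI[OF bcf H h] C M hp in auto)
      then have "form_norm Q n (\<lambda>hs. ?F (x + 2 *\<^sub>R h) hs - 2 * ?F (x + h) hs + ?F x hs) / ennreal ?p \<le> ennreal (C * M * ?p) / ennreal ?p"
        by (rule divide_right_mono_ennreal)
      also have "\<dots> = ennreal (C * M)" using hp C M by (subst divide_ennreal) auto
      finally show "form_norm Q n (\<lambda>hs. ?F (x + 2 *\<^sub>R h) hs - 2 * ?F (x + h) hs + ?F x hs) / ennreal ?p \<le> ennreal (C * M)" .
    qed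
    show "R l f \<in> ZH Q (n + 1)"
      using resolvent_CnH(2,3)[OF H kn] le_less_trans[OF hn] by (simp add: ZH_def Let_def eq)
    have "ZH_norm Q (n + 1) (R l f) = CnH_norm Q n (R l f) + zygmund_seminorm Q n ?F"
      by (simp add: ZH_norm_def Let_def eq)
    also have "\<dots> \<le> ennreal (norm f / l + (\<Sum>k=1..n. J k) * M) + ennreal (C * M)"
      by (intro add_mono resolvent_CnH(4)[OF H kn] hn)
    also have "\<dots> = ennreal (norm f / l + ((\<Sum>k=1..n. J k) + C) * M)"
      using l M C J_nonneg by (subst ennreal_plus[symmetric]) (auto simp: algebra_simps intro!: add_nonneg_nonneg mult_nonneg_nonneg sum_nonneg)
    finally show "ZH_norm Q (n + 1) (R l f) \<le> ennreal (norm f / l + ((\<Sum>k=1..n. J k) + C) * M)" .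
  qed
qed

end

section \<open>Right-hand sides as Hoelder functions of exponent \<open>0\<close> or
  \<open>\<alpha>\<close>\<close>

context cov_op
begin

lemma holderH_bounded: "holderH 0 (2 * norm f) (apply_bcontfun f)"
  unfolding holderH_def
proof (intro conjI allI ballI)
  fix z k assume k: "k \<in> CM_space Q"
  show "\<bar>apply_bcontfun f (z + k) - apply_bcontfun f z\<bar> \<le> 2 * norm f * CM_norm Q k powr 0"
  proof (cases "k = 0")
    case False
    then show ?thesis using CM_norm_pos[OF k] norm_bounded[of f "z + k"] norm_bounded[of f z] by simp
  qed simp
qed simp

text \<open>The finite extended seminorm is converted to a real \<open>M\<close>; since the norm of
  \<open>f\<close> is then exactly \<open>norm f + M\<close>, estimates in \<open>norm f\<close> and
  \<open>M\<close> become estimates in the norm of the space.\<close>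

lemma CH_holderH:
  assumes \<alpha>: "0 < \<alpha>" "\<alpha> < 1" and f: "f \<in> CH Q \<alpha>"
  obtains M where "holderH \<alpha> M (apply_bcontfun f)" "CH_norm Q \<alpha> f = ennreal (norm f + M)"
proof -
  let ?F = "H_deriv Q 0 (apply_bcontfun f)"
  have fl: "\<lfloor>\<alpha>\<rfloor> = 0" using \<alpha> by (intro floor_unique) auto
  have fr: "frac \<alpha> = \<alpha>" by (simp add: frac_def fl)
  have fin: "holder_seminorm Q 0 \<alpha> ?F < \<infinity>" using f by (simp add: CH_def Let_def fl fr)
  define M where "M = enn2real (holder_seminorm Q 0 \<alpha> ?F)"
  have M: "0 \<le> M" "holder_seminorm Q 0 \<alpha> ?F = ennreal M" using fin by (simp_all add: M_def del: H_deriv.simps)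
  show thesis
  proof (rule that[of M])
    show "CH_norm Q \<alpha> f = ennreal (norm f + M)"
      using M(1) by (simp add: CH_norm_def CnH_norm_def Let_def fl fr M(2) del: H_deriv.simps)
    show "holderH \<alpha> M (apply_bcontfun f)"
      unfolding holderH_def
    proof (intro conjI allI ballI M(1))
      fix z k assume k: "k \<in> CM_space Q"
      show "\<bar>apply_bcontfun f (z + k) - apply_bcontfun f z\<bar> \<le> M * CM_norm Q k powr \<alpha>"
      proof (cases "k = 0")
        case False
        then have kp: "CM_norm Q k powr \<alpha> > 0" using CM_norm_pos[OF k] by simp
        have "ennreal \<bar>apply_bcontfun f (z + k) - apply_bcontfun f z\<bar> \<le> form_norm Q 0 (\<lambda>hs. ?F (z + k) hs - ?F z hs)"
          using form_norm_upper[of "[]" 0 "\<lambda>hs. ?F (z + k) hs - ?F z hs"] by (simp add: H_args_def)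
        then have "ennreal \<bar>apply_bcontfun f (z + k) - apply_bcontfun f z\<bar> / ennreal (CM_norm Q k powr \<alpha>)
            \<le> form_norm Q 0 (\<lambda>hs. ?F (z + k) hs - ?F z hs) / ennreal (CM_norm Q k powr \<alpha>)"
          by (rule divide_right_mono_ennreal)
        also have "\<dots> \<le> holder_seminorm Q 0 \<alpha> ?F"
          unfolding holder_seminorm_def by (intro SUP_upper2[of z] SUP_upper2[of k]) (use k False in auto)
        finally have "ennreal (\<bar>apply_bcontfun f (z + k) - apply_bcontfun f z\<bar> / CM_norm Q k powr \<alpha>) \<le> ennreal M"
          using kp by (simp add: divide_ennreal M(2) del: H_deriv.simps)
        then show ?thesis using kp M(1) by (simp add: ennreal_le_iff divide_le_eq)
      qed simp
    qed
  qed
qed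

end

theorem theorem5p11:
  fixes Q :: "'a::{real_inner, polish_space} \<Rightarrow>\<^sub>L 'a"
    and \<eta> :: "real \<Rightarrow> real \<Rightarrow> real"
    and l s :: real
  assumes "self_adjoint Q" and "positive_op Q" and "finite_trace Q"
    and "0 < s" and "s < 1" and "0 < l"
    and "is_stable_density s \<eta>"
  shows
    "(s \<noteq> 1/2 \<longrightarrow>
        (\<forall>f. \<exists>!u. solves Q \<eta> l f u) \<and>
        (\<exists>C>0. \<forall>f u. solves Q \<eta> l f u \<longrightarrow>
           u \<in> CH Q (2 * s) \<and> CH_norm Q (2 * s) u \<le> ennreal (C * norm f))) \<and>
     (s = 1/2 \<longrightarrow>
        (\<forall>f. \<exists>!u. solves Q \<eta> l f u) \<and>
        (\<exists>C>0. \<forall>f u. solves Q \<eta> l f u \<longrightarrow>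
           u \<in> ZH Q 1 \<and> ZH_norm Q 1 u \<le> ennreal (C * norm f))) \<and>
     (\<forall>\<alpha>. 0 < \<alpha> \<and> \<alpha> < 1 \<and> \<alpha> + 2 * s \<notin> {1, 2} \<longrightarrow>
        (\<exists>C>0. \<forall>f u. f \<in> CH Q \<alpha> \<and> solves Q \<eta> l f u \<longrightarrow>
           u \<in> CH Q (\<alpha> + 2 * s) \<and>
           CH_norm Q (\<alpha> + 2 * s) u \<le> ennreal C * CH_norm Q \<alpha> f)) \<and>
     (\<forall>\<alpha>. \<forall>k::nat. 0 < \<alpha> \<and> \<alpha> < 1 \<and> k \<in> {1, 2} \<and> \<alpha> + 2 * s = real k \<longrightarrow>
        (\<exists>C>0. \<forall>f u. f \<in> CH Q \<alpha> \<and> solves Q \<eta> l f u \<longrightarrow>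
           u \<in> ZH Q k \<and>
           ZH_norm Q k u \<le> ennreal C * CH_norm Q \<alpha> f))"
proof -
  interpret frac_op Q s \<eta>
    by (simp add: frac_op_def cov_op_def stable_density_def assms)
  note l = assms(6)
  note sol = solves_iff[OF l]
  \<comment> \<open>The four claims are the cases \<open>\<theta> = 0\<close> and
    \<open>\<theta> = \<alpha>\<close>, each with \<open>\<theta> + 2 * s\<close> off the integers
    or equal to one.\<close>
  have res: "frac_res Q s \<eta> l \<theta>" if "0 \<le> \<theta>" "\<theta> < 1" for \<theta>
    using that l by (simp add: frac_res_def frac_res_axioms_def frac_op_axioms)
  have ex1: "\<forall>f. \<exists>!u. solves Q \<eta> l f u" unfolding sol by simp
  \<comment> \<open>The exponent stays below \<open>3\<close> since \<open>\<alpha> < 1\<close> and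
    \<open>s < 1\<close>, so \<open>1\<close> and \<open>2\<close> are the only integers it can
    meet.\<close>
  have nfloor: "\<exists>n::nat. real n < r \<and> r < real n + 1" if "0 < r" "r < 3" "r \<notin> {1, 2}" for r :: real
  proof -
    consider "r < 1" | "1 < r" "r < 2" | "2 < r" using \<open>r \<notin> {1, 2}\<close> by (metis insertCI linorder_neqE_linordered_idom)
    then show ?thesis
    proof cases
      case 1 then show ?thesis using that by (intro exI[of _ 0]) auto
    next
      case 2 then show ?thesis by (intro exI[of _ 1]) auto
    next
      case 3 then show ?thesis using that by (intro exI[of _ 2]) auto
    qed
  qed
  \<comment> \<open>For bounded \<open>f\<close> the oscillation constant is
    \<open>M = 2 * norm f\<close>, which leads to \<open>1 / l + 2 * C\<close>.\<close>
  have cst: "\<exists>C'>0. \<forall>x. norm (x::'a \<Rightarrow>\<^sub>C real) / l + C * (2 * norm x) \<le> C' * norm x" if "0 \<le> C" for C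
  proof (intro exI[of _ "1 / l + 2 * C"] conjI allI)
    show "0 < 1 / l + 2 * C" using l that by (simp add: add_pos_nonneg)
  qed (simp add: algebra_simps)
  have cst': "ennreal (norm (f::'a \<Rightarrow>\<^sub>C real) / l + C * M) \<le> ennreal (1 / l + C) * ennreal (norm f + M)"
    if "0 \<le> C" "0 \<le> M" for C M f
  proof -
    have "norm f / l + C * M \<le> (1 / l + C) * (norm f + M)" using that l by (simp add: algebra_simps)
    also have "ennreal \<dots> = ennreal (1 / l + C) * ennreal (norm f + M)"
      using that l by (intro ennreal_mult) auto
    finally show ?thesis by (simp add: ennreal_leI)
  qed
  have pos': "0 < 1 / l + C" if "0 \<le> C" for C using l that by (simp add: add_pos_nonneg)
  have 1: "\<exists>C>0. \<forall>f u. solves Q \<eta> l f u \<longrightarrow> u \<in> CH Q (2 * s) \<and> CH_norm Q (2 * s) u \<le> ennreal (C * norm f)"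
    if s: "s \<noteq> 1/2"
  proof -
    interpret res: frac_res Q s \<eta> l 0 by (rule res) auto
    obtain n where n: "real n < 0 + 2 * s" "0 + 2 * s < real n + 1" using nfloor[of "2 * s"] s assms by auto
    obtain C where C: "0 \<le> C" "\<And>f M. holderH 0 M (apply_bcontfun f) \<Longrightarrow>
        R l f \<in> CH Q (2 * s) \<and> CH_norm Q (2 * s) (R l f) \<le> ennreal (norm f / l + C * M)"
      using res.resolvent_CH[OF n] by auto
    obtain C' where C': "C' > 0" "\<And>x::'a \<Rightarrow>\<^sub>C real. norm x / l + C * (2 * norm x) \<le> C' * norm x" using cst[OF C(1)] by blast
    show ?thesis unfolding sol
      using C(2)[OF holderH_bounded] order_trans[OF _ ennreal_leI[OF C'(2)]] C'(1) by (intro exI[of _ C']) auto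
  qed
  have 2: "\<exists>C>0. \<forall>f u. solves Q \<eta> l f u \<longrightarrow> u \<in> ZH Q 1 \<and> ZH_norm Q 1 u \<le> ennreal (C * norm f)"
    if s: "s = 1/2"
  proof -
    interpret res: frac_res Q s \<eta> l 0 by (rule res) auto
    have n: "0 + 2 * s = real 0 + 1" using s by simp
    obtain C where C: "0 \<le> C" "\<And>f M. holderH 0 M (apply_bcontfun f) \<Longrightarrow>
        R l f \<in> ZH Q 1 \<and> ZH_norm Q 1 (R l f) \<le> ennreal (norm f / l + C * M)"
      using res.resolvent_ZH[OF n] by auto
    obtain C' where C': "C' > 0" "\<And>x::'a \<Rightarrow>\<^sub>C real. norm x / l + C * (2 * norm x) \<le> C' * norm x" using cst[OF C(1)] by blast
    show ?thesis unfolding sol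
      using C(2)[OF holderH_bounded] order_trans[OF _ ennreal_leI[OF C'(2)]] C'(1) by (intro exI[of _ C']) auto
  qed
  have 3: "\<exists>C>0. \<forall>f u. f \<in> CH Q \<alpha> \<and> solves Q \<eta> l f u \<longrightarrow>
      u \<in> CH Q (\<alpha> + 2 * s) \<and> CH_norm Q (\<alpha> + 2 * s) u \<le> ennreal C * CH_norm Q \<alpha> f"
    if \<alpha>: "0 < \<alpha>" "\<alpha> < 1" "\<alpha> + 2 * s \<notin> {1, 2}" for \<alpha>
  proof -
    interpret res: frac_res Q s \<eta> l \<alpha> by (rule res) (use \<alpha> in auto)
    obtain n where n: "real n < \<alpha> + 2 * s" "\<alpha> + 2 * s < real n + 1" using nfloor[of "\<alpha> + 2 * s"] \<alpha> assms by auto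
    obtain C where C: "0 \<le> C" "\<And>f M. holderH \<alpha> M (apply_bcontfun f) \<Longrightarrow>
        R l f \<in> CH Q (\<alpha> + 2 * s) \<and> CH_norm Q (\<alpha> + 2 * s) (R l f) \<le> ennreal (norm f / l + C * M)"
      using res.resolvent_CH[OF n] by blast
    show ?thesis unfolding sol
    proof (intro exI[of _ "1 / l + C"] conjI pos' C(1) allI impI; elim conjE)
      fix f u assume f: "f \<in> CH Q \<alpha>" and u: "u = R l f"
      obtain M where M: "holderH \<alpha> M (apply_bcontfun f)" "CH_norm Q \<alpha> f = ennreal (norm f + M)"
        using CH_holderH[OF \<alpha>(1,2) f] by blast
      have "0 \<le> M" using M(1) by (simp add: holderH_def)
      then show "u \<in> CH Q (\<alpha> + 2 * s)" "CH_norm Q (\<alpha> + 2 * s) u \<le> ennreal (1 / l + C) * CH_norm Q \<alpha> f"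
        using C(2)[OF M(1)] cst'[OF C(1), of M f] unfolding u M(2) by (auto intro: order_trans)
    qed
  qed
  have 4: "\<exists>C>0. \<forall>f u. f \<in> CH Q \<alpha> \<and> solves Q \<eta> l f u \<longrightarrow>
      u \<in> ZH Q k \<and> ZH_norm Q k u \<le> ennreal C * CH_norm Q \<alpha> f"
    if \<alpha>: "0 < \<alpha>" "\<alpha> < 1" "k \<in> {1, 2}" "\<alpha> + 2 * s = real k" for \<alpha> and k :: nat
  proof -
    interpret res: frac_res Q s \<eta> l \<alpha> by (rule res) (use \<alpha> in auto)
    \<comment> \<open>Truncated subtraction is exact here because \<open>k\<close> is
      \<open>1\<close> or \<open>2\<close>; the Zygmund condition concerns the derivative of order
      \<open>k - 1\<close>.\<close>
    have k: "k = (k - 1) + 1" using \<alpha>(3) by auto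
    then have n: "\<alpha> + 2 * s = real (k - 1) + 1" using \<alpha>(4) by linarith
    obtain C where C: "0 \<le> C" "\<And>f M. holderH \<alpha> M (apply_bcontfun f) \<Longrightarrow>
        R l f \<in> ZH Q k \<and> ZH_norm Q k (R l f) \<le> ennreal (norm f / l + C * M)"
      using res.resolvent_ZH[OF n] k by auto
    show ?thesis unfolding sol
    proof (intro exI[of _ "1 / l + C"] conjI pos' C(1) allI impI; elim conjE)
      fix f u assume f: "f \<in> CH Q \<alpha>" and u: "u = R l f"
      obtain M where M: "holderH \<alpha> M (apply_bcontfun f)" "CH_norm Q \<alpha> f = ennreal (norm f + M)"
        using CH_holderH[OF \<alpha>(1,2) f] by blast
      have "0 \<le> M" using M(1) by (simp add: holderH_def)
      then show "u \<in> ZH Q k" "ZH_norm Q k u \<le> ennreal (1 / l + C) * CH_norm Q \<alpha> f"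
        using C(2)[OF M(1)] cst'[OF C(1), of M f] unfolding u M(2) by (auto intro: order_trans)
    qed
  qed
  show ?thesis
    by (intro conjI impI allI ex1[rule_format]; (elim conjE)?, (rule 1 | rule 2 | rule 3 | rule 4); assumption)
qed

end
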